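(* Let $N\ge3$ and let $g:\mathbb{R}\to\mathbb{R}$ be a continuous (not necessarily odd) function such that $$-\infty<\liminf_{t\to0}\frac{g(t)}{t}\le\limsup_{t\to0}\frac{g(t)}{t}<0\qquad\text{and}\qquad\lim_{|t|\to\infty}\frac{g(t)}{|t|^{\frac{N+2}{N-2}}}=0.$$ Let $G(t):=\int_0^tg(s)\,ds$ and $I(u):=\frac12\int_{\mathbb{R}^N}|\nabla u|^2dx-\int_{\mathbb{R}^N}G(u)\,dx$ for $u\in H^1(\mathbb{R}^N)$. Let $\{u_n\}\subset H^1(\mathbb{R}^N)$ be a bounded Palais-Smale sequence for $I$ at any level $\beta\in\mathbb{R}$. Then, up to a subsequence of $\{u_n\}$, there exists an integer $l\in\mathbb{N}$, $l\ge 1$, and, for each $1\le k\le l$, there is a sequence $\{y^k_n\}\subset\mathbb{R}^N$ and an element $w^k\in H^1(\mathbb{R}^N)$ such that: (i) $y^1_n=0$ for all $n\in\mathbb{N}$, and $|y^i_n-y^j_n|\to\infty$ as $n\to\infty$ for $1\le i<j\le l$; (ii) $u_n(\cdot+y^k_n)\rightharpoonup w^k$ weakly in $H^1(\mathbb{R}^N)$ with $I'(w^k)=0$ for all $1\le k\le l$, and $w^k\neq0$ if $2\le k\le l$; (iii) $\beta=\lim_{n\to\infty}I(u_n)=\sum_{k=1}^lI(w^k)$; (iv) setting $v^l_n:=u_n-\sum_{k=1}^lw^k(\cdot-y^k_n)$ for every $n\in\mathbb{N}$, one has $\|v^l_n\|_{H^1(\mathbb{R}^N)}\to0$ as $n\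to\infty$.
   Context: $H^1(\mathbb{R}^N)$ (real valued functions) carries the norm $\|u\|_{H^1(\mathbb{R}^N)}=(\int_{\mathbb{R}^N}|\nabla u|^2+|u|^2dx)^{1/2}$. Under the stated assumptions $I$ is of class $C^1$ on $H^1(\mathbb{R}^N)$. A bounded Palais-Smale sequence for $I$ at level $\beta$ is a bounded sequence $\{u_n\}$ with $I(u_n)\to\beta$ and $I'(u_n)\to0$ in the dual space. *)

theory Defs
  imports "HOL-Analysis.Analysis"
begin

section \<open>Test functions\<close>

definition partial_deriv :: "'n \<Rightarrow> (real^'n \<Rightarrow> real) \<Rightarrow> real^'n \<Rightarrow> real" where
  "partial_deriv i f x = frechet_derivative f (at x) (axis i 1)"

primrec C_diff :: "nat \<Rightarrow> (real^'n \<Rightarrow> real) \<Rightarrow> bool" where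
  "C_diff 0 f \<longleftrightarrow> continuous_on UNIV f"
| "C_diff (Suc k) f \<longleftrightarrow> (\<forall>x. f differentiable at x) \<and> (\<forall>i. C_diff k (partial_deriv i f))"

definition test_function :: "(real^'n \<Rightarrow> real) \<Rightarrow> bool" where
  "test_function \<phi> \<longleftrightarrow> (\<forall>k. C_diff k \<phi>) \<and> compact (closure {x. \<phi> x \<noteq> 0})"

lemma partial_deriv_eq: "(f has_derivative D) (at x) \<Longrightarrow> partial_deriv i f x = D (axis i 1)"
  unfolding partial_deriv_def by (metis frechet_derivative_at)

lemma C_diff_continuous: "C_diff k f \<Longrightarrow> continuous_on UNIV f"
  by (cases k)
     (auto simp: continuous_on_eq_continuous_within intro: differentiable_imp_continuous_within)

lemma C_diff_Suc_D: "C_diff (Suc k) f \<Longrightarrow> C_diff k f"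
proof (induction k arbitrary: f)
  case 0
  then show ?case using C_diff_continuous by fastforce
next
  case (Suc k)
  then show ?case by (metis C_diff.simps(2))
qed

lemma C_diff_const: "C_diff k (\<lambda>x. c)"
proof (induction k arbitrary: c)
  case (Suc k)
  have "partial_deriv i (\<lambda>x. c) = (\<lambda>x. 0)" for i :: 'a
    by (rule ext) (subst partial_deriv_eq[OF has_derivative_const], rule refl)
  then show ?case using Suc by simp
qed simp

lemma C_diff_add: "C_diff k f \<Longrightarrow> C_diff k g \<Longrightarrow> C_diff k (\<lambda>x. f x + g x)"
proof (induction k arbitrary: f g)
  case 0
  then show ?case by (auto intro: continuous_intros)
next
  case (Suc k)
  have "partial_deriv i (\<lambda>x. f x + g x) = (\<lambda>x. partial_deriv i f x + partial_deriv i g x)" for i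
  proof
    fix x
    have "((\<lambda>x. f x + g x) has_derivative
        (\<lambda>h. frechet_derivative f (at x) h + frechet_derivative g (at x) h)) (at x)"
      using Suc.prems by (intro has_derivative_add) (auto simp: frechet_derivative_works[symmetric])
    then show "partial_deriv i (\<lambda>x. f x + g x) x = partial_deriv i f x + partial_deriv i g x"
      by (simp add: partial_deriv_eq partial_deriv_def[symmetric])
  qed
  then show ?case using Suc by (auto intro: differentiable_add)
qed

lemma C_diff_mult: "C_diff k f \<Longrightarrow> C_diff k g \<Longrightarrow> C_diff k (\<lambda>x. f x * g x)"
proof (induction k arbitrary: f g)
  case 0
  then show ?case by (auto intro: continuous_intros)
next
  case (Suc k)
  have eq: "partial_deriv i (\<lambda>x. f x * g x) =
      (\<lambda>x. f x * partial_deriv i g x + partial_deriv i f x * g x)" for i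
  proof
    fix x
    have "((\<lambda>x. f x * g x) has_derivative
        (\<lambda>h. f x * frechet_derivative g (at x) h + frechet_derivative f (at x) h * g x)) (at x)"
      using Suc.prems by (intro has_derivative_mult) (auto simp: frechet_derivative_works[symmetric])
    then show "partial_deriv i (\<lambda>x. f x * g x) x = f x * partial_deriv i g x + partial_deriv i f x * g x"
      by (simp add: partial_deriv_eq partial_deriv_def[symmetric])
  qed
  have "C_diff k f" "C_diff k g" using Suc.prems C_diff_Suc_D by blast+
  then show ?case using Suc unfolding C_diff.simps eq
    by (auto intro!: differentiable_mult C_diff_add)
qed

lemma C_diff_prod: "finite A \<Longrightarrow> (\<And>i. i \<in> A \<Longrightarrow> C_diff k (f i)) \<Longrightarrow> C_diff k (\<lambda>x. \<Prod>i\<in>A. f i x)"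
  by (induction A rule: finite_induct) (auto intro: C_diff_const C_diff_mult)

lemma partial_deriv_translate:
  assumes "\<forall>x. f differentiable at x"
  shows "partial_deriv i (\<lambda>x. f (x + y)) = (\<lambda>x. partial_deriv i f (x + y))"
    and "(\<lambda>x. f (x + y)) differentiable at x"
proof -
  have "((\<lambda>x. f (x + y)) has_derivative frechet_derivative f (at (x + y))) (at x)" for x
  proof -
    have "(f has_derivative frechet_derivative f (at (x + y))) (at (x + y))"
      using assms frechet_derivative_works by blast
    moreover have "((\<lambda>x. x + y) has_derivative (\<lambda>h. h)) (at x)"
      by (auto intro!: derivative_eq_intros)
    ultimately show ?thesis
      using has_derivative_compose by fastforce
  qed
  note D = this
  show "partial_deriv i (\<lambda>x. f (x + y)) = (\<lambda>x. partial_deriv i f (x + y))"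
    by (rule ext) (simp only: partial_deriv_eq[OF D] partial_deriv_def[of i f])
  show "(\<lambda>x. f (x + y)) differentiable at x"
    using D unfolding differentiable_def by blast
qed

lemma C_diff_translate: "C_diff k f \<Longrightarrow> C_diff k (\<lambda>x. f (x + y))"
proof (induction k arbitrary: f)
  case 0
  then show ?case by (auto intro!: continuous_on_compose2[of UNIV f] continuous_intros)
next
  case (Suc k)
  then show ?case by (simp add: partial_deriv_translate)
qed

lemma test_function_translate:
  assumes "test_function \<phi>" shows "test_function (\<lambda>x. \<phi> (x + y))"
proof -
  have "{x. \<phi> (x + y) \<noteq> 0} = (\<lambda>x. x + (- y)) ` {x. \<phi> x \<noteq> 0}"
  proof (intro set_eqI iffI)
    fix x assume "x \<in> {x. \<phi> (x + y) \<noteq> 0}"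
    then show "x \<in> (\<lambda>x. x + (- y)) ` {x. \<phi> x \<noteq> 0}"
      by (intro image_eqI[of _ _ "x + y"]) auto
  qed auto
  moreover have "bounded {x. \<phi> x \<noteq> 0}"
    using assms compact_imp_bounded bounded_subset closure_subset
    unfolding test_function_def by metis
  ultimately have "bounded {x. \<phi> (x + y) \<noteq> 0}"
    using bounded_translation[of "{x. \<phi> x \<noteq> 0}" "- y"] by (simp add: add.commute)
  then show ?thesis using assms C_diff_translate
    unfolding test_function_def compact_closure by blast
qed

section \<open>Square integrable functions and weak gradients\<close>

definition L2 :: "(real^'n \<Rightarrow> 'b::euclidean_space) \<Rightarrow> bool" where
  "L2 f \<longleftrightarrow> f \<in> borel_measurable lborel \<and> integrable lborel (\<lambda>x. (norm (f x))\<^sup>2)"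

lemma L2_measurable [measurable_dest]: "L2 f \<Longrightarrow> f \<in> borel_measurable borel"
  by (simp add: L2_def)

lemma L2_inner:
  assumes "L2 f" "L2 g" shows "integrable lborel (\<lambda>x. f x \<bullet> g x)"
proof (rule Bochner_Integration.integrable_bound)
  show "integrable lborel (\<lambda>x. (norm (f x))\<^sup>2 + (norm (g x))\<^sup>2)"
    using assms by (auto simp: L2_def)
  show "(\<lambda>x. f x \<bullet> g x) \<in> borel_measurable lborel"
    using assms by (auto simp: L2_def intro: borel_measurable_inner)
  have "norm (f x \<bullet> g x) \<le> norm ((norm (f x))\<^sup>2 + (norm (g x))\<^sup>2)" for x
  proof -
    have "\<bar>f x \<bullet> g x\<bar> \<le> norm (f x) * norm (g x)" by (rule Cauchy_Schwarz_ineq2)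
    also have "\<dots> \<le> 2 * (norm (f x) * norm (g x))" by simp
    also have "\<dots> \<le> (norm (f x))\<^sup>2 + (norm (g x))\<^sup>2"
      using sum_squares_bound[of "norm (f x)" "norm (g x)"] by simp
    finally show ?thesis by simp
  qed
  then show "AE x in lborel. norm (f x \<bullet> g x) \<le> norm ((norm (f x))\<^sup>2 + (norm (g x))\<^sup>2)" by simp
qed

lemma L2_mult:
  fixes f g :: "real^'n \<Rightarrow> real"
  assumes "L2 f" "L2 g" shows "integrable lborel (\<lambda>x. f x * g x)"
  using L2_inner[OF assms] by simp

lemma L2_add:
  assumes "L2 f" "L2 g" shows "L2 (\<lambda>x. f x + g x)"
proof -
  have "integrable lborel (\<lambda>x. (f x + g x) \<bullet> (f x + g x))"
    using L2_inner[OF assms(1,1)] L2_inner[OF assms(1,2)] L2_inner[OF assms(2,1)] L2_inner[OF assms(2,2)]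
    by (simp add: inner_add_left inner_add_right)
  then show ?thesis using assms by (auto simp: L2_def dot_square_norm)
qed

lemma L2_scaleR: "L2 f \<Longrightarrow> L2 (\<lambda>x. c *\<^sub>R f x)"
  by (auto simp: L2_def power_mult_distrib)

lemma L2_zero: "L2 (\<lambda>x. 0)"
  by (simp add: L2_def)

lemma L2_component:
  fixes V :: "real^'n \<Rightarrow> real^'m"
  assumes "L2 V" shows "L2 (\<lambda>x. V x $ i)"
  unfolding L2_def
proof
  show m: "(\<lambda>x. V x $ i) \<in> borel_measurable lborel"
    using measurable_compose[OF L2_measurable[OF assms] borel_measurable_continuous_onI[of "\<lambda>v. v $ i"]]
    by (simp add: continuous_on_component)
  show "integrable lborel (\<lambda>x. (norm (V x $ i))\<^sup>2)"
  proof (rule Bochner_Integration.integrable_bound)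
    show "integrable lborel (\<lambda>x. (norm (V x))\<^sup>2)" using assms by (simp add: L2_def)
    show "(\<lambda>x. (norm (V x $ i))\<^sup>2) \<in> borel_measurable lborel" using m by simp
    show "AE x in lborel. norm ((norm (V x $ i))\<^sup>2) \<le> norm ((norm (V x))\<^sup>2)"
      by (intro AE_I2) (simp add: abs_le_square_iff[symmetric] component_le_norm_cart)
  qed
qed

lemma L2_continuous_compact:
  fixes f :: "real^'n \<Rightarrow> real"
  assumes "continuous_on UNIV f" "compact K" "\<And>x. x \<notin> K \<Longrightarrow> f x = 0"
  shows "L2 f"
  unfolding L2_def
proof
  show "f \<in> borel_measurable lborel"
    using assms(1) by (simp add: borel_measurable_continuous_onI)
  have "integrable lborel (\<lambda>x. indicator K x *\<^sub>R (f x)\<^sup>2)"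
    using assms by (intro borel_integrable_compact continuous_intros) (auto intro: continuous_on_subset)
  moreover have "(\<lambda>x. indicator K x *\<^sub>R (f x)\<^sup>2) = (\<lambda>x. (norm (f x))\<^sup>2)"
    using assms(3) by (auto simp: fun_eq_iff indicator_def)
  ultimately show "integrable lborel (\<lambda>x. (norm (f x))\<^sup>2)" by simp
qed

lemma L2_test_function:
  assumes "test_function \<phi>"
  shows "L2 \<phi>" "L2 (partial_deriv i \<phi>)"
proof -
  let ?K = "closure {x. \<phi> x \<noteq> 0}"
  have K: "compact ?K" and C: "C_diff 0 \<phi>" "C_diff (Suc 0) \<phi>"
    using assms unfolding test_function_def by blast+
  have z: "\<phi> x = 0" if "x \<notin> ?K" for x
    using that closure_subset[of "{x. \<phi> x \<noteq> 0}"] by auto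
  show "L2 \<phi>" by (rule L2_continuous_compact[OF C_diff_continuous[OF C(1)] K z])
  have "partial_deriv i \<phi> x = 0" if "x \<notin> ?K" for x
  proof -
    have "(\<phi> has_derivative (\<lambda>h. 0)) (at x)"
    proof (rule has_derivative_transform_within_open[OF has_derivative_const, of "- ?K"])
      show "open (- ?K)" "x \<in> - ?K" using that by (simp_all add: open_Compl)
      show "0 = \<phi> x'" if "x' \<in> - ?K" for x'
        by (rule z[symmetric]) (use that in blast)
    qed
    then show ?thesis by (simp add: partial_deriv_eq)
  qed
  moreover have "continuous_on UNIV (partial_deriv i \<phi>)" using C(2) by simp
  ultimately show "L2 (partial_deriv i \<phi>)" using L2_continuous_compact[OF _ K] by blast
qed

lemma lborel_integral_translate:
  fixes f :: "real^'n \<Rightarrow> 'b::euclidean_space"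
  assumes "f \<in> borel_measurable borel"
  shows "(\<integral>x. f (x + y) \<partial>lborel) = (\<integral>x. f x \<partial>lborel)"
proof -
  have "(\<integral>x. f x \<partial>lborel) = (\<integral>x. f x \<partial>distr lborel borel ((+) y))"
    by (simp add: lborel_distr_plus)
  also have "\<dots> = (\<integral>x. f (y + x) \<partial>lborel)"
    using assms by (intro integral_distr) auto
  finally show ?thesis by (simp add: add.commute)
qed

lemma lborel_integrable_translate:
  fixes f :: "real^'n \<Rightarrow> 'b::euclidean_space"
  assumes "integrable lborel f"
  shows "integrable lborel (\<lambda>x. f (x + y))"
proof -
  have "integrable (distr lborel borel ((+) y)) f"
    using assms by (simp add: lborel_distr_plus)
  then have "integrable lborel (\<lambda>x. f (y + x))"
    by (rule integrable_distr[rotated]) auto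
  then show ?thesis by (simp add: add.commute)
qed

lemma lborel_AE_translate:
  fixes P :: "real^'n \<Rightarrow> bool"
  assumes "AE x in lborel. P x" "Measurable.pred borel P"
  shows "AE x in lborel. P (x + y)"
proof -
  have "AE x in distr lborel borel ((+) y). P x"
    by (subst lborel_distr_plus) (rule assms(1))
  then have "AE x in lborel. P (y + x)"
    using assms(2) by (subst (asm) AE_distr_iff) auto
  then show ?thesis by (simp add: add.commute)
qed

lemma L2_translate:
  assumes "L2 f" shows "L2 (\<lambda>x. f (x + y))"
proof -
  note [measurable] = L2_measurable[OF assms]
  have "integrable lborel (\<lambda>x. (norm (f (x + y)))\<^sup>2)"
    by (rule lborel_integrable_translate) (use assms in \<open>simp add: L2_def\<close>)
  then show ?thesis by (simp add: L2_def)
qed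

definition is_weak_gradient :: "(real^'n \<Rightarrow> real) \<Rightarrow> (real^'n \<Rightarrow> real^'n) \<Rightarrow> bool" where
  "is_weak_gradient u V \<longleftrightarrow> (\<forall>\<phi>. test_function \<phi> \<longrightarrow> (\<forall>i.
     (\<integral>x. u x * partial_deriv i \<phi> x \<partial>lborel) = - (\<integral>x. V x $ i * \<phi> x \<partial>lborel)))"

text \<open>Determined up to a null set, see \<open>weak_gradient_unique\<close> below.\<close>

definition weak_gradient :: "(real^'n \<Rightarrow> real) \<Rightarrow> real^'n \<Rightarrow> real^'n" where
  "weak_gradient u = (SOME V. L2 V \<and> is_weak_gradient u V)"

definition H1_fun :: "(real^'n \<Rightarrow> real) set" where
  "H1_fun = {u. L2 u \<and> (\<exists>V. L2 V \<and> is_weak_gradient u V)}"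

lemma weak_gradient_L2: "u \<in> H1_fun \<Longrightarrow> L2 (weak_gradient u)"
  and weak_gradient_is_weak_gradient: "u \<in> H1_fun \<Longrightarrow> is_weak_gradient u (weak_gradient u)"
  using someI_ex[of "\<lambda>V. L2 V \<and> is_weak_gradient u V"]
  by (auto simp: weak_gradient_def H1_fun_def)

lemma H1_fun_L2: "u \<in> H1_fun \<Longrightarrow> L2 u"
  by (simp add: H1_fun_def)

lemma is_weak_gradient_add:
  fixes u v :: "real^'n \<Rightarrow> real"
  assumes "is_weak_gradient u V" "is_weak_gradient v W" "L2 u" "L2 v" "L2 V" "L2 W"
  shows "is_weak_gradient (\<lambda>x. u x + v x) (\<lambda>x. V x + W x)"
  unfolding is_weak_gradient_def
proof (intro allI impI)
  fix \<phi> :: "real^'n \<Rightarrow> real" and i assume t: "test_function \<phi>"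
  note [simp] = L2_mult[OF assms(3) L2_test_function(2)[OF t]]
    L2_mult[OF assms(4) L2_test_function(2)[OF t]]
    L2_mult[OF L2_component[OF assms(5)] L2_test_function(1)[OF t]]
    L2_mult[OF L2_component[OF assms(6)] L2_test_function(1)[OF t]]
  show "(\<integral>x. (u x + v x) * partial_deriv i \<phi> x \<partial>lborel) = - (\<integral>x. (V x + W x) $ i * \<phi> x \<partial>lborel)"
    using assms(1,2) t by (simp add: is_weak_gradient_def distrib_right)
qed

lemma is_weak_gradient_scaleR:
  assumes "is_weak_gradient u V"
  shows "is_weak_gradient (\<lambda>x. c * u x) (\<lambda>x. c *\<^sub>R V x)"
  using assms by (simp add: is_weak_gradient_def mult.assoc)

lemma is_weak_gradient_zero: "is_weak_gradient (\<lambda>x. 0) (\<lambda>x. 0)"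
  by (simp add: is_weak_gradient_def)

lemma is_weak_gradient_translate:
  assumes "is_weak_gradient u V" "L2 u" "L2 V"
  shows "is_weak_gradient (\<lambda>x. u (x + y)) (\<lambda>x. V (x + y))"
  unfolding is_weak_gradient_def
proof (intro allI impI)
  fix \<phi> :: "real^'a \<Rightarrow> real" and i
  assume t: "test_function \<phi>"
  let ?\<psi> = "\<lambda>x. \<phi> (x + (- y))"
  have \<psi>: "test_function ?\<psi>" by (rule test_function_translate[OF t])
  have d: "\<forall>x. \<phi> differentiable at x"
    using t unfolding test_function_def by (metis C_diff.simps(2))
  note [measurable] = L2_measurable[OF assms(2)] L2_measurable[OF assms(3)]
    L2_measurable[OF L2_test_function(1)[OF t]] L2_measurable[OF L2_test_function(2)[OF t]]
  have "(\<integral>x. u (x + y) * partial_deriv i \<phi> x \<partial>lborel) =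
      (\<integral>x. u x * partial_deriv i ?\<psi> x \<partial>lborel)"
    unfolding partial_deriv_translate(1)[OF d]
    using lborel_integral_translate[of "\<lambda>x. u x * partial_deriv i \<phi> (x + (- y))" y] by simp
  also have "\<dots> = - (\<integral>x. V x $ i * ?\<psi> x \<partial>lborel)"
    using assms(1) \<psi> unfolding is_weak_gradient_def by blast
  also have "\<dots> = - (\<integral>x. V (x + y) $ i * \<phi> x \<partial>lborel)"
  proof -
    have [measurable]: "(\<lambda>x. V x $ i) \<in> borel_measurable borel"
      using L2_measurable[OF L2_component[OF assms(3)]] .
    show ?thesis
      using lborel_integral_translate[of "\<lambda>x. V x $ i * ?\<psi> x" y] by simp
  qed
  finally show "(\<integral>x. u (x + y) * partial_deriv i \<phi> x \<partial>lborel) = - (\<integral>x. V (x + y) $ i * \<phi> x \<partial>lborel)" .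
qed

lemma is_weak_gradient_cong_AE:
  fixes u v :: "real^'n \<Rightarrow> real"
  assumes "is_weak_gradient u V" "L2 u" "L2 v" "AE x in lborel. u x = v x"
  shows "is_weak_gradient v V"
  unfolding is_weak_gradient_def
proof (intro allI impI)
  fix \<phi> :: "real^'n \<Rightarrow> real" and i assume t: "test_function \<phi>"
  note [measurable] = L2_measurable[OF assms(2)] L2_measurable[OF assms(3)]
    L2_measurable[OF L2_test_function(2)[OF t]]
  have "(\<integral>x. v x * partial_deriv i \<phi> x \<partial>lborel) = (\<integral>x. u x * partial_deriv i \<phi> x \<partial>lborel)"
    by (rule integral_cong_AE) (use assms(4) in auto)
  then show "(\<integral>x. v x * partial_deriv i \<phi> x \<partial>lborel) = - (\<integral>x. V x $ i * \<phi> x \<partial>lborel)"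
    using assms(1) t by (simp add: is_weak_gradient_def)
qed

section \<open>Uniqueness of weak gradients\<close>

definition flat :: "real poly \<Rightarrow> real \<Rightarrow> real" where
  "flat p t = (if 0 < t then poly p (inverse t) * exp (- inverse t) else 0)"

lemma poly_exp_tendsto_0: "((\<lambda>s::real. poly p s * exp (- s)) \<longlongrightarrow> 0) at_top"
proof -
  have "((\<lambda>s::real. \<Sum>i\<le>degree p. coeff p i * (s ^ i / exp s)) \<longlongrightarrow> (\<Sum>i\<le>degree p. coeff p i * 0)) at_top"
    by (intro tendsto_intros tendsto_power_div_exp_0)
  moreover have "(\<lambda>s::real. \<Sum>i\<le>degree p. coeff p i * (s ^ i / exp s)) = (\<lambda>s. poly p s * exp (- s))"
    by (simp add: fun_eq_iff poly_altdef sum_distrib_right exp_minus divide_inverse mult.assoc)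
  ultimately show ?thesis by simp
qed

lemma flat_DERIV:
  "(flat p has_real_derivative flat ([:0, 0, 1:] * (p - pderiv p)) t) (at t)"
proof -
  consider "0 < t" | "t < 0" | "t = 0" by linarith
  then show ?thesis
  proof cases
    case 1
    have "((\<lambda>t. poly p (inverse t) * exp (- inverse t)) has_real_derivative
        flat ([:0, 0, 1:] * (p - pderiv p)) t) (at t)"
      using 1 by (auto intro!: derivative_eq_intros simp: flat_def algebra_simps power2_eq_square)
    then show ?thesis
      by (rule has_field_derivative_transform_within_open[of _ _ _ "{0<..}"])
        (use 1 in \<open>auto simp: flat_def\<close>)
  next
    case 2
    then have e: "flat ([:0, 0, 1:] * (p - pderiv p)) t = 0" by (simp add: flat_def)
    show ?thesis unfolding e
      by (rule has_field_derivative_transform_within_open[of "\<lambda>x. 0" _ _ "{..<0}"])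
        (use 2 in \<open>auto simp: flat_def\<close>)
  next
    case 3
    have r: "((\<lambda>h. flat p h / h) \<longlongrightarrow> 0) (at_right 0)"
    proof (rule Lim_transform_eventually)
      show "((\<lambda>h::real. poly (pCons 0 p) (inverse h) * exp (- inverse h)) \<longlongrightarrow> 0) (at_right 0)"
        by (rule filterlim_compose[OF poly_exp_tendsto_0 filterlim_inverse_at_top_right])
      show "\<forall>\<^sub>F h::real in at_right 0. poly (pCons 0 p) (inverse h) * exp (- inverse h) = flat p h / h"
        by (rule eventually_at_right_less[THEN eventually_mono])
          (simp add: flat_def divide_inverse)
    qed
    have l: "((\<lambda>h. flat p h / h) \<longlongrightarrow> 0) (at_left 0)"
      by (rule Lim_transform_eventually[OF tendsto_const])
        (auto simp: flat_def eventually_at_filter)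
    have "((\<lambda>h. flat p h / h) \<longlongrightarrow> 0) (at 0)"
      using l r by (rule filterlim_split_at)
    then show ?thesis using 3 by (simp add: DERIV_def flat_def)
  qed
qed

lemma C_diff_flat: "C_diff k (\<lambda>x::real^'n. flat p (c * (x $ j) + d))"
proof (induction k arbitrary: p)
  case 0
  have "continuous_on UNIV (flat p)"
    by (meson DERIV_isCont continuous_at_imp_continuous_on flat_DERIV)
  then show ?case
    by (auto intro!: continuous_on_compose2[of UNIV "flat p"] continuous_intros)
next
  case (Suc k)
  let ?q = "[:0, 0, 1:] * (p - pderiv p)"
  have D: "((\<lambda>x::real^'n. flat p (c * (x $ j) + d)) has_derivative
      (\<lambda>h. (c * (h $ j)) * flat ?q (c * (x $ j) + d))) (at x)" for x
  proof -
    have "((\<lambda>x::real^'n. c * (x $ j) + d) has_derivative (\<lambda>h. c * (h $ j))) (at x)"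
      by (auto intro!: derivative_eq_intros bounded_linear.has_derivative[OF bounded_linear_vec_nth])
    from has_derivative_compose[OF this flat_DERIV[unfolded has_field_derivative_def]]
    show ?thesis by (simp add: mult.commute)
  qed
  have "partial_deriv i (\<lambda>x::real^'n. flat p (c * (x $ j) + d)) =
      (\<lambda>x. (c * (axis i 1 $ j)) * flat ?q (c * (x $ j) + d))" for i
    using partial_deriv_eq[OF D] by blast
  then show ?case using Suc.IH[of ?q] D
    by (auto simp: differentiable_def simp del: mult_pCons_left intro!: C_diff_mult C_diff_const)
qed

lemma flat_1_bounds: "0 \<le> flat 1 t" "flat 1 t \<le> 1"
  by (auto simp: flat_def)

lemma flat_1_tendsto: "(\<lambda>m. flat 1 (real (Suc m) * t)) \<longlonglongrightarrow> (if 0 < t then 1 else 0)"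
proof (cases "0 < t")
  case True
  have "(\<lambda>m. exp (- (inverse (real (Suc m)) * inverse t))) \<longlonglongrightarrow> exp (- (0 * inverse t))"
    by (intro tendsto_intros LIMSEQ_inverse_real_of_nat)
  then show ?thesis using True by (simp add: flat_def)
next
  case False
  then have "flat 1 (real (Suc m) * t) = 0" for m
    by (simp add: flat_def zero_less_mult_iff del: of_nat_Suc)
  then show ?thesis using False by simp
qed

lemma integral_box_eq_0:
  fixes f :: "real^'n \<Rightarrow> real"
  assumes f: "L2 f" and 0: "\<And>\<phi>. test_function \<phi> \<Longrightarrow> (\<integral>x. f x * \<phi> x \<partial>lborel) = 0"
  shows "integrable lborel (\<lambda>x. indicator (box a b) x * f x)"
    and "(\<integral>x. indicator (box a b) x * f x \<partial>lborel) = 0"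
proof -
  define \<phi> where "\<phi> m x = (\<Prod>i\<in>UNIV. flat 1 (real (Suc m) * (x $ i - a $ i)) *
    flat 1 (real (Suc m) * (b $ i - x $ i)))" for m and x :: "real^'n"
  have sm: "C_diff k (\<phi> m)" for k m
  proof -
    have "C_diff k (\<lambda>x::real^'n. flat 1 (real (Suc m) * (x $ i) + (- real (Suc m) * a $ i)) *
      flat 1 ((- real (Suc m)) * (x $ i) + real (Suc m) * b $ i))" for i
      by (intro C_diff_mult C_diff_flat)
    then have "C_diff k (\<lambda>x::real^'n. \<Prod>i\<in>UNIV. flat 1 (real (Suc m) * (x $ i) + (- real (Suc m) * a $ i)) *
      flat 1 ((- real (Suc m)) * (x $ i) + real (Suc m) * b $ i))"
      by (intro C_diff_prod) auto
    then show ?thesis by (simp add: \<phi>_def[abs_def] algebra_simps)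
  qed
  have sub: "{x. \<phi> m x \<noteq> 0} \<subseteq> box a b" for m
    by (auto simp: \<phi>_def flat_def mem_box_cart zero_less_mult_iff split: if_splits)
  have "bounded {x. \<phi> m x \<noteq> 0}" for m
    using sub bounded_box bounded_subset by blast
  then have t: "test_function (\<phi> m)" for m
    using sm unfolding test_function_def compact_closure by blast
  have bnd: "\<bar>\<phi> m x\<bar> \<le> indicator (box a b) x" for m x
  proof (cases "x \<in> box a b")
    case True
    have "0 \<le> \<phi> m x" "\<phi> m x \<le> 1" unfolding \<phi>_def
      by (intro prod_nonneg mult_nonneg_nonneg flat_1_bounds)
         (intro prod_le_1 conjI mult_nonneg_nonneg mult_le_one flat_1_bounds)
    then show ?thesis using True by simp
  next
    case False
    then show ?thesis using sub by auto
  qed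
  have lim: "(\<lambda>m. \<phi> m x) \<longlonglongrightarrow> indicator (box a b) x" for x
  proof -
    have "(\<lambda>m. \<phi> m x) \<longlonglongrightarrow> (\<Prod>i\<in>UNIV. (if 0 < x $ i - a $ i then 1 else 0) *
        (if 0 < b $ i - x $ i then 1 else 0))"
      unfolding \<phi>_def by (intro tendsto_prod tendsto_mult flat_1_tendsto)
    also have "(\<Prod>i\<in>UNIV. (if 0 < x $ i - a $ i then 1 else 0) * (if 0 < b $ i - x $ i then 1 else 0)) =
        indicat_real (box a b) x"
    proof (cases "x \<in> box a b")
      case False
      then obtain i where "\<not> (0 < x $ i - a $ i \<and> 0 < b $ i - x $ i)"
        by (auto simp: mem_box_cart)
      then show ?thesis using False by (auto intro!: prod_zero)
    qed (auto simp: mem_box_cart)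
    finally show ?thesis .
  qed
  have [measurable]: "f \<in> borel_measurable borel" "\<phi> m \<in> borel_measurable borel" for m
    using f L2_test_function(1)[OF t] by (auto simp: L2_def)
  have "L2 (indicat_real (box a b))"
    using emeasure_bounded_finite[OF bounded_box, of a b]
    by (auto simp: L2_def power2_eq_square indicator_inter_arith[symmetric]
        intro!: integrable_real_indicator)
  from L2_mult[OF this f] show i: "integrable lborel (\<lambda>x. indicator (box a b) x * f x)" .
  have "(\<lambda>m. \<integral>x. f x * \<phi> m x \<partial>lborel) \<longlonglongrightarrow> (\<integral>x. indicator (box a b) x * f x \<partial>lborel)"
  proof (rule integral_dominated_convergence)
    show "integrable lborel (\<lambda>x. \<bar>indicator (box a b) x * f x\<bar>)" using i by simp
    show "AE x in lborel. (\<lambda>m. f x * \<phi> m x) \<longlonglongrightarrow> indicator (box a b) x * f x"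
      using tendsto_mult[OF tendsto_const lim] by (simp add: mult.commute)
    show "AE x in lborel. norm (f x * \<phi> m x) \<le> \<bar>indicator (box a b) x * f x\<bar>" for m
    proof (intro AE_I2)
      fix x
      have "\<bar>f x\<bar> * \<bar>\<phi> m x\<bar> \<le> \<bar>f x\<bar> * indicator (box a b) x"
        using bnd by (intro mult_left_mono) auto
      then show "norm (f x * \<phi> m x) \<le> \<bar>indicator (box a b) x * f x\<bar>"
        by (simp add: abs_mult mult.commute)
    qed
  qed auto
  then show "(\<integral>x. indicator (box a b) x * f x \<partial>lborel) = 0"
    unfolding 0[OF t] by (simp add: LIMSEQ_const_iff)
qed

lemma AE_0_if_integral_test_functions_0:
  fixes f :: "real^'n \<Rightarrow> real"
  assumes f: "L2 f" and 0: "\<And>\<phi>. test_function \<phi> \<Longrightarrow> (\<integral>x. f x * \<phi> x \<partial>lborel) = 0"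
  shows "AE x in lborel. f x = 0"
proof -
  have [measurable]: "f \<in> borel_measurable borel" using f by (simp add: L2_def)
  have *: "AE x in lborel. indicator (box c d) x * f x = 0" for c d :: "real^'n"
  proof (rule sigma_finite_measure.density_zero[OF lborel.sigma_finite_measure_axioms])
    let ?h = "\<lambda>x. indicator (box c d) x * f x"
    show int: "integrable lborel ?h" using integral_box_eq_0(1)[OF f 0] .
    have seti: "set_integrable lborel A ?h" if "A \<in> sets borel" for A
      using int that unfolding set_integrable_def by (intro integrable_mult_indicator) auto
    fix A :: "(real^'n) set" assume A: "A \<in> sets lborel"
    let ?E = "range (\<lambda>(a, b). box a b :: (real^'n) set)"
    have "A \<in> sigma_sets UNIV ?E" using A by (simp add: borel_eq_box)
    moreover have "Int_stable ?E" by (auto simp: Int_stable_def box_Int_box)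
    moreover have "?E \<subseteq> Pow UNIV" by simp
    ultimately have "Int_stable ?E" "?E \<subseteq> Pow UNIV" "A \<in> sigma_sets UNIV ?E" by blast+
    then show "set_lebesgue_integral lborel A ?h = 0"
    proof (induction rule: sigma_sets_induct_disjoint)
      case (basic A)
      then obtain a b where "A = box a b" by auto
      moreover obtain a' b' where "box a b \<inter> box c d = box a' b'"
        using box_Int_box by blast
      ultimately show ?case
        using integral_box_eq_0(2)[OF f 0, of a' b']
        by (simp add: set_lebesgue_integral_def indicator_inter_arith[symmetric] mult.assoc[symmetric])
    next
      case (compl A)
      then have [measurable]: "A \<in> sets borel" by (simp add: borel_eq_box)
      have "set_lebesgue_integral lborel (A \<union> (UNIV - A)) ?h =
          set_lebesgue_integral lborel A ?h + set_lebesgue_integral lborel (UNIV - A) ?h"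
        by (intro set_integral_Un seti) auto
      then show ?case
        using compl integral_box_eq_0(2)[OF f 0, of c d] by (simp add: set_lebesgue_integral_def)
    next
      case (union A)
      then have [measurable]: "A i \<in> sets borel" for i
        by (simp add: borel_eq_box image_subset_iff)
      show ?case
        using union seti[of "\<Union>i. A i"]
        by (subst lebesgue_integral_countable_add) (auto simp: disjoint_family_on_def)
    qed (simp add: set_lebesgue_integral_def)
  qed
  have "AE x in lborel. \<forall>m::nat. indicator (box (\<chi> i. - real m) (\<chi> i. real m)) x * f x = 0"
    unfolding AE_all_countable using * by blast
  then show ?thesis
  proof (rule AE_mp, intro AE_I2 impI)
    fix x assume a: "\<forall>m::nat. indicator (box (\<chi> i. - real m) (\<chi> i. real m)) x * f x = 0"
    obtain m :: nat where "norm x < real m" using reals_Archimedean2 by blast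
    then have "\<bar>x $ i\<bar> < real m" for i
      using component_le_norm_cart[of x i] by linarith
    then have "x \<in> box (\<chi> i. - real m) (\<chi> i. real m)"
      by (auto simp: mem_box_cart abs_less_iff minus_less_iff)
    then show "f x = 0" using a[rule_format, of m] by simp
  qed
qed

lemma is_weak_gradient_unique:
  assumes "is_weak_gradient u V" "is_weak_gradient u W" "L2 V" "L2 W"
  shows "AE x in lborel. V x = W x"
proof -
  have "AE x in lborel. (V x + (-1) *\<^sub>R W x) $ i = 0" for i
  proof (rule AE_0_if_integral_test_functions_0)
    show "L2 (\<lambda>x. (V x + (-1) *\<^sub>R W x) $ i)"
      by (intro L2_component L2_add L2_scaleR assms)
    fix \<phi> :: "real^'a \<Rightarrow> real" assume t: "test_function \<phi>"
    note [simp] = L2_mult[OF L2_component[OF assms(3)] L2_test_function(1)[OF t]]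
      L2_mult[OF L2_component[OF assms(4)] L2_test_function(1)[OF t]]
    have "(\<integral>x. V x $ i * \<phi> x \<partial>lborel) = (\<integral>x. W x $ i * \<phi> x \<partial>lborel)"
      using assms(1,2) t by (fastforce simp: is_weak_gradient_def)
    then show "(\<integral>x. (V x + (-1) *\<^sub>R W x) $ i * \<phi> x \<partial>lborel) = 0"
      by (simp add: left_diff_distrib)
  qed
  then have "AE x in lborel. \<forall>i\<in>UNIV. (V x + (-1) *\<^sub>R W x) $ i = 0"
    by (intro AE_finite_allI) auto
  then show ?thesis by (rule AE_mp) (auto simp: vec_eq_iff)
qed

lemma weak_gradient_unique:
  assumes "is_weak_gradient u V" "L2 V" "L2 u"
  shows "AE x in lborel. weak_gradient u x = V x"
proof -
  have "u \<in> H1_fun" using assms by (auto simp: H1_fun_def)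
  then show ?thesis
    using assms is_weak_gradient_unique weak_gradient_L2 weak_gradient_is_weak_gradient by blast
qed

lemma weak_gradient_cong_AE:
  assumes "u \<in> H1_fun" "v \<in> H1_fun" "AE x in lborel. u x = v x"
  shows "AE x in lborel. weak_gradient v x = weak_gradient u x"
  by (intro weak_gradient_unique weak_gradient_L2[OF assms(1)] H1_fun_L2[OF assms(2)]
      is_weak_gradient_cong_AE[OF weak_gradient_is_weak_gradient[OF assms(1)]
        H1_fun_L2[OF assms(1)] H1_fun_L2[OF assms(2)] assms(3)])

lemma H1_fun_zero: "(\<lambda>x. 0) \<in> H1_fun"
  unfolding H1_fun_def by (intro CollectI conjI exI[of _ "\<lambda>x. 0"] L2_zero is_weak_gradient_zero)

lemma H1_fun_add:
  assumes "u \<in> H1_fun" "v \<in> H1_fun"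
  shows "(\<lambda>x. u x + v x) \<in> H1_fun"
    and "AE x in lborel. weak_gradient (\<lambda>x. u x + v x) x = weak_gradient u x + weak_gradient v x"
proof -
  note a = H1_fun_L2 weak_gradient_L2 weak_gradient_is_weak_gradient
  have g: "is_weak_gradient (\<lambda>x. u x + v x) (\<lambda>x. weak_gradient u x + weak_gradient v x)"
    by (intro is_weak_gradient_add a assms)
  have l: "L2 (\<lambda>x. u x + v x)" "L2 (\<lambda>x. weak_gradient u x + weak_gradient v x)"
    by (intro L2_add a assms)+
  show "(\<lambda>x. u x + v x) \<in> H1_fun" using g l by (auto simp: H1_fun_def)
  show "AE x in lborel. weak_gradient (\<lambda>x. u x + v x) x = weak_gradient u x + weak_gradient v x"
    using weak_gradient_unique[OF g l(2,1)] .
qed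

lemma H1_fun_scaleR:
  assumes "u \<in> H1_fun"
  shows "(\<lambda>x. c * u x) \<in> H1_fun"
    and "AE x in lborel. weak_gradient (\<lambda>x. c * u x) x = c *\<^sub>R weak_gradient u x"
proof -
  note a = H1_fun_L2 weak_gradient_L2 weak_gradient_is_weak_gradient
  have g: "is_weak_gradient (\<lambda>x. c * u x) (\<lambda>x. c *\<^sub>R weak_gradient u x)"
    by (intro is_weak_gradient_scaleR a assms)
  have l: "L2 (\<lambda>x. c * u x)" "L2 (\<lambda>x. c *\<^sub>R weak_gradient u x)"
    using L2_scaleR[OF H1_fun_L2[OF assms]] L2_scaleR[OF weak_gradient_L2[OF assms]] by simp_all
  show "(\<lambda>x. c * u x) \<in> H1_fun" using g l by (auto simp: H1_fun_def)
  show "AE x in lborel. weak_gradient (\<lambda>x. c * u x) x = c *\<^sub>R weak_gradient u x"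
    using weak_gradient_unique[OF g l(2,1)] .
qed

lemma H1_fun_uminus: "u \<in> H1_fun \<Longrightarrow> (\<lambda>x. - u x) \<in> H1_fun"
  using H1_fun_scaleR(1)[of u "-1"] by simp

lemma H1_fun_diff: "u \<in> H1_fun \<Longrightarrow> v \<in> H1_fun \<Longrightarrow> (\<lambda>x. u x - v x) \<in> H1_fun"
  using H1_fun_add(1)[OF _ H1_fun_uminus, of u v] by simp

lemma H1_fun_translate:
  assumes "u \<in> H1_fun" shows "(\<lambda>x. u (x + y)) \<in> H1_fun"
proof -
  obtain V where u: "L2 u" and V: "L2 V" "is_weak_gradient u V"
    using assms unfolding H1_fun_def by blast
  have "is_weak_gradient (\<lambda>x. u (x + y)) (\<lambda>x. V (x + y))"
    by (rule is_weak_gradient_translate[OF V(2) u V(1)])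
  then show ?thesis
    using L2_translate[OF u] L2_translate[OF V(1)] unfolding H1_fun_def by blast
qed

section \<open>The space \<open>H\<^sup>1(\<real>\<^sup>N)\<close>\<close>

definition H1_rel :: "(real^'n \<Rightarrow> real) \<Rightarrow> (real^'n \<Rightarrow> real) \<Rightarrow> bool" where
  "H1_rel u v \<longleftrightarrow> u \<in> H1_fun \<and> v \<in> H1_fun \<and> (AE x in lborel. u x = v x)"

text \<open>Every class of Lebesgue measurable functions modulo null sets has a Borel measurable
  representative, so it does no harm that members of \<open>H1_fun\<close> are Borel measurable.
  For \<open>u :: 'n H1\<close>, \<open>rep_H1 u\<close> is some representative of \<open>u\<close>.\<close>

quotient_type 'n H1 = "real^'n \<Rightarrow> real" / partial: H1_rel
proof (rule part_equivpI)
  show "\<exists>x. H1_rel x x" using H1_fun_zero by (auto simp: H1_rel_def)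
  show "symp H1_rel" by (auto simp: symp_def H1_rel_def)
  show "transp H1_rel" by (auto simp: transp_def H1_rel_def)
qed

instantiation H1 :: (finite) real_vector
begin

lift_definition zero_H1 :: "'a H1" is "\<lambda>x. 0"
  using H1_fun_zero by (simp add: H1_rel_def)

lift_definition plus_H1 :: "'a H1 \<Rightarrow> 'a H1 \<Rightarrow> 'a H1" is "\<lambda>u v x. u x + v x"
  by (auto simp: H1_rel_def intro: H1_fun_add)

lift_definition scaleR_H1 :: "real \<Rightarrow> 'a H1 \<Rightarrow> 'a H1" is "\<lambda>c u x. c * u x"
  by (auto simp: H1_rel_def intro: H1_fun_scaleR)

lift_definition uminus_H1 :: "'a H1 \<Rightarrow> 'a H1" is "\<lambda>u x. - u x"
  by (auto simp: H1_rel_def intro: H1_fun_uminus)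

lift_definition minus_H1 :: "'a H1 \<Rightarrow> 'a H1 \<Rightarrow> 'a H1" is "\<lambda>u v x. u x - v x"
  by (auto simp: H1_rel_def intro: H1_fun_diff)

instance
proof
  fix u v w :: "'a H1" and r s :: real
  note H1_rel_def[simp]
  note in_H1 = H1_fun_add(1) H1_fun_scaleR(1) H1_fun_zero H1_fun_uminus H1_fun_diff
  show "u + v + w = u + (v + w)"
    by transfer (auto simp: add.assoc intro!: in_H1)
  show "u + v = v + u"
    by transfer (auto simp: add.commute intro!: in_H1)
  show "0 + u = u"
    by transfer (auto intro!: in_H1)
  show "- u + u = 0"
    by transfer (auto intro!: in_H1)
  show "u - v = u + - v"
    by transfer (auto intro!: in_H1)
  show "r *\<^sub>R (u + v) = r *\<^sub>R u + r *\<^sub>R v"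
    by transfer (auto simp: distrib_left intro!: in_H1)
  show "(r + s) *\<^sub>R u = r *\<^sub>R u + s *\<^sub>R u"
    by transfer (auto simp: distrib_right intro!: in_H1)
  show "r *\<^sub>R s *\<^sub>R u = (r * s) *\<^sub>R u"
    by transfer (auto simp: mult.assoc intro!: in_H1)
  show "1 *\<^sub>R u = u"
    by transfer (auto intro!: in_H1)
qed

end

instantiation H1 :: (finite) real_inner
begin

lift_definition inner_H1 :: "'a H1 \<Rightarrow> 'a H1 \<Rightarrow> real" is
  "\<lambda>u v. (\<integral>x. weak_gradient u x \<bullet> weak_gradient v x \<partial>lborel) + (\<integral>x. u x * v x \<partial>lborel)"
proof -
  fix u u' v v' :: "real^'a \<Rightarrow> real"
  assume r: "H1_rel u u'" "H1_rel v v'"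
  then have [measurable]: "u \<in> borel_measurable borel" "u' \<in> borel_measurable borel"
    "v \<in> borel_measurable borel" "v' \<in> borel_measurable borel"
    "weak_gradient u \<in> borel_measurable borel" "weak_gradient u' \<in> borel_measurable borel"
    "weak_gradient v \<in> borel_measurable borel" "weak_gradient v' \<in> borel_measurable borel"
    using L2_measurable H1_fun_L2 weak_gradient_L2 by (auto simp: H1_rel_def)
  have "AE x in lborel. weak_gradient u' x = weak_gradient u x"
    "AE x in lborel. weak_gradient v' x = weak_gradient v x"
    using r weak_gradient_cong_AE unfolding H1_rel_def by blast+
  then have "(\<integral>x. weak_gradient u x \<bullet> weak_gradient v x \<partial>lborel) =
      (\<integral>x. weak_gradient u' x \<bullet> weak_gradient v' x \<partial>lborel)"
    by (intro integral_cong_AE) auto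
  moreover have "(\<integral>x. u x * v x \<partial>lborel) = (\<integral>x. u' x * v' x \<partial>lborel)"
    using r by (intro integral_cong_AE) (auto simp: H1_rel_def)
  ultimately show "(\<integral>x. weak_gradient u x \<bullet> weak_gradient v x \<partial>lborel) + (\<integral>x. u x * v x \<partial>lborel) =
      (\<integral>x. weak_gradient u' x \<bullet> weak_gradient v' x \<partial>lborel) + (\<integral>x. u' x * v' x \<partial>lborel)"
    by simp
qed

definition norm_H1 :: "'a H1 \<Rightarrow> real" where
  "norm_H1 u = sqrt (inner u u)"

definition sgn_H1 :: "'a H1 \<Rightarrow> 'a H1" where
  "sgn_H1 u = u /\<^sub>R norm u"

definition dist_H1 :: "'a H1 \<Rightarrow> 'a H1 \<Rightarrow> real" where
  "dist_H1 u v = norm (u - v)"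

definition uniformity_H1 :: "('a H1 \<times> 'a H1) filter" where
  "uniformity_H1 = (INF e\<in>{0<..}. principal {(u, v). dist u v < e})"

definition open_H1 :: "'a H1 set \<Rightarrow> bool" where
  "open_H1 U \<longleftrightarrow> (\<forall>u\<in>U. \<forall>\<^sub>F (u', v) in uniformity. u' = u \<longrightarrow> v \<in> U)"

instance
proof
  fix u v w :: "'a H1" and r :: real and U :: "'a H1 set"
  note H1_rel_def[simp]
  show "dist u v = norm (u - v)" by (rule dist_H1_def)
  show "sgn u = u /\<^sub>R norm u" by (rule sgn_H1_def)
  show "uniformity = (INF e\<in>{0<..}. principal {(u :: 'a H1, v). dist u v < e})"
    by (rule uniformity_H1_def)
  show "open U \<longleftrightarrow> (\<forall>u\<in>U. \<forall>\<^sub>F (u', v) in uniformity. u' = u \<longrightarrow> v \<in> U)"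
    by (rule open_H1_def)
  show "norm u = sqrt (inner u u)" by (rule norm_H1_def)
  show "inner u v = inner v u"
    by transfer (simp add: inner_commute mult.commute)
  show "inner (u + v) w = inner u w + inner v w"
  proof transfer
    fix u v w :: "real^'a \<Rightarrow> real"
    assume "H1_rel u u" "H1_rel v v" "H1_rel w w"
    then have h: "u \<in> H1_fun" "v \<in> H1_fun" "w \<in> H1_fun" by auto
    note l = h[THEN H1_fun_L2] h[THEN weak_gradient_L2]
    note [measurable] = l[THEN L2_measurable]
      L2_measurable[OF weak_gradient_L2[OF H1_fun_add(1)[OF h(1,2)]]]
    have "(\<integral>x. weak_gradient (\<lambda>x. u x + v x) x \<bullet> weak_gradient w x \<partial>lborel) =
        (\<integral>x. (weak_gradient u x + weak_gradient v x) \<bullet> weak_gradient w x \<partial>lborel)"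
      using H1_fun_add(2)[OF h(1,2)] by (intro integral_cong_AE) auto
    then show "(\<integral>x. weak_gradient (\<lambda>x. u x + v x) x \<bullet> weak_gradient w x \<partial>lborel) +
          (\<integral>x. (u x + v x) * w x \<partial>lborel) =
        (\<integral>x. weak_gradient u x \<bullet> weak_gradient w x \<partial>lborel) + (\<integral>x. u x * w x \<partial>lborel) +
        ((\<integral>x. weak_gradient v x \<bullet> weak_gradient w x \<partial>lborel) + (\<integral>x. v x * w x \<partial>lborel))"
      using l by (simp add: inner_add_left distrib_right L2_inner L2_mult)
  qed
  show "inner (r *\<^sub>R u) v = r * inner u v"
  proof transfer
    fix r and u v :: "real^'a \<Rightarrow> real"
    assume "H1_rel u u" "H1_rel v v"
    then have h: "u \<in> H1_fun" "v \<in> H1_fun" by auto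
    note [measurable] = h[THEN weak_gradient_L2, THEN L2_measurable]
      L2_measurable[OF weak_gradient_L2[OF H1_fun_scaleR(1)[OF h(1), of r]]]
    have "(\<integral>x. weak_gradient (\<lambda>x. r * u x) x \<bullet> weak_gradient v x \<partial>lborel) =
        (\<integral>x. (r *\<^sub>R weak_gradient u x) \<bullet> weak_gradient v x \<partial>lborel)"
      using H1_fun_scaleR(2)[OF h(1), of r] by (intro integral_cong_AE) auto
    then show "(\<integral>x. weak_gradient (\<lambda>x. r * u x) x \<bullet> weak_gradient v x \<partial>lborel) +
          (\<integral>x. r * u x * v x \<partial>lborel) =
        r * ((\<integral>x. weak_gradient u x \<bullet> weak_gradient v x \<partial>lborel) + (\<integral>x. u x * v x \<partial>lborel))"
      by (simp add: mult.assoc distrib_left)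
  qed
  show "0 \<le> inner u u"
    by transfer (simp add: integral_nonneg_AE)
  show "inner u u = 0 \<longleftrightarrow> u = 0"
  proof transfer
    fix u :: "real^'a \<Rightarrow> real"
    assume "H1_rel u u"
    then have h: "u \<in> H1_fun" by auto
    note l = H1_fun_L2[OF h] weak_gradient_L2[OF h]
    have "AE x in lborel. u x = 0"
      if "(\<integral>x. weak_gradient u x \<bullet> weak_gradient u x \<partial>lborel) + (\<integral>x. u x * u x \<partial>lborel) = 0"
    proof -
      have "0 \<le> (\<integral>x. weak_gradient u x \<bullet> weak_gradient u x \<partial>lborel)" "0 \<le> (\<integral>x. u x * u x \<partial>lborel)"
        by (simp_all add: integral_nonneg_AE)
      then have "(\<integral>x. u x * u x \<partial>lborel) = 0" using that by linarith
      then show ?thesis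
        using L2_mult[OF l(1,1)] by (subst (asm) integral_nonneg_eq_0_iff_AE) auto
    qed
    moreover have "(\<integral>x. weak_gradient u x \<bullet> weak_gradient u x \<partial>lborel) + (\<integral>x. u x * u x \<partial>lborel) = 0"
      if z: "AE x in lborel. u x = 0"
    proof -
      have "is_weak_gradient u (\<lambda>x. 0)"
        using is_weak_gradient_cong_AE[OF is_weak_gradient_zero L2_zero l(1)] z by auto
      then have "AE x in lborel. weak_gradient u x = 0"
        using weak_gradient_unique L2_zero l(1) by blast
      then have "(\<integral>x. weak_gradient u x \<bullet> weak_gradient u x \<partial>lborel) = 0"
        by (intro integral_eq_zero_AE) auto
      moreover have "(\<integral>x. u x * u x \<partial>lborel) = 0"
        using z by (intro integral_eq_zero_AE) auto
      ultimately show ?thesis by simp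
    qed
    ultimately show "(\<integral>x. weak_gradient u x \<bullet> weak_gradient u x \<partial>lborel) + (\<integral>x. u x * u x \<partial>lborel) = 0
        \<longleftrightarrow> H1_rel u (\<lambda>x. 0)"
      using h H1_fun_zero by auto
  qed
qed

end

definition H1_gradient :: "'n::finite H1 \<Rightarrow> real^'n \<Rightarrow> real^'n" where
  "H1_gradient u = weak_gradient (rep_H1 u)"

lemma rep_H1_in_H1_fun: "rep_H1 u \<in> H1_fun"
  using Quotient3_rep_reflp[OF Quotient3_H1] by (auto simp: H1_rel_def)

lemma rep_H1_abs_H1: "u \<in> H1_fun \<Longrightarrow> AE x in lborel. rep_H1 (abs_H1 u) x = u x"
  using Quotient3_rep_abs[OF Quotient3_H1, of u] by (auto simp: H1_rel_def)

lemma norm_H1_eq: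
  "norm u = sqrt (\<integral>x. (norm (H1_gradient u x))\<^sup>2 + (rep_H1 u x)\<^sup>2 \<partial>lborel)"
proof -
  have "inner u u = inner (abs_H1 (rep_H1 u)) (abs_H1 (rep_H1 u))"
    by (simp add: Quotient3_abs_rep[OF Quotient3_H1])
  also have "\<dots> = (\<integral>x. H1_gradient u x \<bullet> H1_gradient u x \<partial>lborel) + (\<integral>x. rep_H1 u x * rep_H1 u x \<partial>lborel)"
    unfolding H1_gradient_def
    by (rule inner_H1.abs_eq) (simp_all add: H1_rel_def rep_H1_in_H1_fun)
  also have "\<dots> = (\<integral>x. (norm (H1_gradient u x))\<^sup>2 + (rep_H1 u x)\<^sup>2 \<partial>lborel)"
    using L2_inner[OF weak_gradient_L2 weak_gradient_L2, OF rep_H1_in_H1_fun rep_H1_in_H1_fun, of u u]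
      L2_mult[OF H1_fun_L2 H1_fun_L2, OF rep_H1_in_H1_fun rep_H1_in_H1_fun, of u u]
    by (simp add: H1_gradient_def dot_square_norm power2_eq_square)
  finally show ?thesis by (simp add: norm_H1_def)
qed

lift_definition translate :: "real^'n \<Rightarrow> 'n::finite H1 \<Rightarrow> 'n H1" is "\<lambda>y u x. u (x + y)"
proof -
  fix y and u v :: "real^'n \<Rightarrow> real"
  assume r: "H1_rel u v"
  then have [measurable]: "u \<in> borel_measurable borel" "v \<in> borel_measurable borel"
    using L2_measurable H1_fun_L2 by (auto simp: H1_rel_def)
  have "AE x in lborel. u (x + y) = v (x + y)"
    by (rule lborel_AE_translate) (use r in \<open>auto simp: H1_rel_def\<close>)
  then show "H1_rel (\<lambda>x. u (x + y)) (\<lambda>x. v (x + y))"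
    using r H1_fun_translate by (auto simp: H1_rel_def)
qed

section \<open>Weak convergence, Palais-Smale sequences and the energy functional\<close>

definition weakly_converges_to :: "(nat \<Rightarrow> 'a::real_normed_vector) \<Rightarrow> 'a \<Rightarrow> bool" where
  "weakly_converges_to u w \<longleftrightarrow> (\<forall>\<Lambda> :: 'a \<Rightarrow> real. bounded_linear \<Lambda> \<longrightarrow> (\<lambda>n. \<Lambda> (u n)) \<longlonglongrightarrow> \<Lambda> w)"

text \<open>For \<open>J\<close> of class \<open>C\<^sup>1\<close> the differentiability conjunct is automatic; it is there because
  \<open>frechet_derivative\<close> is unspecified where \<open>J\<close> is not differentiable.\<close>

definition bounded_Palais_Smale ::
    "('a::real_normed_vector \<Rightarrow> real) \<Rightarrow> real \<Rightarrow> (nat \<Rightarrow> 'a) \<Rightarrow> bool" where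
  "bounded_Palais_Smale J \<beta> u \<longleftrightarrow>
     bounded (range u) \<and> (\<lambda>n. J (u n)) \<longlonglongrightarrow> \<beta> \<and>
     (\<forall>n. J differentiable at (u n)) \<and>
     (\<lambda>n. onorm (frechet_derivative J (at (u n)))) \<longlonglongrightarrow> 0"

text \<open>The interval integral is oriented, so this is also correct for \<open>t < 0\<close>.\<close>

definition primitive :: "(real \<Rightarrow> real) \<Rightarrow> real \<Rightarrow> real" where
  "primitive g t = (LBINT s=0..ereal t. g s)"

text \<open>For continuous \<open>g\<close> the value does not depend on the representatives chosen by
  \<open>rep_H1\<close> and \<open>H1_gradient\<close>.\<close>

definition energy :: "(real \<Rightarrow> real) \<Rightarrow> 'n::finite H1 \<Rightarrow> real" where
  "energy g u = (\<integral>x. (norm (H1_gradient u x))\<^sup>2 \<partial>lborel) / 2 - (\<integral>x. primitive g (rep_H1 u x) \<partial>lborel)"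

end

theory Submission
  imports Defs "HOL-Library.Diagonal_Subsequence"
begin

text \<open>Put \<open>f t = t + g t\<close>, so that the derivative of the energy at \<open>u\<close> is \<open>h \<mapsto> u \<bullet> h - \<integral> f(u) h\<close> with
  the inner product of \<open>H\<^sup>1\<close>. From a bounded Palais-Smale sequence one splits off weak limits of translates,
  one at a time. Each of them is a critical point, and splitting it off also splits the squared norm and the
  energy. Nonzero critical points are bounded away from 0, so there is a maximal family of profiles. All
  translates of its remainder \<open>v\<close> tend weakly to 0, which forces the mass of \<open>v\<close> on \<open>{|v| > \<delta>}\<close> to
  vanish in the limit. Since \<open>f t * t \<le> (1 - m) * t\<^sup>2\<close> near 0 and \<open>f\<close> grows subcritically, testing the derivative
  with \<open>v\<close> yields \<open>m * (norm v)\<^sup>2 \<longlonglongrightarrow> 0\<close>.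

  The weak gradient enters only through the completeness of \<open>H\<^sup>1\<close> and the estimate
  \<open>\<integral> (u (x + h) - u x)\<^sup>2 dx \<le> (norm h)\<^sup>2 * (norm u)\<^sup>2\<close>: local compactness and vanishing follow from it by averaging
  over small balls, the critical Sobolev embedding by truncation.\<close>

section \<open>Hilbert spaces\<close>

text \<open>The remainder \<open>v\<close> is never shown to be a Palais-Smale sequence. The
  derivative is taken at \<open>u = v + W\<close>, with \<open>W\<close> the sum of the translated
  profiles, and tested with \<open>v\<close>; whatever couples \<open>v\<close> to \<open>W\<close>
  vanishes, because in the frame of each profile \<open>v\<close> tends weakly to 0. Besides
  translations, the critical growth obstructs compactness: powers of order \<open>p\<close> are
  bounded under weak convergence, but need not converge. In the limit arguments they therefore
  always carry an arbitrarily small coefficient \<open>\<eta>\<close>, and the Sobolev embedding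
  bounds their integrals. What is left is quadratic, and products
  \<open>\<bar>v\<bar> * \<bar>\<phi>\<bar>\<close> with a fixed \<open>\<phi>\<close> in L2 do tend
  to 0. Pointwise inequalities followed by a choice of \<open>\<eta>\<close> thus do the work of
  interpolation. The first profile sits at the prescribed centre 0 and may be 0, so the lower bound
  on norms counts profiles only from the second on.\<close>

lemma LIMSEQ_if_subseq_subseq:
  fixes X :: "nat \<Rightarrow> 'a::metric_space"
  assumes "\<And>r::nat \<Rightarrow> nat. strict_mono r \<Longrightarrow> \<exists>s. strict_mono s \<and> (\<lambda>n. X (r (s n))) \<longlonglongrightarrow> L"
  shows "X \<longlonglongrightarrow> L"
proof (rule ccontr)
  assume "\<not> X \<longlonglongrightarrow> L"
  then obtain e where e: "e > 0" "\<exists>\<^sub>F n in sequentially. dist (X n) L \<ge> e"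
    unfolding tendsto_iff by (auto simp: not_eventually not_less)
  then have "infinite {n. dist (X n) L \<ge> e}"
    by (simp add: frequently_cofinite cofinite_eq_sequentially[symmetric])
  then obtain r :: "nat \<Rightarrow> nat" where r: "strict_mono r" "\<And>n. r n \<in> {n. dist (X n) L \<ge> e}"
    using infinite_enumerate by blast
  obtain s where "(\<lambda>n. X (r (s n))) \<longlonglongrightarrow> L" using assms[OF r(1)] by blast
  then have "\<forall>\<^sub>F n in sequentially. dist (X (r (s n))) L < e"
    using e(1) by (simp add: tendsto_iff)
  then show False using r(2) by (auto simp: not_less[symmetric] dest!: eventually_happens)
qed

lemma norm_diff_squared: "(norm (x - y))\<^sup>2 = (norm x)\<^sup>2 - 2 * (x \<bullet> y) + (norm (y::'a::real_inner))\<^sup>2"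
  by (simp add: power2_norm_eq_inner inner_diff inner_commute)

lemma parallelogram_midpoint:
  fixes h p q :: "'a::real_inner"
  shows "(norm (p - q))\<^sup>2 = 2 * (norm (h - p))\<^sup>2 + 2 * (norm (h - q))\<^sup>2 - 4 * (norm (h - (1/2) *\<^sub>R (p + q)))\<^sup>2"
  unfolding power2_norm_eq_inner
  by (simp add: inner_diff_left inner_diff_right inner_add_left inner_add_right inner_commute algebra_simps)

text \<open>A minimising sequence for the distance is Cauchy by the parallelogram law. Completeness
  is an explicit hypothesis because \<open>H1\<close> is set up only as an instance of
  \<open>real_inner\<close>; \<open>complete_H1\<close> supplies it later.\<close>

lemma orthogonal_projection_exists:
  fixes M :: "'a::real_inner set"
  assumes comp: "complete (UNIV :: 'a set)" and "closed M" and sub: "subspace M"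
  obtains p where "p \<in> M" "\<And>q. q \<in> M \<Longrightarrow> (h - p) \<bullet> q = 0"
proof -
  define D where "D = Inf ((\<lambda>q. (norm (h - q))\<^sup>2) ` M)"
  have ne: "M \<noteq> {}" using subspace_0[OF sub] by blast
  have bdd: "bdd_below ((\<lambda>q. (norm (h - q))\<^sup>2) ` M)"
    by (rule bdd_belowI[of _ 0]) auto
  have D_le: "D \<le> (norm (h - q))\<^sup>2" if "q \<in> M" for q
    unfolding D_def using that bdd by (intro cInf_lower) auto
  have "\<exists>q\<in>M. (norm (h - q))\<^sup>2 < D + inverse (real (Suc n))" for n
    using cInf_lessD[of "(\<lambda>q. (norm (h - q))\<^sup>2) ` M" "D + inverse (real (Suc n))"] ne
    unfolding D_def[symmetric] by auto
  then obtain P where P: "\<And>n. P n \<in> M" "\<And>n. (norm (h - P n))\<^sup>2 < D + inverse (real (Suc n))"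
    by metis
  \<comment> \<open>The midpoint of \<open>P m\<close> and \<open>P n\<close> lies in
    \<open>M\<close>, so its squared distance to \<open>h\<close> is at least
    \<open>D\<close>.\<close>
  have close: "(norm (P m - P n))\<^sup>2 \<le> 2 * inverse (real (Suc m)) + 2 * inverse (real (Suc n))" for m n
  proof -
    have "(1/2) *\<^sub>R (P m + P n) \<in> M" using P(1) sub by (intro subspace_scale subspace_add)
    then show ?thesis
      using D_le[of "(1/2) *\<^sub>R (P m + P n)"] P(2)[of m] P(2)[of n] parallelogram_midpoint[of "P m" "P n" h]
      by linarith
  qed
  have "Cauchy P"
    unfolding Cauchy_def
  proof (intro allI impI)
    fix e :: real assume "e > 0"
    then obtain N where N: "inverse (real (Suc N)) < e\<^sup>2 / 4"
      using reals_Archimedean[of "e\<^sup>2 / 4"] by auto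
    have "dist (P m) (P n) < e" if "m \<ge> N" "n \<ge> N" for m n
    proof -
      have "inverse (real (Suc m)) \<le> inverse (real (Suc N))" "inverse (real (Suc n)) \<le> inverse (real (Suc N))"
        using that by (auto intro!: le_imp_inverse_le)
      then have "(norm (P m - P n))\<^sup>2 < e\<^sup>2" using close[of m n] N by linarith
      then show ?thesis using \<open>e > 0\<close> by (simp add: dist_norm power2_less_imp_less)
    qed
    then show "\<exists>N. \<forall>m\<ge>N. \<forall>n\<ge>N. dist (P m) (P n) < e" by blast
  qed
  then obtain p where p: "P \<longlonglongrightarrow> p" using comp unfolding complete_def by blast
  have pM: "p \<in> M" using \<open>closed M\<close> P(1) p closed_sequentially by blast
  have "(\<lambda>n. (norm (h - P n))\<^sup>2) \<longlonglongrightarrow> (norm (h - p))\<^sup>2" by (intro tendsto_intros p)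
  moreover have "(\<lambda>n. D + inverse (real (Suc n))) \<longlonglongrightarrow> D + 0"
    by (intro tendsto_intros LIMSEQ_inverse_real_of_nat)
  ultimately have "(norm (h - p))\<^sup>2 \<le> D + 0"
    by (rule LIMSEQ_le) (use P(2) less_imp_le in blast)
  then have le: "(norm (h - p))\<^sup>2 \<le> D" by simp
  have "(h - p) \<bullet> q = 0" if q: "q \<in> M" for q
  proof (cases "q = 0")
    case False
    \<comment> \<open>The value minimising \<open>norm ((h - p) - t *\<^sub>R q)\<close>; comparison
      with \<open>t = 0\<close> forces the inner product to vanish.\<close>
    define t where "t = ((h - p) \<bullet> q) / (q \<bullet> q)"
    have "p + t *\<^sub>R q \<in> M" using pM q sub by (intro subspace_scale subspace_add)
    then have "(norm (h - p))\<^sup>2 \<le> (norm ((h - p) - t *\<^sub>R q))\<^sup>2"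
      unfolding diff_diff_eq using D_le[of "p + t *\<^sub>R q"] le by linarith
    then have "2 * (t * ((h - p) \<bullet> q)) \<le> t * t * (q \<bullet> q)"
      unfolding norm_diff_squared[of "h - p"] unfolding power2_norm_eq_inner by simp
    moreover have "t * t * (q \<bullet> q) = ((h - p) \<bullet> q)\<^sup>2 / (q \<bullet> q)" "t * ((h - p) \<bullet> q) = ((h - p) \<bullet> q)\<^sup>2 / (q \<bullet> q)"
      using False by (simp_all add: t_def power2_eq_square)
    ultimately have "((h - p) \<bullet> q)\<^sup>2 / (q \<bullet> q) \<le> 0" by linarith
    moreover have "q \<bullet> q > 0" using False by simp
    ultimately have "((h - p) \<bullet> q)\<^sup>2 \<le> 0" by (simp add: divide_le_0_iff)
    then show ?thesis by simp
  qed simp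
  then show thesis using that pM by blast
qed

text \<open>Projecting a vector \<open>h\<close> outside the kernel onto the kernel leaves
  \<open>z = h - p\<close> orthogonal to it, and every \<open>x\<close> is a multiple of
  \<open>z\<close> up to an element of the kernel.\<close>

lemma Riesz_representation:
  fixes \<Lambda> :: "'a::real_inner \<Rightarrow> real"
  assumes comp: "complete (UNIV :: 'a set)" and L: "bounded_linear \<Lambda>"
  obtains w where "\<And>x. \<Lambda> x = x \<bullet> w"
proof (cases "\<forall>x. \<Lambda> x = 0")
  case True
  then show ?thesis using that[of 0] by simp
next
  case False
  then obtain h where h: "\<Lambda> h \<noteq> 0" by blast
  interpret \<Lambda>: bounded_linear \<Lambda> by (rule L)
  have "closed {x. \<Lambda> x = 0}"
    by (intro closed_Collect_eq \<Lambda>.continuous_on continuous_intros)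
  moreover have "subspace {x. \<Lambda> x = 0}"
    by (auto simp: subspace_def \<Lambda>.zero \<Lambda>.add \<Lambda>.scaleR)
  ultimately obtain p where p: "\<Lambda> p = 0" "\<And>q. \<Lambda> q = 0 \<Longrightarrow> (h - p) \<bullet> q = 0"
    using orthogonal_projection_exists[OF comp, of "{x. \<Lambda> x = 0}" h] by auto
  define z where "z = h - p"
  have z: "\<Lambda> z \<noteq> 0" using h p(1) by (simp add: z_def \<Lambda>.diff)
  then have "z \<noteq> 0" using \<Lambda>.zero by auto
  show ?thesis
  proof (rule that[of "(\<Lambda> z / (z \<bullet> z)) *\<^sub>R z"])
    fix x
    have "\<Lambda> (x - (\<Lambda> x / \<Lambda> z) *\<^sub>R z) = 0" using z by (simp add: \<Lambda>.diff \<Lambda>.scaleR)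
    then have "z \<bullet> (x - (\<Lambda> x / \<Lambda> z) *\<^sub>R z) = 0" using p(2) by (simp add: z_def)
    then have "x \<bullet> z = \<Lambda> x / \<Lambda> z * (z \<bullet> z)" by (simp add: inner_diff_right inner_commute)
    then show "\<Lambda> x = x \<bullet> ((\<Lambda> z / (z \<bullet> z)) *\<^sub>R z)"
      using z \<open>z \<noteq> 0\<close> by simp
  qed
qed

lemma weakly_converges_to_iff_inner:
  fixes x :: "nat \<Rightarrow> 'a::real_inner"
  assumes comp: "complete (UNIV :: 'a set)"
  shows "weakly_converges_to x w \<longleftrightarrow> (\<forall>h. (\<lambda>n. x n \<bullet> h) \<longlonglongrightarrow> w \<bullet> h)"
proof
  assume "weakly_converges_to x w"
  then show "\<forall>h. (\<lambda>n. x n \<bullet> h) \<longlonglongrightarrow> w \<bullet> h"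
    unfolding weakly_converges_to_def using bounded_linear_inner_left by blast
next
  assume a: "\<forall>h. (\<lambda>n. x n \<bullet> h) \<longlonglongrightarrow> w \<bullet> h"
  show "weakly_converges_to x w"
    unfolding weakly_converges_to_def
  proof (intro allI impI)
    fix \<Lambda> :: "'a \<Rightarrow> real" assume "bounded_linear \<Lambda>"
    then obtain z where "\<And>x. \<Lambda> x = x \<bullet> z" using Riesz_representation[OF comp] by blast
    then show "(\<lambda>n. \<Lambda> (x n)) \<longlonglongrightarrow> \<Lambda> w" using a by simp
  qed
qed

lemma weak_limit_unique:
  fixes x :: "nat \<Rightarrow> 'a::real_inner"
  assumes "weakly_converges_to x v" "weakly_converges_to x w"
  shows "v = w"
proof -
  have "bounded_linear (\<lambda>x. x \<bullet> (v - w))" by (rule bounded_linear_inner_left)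
  then have "v \<bullet> (v - w) = w \<bullet> (v - w)"
    using assms LIMSEQ_unique unfolding weakly_converges_to_def by blast
  then have "(v - w) \<bullet> (v - w) = 0" by (simp add: inner_diff_left)
  then show ?thesis by simp
qed

lemma weakly_converges_to_subseq:
  assumes "weakly_converges_to x w" "strict_mono r"
  shows "weakly_converges_to (\<lambda>n. x (r n)) w"
  using assms LIMSEQ_subseq_LIMSEQ unfolding weakly_converges_to_def comp_def by blast

lemma weakly_converges_to_add:
  assumes "weakly_converges_to x v" "weakly_converges_to y w"
  shows "weakly_converges_to (\<lambda>n. x n + y n) (v + w)"
  using assms unfolding weakly_converges_to_def
  by (auto simp: linear_add bounded_linear.linear intro!: tendsto_add)

lemma weakly_converges_to_diff:
  assumes "weakly_converges_to x v" "weakly_converges_to y w"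
  shows "weakly_converges_to (\<lambda>n. x n - y n) (v - w)"
  using assms unfolding weakly_converges_to_def
  by (auto simp: linear_diff bounded_linear.linear intro!: tendsto_diff)

lemma weakly_converges_to_const: "weakly_converges_to (\<lambda>n. w) w"
  by (simp add: weakly_converges_to_def)

lemma weakly_converges_to_sum:
  assumes "\<And>i. i \<in> I \<Longrightarrow> weakly_converges_to (\<lambda>n. x i n) (w i)"
  shows "weakly_converges_to (\<lambda>n. \<Sum>i\<in>I. x i n) (\<Sum>i\<in>I. w i)"
  using assms by (induction I rule: infinite_finite_induct)
    (auto simp: weakly_converges_to_const intro!: weakly_converges_to_add)

text \<open>The vectors \<open>h\<close> for which \<open>x (r n) \<bullet> h\<close> converges form a closed subspace, which contains every
  \<open>x m\<close> by a diagonal argument and hence, by projection, everything.\<close>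

lemma bounded_has_weakly_convergent_subseq:
  fixes x :: "nat \<Rightarrow> 'a::real_inner"
  assumes comp: "complete (UNIV :: 'a set)" and "bounded (range x)"
  obtains r w where "strict_mono r" "weakly_converges_to (\<lambda>n. x (r n)) w"
proof -
  obtain B where B: "B > 0" "\<And>n. norm (x n) \<le> B"
    using assms(2) by (force simp: bounded_pos)
  have ip: "\<bar>x n \<bullet> h\<bar> \<le> B * norm h" for n h
    using Cauchy_Schwarz_ineq2[of "x n" h] B(2)[of n] by (meson mult_right_mono norm_ge_zero order_trans)
  interpret subseqs "\<lambda>m s. convergent (\<lambda>n. x (s n) \<bullet> x m)"
  proof
    fix m and s :: "nat \<Rightarrow> nat" assume "strict_mono s"
    have "bounded (range (\<lambda>n. x (s n) \<bullet> x m))"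
      using ip by (auto simp: bounded_iff)
    then obtain l r' where "strict_mono r'" "((\<lambda>n. x (s n) \<bullet> x m) \<circ> r') \<longlonglongrightarrow> l"
      using bounded_imp_convergent_subsequence by metis
    then show "\<exists>r'. strict_mono r' \<and> convergent (\<lambda>n. x ((s \<circ> r') n) \<bullet> x m)"
      by (auto simp: convergent_def comp_def)
  qed
  define r where "r = diagseq"
  have r: "strict_mono r" unfolding r_def by (rule subseq_diagseq)
  define M where "M = {h. convergent (\<lambda>n. x (r n) \<bullet> h)}"
  have xM: "x m \<in> M" for m
  proof -
    \<comment> \<open>The diagonal sequence is a subsequence of the one chosen for \<open>m\<close>
      only from index \<open>Suc m\<close> on.\<close>
    have "convergent (\<lambda>n. x ((diagseq \<circ> ((+) (Suc m))) n) \<bullet> x m)"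
    proof (rule diagseq_holds)
      fix r s :: "nat \<Rightarrow> nat" and n
      assume "strict_mono r" "convergent (\<lambda>i. x (s i) \<bullet> x n)"
      from convergent_subseq_convergent[OF this(2,1)]
      show "convergent (\<lambda>i. x ((s \<circ> r) i) \<bullet> x n)" by (simp add: comp_def)
    qed
    then have "convergent (\<lambda>n. x (r (n + Suc m)) \<bullet> x m)"
      by (simp add: r_def comp_def add.commute)
    then show ?thesis
      unfolding M_def using convergent_ignore_initial_segment[of "\<lambda>n. x (r n) \<bullet> x m" "Suc m"] by blast
  qed
  have sub: "subspace M"
    unfolding subspace_def M_def
    by (auto simp: inner_add_right intro: convergent_add convergent_mult convergent_const)
  have "closed M"
    unfolding closed_sequential_limits
  proof (intro allI impI)
    fix h l assume a: "(\<forall>k. h k \<in> M) \<and> h \<longlonglongrightarrow> l"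
    have "Cauchy (\<lambda>n. x (r n) \<bullet> l)"
    proof (rule metric_CauchyI)
      fix e :: real assume "e > 0"
      then obtain k where k: "norm (h k - l) < e / (3 * B)"
        using a LIMSEQ_iff[of h l] B(1) by (metis divide_pos_pos mult_pos_pos order_refl zero_less_numeral)
      have d: "\<bar>x n \<bullet> l - x n \<bullet> h k\<bar> < e / 3" for n
      proof -
        have "\<bar>x n \<bullet> (l - h k)\<bar> \<le> B * norm (l - h k)" by (rule ip)
        also have "\<dots> < B * (e / (3 * B))" using k B(1) by (intro mult_strict_left_mono) (auto simp: norm_minus_commute)
        finally show ?thesis using B(1) by (simp add: inner_diff_right)
      qed
      have "Cauchy (\<lambda>n. x (r n) \<bullet> h k)" using a by (auto simp: M_def Cauchy_convergent_iff)
      then obtain N where N: "\<And>m n. m \<ge> N \<Longrightarrow> n \<ge> N \<Longrightarrow> dist (x (r m) \<bullet> h k) (x (r n) \<bullet> h k) < e / 3"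
        using \<open>e > 0\<close> unfolding Cauchy_def by (metis divide_pos_pos zero_less_numeral)
      have "dist (x (r m) \<bullet> l) (x (r n) \<bullet> l) < e" if "m \<ge> N" "n \<ge> N" for m n
        using N[OF that] d[of "r m"] d[of "r n"] unfolding dist_real_def by linarith
      then show "\<exists>N. \<forall>m\<ge>N. \<forall>n\<ge>N. dist (x (r m) \<bullet> l) (x (r n) \<bullet> l) < e" by blast
    qed
    then show "l \<in> M" by (simp add: M_def Cauchy_convergent_iff)
  qed
  have conv: "convergent (\<lambda>n. x (r n) \<bullet> h)" for h
  proof -
    obtain p where p: "p \<in> M" "\<And>q. q \<in> M \<Longrightarrow> (h - p) \<bullet> q = 0"
      using orthogonal_projection_exists[OF comp \<open>closed M\<close> sub] by blast
    \<comment> \<open>All \<open>x m\<close> lie in \<open>M\<close>, so the part of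
      \<open>h\<close> orthogonal to \<open>M\<close> is invisible to the sequence.\<close>
    have "x (r n) \<bullet> h = x (r n) \<bullet> p" for n
      using p(2)[OF xM, of "r n"] by (simp add: inner_diff_left inner_commute)
    then show ?thesis using p(1) by (simp add: M_def)
  qed
  define \<Lambda> where "\<Lambda> h = lim (\<lambda>n. x (r n) \<bullet> h)" for h
  have \<Lambda>: "(\<lambda>n. x (r n) \<bullet> h) \<longlonglongrightarrow> \<Lambda> h" for h
    using conv by (simp add: \<Lambda>_def convergent_LIMSEQ_iff)
  have "bounded_linear \<Lambda>"
  proof (rule bounded_linear_intro[of _ B])
    show "\<Lambda> (a + b) = \<Lambda> a + \<Lambda> b" for a b
      using tendsto_add[OF \<Lambda>[of a] \<Lambda>[of b]] \<Lambda>[of "a + b"]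
      by (auto simp: inner_add_right intro: LIMSEQ_unique)
    show "\<Lambda> (c *\<^sub>R a) = c *\<^sub>R \<Lambda> a" for a c
      using tendsto_mult[OF tendsto_const[of c] \<Lambda>[of a]] \<Lambda>[of "c *\<^sub>R a"] by (auto intro: LIMSEQ_unique)
    show "norm (\<Lambda> a) \<le> norm a * B" for a
      using LIMSEQ_le_const2[OF tendsto_rabs[OF \<Lambda>[of a]], of "B * norm a"] ip[of _ a]
      by (auto simp: mult.commute)
  qed
  then obtain w where w: "\<And>h. \<Lambda> h = h \<bullet> w" using Riesz_representation[OF comp] by blast
  have "weakly_converges_to (\<lambda>n. x (r n)) w"
    unfolding weakly_converges_to_iff_inner[OF comp] using \<Lambda> w by (simp add: inner_commute)
  then show thesis using that r by blast
qed

section \<open>Translations of Sobolev functions\<close>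

lemma L2_square_integrable:
  fixes f :: "real^'n \<Rightarrow> real"
  shows "L2 f \<Longrightarrow> integrable lborel (\<lambda>x. (f x)\<^sup>2)"
  by (simp add: L2_def)

lemma L2_nn_integral:
  fixes f :: "real^'n \<Rightarrow> real"
  shows "L2 f \<Longrightarrow> (\<integral>\<^sup>+x. ennreal ((f x)\<^sup>2) \<partial>lborel) = ennreal (\<integral>x. (f x)\<^sup>2 \<partial>lborel)"
  by (intro nn_integral_eq_integral L2_square_integrable) auto

lemma L2I_nn_integral:
  fixes f :: "real^'n \<Rightarrow> real"
  assumes "f \<in> borel_measurable borel" "(\<integral>\<^sup>+x. ennreal ((f x)\<^sup>2) \<partial>lborel) < \<infinity>"
  shows "L2 f"
  using assms by (auto simp: L2_def intro!: integrableI_bounded)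

lemma L2_uminus: "L2 f \<Longrightarrow> L2 (\<lambda>x. - f x)"
  by (simp add: L2_def)

lemma L2_diff: "L2 f \<Longrightarrow> L2 g \<Longrightarrow> L2 (\<lambda>x. f x - g x)"
  using L2_add[OF _ L2_uminus] by fastforce

lemma L2_sum:
  assumes "\<And>i. i \<in> I \<Longrightarrow> L2 (f i)"
  shows "L2 (\<lambda>x. \<Sum>i\<in>I. f i x)"
  using assms by (induction I rule: infinite_finite_induct) (auto simp: L2_zero L2_add)

lemma L2_abs: "L2 (f :: real^'n \<Rightarrow> real) \<Longrightarrow> L2 (\<lambda>x. \<bar>f x\<bar>)"
  by (auto simp: L2_def)

lemma L2_cmult: "L2 (f :: real^'n \<Rightarrow> real) \<Longrightarrow> L2 (\<lambda>x. c * f x)"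
  using L2_scaleR[of f c] by simp

lemma L2_inner_const:
  fixes V :: "real^'n \<Rightarrow> real^'m"
  assumes "L2 V" shows "L2 (\<lambda>x. V x \<bullet> h)"
proof -
  have "L2 (\<lambda>x. \<Sum>i\<in>UNIV. h $ i * V x $ i)"
    by (intro L2_sum L2_cmult L2_component assms)
  then show ?thesis by (simp add: inner_vec_def mult.commute)
qed

text \<open>Cauchy-Schwarz against the indicator. Integrability is not assumed: where it fails, the
  Bochner integral is 0 by convention and the claim is trivial.\<close>

lemma Jensen_square_nn_integral:
  fixes f :: "'a \<Rightarrow> real"
  assumes [measurable]: "f \<in> borel_measurable M" "Q \<in> sets M"
  shows "ennreal ((\<integral>x. indicator Q x * f x \<partial>M)\<^sup>2)
    \<le> emeasure M Q * (\<integral>\<^sup>+x. indicator Q x * ennreal ((f x)\<^sup>2) \<partial>M)"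
proof (cases "integrable M (\<lambda>x. indicator Q x * f x)")
  case True
  have "ennreal \<bar>\<integral>x. indicator Q x * f x \<partial>M\<bar> \<le> (\<integral>\<^sup>+x. ennreal \<bar>indicator Q x * f x\<bar> \<partial>M)"
    using integral_norm_bound_ennreal[OF True] by simp
  also have "\<dots> = (\<integral>\<^sup>+x. indicator Q x * ennreal (indicator Q x * \<bar>f x\<bar>) \<partial>M)"
    by (intro nn_integral_cong) (auto simp: indicator_def)
  finally have "(ennreal \<bar>\<integral>x. indicator Q x * f x \<partial>M\<bar>)\<^sup>2 \<le> (\<integral>\<^sup>+x. indicator Q x * ennreal (indicator Q x * \<bar>f x\<bar>) \<partial>M)\<^sup>2"
    by (rule power_mono) simp
  also have "\<dots> \<le> (\<integral>\<^sup>+x. (indicator Q x)\<^sup>2 \<partial>M) * (\<integral>\<^sup>+x. (ennreal (indicator Q x * \<bar>f x\<bar>))\<^sup>2 \<partial>M)"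
    by (rule Cauchy_Schwarz_nn_integral) auto
  also have "(\<integral>\<^sup>+x. (indicator Q x :: ennreal)\<^sup>2 \<partial>M) = emeasure M Q"
  proof -
    have "(\<integral>\<^sup>+x. (indicator Q x :: ennreal)\<^sup>2 \<partial>M) = (\<integral>\<^sup>+x. indicator Q x \<partial>M)"
      by (intro nn_integral_cong) (auto simp: indicator_def)
    then show ?thesis by simp
  qed
  also have "(\<integral>\<^sup>+x. (ennreal (indicator Q x * \<bar>f x\<bar>))\<^sup>2 \<partial>M) = (\<integral>\<^sup>+x. indicator Q x * ennreal ((f x)\<^sup>2) \<partial>M)"
    by (intro nn_integral_cong) (auto simp: indicator_def ennreal_power)
  finally show ?thesis by (simp add: ennreal_power)
qed (simp add: not_integrable_integral_eq)

lemma nn_integral_lborel_translate: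
  fixes f :: "'a::euclidean_space \<Rightarrow> ennreal"
  assumes [measurable]: "f \<in> borel_measurable borel"
  shows "(\<integral>\<^sup>+x. f (x + y) \<partial>lborel) = (\<integral>\<^sup>+x. f x \<partial>lborel)"
proof -
  have "(\<integral>\<^sup>+x. f x \<partial>lborel) = (\<integral>\<^sup>+x. f x \<partial>distr lborel borel ((+) y))"
    by (simp add: lborel_distr_plus)
  also have "\<dots> = (\<integral>\<^sup>+x. f (y + x) \<partial>lborel)" by (subst nn_integral_distr) auto
  finally show ?thesis by (simp add: add.commute)
qed

text \<open>By Tonelli: for each \<open>s\<close> the shift leaves the integral unchanged, and the
  parameter interval has length 1.\<close>

lemma nn_integral_average_translates:
  fixes f :: "real^'n \<Rightarrow> ennreal" and h :: "real^'n"
  assumes [measurable]: "f \<in> borel_measurable borel"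
  shows "(\<integral>\<^sup>+x. (\<integral>\<^sup>+s. indicator {0..1::real} s * f (x + s *\<^sub>R h) \<partial>lborel) \<partial>lborel) = (\<integral>\<^sup>+x. f x \<partial>lborel)"
proof -
  have "(\<integral>\<^sup>+x. (\<integral>\<^sup>+s. indicator {0..1::real} s * f (x + s *\<^sub>R h) \<partial>lborel) \<partial>lborel)
      = (\<integral>\<^sup>+s. (\<integral>\<^sup>+x. indicator {0..1::real} s * f (x + s *\<^sub>R h) \<partial>lborel) \<partial>lborel)"
    by (rule lborel_pair.Fubini'[symmetric]) simp
  also have "\<dots> = (\<integral>\<^sup>+s. (\<integral>\<^sup>+x. f x \<partial>lborel) * indicator {0..1::real} s \<partial>lborel)"
    by (simp add: nn_integral_cmult nn_integral_lborel_translate mult.commute)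
  also have "\<dots> = (\<integral>\<^sup>+x. f x \<partial>lborel)" by (simp add: nn_integral_cmult_indicator)
  finally show ?thesis .
qed

lemma abs_mult_le_squares: "\<bar>a * b\<bar> \<le> a\<^sup>2 + (b::real)\<^sup>2"
proof -
  have "2 * (\<bar>a\<bar> * \<bar>b\<bar>) \<le> a\<^sup>2 + b\<^sup>2" using sum_squares_bound[of "\<bar>a\<bar>" "\<bar>b\<bar>"] by simp
  then show ?thesis using abs_ge_zero[of "a * b"] unfolding abs_mult by linarith
qed

text \<open>Justifies Fubini. The majorant from \<open>abs_mult_le_squares\<close> is integrable in
  both variables because \<open>s\<close> ranges over an interval of length 1.\<close>

lemma integrable_average_translates:
  fixes f \<phi> :: "real^'n \<Rightarrow> real" and h :: "real^'n"
  assumes f: "L2 f" and \<phi>: "L2 \<phi>"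
  shows "integrable (lborel \<Otimes>\<^sub>M lborel) (\<lambda>(x, s). indicator {0..1::real} s * f (x + s *\<^sub>R h) * \<phi> x)"
proof (rule integrableI_bounded)
  note [measurable] = L2_measurable[OF f] L2_measurable[OF \<phi>]
  show "(\<lambda>(x, s). indicator {0..1::real} s * f (x + s *\<^sub>R h) * \<phi> x) \<in> borel_measurable (lborel \<Otimes>\<^sub>M lborel)"
    by measurable
  have "(\<integral>\<^sup>+z. ennreal (norm (case z of (x, s) \<Rightarrow> indicator {0..1::real} s * f (x + s *\<^sub>R h) * \<phi> x)) \<partial>(lborel \<Otimes>\<^sub>M lborel))
      = (\<integral>\<^sup>+x. \<integral>\<^sup>+s. ennreal (norm (indicator {0..1::real} s * f (x + s *\<^sub>R h) * \<phi> x)) \<partial>lborel \<partial>lborel)"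
    by (subst lborel.nn_integral_fst[symmetric]) simp_all
  also have "\<dots> \<le> (\<integral>\<^sup>+x. \<integral>\<^sup>+s. indicator {0..1::real} s * ennreal ((f (x + s *\<^sub>R h))\<^sup>2)
      + ennreal ((\<phi> x)\<^sup>2) * indicator {0..1::real} s \<partial>lborel \<partial>lborel)"
  proof (intro nn_integral_mono)
    fix x and s :: real
    have "ennreal \<bar>f (x + s *\<^sub>R h) * \<phi> x\<bar> \<le> ennreal ((f (x + s *\<^sub>R h))\<^sup>2) + ennreal ((\<phi> x)\<^sup>2)"
      using ennreal_leI[OF abs_mult_le_squares] by (metis ennreal_plus zero_le_power2)
    then show "ennreal (norm (indicator {0..1::real} s * f (x + s *\<^sub>R h) * \<phi> x))
        \<le> indicator {0..1::real} s * ennreal ((f (x + s *\<^sub>R h))\<^sup>2) + ennreal ((\<phi> x)\<^sup>2) * indicator {0..1::real} s"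
      by (cases "s \<in> {0..1}") simp_all
  qed
  also have "\<dots> = (\<integral>\<^sup>+x. ennreal ((f x)\<^sup>2) \<partial>lborel) + (\<integral>\<^sup>+x. ennreal ((\<phi> x)\<^sup>2) \<partial>lborel)"
    by (simp add: nn_integral_add nn_integral_cmult_indicator nn_integral_average_translates[of "\<lambda>x. ennreal ((f x)\<^sup>2)"])
  also have "\<dots> < \<infinity>" by (simp add: L2_nn_integral f \<phi>)
  finally show "(\<integral>\<^sup>+z. ennreal (norm (case z of (x, s) \<Rightarrow> indicator {0..1::real} s * f (x + s *\<^sub>R h) * \<phi> x)) \<partial>(lborel \<Otimes>\<^sub>M lborel)) < \<infinity>" .
qed

lemma Fubini_average_translates:
  fixes f \<phi> :: "real^'n \<Rightarrow> real" and h :: "real^'n"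
  assumes "L2 f" "L2 \<phi>"
  shows "(\<integral>x. (\<integral>s. indicator {0..1::real} s * f (x + s *\<^sub>R h) \<partial>lborel) * \<phi> x \<partial>lborel)
    = (\<integral>s. indicator {0..1::real} s * (\<integral>x. f (x + s *\<^sub>R h) * \<phi> x \<partial>lborel) \<partial>lborel)"
proof -
  have "(\<integral>x. indicator {0..1::real} s * f (x + s *\<^sub>R h) * \<phi> x \<partial>lborel)
      = indicator {0..1::real} s * (\<integral>x. f (x + s *\<^sub>R h) * \<phi> x \<partial>lborel)" for s
    by (simp add: mult.assoc)
  then show ?thesis
    using lborel_pair.Fubini_integral[OF integrable_average_translates[OF assms, of h]] by simp
qed

definition dir_deriv :: "real^'n \<Rightarrow> (real^'n \<Rightarrow> real) \<Rightarrow> real^'n \<Rightarrow> real" where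
  "dir_deriv h \<phi> x = (\<Sum>i\<in>UNIV. h $ i * partial_deriv i \<phi> x)"

lemma test_function_differentiable: "test_function \<phi> \<Longrightarrow> \<phi> differentiable at x"
  unfolding test_function_def by (metis C_diff.simps(2))

lemma test_function_partial_continuous: "test_function \<phi> \<Longrightarrow> continuous_on UNIV (partial_deriv i \<phi>)"
  unfolding test_function_def using C_diff.simps(1,2) by metis

lemma L2_dir_deriv: "test_function \<phi> \<Longrightarrow> L2 (dir_deriv h \<phi>)"
  unfolding dir_deriv_def[abs_def] by (intro L2_sum L2_cmult L2_test_function)

lemma dir_deriv_has_derivative:
  assumes "test_function \<phi>"
  shows "((\<lambda>s. \<phi> (x + s *\<^sub>R h)) has_real_derivative dir_deriv h \<phi> (x + s *\<^sub>R h)) (at s)"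
proof -
  let ?D = "frechet_derivative \<phi> (at (x + s *\<^sub>R h))"
  have D: "(\<phi> has_derivative ?D) (at (x + s *\<^sub>R h))"
    using test_function_differentiable[OF assms] frechet_derivative_works by blast
  then interpret bounded_linear ?D by (rule has_derivative_bounded_linear)
  have "?D h = ?D (\<Sum>i\<in>UNIV. (h $ i) *\<^sub>R axis i 1)"
    by (simp add: basis_expansion scalar_mult_eq_scaleR[symmetric])
  also have "\<dots> = dir_deriv h \<phi> (x + s *\<^sub>R h)"
    by (simp add: sum scaleR dir_deriv_def partial_deriv_def)
  finally have e: "?D h = dir_deriv h \<phi> (x + s *\<^sub>R h)" .
  have "((\<lambda>s. x + s *\<^sub>R h) has_derivative (\<lambda>s. s *\<^sub>R h)) (at s)"
    by (auto intro!: derivative_eq_intros)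
  from has_derivative_compose[OF this D] show ?thesis
    by (simp add: has_field_derivative_def scaleR e mult_commute_abs)
qed

lemma integral_dir_deriv:
  fixes \<phi> :: "real^'n \<Rightarrow> real"
  assumes "test_function \<phi>"
  shows "(\<integral>s. indicator {0..1::real} s * dir_deriv h \<phi> (x + s *\<^sub>R h) \<partial>lborel) = \<phi> (x + h) - \<phi> x"
proof -
  have "continuous_on UNIV (\<lambda>s. dir_deriv h \<phi> (x + s *\<^sub>R h))"
    unfolding dir_deriv_def
    by (intro continuous_intros continuous_on_compose2[OF test_function_partial_continuous[OF assms]]) auto
  then have "(\<integral>s. dir_deriv h \<phi> (x + s *\<^sub>R h) * indicator {0..1::real} s \<partial>lborel) = \<phi> (x + 1 *\<^sub>R h) - \<phi> (x + 0 *\<^sub>R h)"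
    by (intro integral_FTC_Icc_real dir_deriv_has_derivative assms)
      (auto simp: continuous_on_eq_continuous_at)
  then show ?thesis by (simp add: mult.commute)
qed

lemma weak_gradient_dir_deriv:
  fixes u :: "real^'n \<Rightarrow> real"
  assumes "L2 u" "L2 V" "is_weak_gradient u V" "test_function \<phi>"
  shows "(\<integral>x. u x * dir_deriv h \<phi> x \<partial>lborel) = - (\<integral>x. (V x \<bullet> h) * \<phi> x \<partial>lborel)"
proof -
  note [simp] = L2_mult[OF assms(1) L2_test_function(2)[OF assms(4)]]
    L2_mult[OF L2_component[OF assms(2)] L2_test_function(1)[OF assms(4)]]
  have "(\<integral>x. u x * dir_deriv h \<phi> x \<partial>lborel) = (\<Sum>i\<in>UNIV. h $ i * (\<integral>x. u x * partial_deriv i \<phi> x \<partial>lborel))"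
    unfolding dir_deriv_def sum_distrib_left mult.left_commute[of "u _"] by (simp add: Bochner_Integration.integral_sum)
  also have "\<dots> = (\<Sum>i\<in>UNIV. h $ i * - (\<integral>x. V x $ i * \<phi> x \<partial>lborel))"
    using assms(3,4) by (simp add: is_weak_gradient_def)
  also have "\<dots> = - (\<integral>x. (\<Sum>i\<in>UNIV. h $ i * (V x $ i * \<phi> x)) \<partial>lborel)"
    by (simp add: Bochner_Integration.integral_sum sum_negf)
  also have "(\<lambda>x. \<Sum>i\<in>UNIV. h $ i * (V x $ i * \<phi> x)) = (\<lambda>x. (V x \<bullet> h) * \<phi> x)"
    by (simp add: fun_eq_iff inner_vec_def sum_distrib_left mult_ac)
  finally show ?thesis .
qed

lemma dir_deriv_translate:
  assumes "test_function \<phi>"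
  shows "dir_deriv h (\<lambda>x. \<phi> (x + y)) = (\<lambda>x. dir_deriv h \<phi> (x + y))"
  unfolding dir_deriv_def[abs_def]
  using partial_deriv_translate(1)[of \<phi> _ y] test_function_differentiable[OF assms] by simp

text \<open>Both sides of the first claim are square integrable and have the same integral against every test
  function.\<close>

lemma weak_gradient_increment:
  fixes u :: "real^'n \<Rightarrow> real"
  assumes u: "L2 u" and V: "L2 V" and g: "is_weak_gradient u V"
  shows "AE x in lborel. u (x + h) - u x = (\<integral>s. indicator {0..1::real} s * (V (x + s *\<^sub>R h) \<bullet> h) \<partial>lborel)"
    and "(\<integral>\<^sup>+x. ennreal ((\<integral>s. indicator {0..1::real} s * (V (x + s *\<^sub>R h) \<bullet> h) \<partial>lborel)\<^sup>2) \<partial>lborel)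
      \<le> (\<integral>\<^sup>+x. ennreal ((V x \<bullet> h)\<^sup>2) \<partial>lborel)"
proof -
  let ?q = "\<lambda>x. V x \<bullet> h"
  let ?I = "\<lambda>x. \<integral>s. indicator {0..1::real} s * ?q (x + s *\<^sub>R h) \<partial>lborel"
  have q: "L2 ?q" by (rule L2_inner_const[OF V])
  note [measurable] = L2_measurable[OF u] L2_measurable[OF q]
  have "(\<integral>\<^sup>+x. ennreal ((?I x)\<^sup>2) \<partial>lborel)
      \<le> (\<integral>\<^sup>+x. (\<integral>\<^sup>+s. indicator {0..1::real} s * ennreal ((?q (x + s *\<^sub>R h))\<^sup>2) \<partial>lborel) \<partial>lborel)"
  proof (intro nn_integral_mono)
    fix x
    show "ennreal ((?I x)\<^sup>2) \<le> (\<integral>\<^sup>+s. indicator {0..1::real} s * ennreal ((?q (x + s *\<^sub>R h))\<^sup>2) \<partial>lborel)"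
      using Jensen_square_nn_integral[of "\<lambda>s. ?q (x + s *\<^sub>R h)" lborel "{0..1::real}"] by simp
  qed
  also have "\<dots> = (\<integral>\<^sup>+x. ennreal ((?q x)\<^sup>2) \<partial>lborel)"
    by (rule nn_integral_average_translates) simp
  finally show le: "(\<integral>\<^sup>+x. ennreal ((?I x)\<^sup>2) \<partial>lborel) \<le> (\<integral>\<^sup>+x. ennreal ((?q x)\<^sup>2) \<partial>lborel)" .
  have I: "L2 ?I"
  proof (rule L2I_nn_integral)
    show "?I \<in> borel_measurable borel"
      using lborel.borel_measurable_lebesgue_integral[of "\<lambda>x s. indicator {0..1::real} s * ?q (x + s *\<^sub>R h)" lborel]
      by simp
    show "(\<integral>\<^sup>+x. ennreal ((?I x)\<^sup>2) \<partial>lborel) < \<infinity>"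
      using le L2_nn_integral[OF q] by (simp add: order_le_less_trans)
  qed
  have uh: "L2 (\<lambda>x. u (x + h))" by (rule L2_translate[OF u])
  have "AE x in lborel. u (x + h) - u x - ?I x = 0"
  proof (rule AE_0_if_integral_test_functions_0)
    show "L2 (\<lambda>x. u (x + h) - u x - ?I x)" by (intro L2_diff uh u I)
    fix \<phi> :: "real^'n \<Rightarrow> real" assume t: "test_function \<phi>"
    note \<phi> = L2_test_function(1)[OF t] and d\<phi> = L2_dir_deriv[OF t, of h]
    note [measurable] = L2_measurable[OF \<phi>] L2_measurable[OF d\<phi>]
    have "(\<integral>x. ?I x * \<phi> x \<partial>lborel) = (\<integral>s. indicator {0..1::real} s * (\<integral>x. ?q (x + s *\<^sub>R h) * \<phi> x \<partial>lborel) \<partial>lborel)"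
      by (rule Fubini_average_translates[OF q \<phi>])
    \<comment> \<open>Shifting \<open>x\<close> by \<open>- s *\<^sub>R h\<close> moves the
      translation onto the test function, where the definition of the weak gradient applies.\<close>
    also have "\<dots> = (\<integral>s. indicator {0..1::real} s * - (\<integral>x. dir_deriv h \<phi> (x + s *\<^sub>R (- h)) * u x \<partial>lborel) \<partial>lborel)"
    proof -
      have "(\<integral>x. ?q (x + s *\<^sub>R h) * \<phi> x \<partial>lborel) = - (\<integral>x. dir_deriv h \<phi> (x + s *\<^sub>R (- h)) * u x \<partial>lborel)" for s
      proof -
        have "(\<integral>x. ?q (x + s *\<^sub>R h) * \<phi> x \<partial>lborel) = (\<integral>x. ?q x * \<phi> (x + s *\<^sub>R (- h)) \<partial>lborel)"
          using lborel_integral_translate[of "\<lambda>x. ?q (x + s *\<^sub>R h) * \<phi> x" "s *\<^sub>R (- h)"] by simp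
        then show ?thesis
          using weak_gradient_dir_deriv[OF u V g test_function_translate[OF t, of "s *\<^sub>R (- h)"], of h]
          unfolding dir_deriv_translate[OF t] by (simp add: mult.commute)
      qed
      then show ?thesis by simp
    qed
    also have "\<dots> = - (\<integral>x. (\<integral>s. indicator {0..1::real} s * dir_deriv h \<phi> (x + s *\<^sub>R (- h)) \<partial>lborel) * u x \<partial>lborel)"
      using Fubini_average_translates[OF d\<phi> u, of "- h"] by simp
    \<comment> \<open>The minus sign goes into the direction, so that the inner integral runs over
      the derivative of the test function along the segment from \<open>x\<close> to
      \<open>x - h\<close>.\<close>
    also have "\<dots> = (\<integral>x. (\<integral>s. indicator {0..1::real} s * dir_deriv (- h) \<phi> (x + s *\<^sub>R (- h)) \<partial>lborel) * u x \<partial>lborel)"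
      by (simp add: dir_deriv_def sum_negf)
    also have "\<dots> = (\<integral>x. (\<phi> (x + - h) - \<phi> x) * u x \<partial>lborel)"
      by (simp only: integral_dir_deriv[OF t])
    also have "\<dots> = (\<integral>x. \<phi> (x + - h) * u x \<partial>lborel) - (\<integral>x. \<phi> x * u x \<partial>lborel)"
      using L2_mult[OF L2_translate[OF \<phi>, of "- h"] u] L2_mult[OF \<phi> u]
      by (simp add: left_diff_distrib)
    also have "(\<integral>x. \<phi> (x + - h) * u x \<partial>lborel) = (\<integral>x. \<phi> x * u (x + h) \<partial>lborel)"
      using lborel_integral_translate[of "\<lambda>x. \<phi> (x + - h) * u x" h] by simp
    finally have "(\<integral>x. ?I x * \<phi> x \<partial>lborel) = (\<integral>x. u (x + h) * \<phi> x \<partial>lborel) - (\<integral>x. u x * \<phi> x \<partial>lborel)"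
      by (simp only: mult.commute[of "\<phi> _"])
    then show "(\<integral>x. (u (x + h) - u x - ?I x) * \<phi> x \<partial>lborel) = 0"
      using L2_mult[OF uh \<phi>] L2_mult[OF u \<phi>] L2_mult[OF I \<phi>] by (simp add: left_diff_distrib)
  qed
  then show "AE x in lborel. u (x + h) - u x = ?I x" by simp
qed

lemma translation_estimate:
  fixes u :: "real^'n \<Rightarrow> real"
  assumes u: "L2 u" and V: "L2 V" and g: "is_weak_gradient u V"
  shows "(\<integral>\<^sup>+x. ennreal ((u (x + h) - u x)\<^sup>2) \<partial>lborel) \<le> ennreal ((norm h)\<^sup>2 * (\<integral>x. (norm (V x))\<^sup>2 \<partial>lborel))"
proof -
  have "(\<integral>\<^sup>+x. ennreal ((u (x + h) - u x)\<^sup>2) \<partial>lborel)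
      = (\<integral>\<^sup>+x. ennreal ((\<integral>s. indicator {0..1::real} s * (V (x + s *\<^sub>R h) \<bullet> h) \<partial>lborel)\<^sup>2) \<partial>lborel)"
    by (rule nn_integral_cong_AE) (use weak_gradient_increment(1)[OF assms, of h] in auto)
  also have "\<dots> \<le> (\<integral>\<^sup>+x. ennreal ((V x \<bullet> h)\<^sup>2) \<partial>lborel)"
    by (rule weak_gradient_increment(2)[OF assms])
  also have "\<dots> \<le> (\<integral>\<^sup>+x. ennreal ((norm h)\<^sup>2 * (norm (V x))\<^sup>2) \<partial>lborel)"
  proof (intro nn_integral_mono ennreal_leI)
    fix x show "(V x \<bullet> h)\<^sup>2 \<le> (norm h)\<^sup>2 * (norm (V x))\<^sup>2"
      using Cauchy_Schwarz_ineq[of "V x" h] by (simp add: power2_norm_eq_inner mult.commute)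
  qed
  also have "\<dots> = ennreal (\<integral>x. (norm h)\<^sup>2 * (norm (V x))\<^sup>2 \<partial>lborel)"
    using V by (intro nn_integral_eq_integral) (auto simp: L2_def)
  finally show ?thesis by simp
qed

section \<open>Completeness of \<open>H\<^sup>1\<close>\<close>

text \<open>On a space of infinite measure an L2 Cauchy sequence need not be Cauchy in L1.
  Multiplication by a bounded positive integrable weight \<open>w\<close> makes it so, which yields
  an a.e. convergent subsequence; Fatou's lemma then identifies its limit as the L2 limit.\<close>

lemma L2_complete:
  fixes f :: "nat \<Rightarrow> real^'n \<Rightarrow> 'b::euclidean_space"
  assumes f: "\<And>n. L2 (f n)"
    and Cauchy: "\<And>e. e > 0 \<Longrightarrow> \<exists>N. \<forall>m\<ge>N. \<forall>n\<ge>N. (\<integral>x. (norm (f m x - f n x))\<^sup>2 \<partial>lborel) < e"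
  obtains F where "L2 F" "(\<lambda>n. \<integral>x. (norm (f n x - F x))\<^sup>2 \<partial>lborel) \<longlonglongrightarrow> 0"
proof -
  have [measurable]: "f n \<in> borel_measurable borel" for n using f by (rule L2_measurable)
  have diff: "L2 (\<lambda>x. f m x - f n x)" for m n by (intro L2_diff f)
  obtain w :: "real^'n \<Rightarrow> real" where w [measurable]: "w \<in> borel_measurable lborel"
      and w01: "\<And>x. 0 < w x" "\<And>x. w x \<le> 1" and wi: "integrable lborel w"
    using sigma_finite_measure.obtain_positive_integrable_function[OF sigma_finite_lborel] by blast
  have ww: "(w x)\<^sup>2 \<le> w x" for x
    using w01[of x] by (simp add: power2_eq_square mult_left_le)
  \<comment> \<open>Young's inequality with parameter \<open>t\<close>. Since
    \<open>w \<le> 1\<close> gives \<open>w\<^sup>2 \<le> w\<close>, the first term is integrable,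
    and its integral does not depend on \<open>m\<close> and \<open>n\<close>.\<close>
  have young: "w x * norm (f m x - f n x) \<le> t * w x + (norm (f m x - f n x))\<^sup>2 / t" if "t > 0" for t x m n
  proof -
    have "2 * (t * w x) * norm (f m x - f n x) \<le> (t * w x)\<^sup>2 + (norm (f m x - f n x))\<^sup>2"
      by (rule sum_squares_bound)
    moreover have "(t * w x)\<^sup>2 \<le> t\<^sup>2 * w x"
      using ww by (simp add: power_mult_distrib mult_left_mono)
    ultimately have "t * (w x * norm (f m x - f n x)) \<le> t\<^sup>2 * w x + (norm (f m x - f n x))\<^sup>2"
      using mult_nonneg_nonneg[OF mult_nonneg_nonneg[of t "w x"] norm_ge_zero[of "f m x - f n x"]] that w01(1)[of x]
      unfolding mult.assoc by linarith
    then have "w x * norm (f m x - f n x) \<le> (t\<^sup>2 * w x + (norm (f m x - f n x))\<^sup>2) / t"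
      using that by (simp add: pos_le_divide_eq mult.commute)
    then show ?thesis using that by (simp add: add_divide_distrib power2_eq_square)
  qed
  have int: "integrable lborel (\<lambda>x. w x *\<^sub>R f n x)" for n
  proof (rule Bochner_Integration.integrable_bound)
    show "integrable lborel (\<lambda>x. w x + (norm (f n x))\<^sup>2)" using f[of n] wi by (simp add: L2_def)
    have "norm (w x *\<^sub>R f n x) \<le> w x + (norm (f n x))\<^sup>2" for x
      using abs_mult_le_squares[of "w x" "norm (f n x)"] ww[of x] w01(1)[of x] by simp
    then show "AE x in lborel. norm (w x *\<^sub>R f n x) \<le> norm (w x + (norm (f n x))\<^sup>2)"
      using w01(1) by (auto simp: less_imp_le intro!: AE_I2 order_trans[OF _ abs_ge_self])
  qed simp
  have L1C: "\<exists>N. \<forall>i\<ge>N. \<forall>j\<ge>N. (\<integral>x. norm (w x *\<^sub>R f i x - w x *\<^sub>R f j x) \<partial>lborel) < e" if e: "e > 0" for e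
  proof -
    \<comment> \<open>Makes the weight term at most \<open>e / 2\<close>, whatever the integral of
      \<open>w\<close> is.\<close>
    define t where "t = e / (2 * (1 + integral\<^sup>L lborel w))"
    have W: "0 \<le> integral\<^sup>L lborel w" using w01(1) by (simp add: less_imp_le)
    have t: "t > 0" using that W by (simp add: t_def add_pos_nonneg)
    have tw: "t * integral\<^sup>L lborel w \<le> e / 2"
      using that W by (simp add: t_def field_simps add_pos_nonneg)
    obtain N where N: "\<And>m n. m \<ge> N \<Longrightarrow> n \<ge> N \<Longrightarrow> (\<integral>x. (norm (f m x - f n x))\<^sup>2 \<partial>lborel) < t * (e / 2)"
      using Cauchy[of "t * (e / 2)"] t e by auto
    have "(\<integral>x. norm (w x *\<^sub>R f i x - w x *\<^sub>R f j x) \<partial>lborel) < e" if "i \<ge> N" "j \<ge> N" for i j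
    proof -
      have "(\<integral>x. norm (w x *\<^sub>R f i x - w x *\<^sub>R f j x) \<partial>lborel)
          \<le> (\<integral>x. t * w x + (norm (f i x - f j x))\<^sup>2 / t \<partial>lborel)"
      proof (rule integral_mono)
        show "integrable lborel (\<lambda>x. norm (w x *\<^sub>R f i x - w x *\<^sub>R f j x))" using int by simp
        show "integrable lborel (\<lambda>x. t * w x + (norm (f i x - f j x))\<^sup>2 / t)"
          using diff[of i j] wi by (simp add: L2_def)
        show "norm (w x *\<^sub>R f i x - w x *\<^sub>R f j x) \<le> t * w x + (norm (f i x - f j x))\<^sup>2 / t" for x
          using young[OF t, of x i j] w01(1)[of x] by (simp add: scaleR_diff_right[symmetric])
      qed
      also have "\<dots> = t * integral\<^sup>L lborel w + (\<integral>x. (norm (f i x - f j x))\<^sup>2 \<partial>lborel) / t"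
        using diff[of i j] wi by (simp add: L2_def)
      also have "\<dots> < e / 2 + t * (e / 2) / t"
        using tw N[OF that] t by (intro add_le_less_mono divide_strict_right_mono)
      finally show ?thesis using t by simp
    qed
    then show ?thesis by blast
  qed
  obtain r where r: "strict_mono r" and rC: "AE x in lborel. Cauchy (\<lambda>i. w x *\<^sub>R f (r i) x)"
    using cauchy_L1_AE_cauchy_subseq[of lborel "\<lambda>n x. w x *\<^sub>R f n x", OF int L1C] by blast
  define F where "F x = lim (\<lambda>i. f (r i) x)" for x
  have [measurable]: "F \<in> borel_measurable borel"
    unfolding F_def[abs_def] by (rule borel_measurable_lim_metric) simp
  have F: "AE x in lborel. (\<lambda>i. f (r i) x) \<longlonglongrightarrow> F x"
    using rC
  proof (rule AE_mp, intro AE_I2 impI)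
    fix x assume "Cauchy (\<lambda>i. w x *\<^sub>R f (r i) x)"
    then have "Cauchy (\<lambda>i. inverse (w x) *\<^sub>R (w x *\<^sub>R f (r i) x))"
      by (rule bounded_linear.Cauchy[OF bounded_linear_scaleR_right])
    then have "convergent (\<lambda>i. f (r i) x)"
      using w01(1)[of x] by (simp add: Cauchy_convergent_iff)
    then show "(\<lambda>i. f (r i) x) \<longlonglongrightarrow> F x" by (simp add: F_def convergent_LIMSEQ_iff)
  qed
  \<comment> \<open>Fatou along the subsequence \<open>r\<close>: the Cauchy bound for
    \<open>f n - f (r i)\<close> passes to \<open>f n - F\<close>.\<close>
  have le: "\<exists>N. \<forall>n\<ge>N. (\<integral>\<^sup>+x. ennreal ((norm (f n x - F x))\<^sup>2) \<partial>lborel) \<le> ennreal e" if e: "e > 0" for e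
  proof -
    obtain N where N: "\<And>m n. m \<ge> N \<Longrightarrow> n \<ge> N \<Longrightarrow> (\<integral>x. (norm (f m x - f n x))\<^sup>2 \<partial>lborel) < e"
      using Cauchy[OF e] by auto
    have "(\<integral>\<^sup>+x. ennreal ((norm (f n x - F x))\<^sup>2) \<partial>lborel) \<le> ennreal e" if n: "n \<ge> N" for n
    proof -
      have "(\<integral>\<^sup>+x. ennreal ((norm (f n x - F x))\<^sup>2) \<partial>lborel)
          = (\<integral>\<^sup>+x. liminf (\<lambda>i. ennreal ((norm (f n x - f (r i) x))\<^sup>2)) \<partial>lborel)"
      proof (rule nn_integral_cong_AE, use F in \<open>rule AE_mp\<close>, intro AE_I2 impI)
        fix x assume "(\<lambda>i. f (r i) x) \<longlonglongrightarrow> F x"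
        then have "(\<lambda>i. ennreal ((norm (f n x - f (r i) x))\<^sup>2)) \<longlonglongrightarrow> ennreal ((norm (f n x - F x))\<^sup>2)"
          by (intro tendsto_ennrealI tendsto_intros)
        then show "ennreal ((norm (f n x - F x))\<^sup>2) = liminf (\<lambda>i. ennreal ((norm (f n x - f (r i) x))\<^sup>2))"
          by (rule lim_imp_Liminf[OF trivial_limit_sequentially, symmetric])
      qed
      also have "\<dots> \<le> liminf (\<lambda>i. \<integral>\<^sup>+x. ennreal ((norm (f n x - f (r i) x))\<^sup>2) \<partial>lborel)"
        by (rule nn_integral_liminf) simp
      also have "\<dots> \<le> ennreal e"
      proof (rule Liminf_le)
        have "(\<integral>\<^sup>+x. ennreal ((norm (f n x - f (r i) x))\<^sup>2) \<partial>lborel) \<le> ennreal e" if "i \<ge> N" for i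
        proof -
          have "r i \<ge> N" using that seq_suble[OF r, of i] by linarith
          then show ?thesis
            using less_imp_le[OF N[OF n, of "r i"]] diff[of n "r i"]
            by (subst nn_integral_eq_integral) (auto simp: L2_def intro!: ennreal_leI)
        qed
        then show "\<forall>\<^sub>F i in sequentially. (\<integral>\<^sup>+x. ennreal ((norm (f n x - f (r i) x))\<^sup>2) \<partial>lborel) \<le> ennreal e"
          by (auto simp: eventually_sequentially)
      qed simp
      finally show ?thesis .
    qed
    then show ?thesis by blast
  qed
  have L2d: "\<exists>N. \<forall>n\<ge>N. L2 (\<lambda>x. f n x - F x)"
  proof -
    obtain N where N: "\<And>n. n \<ge> N \<Longrightarrow> (\<integral>\<^sup>+x. ennreal ((norm (f n x - F x))\<^sup>2) \<partial>lborel) \<le> ennreal 1"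
      using le[of 1] by auto
    then have "L2 (\<lambda>x. f n x - F x)" if "n \<ge> N" for n
      unfolding L2_def using order_le_less_trans[OF N[OF that]] by (auto intro!: integrableI_bounded)
    then show ?thesis by blast
  qed
  then obtain N0 where N0: "\<And>n. n \<ge> N0 \<Longrightarrow> L2 (\<lambda>x. f n x - F x)" by blast
  have "L2 F" using L2_diff[OF f[of N0] N0[OF order_refl]] by simp
  moreover have "(\<lambda>n. \<integral>x. (norm (f n x - F x))\<^sup>2 \<partial>lborel) \<longlonglongrightarrow> 0"
    unfolding LIMSEQ_iff
  proof (intro allI impI)
    fix e :: real assume "e > 0"
    then obtain N where N: "\<And>n. n \<ge> N \<Longrightarrow> (\<integral>\<^sup>+x. ennreal ((norm (f n x - F x))\<^sup>2) \<partial>lborel) \<le> ennreal (e / 2)"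
      using le[of "e / 2"] by auto
    have "norm ((\<integral>x. (norm (f n x - F x))\<^sup>2 \<partial>lborel) - 0) < e" if "n \<ge> max N N0" for n
    proof -
      have "ennreal (\<integral>x. (norm (f n x - F x))\<^sup>2 \<partial>lborel) = (\<integral>\<^sup>+x. ennreal ((norm (f n x - F x))\<^sup>2) \<partial>lborel)"
        using N0[of n] that by (intro nn_integral_eq_integral[symmetric]) (auto simp: L2_def)
      then have "(\<integral>x. (norm (f n x - F x))\<^sup>2 \<partial>lborel) \<le> e / 2"
        using N[of n] that \<open>e > 0\<close> by (metis ennreal_le_iff half_gt_zero less_imp_le max.bounded_iff)
      then show ?thesis using \<open>e > 0\<close> by simp
    qed
    then show "\<exists>no. \<forall>n\<ge>no. norm ((\<integral>x. (norm (f n x - F x))\<^sup>2 \<partial>lborel) - 0) < e" by blast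
  qed
  ultimately show thesis using that by blast
qed

text \<open>Takes the place of Hoelder's inequality in the limit arguments: \<open>t\<close> is
  chosen so that the factor which is merely bounded contributes little, and then the other factor is
  made small.\<close>

lemma L2_young:
  fixes f g :: "real^'n \<Rightarrow> real"
  assumes "L2 f" "L2 g" "t > 0"
  shows "(\<integral>x. \<bar>f x\<bar> * \<bar>g x\<bar> \<partial>lborel) \<le> t * (\<integral>x. (f x)\<^sup>2 \<partial>lborel) + (\<integral>x. (g x)\<^sup>2 \<partial>lborel) / t"
proof -
  have "(\<integral>x. \<bar>f x\<bar> * \<bar>g x\<bar> \<partial>lborel) \<le> (\<integral>x. t * (f x)\<^sup>2 + (g x)\<^sup>2 / t \<partial>lborel)"
  proof (rule integral_mono)
    show "integrable lborel (\<lambda>x. \<bar>f x\<bar> * \<bar>g x\<bar>)" by (intro L2_mult L2_abs assms)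
    show "integrable lborel (\<lambda>x. t * (f x)\<^sup>2 + (g x)\<^sup>2 / t)"
      using L2_square_integrable[OF assms(1)] L2_square_integrable[OF assms(2)] by simp
    fix x
    have "\<bar>(t * f x) * g x\<bar> \<le> (t * f x)\<^sup>2 + (g x)\<^sup>2" by (rule abs_mult_le_squares)
    then have "\<bar>f x\<bar> * \<bar>g x\<bar> \<le> ((t * f x)\<^sup>2 + (g x)\<^sup>2) / t"
      using assms(3) by (simp add: abs_mult pos_le_divide_eq mult_ac)
    then show "\<bar>f x\<bar> * \<bar>g x\<bar> \<le> t * (f x)\<^sup>2 + (g x)\<^sup>2 / t"
      using assms(3) by (simp add: power2_eq_square add_divide_distrib mult_ac)
  qed
  also have "\<dots> = t * (\<integral>x. (f x)\<^sup>2 \<partial>lborel) + (\<integral>x. (g x)\<^sup>2 \<partial>lborel) / t"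
    using L2_square_integrable[OF assms(1)] L2_square_integrable[OF assms(2)] by simp
  finally show ?thesis .
qed

lemma L2_mult_tendsto_0:
  fixes f :: "nat \<Rightarrow> real^'n \<Rightarrow> real"
  assumes f: "\<And>n. L2 (f n)" and g: "L2 g" and lim: "(\<lambda>n. \<integral>x. (f n x)\<^sup>2 \<partial>lborel) \<longlonglongrightarrow> 0"
  shows "(\<lambda>n. \<integral>x. f n x * g x \<partial>lborel) \<longlonglongrightarrow> 0"
  unfolding LIMSEQ_iff
proof (intro allI impI)
  fix e :: real assume e: "e > 0"
  define G where "G = (\<integral>x. (g x)\<^sup>2 \<partial>lborel)"
  have G: "G \<ge> 0" by (simp add: G_def)
  \<comment> \<open>Makes the second Young term smaller than \<open>e / 2\<close> for all
    \<open>n\<close>; the first one is then small for large \<open>n\<close>.\<close>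
  define t where "t = 2 * (G + 1) / e"
  have t: "t > 0" using e G by (simp add: t_def)
  have Gt: "G / t < e / 2" using e G by (simp add: t_def field_simps)
  have "\<forall>\<^sub>F n in sequentially. (\<integral>x. (f n x)\<^sup>2 \<partial>lborel) < e / (2 * t)"
    using e t by (intro order_tendstoD(2)[OF lim]) simp
  then have "\<forall>\<^sub>F n in sequentially. \<bar>\<integral>x. f n x * g x \<partial>lborel\<bar> < e"
  proof eventually_elim
    case (elim n)
    have "\<bar>\<integral>x. f n x * g x \<partial>lborel\<bar> \<le> (\<integral>x. \<bar>f n x * g x\<bar> \<partial>lborel)"
      by (rule integral_abs_bound)
    also have "\<dots> \<le> t * (\<integral>x. (f n x)\<^sup>2 \<partial>lborel) + G / t"
      using L2_young[OF f g t, of n] by (simp add: G_def abs_mult)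
    also have "\<dots> < t * (e / (2 * t)) + G / t"
      using elim t by (intro add_strict_right_mono mult_strict_left_mono)
    also have "t * (e / (2 * t)) = e / 2" using t by simp
    also have "e / 2 + G / t < e" using Gt by linarith
    finally show ?case .
  qed
  then show "\<exists>no. \<forall>n\<ge>no. norm ((\<integral>x. f n x * g x \<partial>lborel) - 0) < e"
    by (simp add: eventually_sequentially)
qed

lemma is_weak_gradient_limit:
  fixes u :: "nat \<Rightarrow> real^'n \<Rightarrow> real"
  assumes u: "\<And>n. L2 (u n)" and V: "\<And>n. L2 (V n)" and g: "\<And>n. is_weak_gradient (u n) (V n)"
    and u': "L2 u'" and V': "L2 V'"
    and lu: "(\<lambda>n. \<integral>x. (norm (u n x - u' x))\<^sup>2 \<partial>lborel) \<longlonglongrightarrow> 0"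
    and lV: "(\<lambda>n. \<integral>x. (norm (V n x - V' x))\<^sup>2 \<partial>lborel) \<longlonglongrightarrow> 0"
  shows "is_weak_gradient u' V'"
  unfolding is_weak_gradient_def
proof (intro allI impI)
  fix \<phi> :: "real^'n \<Rightarrow> real" and i assume t: "test_function \<phi>"
  note \<phi> = L2_test_function[OF t]
  have "(\<lambda>n. \<integral>x. (u n x - u' x) * partial_deriv i \<phi> x \<partial>lborel) \<longlonglongrightarrow> 0"
    using lu by (intro L2_mult_tendsto_0 L2_diff u u' \<phi>) simp
  then have "(\<lambda>n. (\<integral>x. u n x * partial_deriv i \<phi> x \<partial>lborel) - (\<integral>x. u' x * partial_deriv i \<phi> x \<partial>lborel)) \<longlonglongrightarrow> 0"
    using L2_mult[OF u \<phi>(2)] L2_mult[OF u' \<phi>(2)] by (simp add: left_diff_distrib)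
  then have lim1: "(\<lambda>n. \<integral>x. u n x * partial_deriv i \<phi> x \<partial>lborel) \<longlonglongrightarrow> (\<integral>x. u' x * partial_deriv i \<phi> x \<partial>lborel)"
    by (rule Lim_null[THEN iffD2])
  have "(\<lambda>n. \<integral>x. (V n x $ i - V' x $ i)\<^sup>2 \<partial>lborel) \<longlonglongrightarrow> 0"
  proof (rule tendsto_sandwich[OF _ _ tendsto_const lV])
    have "(\<integral>x. (V n x $ i - V' x $ i)\<^sup>2 \<partial>lborel) \<le> (\<integral>x. (norm (V n x - V' x))\<^sup>2 \<partial>lborel)" for n
    proof (rule integral_mono)
      show "integrable lborel (\<lambda>x. (V n x $ i - V' x $ i)\<^sup>2)"
        using L2_square_integrable[OF L2_component[OF L2_diff[OF V V']]] by simp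
      show "integrable lborel (\<lambda>x. (norm (V n x - V' x))\<^sup>2)"
        using L2_diff[OF V V'] by (simp add: L2_def)
      show "(V n x $ i - V' x $ i)\<^sup>2 \<le> (norm (V n x - V' x))\<^sup>2" for x
        using component_le_norm_cart[of "V n x - V' x" i] by (simp add: abs_le_square_iff[symmetric])
    qed
    then show "\<forall>\<^sub>F n in sequentially. (\<integral>x. (V n x $ i - V' x $ i)\<^sup>2 \<partial>lborel) \<le> (\<integral>x. (norm (V n x - V' x))\<^sup>2 \<partial>lborel)"
      by simp
  qed simp
  then have "(\<lambda>n. \<integral>x. (V n x $ i - V' x $ i) * \<phi> x \<partial>lborel) \<longlonglongrightarrow> 0"
    by (intro L2_mult_tendsto_0 L2_diff L2_component V V' \<phi>)
  then have "(\<lambda>n. (\<integral>x. V n x $ i * \<phi> x \<partial>lborel) - (\<integral>x. V' x $ i * \<phi> x \<partial>lborel)) \<longlonglongrightarrow> 0"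
    using L2_mult[OF L2_component[OF V] \<phi>(1)] L2_mult[OF L2_component[OF V'] \<phi>(1)] by (simp add: left_diff_distrib)
  then have lim2: "(\<lambda>n. \<integral>x. V n x $ i * \<phi> x \<partial>lborel) \<longlonglongrightarrow> (\<integral>x. V' x $ i * \<phi> x \<partial>lborel)"
    by (rule Lim_null[THEN iffD2])
  have "(\<lambda>n. \<integral>x. u n x * partial_deriv i \<phi> x \<partial>lborel) = (\<lambda>n. - (\<integral>x. V n x $ i * \<phi> x \<partial>lborel))"
    using g t by (simp add: is_weak_gradient_def)
  then show "(\<integral>x. u' x * partial_deriv i \<phi> x \<partial>lborel) = - (\<integral>x. V' x $ i * \<phi> x \<partial>lborel)"
    using LIMSEQ_unique[OF lim1] tendsto_minus[OF lim2] by simp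
qed

section \<open>Representatives of elements of \<open>H\<^sup>1\<close>\<close>

lemma L2_rep: "L2 (rep_H1 u)"
  and L2_H1_gradient: "L2 (H1_gradient u)"
  and is_weak_gradient_rep: "is_weak_gradient (rep_H1 u) (H1_gradient u)"
  unfolding H1_gradient_def
  by (intro H1_fun_L2 weak_gradient_L2 weak_gradient_is_weak_gradient rep_H1_in_H1_fun)+

lemma measurable_rep [measurable]: "rep_H1 u \<in> borel_measurable borel"
  by (rule L2_measurable[OF L2_rep])

lemma abs_rep_H1: "abs_H1 (rep_H1 u) = u"
  by (rule Quotient3_abs_rep[OF Quotient3_H1])

lemma H1_rel_rep: "H1_rel (rep_H1 u) (rep_H1 u)"
  by (simp add: H1_rel_def rep_H1_in_H1_fun)

lemma rep_plus: "AE x in lborel. rep_H1 (u + v) x = rep_H1 u x + rep_H1 v x"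
proof -
  have "u + v = abs_H1 (\<lambda>x. rep_H1 u x + rep_H1 v x)"
    using plus_H1.abs_eq[OF H1_rel_rep H1_rel_rep, of u v] by (simp add: abs_rep_H1)
  then show ?thesis
    using rep_H1_abs_H1[OF H1_fun_add(1)[OF rep_H1_in_H1_fun rep_H1_in_H1_fun], of u v] by simp
qed

lemma rep_diff: "AE x in lborel. rep_H1 (u - v) x = rep_H1 u x - rep_H1 v x"
proof -
  have "u - v = abs_H1 (\<lambda>x. rep_H1 u x - rep_H1 v x)"
    using minus_H1.abs_eq[OF H1_rel_rep H1_rel_rep, of u v] by (simp add: abs_rep_H1)
  then show ?thesis
    using rep_H1_abs_H1[OF H1_fun_diff[OF rep_H1_in_H1_fun rep_H1_in_H1_fun], of u v] by simp
qed

lemma rep_scaleR: "AE x in lborel. rep_H1 (c *\<^sub>R u) x = c * rep_H1 u x"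
proof -
  have "c *\<^sub>R u = abs_H1 (\<lambda>x. c * rep_H1 u x)"
    using scaleR_H1.abs_eq[OF H1_rel_rep, of c u] by (simp add: abs_rep_H1)
  then show ?thesis
    using rep_H1_abs_H1[OF H1_fun_scaleR(1)[OF rep_H1_in_H1_fun], of c u] by simp
qed

lemma rep_zero: "AE x in lborel. rep_H1 0 x = 0"
  using rep_H1_abs_H1[OF H1_fun_zero] by (simp add: zero_H1.abs_eq)

lemma rep_translate: "AE x in lborel. rep_H1 (translate y u) x = rep_H1 u (x + y)"
proof -
  have "translate y u = abs_H1 (\<lambda>x. rep_H1 u (x + y))"
    using translate.abs_eq[OF H1_rel_rep, of y u] by (simp add: abs_rep_H1)
  then show ?thesis
    using rep_H1_abs_H1[OF H1_fun_translate[OF rep_H1_in_H1_fun], of u y] by simp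
qed

lemma H1_eqI: "AE x in lborel. rep_H1 u x = rep_H1 v x \<Longrightarrow> u = v"
  using abs_rep_H1 Quotient3_rel_abs[OF Quotient3_H1, of "rep_H1 u" "rep_H1 v"]
  by (metis H1_rel_def rep_H1_in_H1_fun)

lemma inner_H1_eq:
  "u \<bullet> v = (\<integral>x. H1_gradient u x \<bullet> H1_gradient v x \<partial>lborel) + (\<integral>x. rep_H1 u x * rep_H1 v x \<partial>lborel)"
  using inner_H1.abs_eq[OF H1_rel_rep H1_rel_rep, of u v] by (simp add: abs_rep_H1 H1_gradient_def)

lemma H1_gradient_cong:
  assumes "is_weak_gradient (rep_H1 u) V" "L2 V"
  shows "AE x in lborel. H1_gradient u x = V x"
  unfolding H1_gradient_def by (rule weak_gradient_unique[OF assms L2_rep])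

lemma H1_gradient_translate: "AE x in lborel. H1_gradient (translate y u) x = H1_gradient u (x + y)"
proof (rule H1_gradient_cong)
  show "L2 (\<lambda>x. H1_gradient u (x + y))" by (rule L2_translate[OF L2_H1_gradient])
  have "is_weak_gradient (\<lambda>x. rep_H1 u (x + y)) (\<lambda>x. H1_gradient u (x + y))"
    by (intro is_weak_gradient_translate is_weak_gradient_rep L2_rep L2_H1_gradient)
  then show "is_weak_gradient (rep_H1 (translate y u)) (\<lambda>x. H1_gradient u (x + y))"
    by (rule is_weak_gradient_cong_AE) (use rep_translate[of y u] L2_translate[OF L2_rep] L2_rep in auto)
qed

lemma H1_gradient_diff: "AE x in lborel. H1_gradient (u - v) x = H1_gradient u x - H1_gradient v x"
proof (rule H1_gradient_cong)
  show L: "L2 (\<lambda>x. H1_gradient u x - H1_gradient v x)" by (intro L2_diff L2_H1_gradient)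
  have "is_weak_gradient (\<lambda>x. rep_H1 u x + (-1) * rep_H1 v x) (\<lambda>x. H1_gradient u x + (-1) *\<^sub>R H1_gradient v x)"
    using L2_cmult[OF L2_rep, of "-1" v] L2_scaleR[OF L2_H1_gradient, of "-1" v]
    by (intro is_weak_gradient_add is_weak_gradient_scaleR is_weak_gradient_rep L2_rep L2_H1_gradient) auto
  then have "is_weak_gradient (\<lambda>x. rep_H1 u x - rep_H1 v x) (\<lambda>x. H1_gradient u x - H1_gradient v x)"
    by simp
  then show "is_weak_gradient (rep_H1 (u - v)) (\<lambda>x. H1_gradient u x - H1_gradient v x)"
    by (rule is_weak_gradient_cong_AE) (use rep_diff[of u v] L2_diff[OF L2_rep L2_rep] L2_rep in auto)
qed

lemma inner_translate: "translate y u \<bullet> translate y v = u \<bullet> v"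
proof -
  note [measurable] = L2_measurable[OF L2_H1_gradient]
  have "(\<integral>x. H1_gradient (translate y u) x \<bullet> H1_gradient (translate y v) x \<partial>lborel)
      = (\<integral>x. H1_gradient u (x + y) \<bullet> H1_gradient v (x + y) \<partial>lborel)"
    using H1_gradient_translate[of y u] H1_gradient_translate[of y v] by (intro integral_cong_AE) auto
  also have "\<dots> = (\<integral>x. H1_gradient u x \<bullet> H1_gradient v x \<partial>lborel)"
    by (rule lborel_integral_translate) simp
  finally have 1: "(\<integral>x. H1_gradient (translate y u) x \<bullet> H1_gradient (translate y v) x \<partial>lborel)
      = (\<integral>x. H1_gradient u x \<bullet> H1_gradient v x \<partial>lborel)" .
  have "(\<integral>x. rep_H1 (translate y u) x * rep_H1 (translate y v) x \<partial>lborel)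
      = (\<integral>x. rep_H1 u (x + y) * rep_H1 v (x + y) \<partial>lborel)"
    using rep_translate[of y u] rep_translate[of y v] by (intro integral_cong_AE) auto
  also have "\<dots> = (\<integral>x. rep_H1 u x * rep_H1 v x \<partial>lborel)"
    by (rule lborel_integral_translate) simp
  finally show ?thesis using 1 by (simp add: inner_H1_eq)
qed

lemma norm_translate: "norm (translate y u) = norm u"
  by (simp add: norm_eq_sqrt_inner inner_translate)

lemma translate_translate: "translate y (translate z u) = translate (y + z) u"
proof (rule H1_eqI)
  have 1: "AE x in lborel. rep_H1 (translate z u) (x + y) = rep_H1 u ((x + y) + z)"
    using lborel_AE_translate[OF rep_translate[of z u], of y] by simp
  show "AE x in lborel. rep_H1 (translate y (translate z u)) x = rep_H1 (translate (y + z) u) x"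
    using 1 rep_translate[of y "translate z u"] rep_translate[of "y + z" u]
    by eventually_elim (simp add: add.assoc)
qed

lemma translate_0: "translate 0 u = u"
  by (rule H1_eqI) (use rep_translate[of 0 u] in simp)

lemma translate_diff: "translate y (u - v) = translate y u - translate y v"
proof (rule H1_eqI)
  have 1: "AE x in lborel. rep_H1 (u - v) (x + y) = rep_H1 u (x + y) - rep_H1 v (x + y)"
    using lborel_AE_translate[OF rep_diff[of u v], of y] by simp
  show "AE x in lborel. rep_H1 (translate y (u - v)) x = rep_H1 (translate y u - translate y v) x"
    using 1 rep_translate[of y "u - v"] rep_translate[of y u] rep_translate[of y v]
      rep_diff[of "translate y u" "translate y v"]
    by eventually_elim simp
qed

lemma translate_zero: "translate y 0 = 0"
  using translate_diff[of y 0 0] by simp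

lemma translate_add: "translate y (u + v) = translate y u + translate y v"
  using translate_diff[of y "u + v" v] by simp

lemma translate_sum: "translate y (\<Sum>i\<in>I. u i) = (\<Sum>i\<in>I. translate y (u i))"
  by (induction I rule: infinite_finite_induct) (simp_all add: translate_zero translate_add)

lemma inner_translate_left: "translate y u \<bullet> v = u \<bullet> translate (- y) v"
  using inner_translate[of "- y" "translate y u" v] by (simp add: translate_translate translate_0)

lemma norm_H1_squared:
  "(norm u)\<^sup>2 = (\<integral>x. (norm (H1_gradient u x))\<^sup>2 \<partial>lborel) + (\<integral>x. (rep_H1 u x)\<^sup>2 \<partial>lborel)"
  by (simp add: power2_norm_eq_inner inner_H1_eq flip: power2_eq_square)

lemma integral_rep_squared_le: "(\<integral>x. (rep_H1 u x)\<^sup>2 \<partial>lborel) \<le> (norm u)\<^sup>2"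
  and integral_gradient_squared_le: "(\<integral>x. (norm (H1_gradient u x))\<^sup>2 \<partial>lborel) \<le> (norm u)\<^sup>2"
  by (simp_all add: norm_H1_squared)

lemma H1_translation_estimate:
  "(\<integral>\<^sup>+x. ennreal ((rep_H1 u (x + h) - rep_H1 u x)\<^sup>2) \<partial>lborel) \<le> ennreal ((norm h)\<^sup>2 * (norm u)\<^sup>2)"
  using integral_gradient_squared_le[of u]
  by (intro order_trans[OF translation_estimate[OF L2_rep L2_H1_gradient is_weak_gradient_rep]] ennreal_leI
      mult_left_mono) auto

text \<open>Representatives and weak gradients converge separately in L2, and
  \<open>is_weak_gradient_limit\<close> says that the weak gradient has a closed graph.\<close>

lemma complete_H1: "complete (UNIV :: 'n::finite H1 set)"
  unfolding complete_def
proof (intro allI impI)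
  fix x :: "nat \<Rightarrow> 'n H1" assume "(\<forall>n. x n \<in> UNIV) \<and> Cauchy x"
  then have C: "Cauchy x" by simp
  have C': "\<exists>N. \<forall>m\<ge>N. \<forall>n\<ge>N. (norm (x m - x n))\<^sup>2 < e" if "e > 0" for e
  proof -
    have "sqrt e > 0" using that by simp
    from C[unfolded Cauchy_iff, rule_format, OF this]
    obtain N where N: "\<And>m n. m \<ge> N \<Longrightarrow> n \<ge> N \<Longrightarrow> norm (x m - x n) < sqrt e" by blast
    have "(norm (x m - x n))\<^sup>2 < e" if "m \<ge> N" "n \<ge> N" for m n
      using power_strict_mono[OF N[OF that], of 2] \<open>e > 0\<close> by simp
    then show ?thesis by blast
  qed
  note [measurable] = L2_measurable[OF L2_H1_gradient]
  have le1: "(\<integral>t. (norm (rep_H1 (x m) t - rep_H1 (x n) t))\<^sup>2 \<partial>lborel) \<le> (norm (x m - x n))\<^sup>2" for m n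
  proof -
    have "(\<integral>t. (norm (rep_H1 (x m) t - rep_H1 (x n) t))\<^sup>2 \<partial>lborel) = (\<integral>t. (rep_H1 (x m - x n) t)\<^sup>2 \<partial>lborel)"
      using rep_diff[of "x m" "x n"] by (intro integral_cong_AE) auto
    then show ?thesis using integral_rep_squared_le[of "x m - x n"] by simp
  qed
  have le2: "(\<integral>t. (norm (H1_gradient (x m) t - H1_gradient (x n) t))\<^sup>2 \<partial>lborel) \<le> (norm (x m - x n))\<^sup>2" for m n
  proof -
    have "(\<integral>t. (norm (H1_gradient (x m) t - H1_gradient (x n) t))\<^sup>2 \<partial>lborel)
        = (\<integral>t. (norm (H1_gradient (x m - x n) t))\<^sup>2 \<partial>lborel)"
      using H1_gradient_diff[of "x m" "x n"] by (intro integral_cong_AE) auto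
    then show ?thesis using integral_gradient_squared_le[of "x m - x n"] by simp
  qed
  obtain u where u: "L2 u" "(\<lambda>n. \<integral>t. (norm (rep_H1 (x n) t - u t))\<^sup>2 \<partial>lborel) \<longlonglongrightarrow> 0"
  proof (rule L2_complete)
    show "\<exists>N. \<forall>m\<ge>N. \<forall>n\<ge>N. (\<integral>t. (norm (rep_H1 (x m) t - rep_H1 (x n) t))\<^sup>2 \<partial>lborel) < e" if "e > 0" for e
      using C'[OF that] order_le_less_trans[OF le1] by blast
  qed (rule L2_rep)
  obtain V where V: "L2 V" "(\<lambda>n. \<integral>t. (norm (H1_gradient (x n) t - V t))\<^sup>2 \<partial>lborel) \<longlonglongrightarrow> 0"
  proof (rule L2_complete)
    show "\<exists>N. \<forall>m\<ge>N. \<forall>n\<ge>N. (\<integral>t. (norm (H1_gradient (x m) t - H1_gradient (x n) t))\<^sup>2 \<partial>lborel) < e" if "e > 0" for e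
      using C'[OF that] order_le_less_trans[OF le2] by blast
  qed (rule L2_H1_gradient)
  note [measurable] = L2_measurable[OF u(1)] L2_measurable[OF V(1)]
  have g: "is_weak_gradient u V"
    by (rule is_weak_gradient_limit[OF L2_rep L2_H1_gradient is_weak_gradient_rep u(1) V(1) u(2) V(2)])
  then have uH: "u \<in> H1_fun" using u V by (auto simp: H1_fun_def)
  define w where "w = abs_H1 u"
  have w: "AE t in lborel. rep_H1 w t = u t" unfolding w_def by (rule rep_H1_abs_H1[OF uH])
  have wV: "AE t in lborel. H1_gradient w t = V t"
  proof (rule H1_gradient_cong[OF is_weak_gradient_cong_AE[OF g u(1) L2_rep] V(1)])
    show "AE x in lborel. u x = rep_H1 w x" using w by auto
  qed
  have "(norm (x n - w))\<^sup>2 = (\<integral>t. (norm (H1_gradient (x n) t - V t))\<^sup>2 \<partial>lborel)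
      + (\<integral>t. (norm (rep_H1 (x n) t - u t))\<^sup>2 \<partial>lborel)" for n
  proof -
    have "(\<integral>t. (norm (H1_gradient (x n - w) t))\<^sup>2 \<partial>lborel) = (\<integral>t. (norm (H1_gradient (x n) t - V t))\<^sup>2 \<partial>lborel)"
    proof (rule integral_cong_AE)
      show "AE t in lborel. (norm (H1_gradient (x n - w) t))\<^sup>2 = (norm (H1_gradient (x n) t - V t))\<^sup>2"
        using H1_gradient_diff[of "x n" w] wV by eventually_elim simp
    qed simp_all
    moreover have "(\<integral>t. (rep_H1 (x n - w) t)\<^sup>2 \<partial>lborel) = (\<integral>t. (norm (rep_H1 (x n) t - u t))\<^sup>2 \<partial>lborel)"
    proof (rule integral_cong_AE)
      show "AE t in lborel. (rep_H1 (x n - w) t)\<^sup>2 = (norm (rep_H1 (x n) t - u t))\<^sup>2"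
        using rep_diff[of "x n" w] w by eventually_elim simp
    qed simp_all
    ultimately show ?thesis unfolding norm_H1_squared[of "x n - w"] by simp
  qed
  then have "(\<lambda>n. (norm (x n - w))\<^sup>2) \<longlonglongrightarrow> 0"
    using tendsto_add[OF V(2) u(2)] by simp
  then have "(\<lambda>n. sqrt ((norm (x n - w))\<^sup>2)) \<longlonglongrightarrow> sqrt 0" by (rule tendsto_real_sqrt)
  then have "x \<longlonglongrightarrow> w" by (simp add: tendsto_norm_zero_iff LIM_zero_iff)
  then show "\<exists>l\<in>UNIV. x \<longlonglongrightarrow> l" by blast
qed

text \<open>Turns weak convergence in \<open>H1\<close> into convergence of integrals against a
  fixed L2 function.\<close>

lemma bounded_linear_L2_pairing:
  assumes \<phi>: "L2 \<phi>"
  shows "bounded_linear (\<lambda>z. \<integral>x. \<phi> x * rep_H1 z x \<partial>lborel)"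
proof (rule bounded_linear_intro[of _ "(\<integral>x. (\<phi> x)\<^sup>2 \<partial>lborel) + 1"])
  note [measurable] = L2_measurable[OF \<phi>]
  fix z z' :: "'a H1" and c :: real
  have "(\<integral>x. \<phi> x * rep_H1 (z + z') x \<partial>lborel) = (\<integral>x. \<phi> x * rep_H1 z x + \<phi> x * rep_H1 z' x \<partial>lborel)"
    using rep_plus[of z z'] by (intro integral_cong_AE) (auto simp: distrib_left)
  then show "(\<integral>x. \<phi> x * rep_H1 (z + z') x \<partial>lborel) = (\<integral>x. \<phi> x * rep_H1 z x \<partial>lborel) + (\<integral>x. \<phi> x * rep_H1 z' x \<partial>lborel)"
    using L2_mult[OF \<phi> L2_rep] by simp
  have "(\<integral>x. \<phi> x * rep_H1 (c *\<^sub>R z) x \<partial>lborel) = (\<integral>x. c * (\<phi> x * rep_H1 z x) \<partial>lborel)"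
    using rep_scaleR[of c z] by (intro integral_cong_AE) auto
  then show "(\<integral>x. \<phi> x * rep_H1 (c *\<^sub>R z) x \<partial>lborel) = c *\<^sub>R (\<integral>x. \<phi> x * rep_H1 z x \<partial>lborel)"
    by simp
  show "norm (\<integral>x. \<phi> x * rep_H1 z x \<partial>lborel) \<le> norm z * ((\<integral>x. (\<phi> x)\<^sup>2 \<partial>lborel) + 1)"
  proof (cases "z = 0")
    case True
    have "(\<integral>x. \<phi> x * rep_H1 0 x \<partial>lborel) = (\<integral>x. 0 \<partial>(lborel :: (real^'a) measure))"
      using rep_zero by (intro integral_cong_AE) auto
    then show ?thesis using True by simp
  next
    case False
    have "\<bar>\<integral>x. \<phi> x * rep_H1 z x \<partial>lborel\<bar> \<le> (\<integral>x. \<bar>\<phi> x * rep_H1 z x\<bar> \<partial>lborel)" by (rule integral_abs_bound)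
    \<comment> \<open>The Young parameter is \<open>norm z\<close>, so that both terms scale
      linearly in \<open>z\<close>.\<close>
    also have "\<dots> \<le> norm z * (\<integral>x. (\<phi> x)\<^sup>2 \<partial>lborel) + (\<integral>x. (rep_H1 z x)\<^sup>2 \<partial>lborel) / norm z"
      using L2_young[OF \<phi> L2_rep, of "norm z" z] False by (simp add: abs_mult)
    also have "\<dots> \<le> norm z * (\<integral>x. (\<phi> x)\<^sup>2 \<partial>lborel) + (norm z)\<^sup>2 / norm z"
      by (intro add_left_mono divide_right_mono integral_rep_squared_le) simp
    finally show ?thesis using False by (simp add: power2_eq_square distrib_left)
  qed
qed

section \<open>Local averages and weak convergence\<close>

lemma pred_ball [measurable (raw)]:
  fixes a :: "'b::euclidean_space"
  assumes "f \<in> borel_measurable M"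
  shows "Measurable.pred M (\<lambda>x. f x \<in> ball a r)"
  unfolding mem_ball using assms by measurable

lemma sets_ball [measurable]: "ball (a :: 'b::euclidean_space) r \<in> sets borel"
  by simp

lemma L2_indicator_ball_mult:
  fixes f :: "real^'n \<Rightarrow> real"
  assumes "f \<in> borel_measurable borel" "\<And>x. \<bar>f x\<bar> \<le> 1"
  shows "L2 (\<lambda>x. indicator (ball a R) x * f x)"
  unfolding L2_def
proof
  note [measurable] = assms(1)
  show "(\<lambda>x. indicator (ball a R) x * f x) \<in> borel_measurable lborel" by simp
  show "integrable lborel (\<lambda>x. (norm (indicator (ball a R) x * f x))\<^sup>2)"
  proof (rule Bochner_Integration.integrable_bound)
    show "integrable lborel (\<lambda>x. indicator (ball a R) x :: real)"
      by (intro integrable_real_indicator emeasure_bounded_finite) auto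
    have "(f x)\<^sup>2 \<le> 1" for x
      using assms(2)[of x] by (simp add: abs_square_le_1)
    then show "AE x in lborel. norm ((norm (indicator (ball a R) x * f x))\<^sup>2) \<le> norm (indicator (ball a R) x :: real)"
      by (auto simp: indicator_def)
  qed simp
qed

lemma L2_indicator_ball: "L2 (indicator (ball a R) :: real^'n \<Rightarrow> real)"
  using L2_indicator_ball_mult[of "\<lambda>_. 1" a R] by simp

section \<open>Averages over small balls\<close>

abbreviation ball_vol :: "real^'n \<Rightarrow> real \<Rightarrow> real" where
  "ball_vol a r \<equiv> measure lborel (ball a r)"

lemma ball_vol_pos: "r > 0 \<Longrightarrow> ball_vol a r > 0"
  by (simp add: content_ball_pos)

lemma emeasure_ball_eq: "emeasure lborel (ball a r) = ennreal (ball_vol a r)"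
  using emeasure_bounded_finite[OF bounded_ball, of a r] by (intro emeasure_eq_ennreal_measure) auto

definition avg :: "real \<Rightarrow> (real^'n \<Rightarrow> real) \<Rightarrow> real^'n \<Rightarrow> real" where
  "avg r v x = (\<integral>y. indicator (ball 0 r) y * v (x + y) \<partial>lborel) / ball_vol (0::real^'n) r"

lemma L2_translate': "L2 v \<Longrightarrow> L2 (\<lambda>y. v (x + y))"
  using L2_translate[of v x] by (simp add: add.commute)

lemma measurable_avg [measurable (raw)]:
  assumes [measurable]: "v \<in> borel_measurable borel"
  shows "avg r v \<in> borel_measurable borel"
proof -
  have "(\<lambda>x. \<integral>y. indicator (ball 0 r) y * v (x + y) \<partial>lborel) \<in> borel_measurable borel"
    using lborel.borel_measurable_lebesgue_integral[of "\<lambda>x y. indicator (ball 0 r) y * v (x + y)" lborel] by simp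
  then show ?thesis unfolding avg_def by simp
qed

lemma diff_avg:
  fixes v :: "real^'n \<Rightarrow> real"
  assumes "L2 v" "r > 0"
  shows "v x - avg r v x = (\<integral>y. indicator (ball 0 r) y * (v x - v (x + y)) \<partial>lborel) / ball_vol (0::real^'n) r"
proof -
  have "integrable lborel (indicator (ball (0::real^'n) r) :: _ \<Rightarrow> real)"
    by (intro integrable_real_indicator emeasure_bounded_finite) auto
  moreover have "integrable lborel (\<lambda>y. indicator (ball 0 r) y * v (x + y))"
    by (intro L2_mult L2_indicator_ball L2_translate' assms)
  ultimately have "(\<integral>y. indicator (ball 0 r) y * (v x - v (x + y)) \<partial>lborel)
      = ball_vol (0::real^'n) r * v x - (\<integral>y. indicator (ball 0 r) y * v (x + y) \<partial>lborel)"
    by (simp add: right_diff_distrib)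
  then show ?thesis
    using ball_vol_pos[OF assms(2), of "0 :: real^'n"] by (simp add: avg_def field_simps)
qed

text \<open>Jensen's inequality on the ball and Tonelli reduce the claim to single shifts
  \<open>y\<close> with \<open>norm y < r\<close>, where the translation estimate applies. The error
  is uniform on bounded sets of \<open>H1\<close>; the local compactness used below comes from
  this.\<close>

lemma rep_diff_avg:
  fixes z :: "'n::finite H1"
  assumes r: "r > 0"
  shows "(\<integral>\<^sup>+x. ennreal ((rep_H1 z x - avg r (rep_H1 z) x)\<^sup>2) \<partial>lborel) \<le> ennreal (r\<^sup>2 * (norm z)\<^sup>2)"
proof -
  let ?v = "rep_H1 z" let ?c = "ball_vol (0::real^'n) r"
  have c: "?c > 0" by (rule ball_vol_pos[OF r])
  have "(\<integral>\<^sup>+x. ennreal ((?v x - avg r ?v x)\<^sup>2) \<partial>lborel)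
      \<le> (\<integral>\<^sup>+x. (\<integral>\<^sup>+y. ennreal (1 / ?c) * (indicator (ball 0 r) y * ennreal ((?v (x + y) - ?v x)\<^sup>2)) \<partial>lborel) \<partial>lborel)"
  proof (intro nn_integral_mono)
    fix x
    let ?I = "\<integral>y. indicator (ball 0 r) y * (?v x - ?v (x + y)) \<partial>lborel"
    have "ennreal ((?v x - avg r ?v x)\<^sup>2) = ennreal (1 / ?c\<^sup>2) * ennreal (?I\<^sup>2)"
      using c by (simp add: diff_avg[OF L2_rep r] power_divide ennreal_mult[symmetric])
    also have "\<dots> \<le> ennreal (1 / ?c\<^sup>2) * (emeasure lborel (ball (0::real^'n) r)
        * (\<integral>\<^sup>+y. indicator (ball 0 r) y * ennreal ((?v x - ?v (x + y))\<^sup>2) \<partial>lborel))"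
      by (intro mult_left_mono Jensen_square_nn_integral) auto
    also have "\<dots> = ennreal (1 / ?c) * (\<integral>\<^sup>+y. indicator (ball 0 r) y * ennreal ((?v (x + y) - ?v x)\<^sup>2) \<partial>lborel)"
      using c by (simp add: emeasure_ball_eq mult.assoc[symmetric] ennreal_mult[symmetric] power2_eq_square[of ?c]
          power2_commute[of "?v x"])
    also have "\<dots> = (\<integral>\<^sup>+y. ennreal (1 / ?c) * (indicator (ball 0 r) y * ennreal ((?v (x + y) - ?v x)\<^sup>2)) \<partial>lborel)"
      by (rule nn_integral_cmult[symmetric]) simp
    finally show "ennreal ((?v x - avg r ?v x)\<^sup>2)
        \<le> (\<integral>\<^sup>+y. ennreal (1 / ?c) * (indicator (ball 0 r) y * ennreal ((?v (x + y) - ?v x)\<^sup>2)) \<partial>lborel)" .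
  qed
  also have "\<dots> = (\<integral>\<^sup>+y. (\<integral>\<^sup>+x. ennreal (1 / ?c) * (indicator (ball 0 r) y * ennreal ((?v (x + y) - ?v x)\<^sup>2)) \<partial>lborel) \<partial>lborel)"
    by (rule lborel_pair.Fubini'[symmetric]) simp
  also have "\<dots> \<le> (\<integral>\<^sup>+y. ennreal (1 / ?c * (r\<^sup>2 * (norm z)\<^sup>2)) * indicator (ball (0::real^'n) r) y \<partial>lborel)"
  proof (intro nn_integral_mono)
    fix y :: "real^'n"
    show "(\<integral>\<^sup>+x. ennreal (1 / ?c) * (indicator (ball 0 r) y * ennreal ((?v (x + y) - ?v x)\<^sup>2)) \<partial>lborel)
        \<le> ennreal (1 / ?c * (r\<^sup>2 * (norm z)\<^sup>2)) * indicator (ball 0 r) y"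
    proof (cases "y \<in> ball 0 r")
      case True
      have "(\<integral>\<^sup>+x. ennreal (1 / ?c) * ennreal ((?v (x + y) - ?v x)\<^sup>2) \<partial>lborel)
          = ennreal (1 / ?c) * (\<integral>\<^sup>+x. ennreal ((?v (x + y) - ?v x)\<^sup>2) \<partial>lborel)"
        by (rule nn_integral_cmult) simp
      also have "\<dots> \<le> ennreal (1 / ?c) * ennreal ((norm y)\<^sup>2 * (norm z)\<^sup>2)"
        by (intro mult_left_mono H1_translation_estimate) simp
      also have "\<dots> \<le> ennreal (1 / ?c) * ennreal (r\<^sup>2 * (norm z)\<^sup>2)"
        using True r by (intro mult_left_mono ennreal_leI mult_right_mono power_mono) auto
      also have "\<dots> = ennreal (1 / ?c * (r\<^sup>2 * (norm z)\<^sup>2))"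
        by (rule ennreal_mult[symmetric]) auto
      finally show ?thesis using True by simp
    qed simp
  qed
  also have "\<dots> = ennreal (1 / ?c * (r\<^sup>2 * (norm z)\<^sup>2)) * ennreal ?c"
    by (subst nn_integral_cmult_indicator) (auto simp: emeasure_ball_eq)
  also have "\<dots> = ennreal (r\<^sup>2 * (norm z)\<^sup>2)"
    using c by (subst ennreal_mult[symmetric]) auto
  finally show ?thesis .
qed

lemma L2_rep_diff_avg:
  assumes "r > 0"
  shows "L2 (\<lambda>x. rep_H1 z x - avg r (rep_H1 z) x)"
    and "(\<integral>x. (rep_H1 z x - avg r (rep_H1 z) x)\<^sup>2 \<partial>lborel) \<le> r\<^sup>2 * (norm z)\<^sup>2"
proof -
  show L: "L2 (\<lambda>x. rep_H1 z x - avg r (rep_H1 z) x)"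
    by (rule L2I_nn_integral) (use order_le_less_trans[OF rep_diff_avg[OF assms, of z]] in auto)
  show "(\<integral>x. (rep_H1 z x - avg r (rep_H1 z) x)\<^sup>2 \<partial>lborel) \<le> r\<^sup>2 * (norm z)\<^sup>2"
    using rep_diff_avg[OF assms, of z] unfolding L2_nn_integral[OF L] by (subst (asm) ennreal_le_iff) auto
qed

lemma avg_eq_pairing: "avg r v t = (\<integral>y. indicator (ball t r) y * v y \<partial>lborel) / ball_vol (0::real^'n) r"
  if [measurable]: "v \<in> borel_measurable borel" for v :: "real^'n \<Rightarrow> real"
proof -
  have "(\<integral>y. indicator (ball t r) (y + t) * v (y + t) \<partial>lborel) = (\<integral>y. indicator (ball t r) y * v y \<partial>lborel)"
    by (rule lborel_integral_translate) simp
  moreover have "(\<lambda>y. indicator (ball t r) (y + t) * v (y + t)) = (\<lambda>y. indicator (ball 0 r) y * v (t + y))"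
    by (auto simp: fun_eq_iff indicator_def dist_norm add.commute norm_minus_commute)
  ultimately show ?thesis by (simp add: avg_def)
qed

text \<open>At a fixed point the average is a bounded linear functional on
  \<open>H1\<close>.\<close>

lemma avg_tendsto_0:
  fixes x :: "nat \<Rightarrow> 'n::finite H1"
  assumes "weakly_converges_to x 0"
  shows "(\<lambda>n. avg r (rep_H1 (x n)) t) \<longlonglongrightarrow> 0"
proof -
  have "bounded_linear (\<lambda>z :: 'n H1. \<integral>y. indicator (ball t r) y * rep_H1 z y \<partial>lborel)"
    by (rule bounded_linear_L2_pairing[OF L2_indicator_ball])
  then have "(\<lambda>n. \<integral>y. indicator (ball t r) y * rep_H1 (x n) y \<partial>lborel) \<longlonglongrightarrow> 0"
    using assms linear_0[OF bounded_linear.linear] unfolding weakly_converges_to_def by fastforce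
  from tendsto_divide_zero[OF this] show ?thesis by (simp add: avg_eq_pairing)
qed

text \<open>A bound uniform in the point; it provides the dominating function for the averages of a
  bounded sequence.\<close>

lemma avg_squared_le:
  fixes z :: "'n::finite H1"
  assumes "r > 0"
  shows "(avg r (rep_H1 z) t)\<^sup>2 \<le> (norm z)\<^sup>2 / ball_vol (0::real^'n) r"
proof -
  let ?c = "ball_vol (0::real^'n) r" let ?v = "rep_H1 z"
  have c: "?c > 0" by (rule ball_vol_pos[OF assms])
  let ?I = "\<integral>y. indicator (ball 0 r) y * ?v (t + y) \<partial>lborel"
  have "ennreal (?I\<^sup>2) \<le> emeasure lborel (ball (0::real^'n) r) * (\<integral>\<^sup>+y. indicator (ball 0 r) y * ennreal ((?v (t + y))\<^sup>2) \<partial>lborel)"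
    by (rule Jensen_square_nn_integral) auto
  also have "\<dots> \<le> ennreal ?c * (\<integral>\<^sup>+y. ennreal ((?v (t + y))\<^sup>2) \<partial>lborel)"
    unfolding emeasure_ball_eq by (intro mult_left_mono nn_integral_mono) (auto simp: indicator_def)
  also have "(\<integral>\<^sup>+y. ennreal ((?v (t + y))\<^sup>2) \<partial>lborel) = ennreal (\<integral>y. (?v y)\<^sup>2 \<partial>lborel)"
    using nn_integral_lborel_translate[of "\<lambda>y. ennreal ((?v y)\<^sup>2)" t] L2_nn_integral[OF L2_rep, of z]
    by (simp add: add.commute)
  also have "ennreal ?c * ennreal (\<integral>y. (?v y)\<^sup>2 \<partial>lborel) = ennreal (?c * (\<integral>y. (?v y)\<^sup>2 \<partial>lborel))"
    by (rule ennreal_mult[symmetric]) auto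
  also have "\<dots> \<le> ennreal (?c * (norm z)\<^sup>2)"
    by (intro ennreal_leI mult_left_mono integral_rep_squared_le) auto
  finally have "?I\<^sup>2 \<le> ?c * (norm z)\<^sup>2" by (subst (asm) ennreal_le_iff) auto
  then have "?I\<^sup>2 / ?c\<^sup>2 \<le> ?c * (norm z)\<^sup>2 / ?c\<^sup>2" by (rule divide_right_mono) simp
  then show ?thesis using c by (simp add: avg_def power_divide power2_eq_square[of ?c])
qed

text \<open>Isolates the small values of \<open>\<phi>\<close>. The rest of \<open>\<phi>\<close> is
  in L1, because \<open>\<bar>\<phi> x\<bar> > inverse (Suc k)\<close> gives
  \<open>\<bar>\<phi> x\<bar> \<le> Suc k * (\<phi> x)\<^sup>2\<close>, and bounded averages can be
  integrated against it.\<close>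

lemma L2_truncation_tendsto_0:
  fixes \<phi> :: "real^'n \<Rightarrow> real"
  assumes "L2 \<phi>"
  shows "(\<lambda>k. \<integral>x. (if \<bar>\<phi> x\<bar> \<le> inverse (real (Suc k)) then \<phi> x else 0)\<^sup>2 \<partial>lborel) \<longlonglongrightarrow> 0"
proof -
  note [measurable] = L2_measurable[OF assms]
  have "(\<lambda>k. \<integral>x. (if \<bar>\<phi> x\<bar> \<le> inverse (real (Suc k)) then \<phi> x else 0)\<^sup>2 \<partial>lborel) \<longlonglongrightarrow> (\<integral>x. 0 \<partial>(lborel :: (real^'n) measure))"
  proof (rule integral_dominated_convergence)
    show "integrable lborel (\<lambda>x. (\<phi> x)\<^sup>2)" by (rule L2_square_integrable[OF assms])
    have "(\<lambda>k. (if \<bar>\<phi> x\<bar> \<le> inverse (real (Suc k)) then \<phi> x else 0)\<^sup>2) \<longlonglongrightarrow> 0" for x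
    proof (cases "\<phi> x = 0")
      case False
      then have "\<forall>\<^sub>F k in sequentially. inverse (real (Suc k)) < \<bar>\<phi> x\<bar>"
        by (intro order_tendstoD(2)[OF LIMSEQ_inverse_real_of_nat]) simp
      then have "\<forall>\<^sub>F k in sequentially. (if \<bar>\<phi> x\<bar> \<le> inverse (real (Suc k)) then \<phi> x else 0)\<^sup>2 = 0"
        by eventually_elim auto
      then show ?thesis by (rule tendsto_eventually)
    qed (simp add: if_distrib[of "\<lambda>t. t\<^sup>2"])
    then show "AE x in lborel. (\<lambda>k. (if \<bar>\<phi> x\<bar> \<le> inverse (real (Suc k)) then \<phi> x else 0)\<^sup>2) \<longlonglongrightarrow> 0" by simp
  qed auto
  then show ?thesis by simp
qed

text \<open>A form of Rellich's theorem: with absolute values inside the integral, weak convergence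
  alone does not suffice. Replacing a function by its averages over balls of radius \<open>r\<close>
  costs at most \<open>r * norm (x n)\<close> in L2, and the averages tend to 0 pointwise and
  boundedly. Since they are dominated only by a constant, they are paired with the L1 part of
  \<open>\<phi>\<close>.\<close>

lemma weak_null_imp_pairing_null:
  fixes x :: "nat \<Rightarrow> 'n::finite H1"
  assumes x: "weakly_converges_to x 0" and B: "\<And>n. norm (x n) \<le> B" and \<phi>: "L2 \<phi>"
  shows "(\<lambda>n. \<integral>t. \<bar>rep_H1 (x n) t\<bar> * \<bar>\<phi> t\<bar> \<partial>lborel) \<longlonglongrightarrow> 0"
  unfolding LIMSEQ_iff
proof (intro allI impI)
  note [measurable] = L2_measurable[OF \<phi>]
  fix e :: real assume e: "e > 0"
  define F where "F = (\<integral>t. (\<phi> t)\<^sup>2 \<partial>lborel)"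
  have F: "F \<ge> 0" by (simp add: F_def)
  have B0: "B \<ge> 0" using B[of 0] norm_ge_zero order_trans by blast
  \<comment> \<open>Young parameter: the factors that are merely bounded contribute
    \<open>t * (B\<^sup>2 + F) \<le> e / 8\<close> in total. Truncation, averaging and the averages
    themselves get \<open>e / 8\<close> each.\<close>
  define t where "t = e / (8 * (B\<^sup>2 + F + 1))"
  have t: "t > 0" using e F by (simp add: t_def add_nonneg_pos)
  have tt: "t * B\<^sup>2 + t * F \<le> e / 8"
  proof -
    have "t * (B\<^sup>2 + F) \<le> t * (B\<^sup>2 + F + 1)" using t by simp
    also have "\<dots> = e / 8" using F by (simp add: t_def field_simps add_nonneg_eq_0_iff)
    finally show ?thesis by (simp add: distrib_left)
  qed
  have "\<forall>\<^sub>F k in sequentially. (\<integral>x. (if \<bar>\<phi> x\<bar> \<le> inverse (real (Suc k)) then \<phi> x else 0)\<^sup>2 \<partial>lborel) < t * e / 8"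
    using t e by (intro order_tendstoD(2)[OF L2_truncation_tendsto_0[OF \<phi>]]) simp
  then obtain k where k: "(\<integral>x. (if \<bar>\<phi> x\<bar> \<le> inverse (real (Suc k)) then \<phi> x else 0)\<^sup>2 \<partial>lborel) < t * e / 8"
    using eventually_happens trivial_limit_sequentially by blast
  define \<phi>2 where "\<phi>2 x = (if \<bar>\<phi> x\<bar> \<le> inverse (real (Suc k)) then \<phi> x else 0)" for x
  define \<phi>1 where "\<phi>1 x = (if \<bar>\<phi> x\<bar> \<le> inverse (real (Suc k)) then 0 else \<phi> x)" for x
  have [measurable]: "\<phi>1 \<in> borel_measurable borel" "\<phi>2 \<in> borel_measurable borel"
    unfolding \<phi>1_def[abs_def] \<phi>2_def[abs_def] by measurable
  have \<phi>2: "L2 \<phi>2"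
    unfolding L2_def
  proof
    show "integrable lborel (\<lambda>x. (norm (\<phi>2 x))\<^sup>2)"
      by (rule Bochner_Integration.integrable_bound[OF L2_square_integrable[OF \<phi>]]) (auto simp: \<phi>2_def)
  qed simp
  have \<phi>1: "integrable lborel \<phi>1"
  proof (rule Bochner_Integration.integrable_bound)
    show "integrable lborel (\<lambda>x. real (Suc k) * (\<phi> x)\<^sup>2)" using L2_square_integrable[OF \<phi>] by simp
    have "\<bar>\<phi>1 x\<bar> \<le> real (Suc k) * (\<phi> x)\<^sup>2" for x
    proof (cases "\<bar>\<phi> x\<bar> \<le> inverse (real (Suc k))")
      case False
      then have "1 \<le> real (Suc k) * \<bar>\<phi> x\<bar>" by (simp add: inverse_eq_divide not_le divide_less_eq mult.commute)
      then have "\<bar>\<phi> x\<bar> * 1 \<le> \<bar>\<phi> x\<bar> * (real (Suc k) * \<bar>\<phi> x\<bar>)" by (intro mult_left_mono) auto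
      then show ?thesis using False by (simp add: \<phi>1_def power2_eq_square mult_ac)
    qed (simp add: \<phi>1_def)
    then show "AE x in lborel. norm (\<phi>1 x) \<le> norm (real (Suc k) * (\<phi> x)\<^sup>2)"
      by (auto intro!: AE_I2 order_trans[OF _ abs_ge_self] simp del: of_nat_Suc)
  qed simp
  \<comment> \<open>The radius brings the squared L2 error of averaging below
    \<open>t * e / 8\<close>, which Young's inequality then divides by \<open>t\<close>.\<close>
  obtain r where r: "r > 0" and rB: "r\<^sup>2 * B\<^sup>2 \<le> t * e / 8"
  proof
    define r where "r = sqrt (t * e / (8 * (B\<^sup>2 + 1)))"
    have "0 < t * e / (8 * (B\<^sup>2 + 1))" using t e by (simp add: add_nonneg_pos)
    then show "r > 0" by (simp add: r_def)
    have "r\<^sup>2 = t * e / (8 * (B\<^sup>2 + 1))" using \<open>0 < t * e / _\<close> by (simp add: r_def)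
    then have "r\<^sup>2 * (B\<^sup>2 + 1) = t * e / 8" by (simp add: field_simps add_nonneg_eq_0_iff)
    then show "r\<^sup>2 * B\<^sup>2 \<le> t * e / 8" using zero_le_power2[of r] unfolding distrib_left by linarith
  qed
  define C where "C = 1 + B\<^sup>2 / ball_vol (0::real^'n) r"
  have avgC: "\<bar>avg r (rep_H1 (x n)) s\<bar> \<le> C" for n s
  proof -
    have "(avg r (rep_H1 (x n)) s)\<^sup>2 \<le> B\<^sup>2 / ball_vol (0::real^'n) r"
      using avg_squared_le[OF r, of "x n" s] B[of n] B0 ball_vol_pos[OF r, of "0::real^'n"]
      by (elim order_trans) (auto intro!: divide_right_mono power_mono)
    moreover have "\<bar>a\<bar> \<le> 1 + a\<^sup>2" for a :: real
      using abs_mult_le_squares[of 1 a] by simp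
    ultimately show ?thesis unfolding C_def by (meson add_left_mono order_trans)
  qed
  have [measurable]: "avg r (rep_H1 (x n)) \<in> borel_measurable borel" for n by measurable
  have "(\<lambda>n. \<integral>s. \<bar>avg r (rep_H1 (x n)) s\<bar> * \<bar>\<phi>1 s\<bar> \<partial>lborel) \<longlonglongrightarrow> (\<integral>s. 0 \<partial>(lborel :: (real^'n) measure))"
  proof (rule integral_dominated_convergence)
    show "integrable lborel (\<lambda>s. C * \<bar>\<phi>1 s\<bar>)" using \<phi>1 by simp
    show "AE s in lborel. (\<lambda>n. \<bar>avg r (rep_H1 (x n)) s\<bar> * \<bar>\<phi>1 s\<bar>) \<longlonglongrightarrow> 0"
      using avg_tendsto_0[OF x] by (intro AE_I2 tendsto_mult_left_zero tendsto_rabs_zero)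
    show "AE s in lborel. norm (\<bar>avg r (rep_H1 (x n)) s\<bar> * \<bar>\<phi>1 s\<bar>) \<le> C * \<bar>\<phi>1 s\<bar>" for n
      using avgC by (auto simp: mult_right_mono)
  qed auto
  then have "\<forall>\<^sub>F n in sequentially. (\<integral>s. \<bar>avg r (rep_H1 (x n)) s\<bar> * \<bar>\<phi>1 s\<bar> \<partial>lborel) < e / 8"
    using order_tendstoD(2)[of _ _ _ "e / 8"] e by fastforce
  then have "\<forall>\<^sub>F n in sequentially. (\<integral>s. \<bar>rep_H1 (x n) s\<bar> * \<bar>\<phi> s\<bar> \<partial>lborel) < e"
  proof eventually_elim
    case (elim n)
    let ?v = "rep_H1 (x n)"
    have i1: "integrable lborel (\<lambda>s. \<bar>?v s\<bar> * \<bar>\<phi>2 s\<bar>)" by (intro L2_mult L2_abs L2_rep \<phi>2)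
    have i2: "integrable lborel (\<lambda>s. \<bar>\<phi> s\<bar> * \<bar>?v s - avg r ?v s\<bar>)"
      by (intro L2_mult L2_abs L2_rep_diff_avg r \<phi>)
    have i3: "integrable lborel (\<lambda>s. \<bar>avg r ?v s\<bar> * \<bar>\<phi>1 s\<bar>)"
    proof (rule Bochner_Integration.integrable_bound)
      show "integrable lborel (\<lambda>s. C * \<bar>\<phi>1 s\<bar>)" using \<phi>1 by simp
      show "AE s in lborel. norm (\<bar>avg r ?v s\<bar> * \<bar>\<phi>1 s\<bar>) \<le> norm (C * \<bar>\<phi>1 s\<bar>)"
        using avgC order_trans[OF abs_ge_zero avgC] by (auto intro!: AE_I2 mult_right_mono simp: abs_mult)
    qed simp
    have "(\<integral>s. \<bar>?v s\<bar> * \<bar>\<phi> s\<bar> \<partial>lborel)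
        \<le> (\<integral>s. \<bar>?v s\<bar> * \<bar>\<phi>2 s\<bar> + \<bar>\<phi> s\<bar> * \<bar>?v s - avg r ?v s\<bar> + \<bar>avg r ?v s\<bar> * \<bar>\<phi>1 s\<bar> \<partial>lborel)"
    proof (rule integral_mono)
      show "integrable lborel (\<lambda>s. \<bar>?v s\<bar> * \<bar>\<phi> s\<bar>)" by (intro L2_mult L2_abs L2_rep \<phi>)
      show "integrable lborel (\<lambda>s. \<bar>?v s\<bar> * \<bar>\<phi>2 s\<bar> + \<bar>\<phi> s\<bar> * \<bar>?v s - avg r ?v s\<bar> + \<bar>avg r ?v s\<bar> * \<bar>\<phi>1 s\<bar>)"
        by (intro Bochner_Integration.integrable_add i1 i2 i3)
      fix s
      have "\<bar>?v s\<bar> * \<bar>\<phi> s\<bar> \<le> (\<bar>?v s - avg r ?v s\<bar> + \<bar>avg r ?v s\<bar>) * \<bar>\<phi> s\<bar>"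
        by (intro mult_right_mono) auto
      then show "\<bar>?v s\<bar> * \<bar>\<phi> s\<bar> \<le> \<bar>?v s\<bar> * \<bar>\<phi>2 s\<bar> + \<bar>\<phi> s\<bar> * \<bar>?v s - avg r ?v s\<bar> + \<bar>avg r ?v s\<bar> * \<bar>\<phi>1 s\<bar>"
        by (auto simp: \<phi>1_def \<phi>2_def distrib_left mult.commute)
    qed
    also have "\<dots> = (\<integral>s. \<bar>?v s\<bar> * \<bar>\<phi>2 s\<bar> \<partial>lborel) + (\<integral>s. \<bar>\<phi> s\<bar> * \<bar>?v s - avg r ?v s\<bar> \<partial>lborel)
        + (\<integral>s. \<bar>avg r ?v s\<bar> * \<bar>\<phi>1 s\<bar> \<partial>lborel)"
      using i1 i2 i3 by simp
    also have "\<dots> \<le> (t * B\<^sup>2 + e / 8) + (t * F + e / 8) + e / 8"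
    proof (intro add_mono)
      have v2: "(\<integral>s. (?v s)\<^sup>2 \<partial>lborel) \<le> B\<^sup>2"
        using integral_rep_squared_le[of "x n"] B[of n] B0 by (elim order_trans) (auto intro!: power_mono)
      have "(\<integral>s. \<bar>?v s\<bar> * \<bar>\<phi>2 s\<bar> \<partial>lborel) \<le> t * (\<integral>s. (?v s)\<^sup>2 \<partial>lborel) + (\<integral>s. (\<phi>2 s)\<^sup>2 \<partial>lborel) / t"
        by (rule L2_young[OF L2_rep \<phi>2 t])
      also have "\<dots> \<le> t * B\<^sup>2 + (t * e / 8) / t"
        using v2 k t by (intro add_mono mult_left_mono divide_right_mono) (auto simp: \<phi>2_def)
      finally show "(\<integral>s. \<bar>?v s\<bar> * \<bar>\<phi>2 s\<bar> \<partial>lborel) \<le> t * B\<^sup>2 + e / 8" using t by simp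
      have d2: "(\<integral>s. (?v s - avg r ?v s)\<^sup>2 \<partial>lborel) \<le> t * e / 8"
      proof -
        have "r\<^sup>2 * (norm (x n))\<^sup>2 \<le> r\<^sup>2 * B\<^sup>2" using B[of n] by (intro mult_left_mono power_mono) auto
        then show ?thesis using L2_rep_diff_avg(2)[OF r, of "x n"] rB by linarith
      qed
      have "(\<integral>s. \<bar>\<phi> s\<bar> * \<bar>?v s - avg r ?v s\<bar> \<partial>lborel) \<le> t * F + (\<integral>s. (?v s - avg r ?v s)\<^sup>2 \<partial>lborel) / t"
        using L2_young[OF \<phi> L2_rep_diff_avg(1)[OF r] t, of "x n"] by (simp add: F_def)
      also have "\<dots> \<le> t * F + (t * e / 8) / t"
        using d2 t by (intro add_mono divide_right_mono) auto
      finally show "(\<integral>s. \<bar>\<phi> s\<bar> * \<bar>?v s - avg r ?v s\<bar> \<partial>lborel) \<le> t * F + e / 8" using t by simp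
      show "(\<integral>s. \<bar>avg r ?v s\<bar> * \<bar>\<phi>1 s\<bar> \<partial>lborel) \<le> e / 8" using elim by simp
    qed
    also have "\<dots> < e" using tt e by linarith
    finally show ?case .
  qed
  then show "\<exists>no. \<forall>n\<ge>no. norm ((\<integral>t. \<bar>rep_H1 (x n) t\<bar> * \<bar>\<phi> t\<bar> \<partial>lborel) - 0) < e"
    by (simp add: eventually_sequentially)
qed

text \<open>Bounded sequences are weakly precompact, so it suffices that weak limits of subsequences
  are 0; local L1 convergence forces that.\<close>

lemma weak_null_if_locally_null:
  fixes x :: "nat \<Rightarrow> 'n::finite H1"
  assumes bdd: "bounded (range x)"
    and loc: "\<And>R. (\<lambda>n. \<integral>t. indicator (ball 0 R) t * \<bar>rep_H1 (x n) t\<bar> \<partial>lborel) \<longlonglongrightarrow> 0"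
  shows "weakly_converges_to x 0"
  unfolding weakly_converges_to_iff_inner[OF complete_H1]
proof (intro allI LIMSEQ_if_subseq_subseq)
  fix h and r :: "nat \<Rightarrow> nat" assume r: "strict_mono r"
  have "bounded (range (\<lambda>n. x (r n)))" using bdd by (rule bounded_subset) auto
  then obtain s w where s: "strict_mono s" and w: "weakly_converges_to (\<lambda>n. x (r (s n))) w"
    using bounded_has_weakly_convergent_subseq[OF complete_H1, of "\<lambda>n. x (r n)"] by auto
  have rs: "strict_mono (\<lambda>n. r (s n))" using strict_mono_o[OF r s] by (simp add: comp_def)
  have AE0: "AE t in lborel. indicator (ball 0 (real m)) t * \<bar>rep_H1 w t\<bar> = 0" for m :: nat
  proof -
    \<comment> \<open>Testing with the sign of the limit turns the pairing into the L1 norm of the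
      limit on the ball.\<close>
    let ?\<phi> = "\<lambda>t. indicator (ball 0 (real m)) t * sgn (rep_H1 w t)"
    have \<phi>: "L2 ?\<phi>" by (rule L2_indicator_ball_mult) (auto simp: abs_sgn_eq)
    have int: "integrable lborel (\<lambda>t. indicator (ball 0 (real m)) t * \<bar>rep_H1 z t\<bar>)" for z :: "'n H1"
      by (intro L2_mult L2_abs L2_rep L2_indicator_ball)
    have eq: "?\<phi> t * rep_H1 w t = indicator (ball 0 (real m)) t * \<bar>rep_H1 w t\<bar>" for t
      by (simp add: abs_sgn mult.commute)
    have "(\<lambda>n. \<integral>t. ?\<phi> t * rep_H1 (x (r (s n))) t \<partial>lborel) \<longlonglongrightarrow> (\<integral>t. ?\<phi> t * rep_H1 w t \<partial>lborel)"
      using w bounded_linear_L2_pairing[OF \<phi>] unfolding weakly_converges_to_def by blast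
    moreover have "(\<lambda>n. \<integral>t. ?\<phi> t * rep_H1 (x (r (s n))) t \<partial>lborel) \<longlonglongrightarrow> 0"
    proof (rule Lim_null_comparison)
      show "(\<lambda>n. \<integral>t. indicator (ball 0 (real m)) t * \<bar>rep_H1 (x (r (s n))) t\<bar> \<partial>lborel) \<longlonglongrightarrow> 0"
        using LIMSEQ_subseq_LIMSEQ[OF loc[of "real m"] rs] by (simp add: comp_def)
      have "norm (\<integral>t. ?\<phi> t * rep_H1 z t \<partial>lborel) \<le> (\<integral>t. indicator (ball 0 (real m)) t * \<bar>rep_H1 z t\<bar> \<partial>lborel)" for z :: "'n H1"
      proof -
        have "norm (\<integral>t. ?\<phi> t * rep_H1 z t \<partial>lborel) \<le> (\<integral>t. \<bar>?\<phi> t * rep_H1 z t\<bar> \<partial>lborel)"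
          using integral_abs_bound[of lborel "\<lambda>t. ?\<phi> t * rep_H1 z t"] by simp
        also have "\<dots> \<le> (\<integral>t. indicator (ball 0 (real m)) t * \<bar>rep_H1 z t\<bar> \<partial>lborel)"
        proof (rule integral_mono)
          show "integrable lborel (\<lambda>t. \<bar>?\<phi> t * rep_H1 z t\<bar>)" using L2_mult[OF \<phi> L2_rep, of z] by simp
          show "\<bar>?\<phi> t * rep_H1 z t\<bar> \<le> indicator (ball 0 (real m)) t * \<bar>rep_H1 z t\<bar>" for t
            by (auto simp: indicator_def abs_mult abs_sgn_eq)
        qed (rule int)
        finally show ?thesis .
      qed
      then show "\<forall>\<^sub>F n in sequentially. norm (\<integral>t. ?\<phi> t * rep_H1 (x (r (s n))) t \<partial>lborel)
          \<le> (\<integral>t. indicator (ball 0 (real m)) t * \<bar>rep_H1 (x (r (s n))) t\<bar> \<partial>lborel)" by simp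
    qed
    ultimately have "(\<integral>t. ?\<phi> t * rep_H1 w t \<partial>lborel) = 0" using LIMSEQ_unique by blast
    then have "(\<integral>t. indicator (ball 0 (real m)) t * \<bar>rep_H1 w t\<bar> \<partial>lborel) = 0" unfolding eq .
    then show ?thesis using int[of w] by (subst (asm) integral_nonneg_eq_0_iff_AE) auto
  qed
  have "AE t in lborel. \<forall>m::nat. indicator (ball 0 (real m)) t * \<bar>rep_H1 w t\<bar> = 0"
    unfolding AE_all_countable using AE0 by blast
  then have "AE t in lborel. rep_H1 w t = 0"
  proof (rule AE_mp, intro AE_I2 impI)
    fix t :: "real^'n" assume a: "\<forall>m::nat. indicator (ball 0 (real m)) t * \<bar>rep_H1 w t\<bar> = 0"
    obtain m :: nat where "norm t < real m" using reals_Archimedean2 by blast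
    then show "rep_H1 w t = 0" using a[rule_format, of m] by simp
  qed
  then have "w = 0" by (intro H1_eqI) (use rep_zero in auto)
  then show "\<exists>s. strict_mono s \<and> (\<lambda>n. x (r (s n)) \<bullet> h) \<longlonglongrightarrow> 0 \<bullet> h"
    using w s unfolding weakly_converges_to_iff_inner[OF complete_H1] by blast
qed

section \<open>Weak limits under translation\<close>

lemma integral_ball_translate:
  "(\<integral>t. indicator (ball 0 R) t * \<bar>rep_H1 (translate y u) t\<bar> \<partial>lborel) = (\<integral>t. indicator (ball y R) t * \<bar>rep_H1 u t\<bar> \<partial>lborel)"
proof -
  have "(\<integral>t. indicator (ball 0 R) t * \<bar>rep_H1 (translate y u) t\<bar> \<partial>lborel)
      = (\<integral>t. indicator (ball y R) (t + y) * \<bar>rep_H1 u (t + y)\<bar> \<partial>lborel)"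
  proof (rule integral_cong_AE)
    show "AE t in lborel. indicator (ball 0 R) t * \<bar>rep_H1 (translate y u) t\<bar>
        = indicator (ball y R) (t + y) * \<bar>rep_H1 u (t + y)\<bar>"
      using rep_translate[of y u] by eventually_elim (simp add: indicator_def dist_norm)
  qed simp_all
  also have "\<dots> = (\<integral>t. indicator (ball y R) t * \<bar>rep_H1 u t\<bar> \<partial>lborel)"
    by (rule lborel_integral_translate) simp
  finally show ?thesis .
qed

lemma bounded_range_translate:
  fixes x :: "nat \<Rightarrow> 'n::finite H1"
  shows "bounded (range x) \<Longrightarrow> bounded (range (\<lambda>n. translate (y n) (x n)))"
  by (auto simp: bounded_iff norm_translate)

text \<open>The ball of radius \<open>R\<close> around \<open>y n\<close> lies in the fixed ball of
  radius \<open>R + S\<close>. Used in the contrapositive: centres at which a sequence has a nonzero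
  weak limit move away from centres at which it tends weakly to 0.\<close>

lemma weak_null_translate_bounded:
  fixes x :: "nat \<Rightarrow> 'n::finite H1" and y :: "nat \<Rightarrow> real^'n"
  assumes x: "weakly_converges_to x 0" and bdd: "bounded (range x)" and y: "\<And>n. norm (y n) \<le> S"
  shows "weakly_converges_to (\<lambda>n. translate (y n) (x n)) 0"
proof (rule weak_null_if_locally_null[OF bounded_range_translate[OF bdd]])
  fix R :: real
  obtain B where B: "\<And>n. norm (x n) \<le> B" using bdd by (auto simp: bounded_iff)
  have "(\<lambda>n. \<integral>t. \<bar>rep_H1 (x n) t\<bar> * \<bar>indicator (ball 0 (R + S)) t\<bar> \<partial>lborel) \<longlonglongrightarrow> 0"
    by (rule weak_null_imp_pairing_null[OF x B L2_indicator_ball])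
  then show "(\<lambda>n. \<integral>t. indicator (ball 0 R) t * \<bar>rep_H1 (translate (y n) (x n)) t\<bar> \<partial>lborel) \<longlonglongrightarrow> 0"
  proof (rule Lim_null_comparison[rotated], intro always_eventually allI)
    fix n
    have "(\<integral>t. indicator (ball (y n) R) t * \<bar>rep_H1 (x n) t\<bar> \<partial>lborel)
        \<le> (\<integral>t. \<bar>rep_H1 (x n) t\<bar> * \<bar>indicator (ball 0 (R + S)) t\<bar> \<partial>lborel)"
    proof (rule integral_mono)
      fix t :: "real^'n"
      have "norm t < R + S" if "norm (y n - t) < R"
        using that y[of n] norm_triangle_ineq4[of "y n" "y n - t"] by simp
      then show "indicator (ball (y n) R) t * \<bar>rep_H1 (x n) t\<bar> \<le> \<bar>rep_H1 (x n) t\<bar> * \<bar>indicator (ball 0 (R + S)) t\<bar>"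
        by (auto simp: indicator_def dist_norm)
    qed (intro L2_mult L2_abs L2_rep L2_indicator_ball)+
    then show "norm (\<integral>t. indicator (ball 0 R) t * \<bar>rep_H1 (translate (y n) (x n)) t\<bar> \<partial>lborel)
        \<le> (\<integral>t. \<bar>rep_H1 (x n) t\<bar> * \<bar>indicator (ball 0 (R + S)) t\<bar> \<partial>lborel)"
      unfolding integral_ball_translate by simp
  qed
qed

text \<open>The L2 mass of \<open>w\<close> on the ball around \<open>y n\<close> tends to 0 by
  dominated convergence, since the ball eventually leaves every point.\<close>

lemma weak_null_translate_at_infinity:
  fixes w :: "'n::finite H1" and y :: "nat \<Rightarrow> real^'n"
  assumes y: "filterlim (\<lambda>n. norm (y n)) at_top sequentially"
  shows "weakly_converges_to (\<lambda>n. translate (y n) w) 0"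
proof (rule weak_null_if_locally_null)
  show "bounded (range (\<lambda>n. translate (y n) w))" by (auto simp: bounded_iff norm_translate)
  fix R :: real
  have l1: "(\<lambda>n. \<integral>t. (indicator (ball (y n) R) t * rep_H1 w t)\<^sup>2 \<partial>lborel) \<longlonglongrightarrow> (\<integral>t. 0 \<partial>(lborel :: (real^'n) measure))"
  proof (rule integral_dominated_convergence)
    show "integrable lborel (\<lambda>t. (rep_H1 w t)\<^sup>2)" by (rule L2_square_integrable[OF L2_rep])
    have "(\<lambda>n. (indicator (ball (y n) R) t * rep_H1 w t)\<^sup>2) \<longlonglongrightarrow> 0" for t
    proof (rule tendsto_eventually)
      have "\<forall>\<^sub>F n in sequentially. R + norm t < norm (y n)" using y by (rule filterlim_at_top_dense[THEN iffD1, rule_format])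
      then show "\<forall>\<^sub>F n in sequentially. (indicator (ball (y n) R) t * rep_H1 w t)\<^sup>2 = 0"
      proof eventually_elim
        case (elim n)
        then show ?case using norm_triangle_ineq2[of "y n" t] by (simp add: indicator_def dist_norm)
      qed
    qed
    then show "AE t in lborel. (\<lambda>n. (indicator (ball (y n) R) t * rep_H1 w t)\<^sup>2) \<longlonglongrightarrow> 0" by simp
  qed (auto simp: indicator_def)
  have l2: "(\<lambda>n. \<integral>t. (indicator (ball 0 R) t * \<bar>rep_H1 w (t + y n)\<bar>)\<^sup>2 \<partial>lborel) \<longlonglongrightarrow> 0"
  proof -
    have "(\<integral>t. (indicator (ball 0 R) t * \<bar>rep_H1 w (t + y n)\<bar>)\<^sup>2 \<partial>lborel)
        = (\<integral>t. (indicator (ball (y n) R) t * rep_H1 w t)\<^sup>2 \<partial>lborel)" for n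
    proof -
      have "(\<integral>t. (indicator (ball (y n) R) (t + y n) * rep_H1 w (t + y n))\<^sup>2 \<partial>lborel)
          = (\<integral>t. (indicator (ball (y n) R) t * rep_H1 w t)\<^sup>2 \<partial>lborel)"
        by (rule lborel_integral_translate) simp
      moreover have "(\<lambda>t. (indicator (ball (y n) R) (t + y n) * rep_H1 w (t + y n))\<^sup>2)
          = (\<lambda>t. (indicator (ball 0 R) t * \<bar>rep_H1 w (t + y n)\<bar>)\<^sup>2)"
        by (auto simp: fun_eq_iff indicator_def dist_norm)
      ultimately show ?thesis by simp
    qed
    then show ?thesis using l1 by simp
  qed
  have "(\<lambda>n. \<integral>t. (indicator (ball 0 R) t * \<bar>rep_H1 w (t + y n)\<bar>) * indicator (ball 0 R) t \<partial>lborel) \<longlonglongrightarrow> 0"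
  proof (rule L2_mult_tendsto_0[OF _ L2_indicator_ball l2])
    fix n
    note w = L2_translate[OF L2_rep, of w "y n"]
    show "L2 (\<lambda>t. indicator (ball 0 R) t * \<bar>rep_H1 w (t + y n)\<bar>)"
      unfolding L2_def
    proof
      show "integrable lborel (\<lambda>t. (norm (indicator (ball 0 R) t * \<bar>rep_H1 w (t + y n)\<bar>))\<^sup>2)"
        by (rule Bochner_Integration.integrable_bound[OF L2_square_integrable[OF w]]) (auto simp: indicator_def)
    qed simp
  qed
  moreover have "(\<integral>t. (indicator (ball 0 R) t * \<bar>rep_H1 w (t + y n)\<bar>) * indicator (ball 0 R) t \<partial>lborel)
      = (\<integral>t. indicator (ball 0 R) t * \<bar>rep_H1 (translate (y n) w) t\<bar> \<partial>lborel)" for n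
  proof (rule integral_cong_AE)
    show "AE t in lborel. (indicator (ball 0 R) t * \<bar>rep_H1 w (t + y n)\<bar>) * indicator (ball 0 R) t
        = indicator (ball 0 R) t * \<bar>rep_H1 (translate (y n) w) t\<bar>"
      using rep_translate[of "y n" w] by eventually_elim (simp add: indicator_def)
  qed simp_all
  ultimately show "(\<lambda>n. \<integral>t. indicator (ball 0 R) t * \<bar>rep_H1 (translate (y n) w) t\<bar> \<partial>lborel) \<longlonglongrightarrow> 0" by simp
qed

text \<open>Where \<open>\<bar>v\<bar> > 2 * \<delta>\<close>, an average of size at most
  \<open>\<delta>\<close> is below \<open>\<bar>v\<bar> / 2\<close>, so \<open>\<bar>v\<bar>\<close>
  is at most twice its distance from the average; hence the factor 4.\<close>

lemma integral_superlevel_le: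
  assumes r: "r > 0" and small: "\<And>t. \<bar>avg r (rep_H1 z) t\<bar> \<le> \<delta>"
  shows "(\<integral>t. (if \<bar>rep_H1 z t\<bar> > 2 * \<delta> then (rep_H1 z t)\<^sup>2 else 0) \<partial>lborel) \<le> 4 * r\<^sup>2 * (norm z)\<^sup>2"
proof -
  let ?v = "rep_H1 z"
  have "(\<integral>t. (if \<bar>?v t\<bar> > 2 * \<delta> then (?v t)\<^sup>2 else 0) \<partial>lborel) \<le> (\<integral>t. 4 * (?v t - avg r ?v t)\<^sup>2 \<partial>lborel)"
  proof (rule integral_mono)
    show "integrable lborel (\<lambda>t. if \<bar>?v t\<bar> > 2 * \<delta> then (?v t)\<^sup>2 else 0)"
      by (rule Bochner_Integration.integrable_bound[OF L2_square_integrable[OF L2_rep, of z]]) auto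
    show "integrable lborel (\<lambda>t. 4 * (?v t - avg r ?v t)\<^sup>2)"
      using L2_square_integrable[OF L2_rep_diff_avg(1)[OF r, of z]] by simp
    fix t
    have "\<bar>?v t\<bar> \<le> \<bar>2 * (?v t - avg r ?v t)\<bar>" if "\<bar>?v t\<bar> > 2 * \<delta>"
      using that small[of t] by (smt (verit))
    then have "(?v t)\<^sup>2 \<le> (2 * (?v t - avg r ?v t))\<^sup>2" if "\<bar>?v t\<bar> > 2 * \<delta>"
      using that by (simp add: abs_le_square_iff)
    moreover have "(2 * (?v t - avg r ?v t))\<^sup>2 = 4 * (?v t - avg r ?v t)\<^sup>2"
      by (simp only: power_mult_distrib) simp
    ultimately show "(if \<bar>?v t\<bar> > 2 * \<delta> then (?v t)\<^sup>2 else 0) \<le> 4 * (?v t - avg r ?v t)\<^sup>2"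
      by simp
  qed
  also have "\<dots> \<le> 4 * (r\<^sup>2 * (norm z)\<^sup>2)" using L2_rep_diff_avg(2)[OF r, of z] by simp
  finally show ?thesis by simp
qed

lemma avg_translate: "avg r (rep_H1 (translate y u)) 0 = avg r (rep_H1 u) y"
proof -
  have "(\<integral>t. indicator (ball 0 r) t * rep_H1 (translate y u) (0 + t) \<partial>lborel)
      = (\<integral>t. indicator (ball 0 r) t * rep_H1 u (y + t) \<partial>lborel)"
  proof (rule integral_cong_AE)
    show "AE t in lborel. indicator (ball 0 r) t * rep_H1 (translate y u) (0 + t) = indicator (ball 0 r) t * rep_H1 u (y + t)"
      using rep_translate[of y u] by eventually_elim (simp add: add.commute)
  qed simp_all
  then show ?thesis unfolding avg_def by simp
qed

text \<open>This replaces Lions' vanishing lemma.\<close>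

lemma vanishing_superlevel:
  fixes x :: "nat \<Rightarrow> 'n::finite H1"
  assumes bdd: "bounded (range x)"
    and van: "\<And>s y w. strict_mono s \<Longrightarrow> weakly_converges_to (\<lambda>n. translate (y n) (x (s n))) w \<Longrightarrow> w = 0"
    and \<delta>: "\<delta> > 0"
  shows "(\<lambda>n. \<integral>t. (if \<bar>rep_H1 (x n) t\<bar> > \<delta> then (rep_H1 (x n) t)\<^sup>2 else 0) \<partial>lborel) \<longlonglongrightarrow> 0"
  unfolding LIMSEQ_iff
proof (intro allI impI)
  fix e :: real assume e: "e > 0"
  obtain B where B: "\<And>n. norm (x n) \<le> B" using bdd by (auto simp: bounded_iff)
  \<comment> \<open>With this radius the bound of \<open>integral_superlevel_le\<close> is below
    \<open>e\<close> for the whole sequence.\<close>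
  define r where "r = sqrt (e / (8 * (B\<^sup>2 + 1)))"
  have p: "0 < e / (8 * (B\<^sup>2 + 1))" using e by (simp add: add_nonneg_pos)
  then have r: "r > 0" by (simp add: r_def)
  have "r\<^sup>2 * (B\<^sup>2 + 1) = e / 8"
    using p by (simp add: r_def field_simps add_nonneg_eq_0_iff)
  then have rB: "4 * r\<^sup>2 * B\<^sup>2 < e"
    using zero_le_power2[of r] e mult_nonneg_nonneg[OF zero_le_power2[of r] zero_le_power2[of B]]
    unfolding distrib_left mult.assoc by linarith
  have "\<forall>\<^sub>F n in sequentially. \<forall>t. \<bar>avg r (rep_H1 (x n)) t\<bar> \<le> \<delta> / 2"
  proof (rule ccontr)
    \<comment> \<open>Averages then stay above \<open>\<delta> / 2\<close> at points
      \<open>y n\<close> along a subsequence. Translated to the origin, a further subsequence has a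
      weak limit, which \<open>van\<close> makes 0; so its averages at the origin tend to 0 after
      all.\<close>
    assume "\<not> ?thesis"
    then have "\<exists>\<^sub>F n in sequentially. \<exists>t. \<bar>avg r (rep_H1 (x n)) t\<bar> > \<delta> / 2"
      by (simp add: not_eventually not_le)
    then have "infinite {n. \<exists>t. \<bar>avg r (rep_H1 (x n)) t\<bar> > \<delta> / 2}"
      by (simp add: frequently_cofinite cofinite_eq_sequentially[symmetric])
    then obtain s :: "nat \<Rightarrow> nat" where s: "strict_mono s" "\<And>n. \<exists>t. \<bar>avg r (rep_H1 (x (s n))) t\<bar> > \<delta> / 2"
      using infinite_enumerate by blast
    then obtain y where y: "\<And>n. \<bar>avg r (rep_H1 (x (s n))) (y n)\<bar> > \<delta> / 2" by metis
    have "bounded (range (\<lambda>n. x (s n)))" using bdd by (rule bounded_subset) auto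
    then obtain s' w where s': "strict_mono s'" and w: "weakly_converges_to (\<lambda>n. translate (y (s' n)) (x (s (s' n)))) w"
      using bounded_has_weakly_convergent_subseq[OF complete_H1 bounded_range_translate[of "\<lambda>n. x (s n)" y]] by blast
    have "w = 0" by (rule van[OF _ w]) (use strict_mono_o[OF s(1) s'] in \<open>simp add: comp_def\<close>)
    then have "(\<lambda>n. avg r (rep_H1 (translate (y (s' n)) (x (s (s' n))))) 0) \<longlonglongrightarrow> 0"
      using avg_tendsto_0 w by blast
    then have "(\<lambda>n. avg r (rep_H1 (x (s (s' n)))) (y (s' n))) \<longlonglongrightarrow> 0"
      by (simp add: avg_translate)
    then have "\<forall>\<^sub>F n in sequentially. \<bar>avg r (rep_H1 (x (s (s' n)))) (y (s' n))\<bar> < \<delta> / 2"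
      using \<delta> by (intro order_tendstoD(2)[OF tendsto_rabs_zero]) auto
    then have "\<forall>\<^sub>F n :: nat in sequentially. False" by eventually_elim (use y less_asym in blast)
    then show False by simp
  qed
  then have "\<forall>\<^sub>F n in sequentially. (\<integral>t. (if \<bar>rep_H1 (x n) t\<bar> > \<delta> then (rep_H1 (x n) t)\<^sup>2 else 0) \<partial>lborel) < e"
  proof eventually_elim
    case (elim n)
    have "(\<integral>t. (if \<bar>rep_H1 (x n) t\<bar> > \<delta> then (rep_H1 (x n) t)\<^sup>2 else 0) \<partial>lborel) \<le> 4 * r\<^sup>2 * (norm (x n))\<^sup>2"
      using integral_superlevel_le[OF r, of "x n" "\<delta> / 2"] elim by simp
    also have "\<dots> \<le> 4 * r\<^sup>2 * B\<^sup>2" using B[of n] by (intro mult_left_mono power_mono) auto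
    finally show ?case using rB by linarith
  qed
  then show "\<exists>no. \<forall>n\<ge>no. norm ((\<integral>t. (if \<bar>rep_H1 (x n) t\<bar> > \<delta> then (rep_H1 (x n) t)\<^sup>2 else 0) \<partial>lborel) - 0) < e"
    by (simp add: eventually_sequentially)
qed

section \<open>The critical Sobolev embedding\<close>

text \<open>The embedding follows from the translation estimate alone, by truncation. Write
  \<open>\<alpha> k = |{|v| > 2^k}|\<close>, and let \<open>layer k v\<close> be the part of \<open>|v|\<close> between \<open>2^k\<close> and \<open>2^(k+1)\<close>. At a scale
  whose cube has volume comparable to \<open>\<alpha> k\<close>, the increments of \<open>layer k v\<close> bound \<open>4^k * \<alpha> (k + 1)\<close>. The
  increments of all layers sum up to at most those of \<open>v\<close>, and replacing the scales by a common finer one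
  only costs the square of the ratio. So \<open>A k = 2^(p k) * \<alpha> k\<close> satisfies
  \<open>A (k + 1) \<le> C * A k powr (2 / N) * e k\<close> with \<open>e\<close> summable, and \<open>2 / N < 1\<close>.\<close>

definition layer :: "nat \<Rightarrow> real \<Rightarrow> real" where
  "layer k t = min (max (\<bar>t\<bar> - 2 ^ k) 0) (2 ^ k)"

lemma measurable_layer [measurable]: "layer k \<in> borel_measurable borel"
  unfolding layer_def[abs_def] by measurable

lemma layer_mono: "\<bar>s\<bar> \<le> \<bar>t\<bar> \<Longrightarrow> layer k s \<le> layer k t"
  unfolding layer_def by (intro min.mono max.mono) auto

lemma sum_layer: "(\<Sum>k<K. layer k t) = min (max (\<bar>t\<bar> - 1) 0) (2 ^ K - 1)"
proof (induction K)
  case (Suc K)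
  have "(1::real) \<le> 2 ^ K" by simp
  then show ?case
    unfolding sum.lessThan_Suc Suc unfolding layer_def power_Suc min_def max_def by (smt (verit))
qed simp

lemma sum_squares_le_square_sum:
  fixes d :: "nat \<Rightarrow> real"
  assumes "\<And>k. d k \<ge> 0"
  shows "(\<Sum>k<K. (d k)\<^sup>2) \<le> (\<Sum>k<K. d k)\<^sup>2"
proof (induction K)
  case (Suc K)
  have "0 \<le> (\<Sum>k<K. d k) * d K" using assms by (intro mult_nonneg_nonneg sum_nonneg)
  then show ?case using Suc by (simp add: power2_sum)
qed simp

text \<open>The layers are nondecreasing in \<open>\<bar>t\<bar>\<close>, so their increments share
  a sign and the sum of squares is at most the square of the sum. That sum is the increment of
  \<open>\<bar>t\<bar>\<close> truncated between \<open>1\<close> and \<open>2 ^ K\<close>.\<close>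

lemma sum_layer_increments: "(\<Sum>k<K. (layer k s - layer k t)\<^sup>2) \<le> (s - t)\<^sup>2"
proof -
  have *: "(\<Sum>k<K. (layer k t - layer k s)\<^sup>2) \<le> (t - s)\<^sup>2" if st: "\<bar>s\<bar> \<le> \<bar>t\<bar>" for s t
  proof -
    have "(\<Sum>k<K. (layer k t - layer k s)\<^sup>2) \<le> (\<Sum>k<K. layer k t - layer k s)\<^sup>2"
      using layer_mono[OF st] by (intro sum_squares_le_square_sum) simp
    also have "\<dots> \<le> (\<bar>t\<bar> - \<bar>s\<bar>)\<^sup>2"
    proof (rule power_mono)
      have "(1::real) \<le> 2 ^ K" by simp
      then show "(\<Sum>k<K. layer k t - layer k s) \<le> \<bar>t\<bar> - \<bar>s\<bar>"
        using st unfolding sum_subtractf sum_layer min_def max_def by (smt (verit))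
      show "0 \<le> (\<Sum>k<K. layer k t - layer k s)"
        using layer_mono[OF st] by (intro sum_nonneg) simp
    qed
    also have "\<dots> \<le> (t - s)\<^sup>2" by (subst abs_le_square_iff[symmetric]) linarith
    finally show ?thesis .
  qed
  show ?thesis
    using *[of s t] *[of t s] by (cases "\<bar>s\<bar> \<le> \<bar>t\<bar>") (simp_all add: power2_commute)
qed

section \<open>Increments of the layers at dyadic scales\<close>

lemma emeasure_lborel_affine:
  fixes a :: "'a::euclidean_space"
  assumes "c > 0" and [measurable]: "A \<in> sets borel"
  shows "emeasure lborel A = ennreal (c ^ DIM('a)) * emeasure lborel {z. a + c *\<^sub>R z \<in> A}"
proof -
  have "emeasure lborel A = emeasure (density (distr lborel borel (\<lambda>x. a + c *\<^sub>R x)) (\<lambda>_. \<bar>c\<bar> ^ DIM('a))) A"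
    using lborel_affine[of c a] assms by simp
  also have "\<dots> = ennreal (c ^ DIM('a)) * emeasure (distr lborel borel (\<lambda>x. a + c *\<^sub>R x)) A"
    using assms by (simp add: emeasure_density nn_integral_cmult_indicator)
  also have "emeasure (distr lborel borel (\<lambda>x. a + c *\<^sub>R x)) A = emeasure lborel {z. a + c *\<^sub>R z \<in> A}"
    by (subst emeasure_distr) (auto simp: vimage_def)
  finally show ?thesis .
qed

definition layer_incr :: "(real^'n \<Rightarrow> real) \<Rightarrow> nat \<Rightarrow> real^'n \<Rightarrow> ennreal" where
  "layer_incr v k h = (\<integral>\<^sup>+x. ennreal ((layer k (v (x + h)) - layer k (v x))\<^sup>2) \<partial>lborel)"

lemma measurable_layer_incr [measurable (raw)]:
  assumes [measurable]: "v \<in> borel_measurable borel" "f \<in> borel_measurable M"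
  shows "(\<lambda>z. layer_incr v k (f z)) \<in> borel_measurable M"
  unfolding layer_incr_def by measurable

text \<open>A step by \<open>2 *\<^sub>R h\<close> is two steps by \<open>h\<close>. The factor 4 is
  what the weight \<open>4 ^ j\<close> of \<open>scaled_incr\<close> compensates.\<close>

lemma layer_incr_double:
  assumes [measurable]: "v \<in> borel_measurable borel"
  shows "layer_incr v k (2 *\<^sub>R h) \<le> 4 * layer_incr v k h"
proof -
  let ?f = "\<lambda>x. layer k (v x)"
  have "layer_incr v k (2 *\<^sub>R h) \<le> (\<integral>\<^sup>+x. 2 * ennreal ((?f ((x + h) + h) - ?f (x + h))\<^sup>2) + 2 * ennreal ((?f (x + h) - ?f x)\<^sup>2) \<partial>lborel)"
    unfolding layer_incr_def
  proof (intro nn_integral_mono)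
    fix x
    have "(a - c)\<^sup>2 \<le> 2 * (a - b)\<^sup>2 + 2 * (b - c)\<^sup>2" for a b c :: real
    proof -
      have "(a - c)\<^sup>2 + ((a - b) - (b - c))\<^sup>2 = 2 * (a - b)\<^sup>2 + 2 * (b - c)\<^sup>2"
        by (simp add: power2_eq_square algebra_simps)
      then show ?thesis using zero_le_power2[of "(a - b) - (b - c)"] by linarith
    qed
    from ennreal_leI[OF this[of "?f ((x + h) + h)" "?f x" "?f (x + h)"]]
    show "ennreal ((?f (x + 2 *\<^sub>R h) - ?f x)\<^sup>2)
        \<le> 2 * ennreal ((?f ((x + h) + h) - ?f (x + h))\<^sup>2) + 2 * ennreal ((?f (x + h) - ?f x)\<^sup>2)"
      by (simp add: ennreal_mult scaleR_2 add.assoc)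
  qed
  also have "\<dots> = 2 * (\<integral>\<^sup>+x. ennreal ((?f ((x + h) + h) - ?f (x + h))\<^sup>2) \<partial>lborel) + 2 * layer_incr v k h"
    unfolding layer_incr_def by (simp add: nn_integral_add nn_integral_cmult)
  also have "(\<integral>\<^sup>+x. ennreal ((?f ((x + h) + h) - ?f (x + h))\<^sup>2) \<partial>lborel) = layer_incr v k h"
    unfolding layer_incr_def
    by (rule nn_integral_lborel_translate[of "\<lambda>x. ennreal ((?f (x + h) - ?f x)\<^sup>2)"]) simp
  also have "2 * layer_incr v k h + 2 * layer_incr v k h = 4 * layer_incr v k h"
    by (simp flip: distrib_right)
  finally show ?thesis .
qed

text \<open>All coordinates of \<open>\<Sum>Basis\<close> are 1. The volume is exactly 1, so that
  side \<open>1 / 2 ^ j\<close> means volume \<open>(1 / 2 ^ j) ^ CARD('n)\<close> without further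
  constants.\<close>

abbreviation unit_cube :: "(real^'n) set" where
  "unit_cube \<equiv> cbox 0 (\<Sum>Basis)"

lemma norm_unit_cube:
  assumes "z \<in> unit_cube" shows "norm (z :: real^'n) \<le> real CARD('n)"
proof -
  have "\<And>b. b \<in> Basis \<Longrightarrow> \<bar>z \<bullet> b\<bar> \<le> 1" using assms by (auto simp: mem_box inner_sum_left_Basis)
  then have "(\<Sum>b\<in>Basis. \<bar>z \<bullet> b\<bar>) \<le> (\<Sum>b\<in>(Basis :: (real^'n) set). 1)" by (intro sum_mono)
  then show ?thesis using norm_le_l1[of z] by simp
qed

lemma emeasure_unit_cube: "emeasure lborel (unit_cube :: (real^'n) set) = 1"
  by (subst emeasure_lborel_cbox) (auto simp: inner_sum_left_Basis)

text \<open>A mean over the cube of side \<open>1 / 2 ^ j\<close> of increments divided by the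
  squared scale. This normalisation makes the quantity monotone in \<open>j\<close>, and its sum
  over the layers bounded uniformly in \<open>j\<close>.\<close>

definition scaled_incr :: "(real^'n \<Rightarrow> real) \<Rightarrow> nat \<Rightarrow> nat \<Rightarrow> ennreal" where
  "scaled_incr v k j = (\<integral>\<^sup>+z. indicator unit_cube z * (4 ^ j * layer_incr v k ((1 / 2 ^ j) *\<^sub>R z)) \<partial>lborel)"

text \<open>Each superlevel set asks for its own scale, while the increments of the layers are
  summed at a single one. Monotonicity lets all of them pass to a common finer scale.\<close>

lemma scaled_incr_mono:
  assumes [measurable]: "v \<in> borel_measurable borel" and "i \<le> j"
  shows "scaled_incr v k i \<le> scaled_incr v k j"
proof (rule lift_Suc_mono_le[OF _ assms(2)])
  fix j
  show "scaled_incr v k j \<le> scaled_incr v k (Suc j)"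
    unfolding scaled_incr_def
  proof (intro nn_integral_mono mult_left_mono)
    fix z :: "real^'a"
    have "layer_incr v k (2 *\<^sub>R ((1 / 2 ^ Suc j) *\<^sub>R z)) \<le> 4 * layer_incr v k ((1 / 2 ^ Suc j) *\<^sub>R z)"
      by (rule layer_incr_double) simp
    then have "4 ^ j * layer_incr v k ((1 / 2 ^ j) *\<^sub>R z) \<le> 4 ^ j * (4 * layer_incr v k ((1 / 2 ^ Suc j) *\<^sub>R z))"
      by (intro mult_left_mono) simp_all
    then show "4 ^ j * layer_incr v k ((1 / 2 ^ j) *\<^sub>R z) \<le> 4 ^ Suc j * layer_incr v k ((1 / 2 ^ Suc j) *\<^sub>R z)"
      by (simp add: mult_ac)
  qed simp
qed

text \<open>For one shift the increments of all layers sum to at most the increment of the function,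
  and the translation estimate cancels \<open>4 ^ j\<close>. The constant is the bound of
  \<open>norm_unit_cube\<close>, squared.\<close>

lemma sum_scaled_incr:
  fixes z :: "'n::finite H1"
  assumes "norm z \<le> 1"
  shows "(\<Sum>k<K. scaled_incr (rep_H1 z) k j) \<le> ennreal ((real CARD('n))\<^sup>2)"
proof -
  let ?v = "rep_H1 z"
  have "(\<Sum>k<K. scaled_incr ?v k j)
      = (\<integral>\<^sup>+t. indicator unit_cube t * (4 ^ j * (\<Sum>k<K. layer_incr ?v k ((1 / 2 ^ j) *\<^sub>R t))) \<partial>lborel)"
    unfolding scaled_incr_def sum_distrib_left by (rule nn_integral_sum[symmetric]) simp
  also have "\<dots> \<le> (\<integral>\<^sup>+t. ennreal ((real CARD('n))\<^sup>2) * indicator (unit_cube :: (real^'n) set) t \<partial>lborel)"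
  proof (intro nn_integral_mono)
    fix t :: "real^'n"
    let ?h = "(1 / 2 ^ j) *\<^sub>R t"
    show "indicator unit_cube t * (4 ^ j * (\<Sum>k<K. layer_incr ?v k ?h)) \<le> ennreal ((real CARD('n))\<^sup>2) * indicator unit_cube t"
    proof (cases "t \<in> unit_cube")
      case True
      have "(\<Sum>k<K. layer_incr ?v k ?h) = (\<integral>\<^sup>+x. (\<Sum>k<K. ennreal ((layer k (?v (x + ?h)) - layer k (?v x))\<^sup>2)) \<partial>lborel)"
        unfolding layer_incr_def by (rule nn_integral_sum[symmetric]) simp
      also have "\<dots> \<le> (\<integral>\<^sup>+x. ennreal ((?v (x + ?h) - ?v x)\<^sup>2) \<partial>lborel)"
        by (intro nn_integral_mono) (simp add: sum_ennreal ennreal_leI sum_layer_increments)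
      also have "\<dots> \<le> ennreal ((norm ?h)\<^sup>2 * (norm z)\<^sup>2)" by (rule H1_translation_estimate)
      also have "\<dots> \<le> ennreal ((1 / 4 ^ j) * (real CARD('n))\<^sup>2)"
      proof (rule ennreal_leI)
        have "(norm ?h)\<^sup>2 = (1 / 4 ^ j) * (norm t)\<^sup>2"
        proof -
          have "((2::real) ^ j)\<^sup>2 = 4 ^ j" by (simp add: power_mult[symmetric] mult.commute[of j] power_mult)
          then show ?thesis by (simp add: power_mult_distrib power_divide)
        qed
        also have "\<dots> \<le> (1 / 4 ^ j) * (real CARD('n))\<^sup>2"
          using norm_unit_cube[OF True] by (intro mult_left_mono power_mono) auto
        finally have "(norm ?h)\<^sup>2 \<le> (1 / 4 ^ j) * (real CARD('n))\<^sup>2" .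
        moreover have "(norm z)\<^sup>2 \<le> 1" using assms by (simp add: abs_square_le_1)
        ultimately show "(norm ?h)\<^sup>2 * (norm z)\<^sup>2 \<le> (1 / 4 ^ j) * (real CARD('n))\<^sup>2"
          using mult_mono[of "(norm ?h)\<^sup>2" _ "(norm z)\<^sup>2" 1] by fastforce
      qed
      finally have "4 ^ j * (\<Sum>k<K. layer_incr ?v k ?h) \<le> 4 ^ j * ennreal ((1 / 4 ^ j) * (real CARD('n))\<^sup>2)"
        by (rule mult_left_mono) simp
      also have "\<dots> = ennreal (4 ^ j) * ennreal ((1 / 4 ^ j) * (real CARD('n))\<^sup>2)"
        by (simp add: ennreal_power[symmetric])
      also have "\<dots> = ennreal ((real CARD('n))\<^sup>2)"
        by (subst ennreal_mult[symmetric]) simp_all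
      finally show ?thesis using True by simp
    qed simp
  qed
  also have "\<dots> = ennreal ((real CARD('n))\<^sup>2)"
    by (subst nn_integral_cmult_indicator) (auto simp: emeasure_unit_cube)
  finally show ?thesis .
qed

section \<open>Measures of superlevel sets\<close>

definition superlevel :: "('a \<Rightarrow> real) \<Rightarrow> nat \<Rightarrow> 'a set" where
  "superlevel v k = {x. \<bar>v x\<bar> > 2 ^ k}"

lemma sets_superlevel [measurable]:
  "v \<in> borel_measurable borel \<Longrightarrow> superlevel v k \<in> sets borel"
  unfolding superlevel_def by measurable

lemma ennreal_half_le:
  fixes X Y :: ennreal
  assumes "2 * Y \<le> 1" "1 \<le> X + Y"
  shows "ennreal (1 / 2) \<le> X"
proof (cases X)
  case (real x)
  have "Y < top" using assms(1) by (cases Y) (auto simp: ennreal_mult_top top_unique)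
  then obtain y where y: "Y = ennreal y" "y \<ge> 0" by (cases Y) auto
  have "ennreal (2 * y) \<le> ennreal 1" using assms(1) y by (simp add: ennreal_mult)
  then have "2 * y \<le> 1" by (subst (asm) ennreal_le_iff) auto
  moreover have "ennreal 1 \<le> ennreal (x + y)" using assms(2) real y by (simp add: ennreal_plus)
  then have "1 \<le> x + y" using real y by (subst (asm) ennreal_le_iff) auto
  ultimately have "1 / 2 \<le> x" by linarith
  then show ?thesis unfolding real by (rule ennreal_leI)
qed simp

text \<open>From a point of \<open>superlevel v (Suc k)\<close>, the layer drops by \<open>2^k\<close> on at least half of the cube of
  side \<open>2^(-j)\<close>.\<close>

lemma superlevel_le_scaled_incr:
  fixes v :: "real^'n \<Rightarrow> real"
  assumes v [measurable]: "v \<in> borel_measurable borel"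
    and small: "2 * emeasure lborel (superlevel v k) \<le> ennreal ((1 / 2 ^ j) ^ CARD('n))"
  shows "ennreal (4 ^ k / 2) * (4 ^ j * emeasure lborel (superlevel v (Suc k))) \<le> scaled_incr v k j"
proof -
  let ?c = "1 / 2 ^ j :: real"
  \<comment> \<open>In rescaled coordinates the part of the cube that falls into
    \<open>superlevel v k\<close> has measure at most 1/2, by \<open>small\<close>.\<close>
  have good: "ennreal (1 / 2) \<le> emeasure lborel {z \<in> unit_cube. \<bar>v (x + ?c *\<^sub>R z)\<bar> \<le> 2 ^ k}" for x
  proof -
    let ?G = "{z \<in> unit_cube. \<bar>v (x + ?c *\<^sub>R z)\<bar> \<le> 2 ^ k}" and ?B = "{z. x + ?c *\<^sub>R z \<in> superlevel v k}"
    have [measurable]: "?G \<in> sets borel" by measurable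
    have Bm [measurable]: "?B \<in> sets borel" unfolding superlevel_def by simp
    have c: "?c ^ CARD('n) > 0" by simp
    have "emeasure lborel (superlevel v k) = ennreal (?c ^ CARD('n)) * emeasure lborel ?B"
      using emeasure_lborel_affine[of ?c "superlevel v k" x] by simp
    then have "ennreal (?c ^ CARD('n)) * (2 * emeasure lborel ?B) \<le> ennreal (?c ^ CARD('n)) * 1"
      using small by (simp add: mult.left_commute)
    then have "2 * emeasure lborel ?B \<le> 1"
      using c by (subst (asm) ennreal_mult_le_mult_iff) auto
    moreover have "1 \<le> emeasure lborel ?G + emeasure lborel ?B"
    proof -
      have "1 = emeasure lborel (unit_cube :: (real^'n) set)" by (simp add: emeasure_unit_cube)
      also have "\<dots> \<le> emeasure lborel (?G \<union> ?B)"
        by (intro emeasure_mono) (auto simp: superlevel_def)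
      also have "\<dots> \<le> emeasure lborel ?G + emeasure lborel ?B"
        by (rule emeasure_subadditive) auto
      finally show ?thesis .
    qed
    ultimately show ?thesis by (rule ennreal_half_le)
  qed
  have "ennreal (4 ^ k / 2) * emeasure lborel (superlevel v (Suc k))
      = (\<integral>\<^sup>+x. ennreal (4 ^ k / 2) * indicator (superlevel v (Suc k)) x \<partial>lborel)"
    by (rule nn_integral_cmult_indicator[symmetric]) simp
  also have "\<dots> \<le> (\<integral>\<^sup>+x. (\<integral>\<^sup>+z. indicator unit_cube z * ennreal ((layer k (v (x + ?c *\<^sub>R z)) - layer k (v x))\<^sup>2) \<partial>lborel) \<partial>lborel)"
  proof (intro nn_integral_mono)
    fix x
    show "ennreal (4 ^ k / 2) * indicator (superlevel v (Suc k)) x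
        \<le> (\<integral>\<^sup>+z. indicator unit_cube z * ennreal ((layer k (v (x + ?c *\<^sub>R z)) - layer k (v x))\<^sup>2) \<partial>lborel)"
    proof (cases "x \<in> superlevel v (Suc k)")
      case True
      then have lx: "layer k (v x) = 2 ^ k" by (simp add: superlevel_def layer_def)
      let ?G = "{z \<in> unit_cube. \<bar>v (x + ?c *\<^sub>R z)\<bar> \<le> 2 ^ k}"
      have Gm: "?G \<in> sets lborel" by simp
      have p4: "((2::real) ^ k)\<^sup>2 = 4 ^ k" by (simp add: power_mult[symmetric] mult.commute[of k] power_mult)
      have "ennreal (4 ^ k / 2) = ennreal (4 ^ k) * ennreal (1 / 2)"
        by (subst ennreal_mult[symmetric]) simp_all
      also have "\<dots> \<le> ennreal (4 ^ k) * emeasure lborel ?G" by (intro mult_left_mono good) simp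
      also have "\<dots> = (\<integral>\<^sup>+z. ennreal (4 ^ k) * indicator ?G z \<partial>lborel)"
        by (rule nn_integral_cmult_indicator[OF Gm, symmetric])
      also have "\<dots> \<le> (\<integral>\<^sup>+z. indicator unit_cube z * ennreal ((layer k (v (x + ?c *\<^sub>R z)) - layer k (v x))\<^sup>2) \<partial>lborel)"
        unfolding lx by (intro nn_integral_mono) (auto simp: indicator_def layer_def p4)
      finally show ?thesis using True by simp
    qed simp
  qed
  also have "\<dots> = (\<integral>\<^sup>+z. (\<integral>\<^sup>+x. indicator unit_cube z * ennreal ((layer k (v (x + ?c *\<^sub>R z)) - layer k (v x))\<^sup>2) \<partial>lborel) \<partial>lborel)"
    by (rule lborel_pair.Fubini'[symmetric]) simp
  also have "\<dots> = (\<integral>\<^sup>+z. indicator unit_cube z * layer_incr v k (?c *\<^sub>R z) \<partial>lborel)"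
    unfolding layer_incr_def by (simp add: nn_integral_cmult)
  finally have "4 ^ j * (ennreal (4 ^ k / 2) * emeasure lborel (superlevel v (Suc k)))
      \<le> 4 ^ j * (\<integral>\<^sup>+z. indicator unit_cube z * layer_incr v k (?c *\<^sub>R z) \<partial>lborel)"
    by (rule mult_left_mono) simp
  also have "\<dots> = scaled_incr v k j"
    unfolding scaled_incr_def by (subst nn_integral_cmult[symmetric]) (simp_all add: mult.left_commute)
  finally show ?thesis by (simp add: mult.left_commute)
qed

lemma dyadic_scale_exists:
  fixes a b :: real
  assumes "0 < a" "a \<le> 1" "0 < b" "b < 1"
  obtains j where "a \<le> b ^ j" "b ^ Suc j < a"
proof -
  define m where "m = (LEAST m. b ^ m < a)"
  have "\<exists>m. b ^ m < a" using real_arch_pow_inv[OF assms(1,4)] by blast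
  then have m: "b ^ m < a" unfolding m_def by (rule LeastI_ex)
  then have "m \<noteq> 0" using assms by (intro notI) auto
  then obtain j where j: "m = Suc j" by (cases m) auto
  have "\<not> b ^ j < a" using not_less_Least[of j "\<lambda>m. b ^ m < a"] j by (simp add: m_def)
  then show thesis using that[of j] m j by simp
qed

text \<open>The common scale depends on \<open>K\<close>, so \<open>e\<close> is provided anew for
  each \<open>K\<close>, but the bound on its sum is the same for all. The exponent
  \<open>2 / CARD('n)\<close> appears because the squared side of a cube is that power of its
  volume; the factor \<open>2 * 2 ^ CARD('n)\<close> in \<open>C\<close> compares this volume with
  \<open>\<alpha> k\<close>.\<close>

lemma superlevel_recursion:
  fixes z :: "'n::finite H1"
  defines "\<alpha> \<equiv> \<lambda>k. measure lborel (superlevel (rep_H1 z) k)"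
    and "C \<equiv> 2 * (2 * 2 ^ CARD('n)) powr (2 / real CARD('n))"
  assumes z: "norm z \<le> 1"
  shows "emeasure lborel (superlevel (rep_H1 z) k) = ennreal (\<alpha> k)"
    and "\<alpha> k \<le> 1 / 4 ^ k"
    and "\<exists>e. (\<forall>k. e k \<ge> 0) \<and> (\<Sum>k<K. e k) \<le> (real CARD('n))\<^sup>2 \<and>
      (\<forall>k. 1 \<le> k \<and> k < K \<longrightarrow> 4 ^ k * \<alpha> (Suc k) \<le> C * \<alpha> k powr (2 / real CARD('n)) * e k)"
proof -
  let ?v = "rep_H1 z" and ?N = "real CARD('n)"
  \<comment> \<open>Chebyshev's inequality in L2.\<close>
  have em: "emeasure lborel (superlevel ?v k) \<le> ennreal (1 / 4 ^ k)" for k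
  proof -
    have p4: "((2::real) ^ k)\<^sup>2 = 4 ^ k" by (simp add: power_mult[symmetric] mult.commute[of k] power_mult)
    have "ennreal (4 ^ k) * emeasure lborel (superlevel ?v k) = (\<integral>\<^sup>+x. ennreal (4 ^ k) * indicator (superlevel ?v k) x \<partial>lborel)"
      by (rule nn_integral_cmult_indicator[symmetric]) simp
    also have "\<dots> \<le> (\<integral>\<^sup>+x. ennreal ((?v x)\<^sup>2) \<partial>lborel)"
    proof (intro nn_integral_mono)
      fix x
      have "4 ^ k \<le> (?v x)\<^sup>2" if "2 ^ k < \<bar>?v x\<bar>"
        using that power_mono[of "2 ^ k" "\<bar>?v x\<bar>" 2] by (simp add: p4)
      then show "ennreal (4 ^ k) * indicator (superlevel ?v k) x \<le> ennreal ((?v x)\<^sup>2)"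
        by (auto simp: indicator_def superlevel_def intro!: ennreal_leI)
    qed
    also have "\<dots> \<le> ennreal 1"
      unfolding L2_nn_integral[OF L2_rep] using z
      by (intro ennreal_leI order_trans[OF integral_rep_squared_le]) (simp add: abs_square_le_1)
    finally have "ennreal (4 ^ k) * emeasure lborel (superlevel ?v k) \<le> ennreal (4 ^ k) * ennreal (1 / 4 ^ k)"
      by (subst ennreal_mult[symmetric]) simp_all
    then show ?thesis by (subst (asm) ennreal_mult_le_mult_iff) auto
  qed
  have fin: "emeasure lborel (superlevel ?v k) = ennreal (\<alpha> k)" for k
    unfolding \<alpha>_def using order_le_less_trans[OF em[of k] ennreal_less_top] by (intro emeasure_eq_ennreal_measure) auto
  then show "emeasure lborel (superlevel ?v k) = ennreal (\<alpha> k)" .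
  have \<alpha>le: "\<alpha> k \<le> 1 / 4 ^ k" for k using em[of k] unfolding fin by (subst (asm) ennreal_le_iff) auto
  then show "\<alpha> k \<le> 1 / 4 ^ k" .
  have \<alpha>0: "\<alpha> k \<ge> 0" for k by (simp add: \<alpha>_def)
  have N: "?N > 0" by simp
  \<comment> \<open>The smallest dyadic cube with volume at least \<open>2 * \<alpha> k\<close>: the
    lower bound serves the half-cube argument, the upper one expresses the side through
    \<open>\<alpha> k\<close>. For \<open>k = 0\<close> the measure may exceed 1/2, and no cube of
    side at most 1 would do; for \<open>\<alpha> k = 0\<close> any scale is fine.\<close>
  have "\<exists>j. 2 * \<alpha> k \<le> (1 / 2 ^ j) ^ CARD('n) \<and> (\<alpha> k > 0 \<longrightarrow> (1 / 2 ^ Suc j) ^ CARD('n) < 2 * \<alpha> k)" if "1 \<le> k" for k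
  proof (cases "\<alpha> k > 0")
    case True
    have "(4::real) ^ 1 \<le> 4 ^ k" using that by (intro power_increasing) auto
    then have "1 / 4 ^ k \<le> 1 / (4::real)" by (intro divide_left_mono) auto
    then have "2 * \<alpha> k \<le> 1" using \<alpha>le[of k] by linarith
    moreover have "(1 / 2 :: real) ^ CARD('n) < 1" by (subst power_less_one_iff) auto
    ultimately obtain j where "2 * \<alpha> k \<le> ((1 / 2) ^ CARD('n)) ^ j" "((1 / 2) ^ CARD('n)) ^ Suc j < 2 * \<alpha> k"
      using dyadic_scale_exists[of "2 * \<alpha> k" "(1 / 2) ^ CARD('n)"] True by auto
    then show ?thesis
      by (intro exI[of _ j]) (simp only: power_mult[symmetric] mult.commute[of "CARD('n)"] power_one_over[symmetric], simp)
  next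
    case False
    then show ?thesis using \<alpha>0[of k] by (intro exI[of _ 0]) auto
  qed
  then obtain j where j: "\<And>k. 1 \<le> k \<Longrightarrow> 2 * \<alpha> k \<le> (1 / 2 ^ j k) ^ CARD('n)"
      "\<And>k. 1 \<le> k \<Longrightarrow> \<alpha> k > 0 \<Longrightarrow> (1 / 2 ^ Suc (j k)) ^ CARD('n) < 2 * \<alpha> k" by metis
  \<comment> \<open>Just a common upper bound of the scales \<open>j k\<close> with
    \<open>k < K\<close>.\<close>
  define J where "J = (\<Sum>k<K. j k)"
  define e where "e k = (if k < K then enn2real (scaled_incr ?v k J) else 0)" for k
  have sumE: "(\<Sum>k<K. scaled_incr ?v k J) \<le> ennreal (?N\<^sup>2)" by (rule sum_scaled_incr[OF z])
  have Efin: "scaled_incr ?v k J = ennreal (e k)" if "k < K" for k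
  proof -
    have "scaled_incr ?v k J \<le> (\<Sum>k<K. scaled_incr ?v k J)" using that by (intro member_le_sum) auto
    then have "scaled_incr ?v k J < top" using sumE by (meson ennreal_less_top order_le_less_trans)
    then show ?thesis using that by (simp add: e_def)
  qed
  have e0: "e k \<ge> 0" for k by (simp add: e_def)
  have "ennreal (\<Sum>k<K. e k) = (\<Sum>k<K. scaled_incr ?v k J)"
  proof -
    have "ennreal (\<Sum>k<K. e k) = (\<Sum>k<K. ennreal (e k))" using e0 by simp
    also have "\<dots> = (\<Sum>k<K. scaled_incr ?v k J)" by (intro sum.cong) (simp_all add: Efin)
    finally show ?thesis .
  qed
  then have es: "(\<Sum>k<K. e k) \<le> ?N\<^sup>2" using sumE by (metis ennreal_le_iff zero_le_power2)
  have rec: "4 ^ k * \<alpha> (Suc k) \<le> C * \<alpha> k powr (2 / ?N) * e k" if k: "1 \<le> k" "k < K" for k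
  proof (cases "\<alpha> k > 0")
    case False
    have "emeasure lborel (superlevel ?v (Suc k)) \<le> emeasure lborel (superlevel ?v k)"
    proof (rule emeasure_mono)
      have "(2::real) ^ k \<le> 2 ^ Suc k" by simp
      then show "superlevel ?v (Suc k) \<subseteq> superlevel ?v k"
        unfolding superlevel_def using order_le_less_trans by blast
    qed simp
    then have "\<alpha> (Suc k) \<le> 0" unfolding fin using False \<alpha>0[of k] by (simp add: ennreal_le_iff2)
    then show ?thesis using False \<alpha>0[of "Suc k"] \<alpha>0[of k] by simp
  next
    case True
    have jJ: "j k \<le> J" unfolding J_def using k by (intro member_le_sum) auto
    have "ennreal (4 ^ k / 2) * (4 ^ j k * emeasure lborel (superlevel ?v (Suc k))) \<le> scaled_incr ?v k (j k)"
    proof (rule superlevel_le_scaled_incr)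
      show "2 * emeasure lborel (superlevel ?v k) \<le> ennreal ((1 / 2 ^ j k) ^ CARD('n))"
        unfolding fin using ennreal_leI[OF j(1)[OF k(1)]] \<alpha>0[of k] by (simp add: ennreal_mult)
    qed simp
    also have "\<dots> \<le> scaled_incr ?v k J" by (rule scaled_incr_mono[OF _ jJ]) simp
    also have "\<dots> = ennreal (e k)" by (rule Efin[OF k(2)])
    also have "ennreal (4 ^ k / 2) * (4 ^ j k * emeasure lborel (superlevel ?v (Suc k)))
        = ennreal (4 ^ k / 2 * (4 ^ j k * \<alpha> (Suc k)))"
    proof -
      have "(4::ennreal) ^ j k = ennreal (4 ^ j k)" by (simp add: ennreal_power[symmetric])
      then show ?thesis unfolding fin using \<alpha>0[of "Suc k"] by (simp only: ennreal_mult[symmetric]) (simp add: ennreal_mult[symmetric])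
    qed
    finally have 1: "4 ^ k / 2 * (4 ^ j k * \<alpha> (Suc k)) \<le> e k" using e0 by (subst (asm) ennreal_le_iff) auto
    \<comment> \<open>The cube of half the side has volume below \<open>2 * \<alpha> k\<close>;
      raising this comparison to the power \<open>2 / ?N\<close> bounds the squared side.\<close>
    have 2: "1 / 4 ^ j k \<le> (2 * 2 ^ CARD('n) * \<alpha> k) powr (2 / ?N)"
    proof -
      have "(1 / 2 ^ j k :: real) ^ CARD('n) = 2 ^ CARD('n) * (1 / 2 ^ Suc (j k)) ^ CARD('n)"
        by (simp add: power_mult_distrib[symmetric])
      also have "\<dots> \<le> 2 ^ CARD('n) * (2 * \<alpha> k)"
        using j(2)[OF k(1) True] by (intro mult_left_mono) auto
      finally have "((1 / 2 ^ j k :: real) ^ CARD('n)) powr (2 / ?N) \<le> (2 * 2 ^ CARD('n) * \<alpha> k) powr (2 / ?N)"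
        by (intro powr_mono2) (auto simp: mult_ac)
      moreover have "((1 / 2 ^ j k :: real) ^ CARD('n)) powr (2 / ?N) = 1 / 4 ^ j k"
      proof -
        have "((1 / 2 ^ j k :: real) ^ CARD('n)) powr (2 / ?N) = (1 / 2 ^ j k) powr (?N * (2 / ?N))"
          by (subst powr_realpow[symmetric]) (simp_all add: powr_powr)
        also have "\<dots> = (1 / 2 ^ j k) powr (real 2)" by simp
        also have "\<dots> = (1 / 2 ^ j k)\<^sup>2" by (subst powr_realpow) simp_all
        also have "\<dots> = 1 / 4 ^ j k" by (simp add: power_divide power_mult[symmetric] mult.commute[of "j k"] power_mult)
        finally show ?thesis .
      qed
      ultimately show ?thesis by simp
    qed
    have "4 ^ k * \<alpha> (Suc k) = 2 * (1 / 4 ^ j k) * (4 ^ k / 2 * (4 ^ j k * \<alpha> (Suc k)))" by simp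
    also have "\<dots> \<le> 2 * (2 * 2 ^ CARD('n) * \<alpha> k) powr (2 / ?N) * e k"
      using 1 2 e0 \<alpha>0 by (intro mult_mono) auto
    also have "\<dots> = C * \<alpha> k powr (2 / ?N) * e k"
      using \<alpha>0[of k] by (simp add: C_def powr_mult)
    finally show ?thesis .
  qed
  show "\<exists>e. (\<forall>k. e k \<ge> 0) \<and> (\<Sum>k<K. e k) \<le> ?N\<^sup>2 \<and>
      (\<forall>k. 1 \<le> k \<and> k < K \<longrightarrow> 4 ^ k * \<alpha> (Suc k) \<le> C * \<alpha> k powr (2 / ?N) * e k)"
    using e0 es rec by blast
qed

text \<open>Since \<open>\<theta> < 1\<close>, some \<open>S\<close> satisfies
  \<open>C * M * S powr \<theta> \<le> S\<close>. With \<open>e k \<le> M\<close> this keeps every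
  \<open>A k\<close> below \<open>S\<close>; inserting that bound once more, the summability of
  \<open>e\<close> controls the sum and not only the terms.\<close>

lemma sublinear_recursion_bound:
  fixes A :: "nat \<Rightarrow> real"
  assumes \<theta>: "0 < \<theta>" "\<theta> < 1" and C: "C > 0" and M: "M > 0" and a0: "a0 > 0"
    and A: "\<And>k. A k \<ge> 0" "A 1 \<le> a0"
    and rec: "\<And>K. \<exists>e. (\<forall>k. e k \<ge> 0) \<and> (\<Sum>k<K. e k) \<le> M \<and>
      (\<forall>k. 1 \<le> k \<and> k < K \<longrightarrow> A (Suc k) \<le> C * A k powr \<theta> * e k)"
  shows "(\<Sum>k<K. A (Suc k)) \<le> 2 * max a0 ((C * M) powr (1 / (1 - \<theta>)))"
proof -
  define S where "S = max a0 ((C * M) powr (1 / (1 - \<theta>)))"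
  have S: "S > 0" "a0 \<le> S" using a0 by (auto simp: S_def)
  have CS: "C * M * S powr \<theta> \<le> S"
  proof -
    have "C * M = ((C * M) powr (1 / (1 - \<theta>))) powr (1 - \<theta>)"
      using \<theta> C M by (simp add: powr_powr)
    also have "\<dots> \<le> S powr (1 - \<theta>)" using \<theta> by (intro powr_mono2) (auto simp: S_def)
    finally have "C * M * S powr \<theta> \<le> S powr (1 - \<theta>) * S powr \<theta>" by (rule mult_right_mono) simp
    also have "\<dots> = S" using S by (simp add: powr_add[symmetric])
    finally show ?thesis .
  qed
  obtain e where e: "\<And>k. e k \<ge> 0" "(\<Sum>k<Suc K. e k) \<le> M"
      "\<And>k. 1 \<le> k \<Longrightarrow> k < Suc K \<Longrightarrow> A (Suc k) \<le> C * A k powr \<theta> * e k"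
    using rec[of "Suc K"] by auto
  have AS: "A k \<le> S" if "1 \<le> k" "k \<le> Suc K" for k
    using that
  proof (induction k rule: nat_induct_at_least)
    case base
    then show ?case using A(2) S by simp
  next
    case (Suc k)
    then have k: "1 \<le> k" "k < Suc K" by auto
    have "e k \<le> M" using e(1) member_le_sum[of k "{..<Suc K}" e] e(2) k by simp
    have "A (Suc k) \<le> C * A k powr \<theta> * e k" by (rule e(3)[OF k])
    also have "\<dots> \<le> C * S powr \<theta> * M"
      using Suc k A(1) C \<theta> e(1) \<open>e k \<le> M\<close> by (intro mult_mono mult_left_mono powr_mono2) auto
    finally show ?case using CS by (simp add: mult_ac)
  qed
  have "(\<Sum>k<K. A (Suc (Suc k))) \<le> (\<Sum>k<K. C * S powr \<theta> * e (Suc k))"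
  proof (rule sum_mono)
    fix k assume "k \<in> {..<K}"
    then have k: "1 \<le> Suc k" "Suc k < Suc K" by auto
    have "A (Suc (Suc k)) \<le> C * A (Suc k) powr \<theta> * e (Suc k)" by (rule e(3)[OF k])
    also have "\<dots> \<le> C * S powr \<theta> * e (Suc k)"
      using AS[of "Suc k"] k A(1) C \<theta> e(1) by (intro mult_right_mono mult_left_mono powr_mono2) auto
    finally show "A (Suc (Suc k)) \<le> C * S powr \<theta> * e (Suc k)" .
  qed
  also have "\<dots> = C * S powr \<theta> * (\<Sum>k<K. e (Suc k))" by (simp add: sum_distrib_left)
  also have "\<dots> \<le> C * S powr \<theta> * M"
  proof (rule mult_left_mono)
    have "(\<Sum>k<Suc K. e k) = e 0 + (\<Sum>k<K. e (Suc k))" by (rule sum.lessThan_Suc_shift)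
    then show "(\<Sum>k<K. e (Suc k)) \<le> M" using e(1)[of 0] e(2) by linarith
  qed (use C in simp)
  finally have 1: "(\<Sum>k<K. A (Suc (Suc k))) \<le> S" using CS by (simp add: mult_ac)
  have "(\<Sum>k<K. A (Suc k)) \<le> (\<Sum>k<Suc K. A (Suc k))" using A(1) by simp
  also have "\<dots> = A 1 + (\<Sum>k<K. A (Suc (Suc k)))" by (subst sum.lessThan_Suc_shift) simp
  also have "\<dots> \<le> 2 * S" using 1 A(2) S by linarith
  finally show ?thesis by (simp add: S_def)
qed

text \<open>The critical Sobolev exponent; one less is the growth exponent
  \<open>(N + 2) / (N - 2)\<close> of the theorem.\<close>

definition crit_exp :: "'n itself \<Rightarrow> real" where
  "crit_exp _ = 2 * real CARD('n) / (real CARD('n) - 2)"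

theorem Sobolev_unit_ball:
  assumes N: "CARD('n::finite) \<ge> 3"
  obtains S where "S > 0"
    "\<And>z::'n H1. norm z \<le> 1 \<Longrightarrow> (\<integral>\<^sup>+x. ennreal (\<bar>rep_H1 z x\<bar> powr crit_exp TYPE('n)) \<partial>lborel) \<le> ennreal S"
proof -
  let ?N = "real CARD('n)"
  define p where "p = crit_exp TYPE('n)"
  define \<theta> where "\<theta> = 2 / ?N"
  have N3: "?N \<ge> 3" using N by simp
  have \<theta>: "0 < \<theta>" "\<theta> < 1" using N3 by (auto simp: \<theta>_def)
  \<comment> \<open>This identity characterises the critical exponent: with the weights
    \<open>2 powr (p * real k)\<close> the recursion for the measures loses its explicit dependence
    on \<open>k\<close>.\<close>
  have p2: "p - 2 = p * \<theta>" "p > 2"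
    using N3 by (auto simp: p_def crit_exp_def \<theta>_def field_simps)
  define C where "C = 2 powr p * (2 * (2 * 2 ^ CARD('n)) powr \<theta>)"
  have C: "C > 0" by (simp add: C_def)
  define T where "T = 2 * max (2 powr p) ((C * ?N\<^sup>2) powr (1 / (1 - \<theta>)))"
  have T: "T > 0" by (simp add: T_def less_max_iff_disj)
  \<comment> \<open>The first summand comes from the points with
    \<open>\<bar>?v x\<bar> \<le> 2\<close>, controlled by L2, the second from the dyadic shells
    above.\<close>
  define S where "S = 2 powr (p - 2) + 2 powr p * T"
  show thesis
  proof (rule that[of S])
    show "S > 0" using T by (simp add: S_def add_pos_pos)
    fix z :: "'n H1" assume z: "norm z \<le> 1"
    let ?v = "rep_H1 z"
    define \<alpha> where "\<alpha> k = measure lborel (superlevel ?v k)" for k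
    define A where "A k = 2 powr (p * real k) * \<alpha> k" for k
    note sr = superlevel_recursion[OF z, folded \<alpha>_def]
    have \<alpha>0: "\<alpha> k \<ge> 0" for k by (simp add: \<alpha>_def)
    have A_sum: "(\<Sum>k<K. A (Suc k)) \<le> T" for K
      unfolding T_def
    proof (rule sublinear_recursion_bound[OF \<theta> C])
      show "A k \<ge> 0" for k using \<alpha>0 by (simp add: A_def)
      show "A 1 \<le> 2 powr p"
        using sr(2)[of 1] \<alpha>0[of 1] by (simp add: A_def mult_left_le)
      fix K
      obtain e where e: "\<And>k. e k \<ge> 0" "(\<Sum>k<K. e k) \<le> ?N\<^sup>2"
        and er: "\<And>k. 1 \<le> k \<Longrightarrow> k < K \<Longrightarrow> 4 ^ k * \<alpha> (Suc k) \<le> 2 * (2 * 2 ^ CARD('n)) powr \<theta> * \<alpha> k powr \<theta> * e k"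
        using sr(3)[of K] unfolding \<theta>_def by blast
      have "A (Suc k) \<le> C * A k powr \<theta> * e k" if k: "1 \<le> k" "k < K" for k
      proof -
        have p4: "(4::real) ^ k = 2 powr (2 * real k)"
        proof -
          have "(4::real) ^ k = 2 ^ (2 * k)" by (simp add: power_mult)
          also have "\<dots> = 2 powr (real (2 * k))" by (subst powr_realpow) simp_all
          finally show ?thesis by simp
        qed
        have "A (Suc k) = 2 powr p * 2 powr ((p - 2) * real k) * (4 ^ k * \<alpha> (Suc k))"
          unfolding p4 A_def by (simp add: powr_add[symmetric] mult.assoc[symmetric] algebra_simps)
        also have "\<dots> \<le> 2 powr p * 2 powr ((p - 2) * real k) * (2 * (2 * 2 ^ CARD('n)) powr \<theta> * \<alpha> k powr \<theta> * e k)"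
          by (intro mult_left_mono er k) simp
        also have "\<dots> = C * (2 powr (p * real k * \<theta>) * \<alpha> k powr \<theta>) * e k"
          by (simp add: C_def p2(1) mult_ac)
        also have "2 powr (p * real k * \<theta>) * \<alpha> k powr \<theta> = A k powr \<theta>"
          using \<alpha>0[of k] by (simp add: A_def powr_mult powr_powr)
        finally show ?thesis .
      qed
      then show "\<exists>e. (\<forall>k. e k \<ge> 0) \<and> (\<Sum>k<K. e k) \<le> ?N\<^sup>2 \<and> (\<forall>k. 1 \<le> k \<and> k < K \<longrightarrow> A (Suc k) \<le> C * A k powr \<theta> * e k)"
        using e by blast
    qed (use N3 in auto)
    have "(\<integral>\<^sup>+x. ennreal (\<bar>?v x\<bar> powr p) \<partial>lborel)
        \<le> (\<integral>\<^sup>+x. ennreal (2 powr (p - 2)) * ennreal ((?v x)\<^sup>2)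
            + (\<Sum>k. ennreal (2 powr (p * real (k + 2))) * indicator (superlevel ?v (Suc k)) x) \<partial>lborel)"
    proof (intro nn_integral_mono)
      fix x
      show "ennreal (\<bar>?v x\<bar> powr p) \<le> ennreal (2 powr (p - 2)) * ennreal ((?v x)\<^sup>2)
            + (\<Sum>k. ennreal (2 powr (p * real (k + 2))) * indicator (superlevel ?v (Suc k)) x)"
      proof (cases "\<bar>?v x\<bar> \<le> 2")
        case True
        have "\<bar>?v x\<bar> powr p = \<bar>?v x\<bar> powr ((p - 2) + 2)" by simp
        also have "\<dots> = \<bar>?v x\<bar> powr (p - 2) * \<bar>?v x\<bar> powr 2" by (rule powr_add)
        also have "\<bar>?v x\<bar> powr 2 = (?v x)\<^sup>2" by (cases "?v x = 0") (simp_all add: powr_numeral)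
        also have "\<bar>?v x\<bar> powr (p - 2) * (?v x)\<^sup>2 \<le> 2 powr (p - 2) * (?v x)\<^sup>2"
          using True p2 by (intro mult_right_mono powr_mono2) auto
        finally have "ennreal (\<bar>?v x\<bar> powr p) \<le> ennreal (2 powr (p - 2)) * ennreal ((?v x)\<^sup>2)"
          by (simp add: ennreal_mult[symmetric] ennreal_leI)
        then show ?thesis by (rule order_trans) simp
      next
        case False
        \<comment> \<open>With \<open>m = k + 2\<close> the point lies in
          \<open>superlevel ?v (Suc k)\<close> and contributes at most
          \<open>2 powr (p * real (k + 2))\<close>, one factor \<open>2 powr p\<close> more than the
          weight in \<open>A (Suc k)\<close>.\<close>
        define m where "m = (LEAST m. \<bar>?v x\<bar> \<le> 2 ^ m)"
        have "\<exists>m. \<bar>?v x\<bar> \<le> 2 ^ m"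
          using real_arch_pow[of 2 "\<bar>?v x\<bar>"] by (auto intro: less_imp_le)
        then have m: "\<bar>?v x\<bar> \<le> 2 ^ m" unfolding m_def by (rule LeastI_ex)
        have "m \<noteq> 0" "m \<noteq> 1" by (rule notI, use m False in simp)+
        then obtain k where k: "m = k + 2" by (metis One_nat_def add_2_eq_Suc' not0_implies_Suc)
        have "\<not> \<bar>?v x\<bar> \<le> 2 ^ (Suc k)" using not_less_Least[of "Suc k" "\<lambda>m. \<bar>?v x\<bar> \<le> 2 ^ m"] k by (simp add: m_def)
        then have x: "x \<in> superlevel ?v (Suc k)" by (simp add: superlevel_def)
        have "\<bar>?v x\<bar> powr p \<le> (2 ^ m) powr p" using m p2 by (intro powr_mono2) auto
        also have "\<dots> = 2 powr (p * real (k + 2))"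
          unfolding k by (subst powr_realpow[symmetric]) (simp_all add: powr_powr mult.commute)
        finally have "ennreal (\<bar>?v x\<bar> powr p) \<le> ennreal (2 powr (p * real (k + 2))) * indicator (superlevel ?v (Suc k)) x"
          using x by (simp add: ennreal_leI)
        also have "\<dots> \<le> (\<Sum>k. ennreal (2 powr (p * real (k + 2))) * indicator (superlevel ?v (Suc k)) x)"
        proof -
          have "F k \<le> (\<Sum>k. F k)" for F :: "nat \<Rightarrow> ennreal"
            using sum_le_suminf[of F "{k}"] by (simp add: summableI)
          then show ?thesis .
        qed
        finally show ?thesis by (rule order_trans) simp
      qed
    qed
    also have "\<dots> = ennreal (2 powr (p - 2)) * (\<integral>\<^sup>+x. ennreal ((?v x)\<^sup>2) \<partial>lborel)
        + (\<Sum>k. ennreal (2 powr (p * real (k + 2))) * emeasure lborel (superlevel ?v (Suc k)))"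
      by (simp add: nn_integral_add nn_integral_cmult nn_integral_suminf nn_integral_cmult_indicator)
    also have "\<dots> \<le> ennreal (2 powr (p - 2)) * 1 + ennreal (2 powr p * T)"
    proof (intro add_mono mult_left_mono)
      show "(\<integral>\<^sup>+x. ennreal ((?v x)\<^sup>2) \<partial>lborel) \<le> 1"
        unfolding L2_nn_integral[OF L2_rep] ennreal_1[symmetric] using z
        by (intro ennreal_leI order_trans[OF integral_rep_squared_le]) (simp add: abs_square_le_1)
      show "(\<Sum>k. ennreal (2 powr (p * real (k + 2))) * emeasure lborel (superlevel ?v (Suc k))) \<le> ennreal (2 powr p * T)"
      proof (rule suminf_le_const)
        fix K
        have "(\<Sum>k<K. ennreal (2 powr (p * real (k + 2))) * emeasure lborel (superlevel ?v (Suc k)))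
            = (\<Sum>k<K. ennreal (2 powr p * A (Suc k)))"
        proof (rule sum.cong[OF refl])
          fix k
          have "2 powr (p * real (k + 2)) * \<alpha> (Suc k) = 2 powr p * A (Suc k)"
            by (simp add: A_def powr_add[symmetric] mult.assoc[symmetric] algebra_simps)
          then show "ennreal (2 powr (p * real (k + 2))) * emeasure lborel (superlevel ?v (Suc k)) = ennreal (2 powr p * A (Suc k))"
            using \<alpha>0 by (simp add: sr(1) ennreal_mult[symmetric])
        qed
        also have "\<dots> = ennreal (2 powr p * (\<Sum>k<K. A (Suc k)))"
          using \<alpha>0 by (simp add: sum_ennreal A_def sum_distrib_left)
        also have "\<dots> \<le> ennreal (2 powr p * T)" by (intro ennreal_leI mult_left_mono A_sum) simp
        finally show "(\<Sum>k<K. ennreal (2 powr (p * real (k + 2))) * emeasure lborel (superlevel ?v (Suc k))) \<le> ennreal (2 powr p * T)" .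
      qed (rule summableI)
    qed simp
    also have "\<dots> = ennreal S" using T by (simp add: S_def ennreal_plus)
    finally show "(\<integral>\<^sup>+x. ennreal (\<bar>?v x\<bar> powr crit_exp TYPE('n)) \<partial>lborel) \<le> ennreal S" by (simp add: p_def)
  qed
qed

section \<open>The energy functional\<close>

lemma powr_add_le:
  fixes x y p :: real
  assumes "0 \<le> x" "0 \<le> y" "0 < p"
  shows "(x + y) powr p \<le> 2 powr p * (x powr p + y powr p)"
proof -
  have "(x + y) powr p \<le> (2 * max x y) powr p" using assms by (intro powr_mono2) auto
  also have "\<dots> = 2 powr p * (max x y) powr p" using assms by (simp add: powr_mult)
  also have "\<dots> \<le> 2 powr p * (x powr p + y powr p)"
    by (intro mult_left_mono) (auto simp: max_def)
  finally show ?thesis .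
qed

lemma powr_minus_one_mult:
  fixes a p :: real
  assumes "0 \<le> a"
  shows "a powr (p - 1) * a = a powr p"
proof -
  have "a powr p = a powr ((p - 1) + 1)" by simp
  also have "\<dots> = a powr (p - 1) * a powr 1" by (rule powr_add)
  finally show ?thesis using assms by simp
qed

text \<open>A crude stand-in for Young's inequality with the exponents \<open>p\<close> and
  \<open>p / (p - 1)\<close>: both bases are bounded by the sum.\<close>

lemma powr_mult_le:
  fixes a b p :: real
  assumes "0 \<le> a" "0 \<le> b" "1 < p"
  shows "a powr (p - 1) * b \<le> (a + b) powr p"
proof -
  have "a powr (p - 1) * b \<le> (a + b) powr (p - 1) * (a + b)"
    using assms by (intro mult_mono powr_mono2) auto
  then show ?thesis using assms by (simp add: powr_minus_one_mult)
qed

text \<open>Pairing with a positive L2 weight gives convergence in L1, hence a.e. along a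
  subsequence; the weight is then divided out.\<close>

lemma AE_null_subseq:
  fixes b :: "nat \<Rightarrow> real^'n \<Rightarrow> real"
  assumes b: "\<And>n. L2 (b n)" and lim: "\<And>\<phi>. L2 \<phi> \<Longrightarrow> (\<lambda>n. \<integral>x. \<bar>b n x\<bar> * \<bar>\<phi> x\<bar> \<partial>lborel) \<longlonglongrightarrow> 0"
  obtains s :: "nat \<Rightarrow> nat" where "strict_mono s" "AE x in lborel. (\<lambda>n. b (s n) x) \<longlonglongrightarrow> 0"
proof -
  obtain w :: "real^'n \<Rightarrow> real" where w [measurable]: "w \<in> borel_measurable lborel"
      and w01: "\<And>x. 0 < w x" "\<And>x. w x \<le> 1" and wi: "integrable lborel w"
    using sigma_finite_measure.obtain_positive_integrable_function[OF sigma_finite_lborel] by blast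
  have wL: "L2 w"
    unfolding L2_def
  proof
    show "integrable lborel (\<lambda>x. (norm (w x))\<^sup>2)"
      by (rule Bochner_Integration.integrable_bound[OF wi])
        (use w01 in \<open>auto simp: power2_eq_square mult_left_le less_imp_le\<close>)
  qed simp
  have "\<exists>s :: nat \<Rightarrow> nat. strict_mono s \<and> (AE x in lborel. (\<lambda>n. b (s n) x * w x) \<longlonglongrightarrow> 0)"
  proof (rule tendsto_L1_AE_subseq)
    show "integrable lborel (\<lambda>x. b n x * w x)" for n by (rule L2_mult[OF b wL])
    show "(\<lambda>n. \<integral>x. norm (b n x * w x) \<partial>lborel) \<longlonglongrightarrow> 0" using lim[OF wL] by (simp add: abs_mult)
  qed
  then obtain s :: "nat \<Rightarrow> nat" where s: "strict_mono s" and "AE x in lborel. (\<lambda>n. b (s n) x * w x) \<longlonglongrightarrow> 0" by blast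
  from this(2) have "AE x in lborel. (\<lambda>n. b (s n) x) \<longlonglongrightarrow> 0"
  proof (rule AE_mp, intro AE_I2 impI)
    fix x assume "(\<lambda>n. b (s n) x * w x) \<longlonglongrightarrow> 0"
    from tendsto_divide_zero[OF this, of "w x"] show "(\<lambda>n. b (s n) x) \<longlonglongrightarrow> 0"
      using w01(1)[of x] by simp
  qed
  then show thesis using that s by blast
qed

text \<open>For the energy of the theorem, \<open>f t = t + g t\<close>, so that \<open>F\<close> absorbs the \<open>L\<^sup>2\<close> part of the norm.
  The parameter \<open>N\<close> only fixes the dimension.\<close>

locale critical_problem =
  fixes f F :: "real \<Rightarrow> real" and p m M \<delta> S :: real and N :: "'n::finite itself"
  assumes continuous_f: "continuous_on UNIV f"
    and DERIV_F: "(F has_real_derivative f t) (at t)"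
    and F_0: "F 0 = 0"
    and p: "p > 2"
    and growth: "\<eta> > 0 \<Longrightarrow> \<exists>C\<ge>0. \<forall>t. \<bar>f t\<bar> \<le> C * \<bar>t\<bar> + \<eta> * \<bar>t\<bar> powr (p - 1)"
    and m: "0 < m" "m \<le> 1" and \<delta>: "\<delta> > 0"
    and near_0: "\<bar>t\<bar> \<le> \<delta> \<Longrightarrow> \<exists>c. f t = c * t \<and> \<bar>c\<bar> \<le> M \<and> c \<le> 1 - m"
    and S: "S > 0"
    and Sobolev: "norm (z :: 'n H1) \<le> 1 \<Longrightarrow> (\<integral>\<^sup>+x. ennreal (\<bar>rep_H1 z x\<bar> powr p) \<partial>lborel) \<le> ennreal S"
begin

section \<open>Pointwise estimates for the nonlinearity\<close>

lemma measurable_f [measurable]: "f \<in> borel_measurable borel"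
  using continuous_f by (rule borel_measurable_continuous_onI)

lemma isCont_f: "isCont f t"
  using continuous_f by (simp add: continuous_on_eq_continuous_at)

lemma isCont_F: "isCont F t"
  using DERIV_F DERIV_isCont by blast

lemma measurable_F [measurable]: "F \<in> borel_measurable borel"
  by (intro borel_measurable_continuous_onI continuous_at_imp_continuous_on ballI isCont_F)

lemma F_increment:
  obtains s where "\<bar>s\<bar> \<le> \<bar>a\<bar> + \<bar>b\<bar>" "F (a + b) - F a = b * f s"
proof (cases b "0::real" rule: linorder_cases)
  case less
  then obtain s where "a + b < s" "s < a" "F a - F (a + b) = (a - (a + b)) * f s"
    using MVT2[of "a + b" a F f] DERIV_F by auto
  then show thesis using that[of s] by (auto simp: algebra_simps)
next
  case equal
  then show thesis using that[of a] by simp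
next
  case greater
  then obtain s where "a < s" "s < a + b" "F (a + b) - F a = (a + b - a) * f s"
    using MVT2[of a "a + b" F f] DERIV_F by auto
  then show thesis using that[of s] by auto
qed

lemma growth_le:
  assumes "\<And>t. \<bar>f t\<bar> \<le> C * \<bar>t\<bar> + \<eta> * \<bar>t\<bar> powr (p - 1)" "C \<ge> 0" "\<eta> > 0" "\<bar>s\<bar> \<le> r"
  shows "\<bar>f s\<bar> \<le> C * r + \<eta> * r powr (p - 1)"
  using assms p by (intro order_trans[OF assms(1)] add_mono mult_left_mono powr_mono2) auto

lemma growth_two:
  assumes "\<eta> > 0"
  obtains C where "C \<ge> 0"
    "\<And>r s t. \<bar>s\<bar> \<le> r \<Longrightarrow> \<bar>t\<bar> \<le> r \<Longrightarrow> \<bar>f s\<bar> + \<bar>f t\<bar> \<le> C * r + \<eta> * r powr (p - 1)"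
proof -
  have \<eta>: "\<eta> / 2 > 0" using assms by simp
  then obtain C where C: "C \<ge> 0" "\<And>t. \<bar>f t\<bar> \<le> C * \<bar>t\<bar> + \<eta> / 2 * \<bar>t\<bar> powr (p - 1)"
    using growth by blast
  have "\<bar>f s\<bar> + \<bar>f t\<bar> \<le> 2 * C * r + \<eta> * r powr (p - 1)" if "\<bar>s\<bar> \<le> r" "\<bar>t\<bar> \<le> r" for r s t
  proof -
    have "\<bar>f s\<bar> + \<bar>f t\<bar> \<le> 2 * (C * r + \<eta> / 2 * r powr (p - 1))"
      unfolding mult_2 by (intro add_mono growth_le[OF C(2) C(1) \<eta>] that)
    then show ?thesis by (simp add: distrib_left)
  qed
  then show thesis using that[of "2 * C"] C(1) by simp
qed

lemma F_growth:
  assumes "\<And>t. \<bar>f t\<bar> \<le> C * \<bar>t\<bar> + \<eta> * \<bar>t\<bar> powr (p - 1)" "C \<ge> 0" "\<eta> > 0"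
  shows "\<bar>F t\<bar> \<le> C * t\<^sup>2 + \<eta> * \<bar>t\<bar> powr p"
proof -
  obtain s where s: "\<bar>s\<bar> \<le> \<bar>t\<bar>" "F t = t * f s" using F_increment[of 0 t] F_0 by auto
  have "\<bar>F t\<bar> \<le> \<bar>t\<bar> * (C * \<bar>t\<bar> + \<eta> * \<bar>t\<bar> powr (p - 1))"
    unfolding s(2) abs_mult by (intro mult_left_mono growth_le[OF assms s(1)]) auto
  also have "\<dots> = C * t\<^sup>2 + \<eta> * (\<bar>t\<bar> powr (p - 1) * \<bar>t\<bar>)"
    by (simp add: distrib_left power2_eq_square mult_ac)
  finally show ?thesis by (simp add: powr_minus_one_mult)
qed

text \<open>A pointwise inequality of Brezis-Lieb type. By symmetry
  \<open>\<bar>b\<bar> \<le> \<bar>a\<bar>\<close>; the mean value theorem handles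
  \<open>F (a + b) - F a\<close>, and squares of the smaller number are absorbed into
  \<open>\<bar>a\<bar> * \<bar>b\<bar>\<close>. The product vanishes in the weak limit; the power
  \<open>p\<close> is only bounded but carries the small \<open>\<eta>\<close>.\<close>

lemma F_splitting:
  assumes gr: "\<And>t. \<bar>f t\<bar> \<le> C * \<bar>t\<bar> + \<eta> * \<bar>t\<bar> powr (p - 1)" "C \<ge> 0" "\<eta> > 0"
  shows "\<bar>F (a + b) - F a - F b\<bar> \<le> 3 * C * (\<bar>a\<bar> * \<bar>b\<bar>) + 2 * \<eta> * (\<bar>a\<bar> + \<bar>b\<bar>) powr p"
proof -
  have *: "\<bar>F (a + b) - F a - F b\<bar> \<le> 3 * C * (\<bar>a\<bar> * \<bar>b\<bar>) + 2 * \<eta> * (\<bar>a\<bar> + \<bar>b\<bar>) powr p" if ba: "\<bar>b\<bar> \<le> \<bar>a\<bar>" for a b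
  proof -
    obtain s where s: "\<bar>s\<bar> \<le> \<bar>a\<bar> + \<bar>b\<bar>" "F (a + b) - F a = b * f s" by (rule F_increment)
    have "\<bar>F (a + b) - F a\<bar> \<le> \<bar>b\<bar> * (C * (\<bar>a\<bar> + \<bar>b\<bar>) + \<eta> * (\<bar>a\<bar> + \<bar>b\<bar>) powr (p - 1))"
      unfolding s(2) abs_mult by (intro mult_left_mono growth_le[OF gr s(1)]) auto
    also have "\<dots> = C * (\<bar>b\<bar> * \<bar>a\<bar> + \<bar>b\<bar> * \<bar>b\<bar>) + \<eta> * ((\<bar>a\<bar> + \<bar>b\<bar>) powr (p - 1) * \<bar>b\<bar>)"
      by (simp add: algebra_simps)
    also have "\<dots> \<le> C * (2 * (\<bar>a\<bar> * \<bar>b\<bar>)) + \<eta> * ((\<bar>a\<bar> + \<bar>b\<bar>) powr (p - 1) * (\<bar>a\<bar> + \<bar>b\<bar>))"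
    proof (intro add_mono mult_left_mono)
      show "\<bar>b\<bar> * \<bar>a\<bar> + \<bar>b\<bar> * \<bar>b\<bar> \<le> 2 * (\<bar>a\<bar> * \<bar>b\<bar>)"
        using mult_right_mono[OF ba, of "\<bar>b\<bar>"] by (simp add: mult.commute)
    qed (use gr in auto)
    also have "\<dots> = 2 * C * (\<bar>a\<bar> * \<bar>b\<bar>) + \<eta> * (\<bar>a\<bar> + \<bar>b\<bar>) powr p"
      by (simp add: powr_minus_one_mult)
    finally have 1: "\<bar>F (a + b) - F a\<bar> \<le> 2 * C * (\<bar>a\<bar> * \<bar>b\<bar>) + \<eta> * (\<bar>a\<bar> + \<bar>b\<bar>) powr p" .
    have "\<bar>F b\<bar> \<le> C * b\<^sup>2 + \<eta> * \<bar>b\<bar> powr p" by (rule F_growth[OF gr])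
    also have "\<dots> \<le> C * (\<bar>a\<bar> * \<bar>b\<bar>) + \<eta> * (\<bar>a\<bar> + \<bar>b\<bar>) powr p"
    proof (intro add_mono mult_left_mono powr_mono2)
      show "b\<^sup>2 \<le> \<bar>a\<bar> * \<bar>b\<bar>" using mult_right_mono[OF ba, of "\<bar>b\<bar>"] by (simp add: power2_eq_square)
    qed (use gr p in auto)
    finally show ?thesis using 1 abs_triangle_ineq4[of "F (a + b) - F a" "F b"] unfolding mult.assoc by linarith
  qed
  show ?thesis
  proof (cases "\<bar>b\<bar> \<le> \<bar>a\<bar>")
    case False
    have "\<bar>F (b + a) - F b - F a\<bar> \<le> 3 * C * (\<bar>b\<bar> * \<bar>a\<bar>) + 2 * \<eta> * (\<bar>b\<bar> + \<bar>a\<bar>) powr p"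
      using False by (intro *) simp
    moreover have "F (b + a) - F b - F a = F (a + b) - F a - F b" by (simp add: add.commute)
    ultimately show ?thesis by (simp only: add.commute[of "\<bar>b\<bar>"] mult.commute[of "\<bar>b\<bar>"])
  qed (rule *)
qed

text \<open>Three cases, matching the error terms. If \<open>v + W\<close> is near 0, the slope of
  \<open>f\<close> is at most \<open>1 - m\<close>. Otherwise either
  \<open>\<bar>v\<bar> > \<delta> / 2\<close>, and \<open>v\<^sup>2\<close> goes into the superlevel
  term, or \<open>\<bar>W\<bar>\<close> dominates \<open>\<bar>v\<bar>\<close> and
  \<open>v\<^sup>2 \<le> \<bar>v\<bar> * \<bar>W\<bar>\<close>. In the last case two terms with
  coefficient \<open>C\<close> merge, whence \<open>D \<ge> 2 * C\<close>.\<close>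

lemma f_coercive:
  assumes gr: "\<And>t. \<bar>f t\<bar> \<le> C * \<bar>t\<bar> + \<eta> * \<bar>t\<bar> powr (p - 1)" "C \<ge> 0" "\<eta> > 0"
    and D: "D \<ge> M" "D \<ge> 2 * C"
  shows "f (v + W) * v \<le> (1 - m) * v\<^sup>2 + D * (if \<bar>v\<bar> > \<delta> / 2 then v\<^sup>2 else 0)
    + D * (\<bar>v\<bar> * \<bar>W\<bar>) + \<eta> * (\<bar>v\<bar> + \<bar>W\<bar>) powr p"
proof (cases "\<bar>v + W\<bar> \<le> \<delta>")
  case True
  then obtain c where c: "f (v + W) = c * (v + W)" "\<bar>c\<bar> \<le> M" "c \<le> 1 - m" using near_0 by blast
  have "f (v + W) * v = c * v\<^sup>2 + c * (v * W)" unfolding c(1) by (simp add: power2_eq_square algebra_simps)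
  also have "\<dots> \<le> (1 - m) * v\<^sup>2 + M * (\<bar>v\<bar> * \<bar>W\<bar>)"
  proof (intro add_mono mult_right_mono)
    have "c * (v * W) \<le> \<bar>c\<bar> * (\<bar>v\<bar> * \<bar>W\<bar>)" by (metis abs_ge_self abs_mult)
    also have "\<dots> \<le> M * (\<bar>v\<bar> * \<bar>W\<bar>)" using c by (intro mult_right_mono) auto
    finally show "c * (v * W) \<le> M * (\<bar>v\<bar> * \<bar>W\<bar>)" .
  qed (use c in auto)
  also have "M * (\<bar>v\<bar> * \<bar>W\<bar>) \<le> D * (\<bar>v\<bar> * \<bar>W\<bar>)" using D by (intro mult_right_mono) auto
  also have "(1 - m) * v\<^sup>2 + D * (\<bar>v\<bar> * \<bar>W\<bar>) \<le> (1 - m) * v\<^sup>2 + D * (if \<bar>v\<bar> > \<delta> / 2 then v\<^sup>2 else 0)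
    + D * (\<bar>v\<bar> * \<bar>W\<bar>) + \<eta> * (\<bar>v\<bar> + \<bar>W\<bar>) powr p"
    using gr D by simp
  finally show ?thesis by simp
next
  case False
  have "f (v + W) * v \<le> \<bar>f (v + W)\<bar> * \<bar>v\<bar>" by (metis abs_ge_self abs_mult)
  also have "\<dots> \<le> (C * (\<bar>v\<bar> + \<bar>W\<bar>) + \<eta> * (\<bar>v\<bar> + \<bar>W\<bar>) powr (p - 1)) * \<bar>v\<bar>"
    by (intro mult_right_mono growth_le[OF gr]) auto
  also have "\<dots> = C * v\<^sup>2 + C * (\<bar>v\<bar> * \<bar>W\<bar>) + \<eta> * ((\<bar>v\<bar> + \<bar>W\<bar>) powr (p - 1) * \<bar>v\<bar>)"
    by (simp add: algebra_simps power2_eq_square)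
  also have "\<dots> \<le> C * v\<^sup>2 + C * (\<bar>v\<bar> * \<bar>W\<bar>) + \<eta> * (\<bar>v\<bar> + \<bar>W\<bar>) powr p"
  proof -
    have "(\<bar>v\<bar> + \<bar>W\<bar>) powr (p - 1) * \<bar>v\<bar> \<le> (\<bar>v\<bar> + \<bar>W\<bar>) powr (p - 1) * (\<bar>v\<bar> + \<bar>W\<bar>)"
      by (intro mult_left_mono) auto
    then show ?thesis using gr by (simp add: powr_minus_one_mult)
  qed
  finally have *: "f (v + W) * v \<le> C * v\<^sup>2 + C * (\<bar>v\<bar> * \<bar>W\<bar>) + \<eta> * (\<bar>v\<bar> + \<bar>W\<bar>) powr p" .
  have m0: "0 \<le> (1 - m) * v\<^sup>2" using m by simp
  show ?thesis
  proof (cases "\<bar>v\<bar> > \<delta> / 2")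
    case True
    have "C * v\<^sup>2 \<le> D * v\<^sup>2" "C * (\<bar>v\<bar> * \<bar>W\<bar>) \<le> D * (\<bar>v\<bar> * \<bar>W\<bar>)"
      using D gr by (auto intro!: mult_right_mono)
    then show ?thesis using * m0 True by simp
  next
    case v: False
    then have "\<bar>v\<bar> \<le> \<bar>W\<bar>" using False by linarith
    then have "v\<^sup>2 \<le> \<bar>v\<bar> * \<bar>W\<bar>" by (metis abs_ge_zero mult_left_mono power2_abs power2_eq_square)
    then have "C * v\<^sup>2 + C * (\<bar>v\<bar> * \<bar>W\<bar>) \<le> 2 * C * (\<bar>v\<bar> * \<bar>W\<bar>)"
      using mult_left_mono[of "v\<^sup>2" "\<bar>v\<bar> * \<bar>W\<bar>" C] gr(2) unfolding mult.assoc by linarith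
    also have "\<dots> \<le> D * (\<bar>v\<bar> * \<bar>W\<bar>)" using D by (intro mult_right_mono) auto
    finally show ?thesis using * m0 v by simp
  qed
qed

text \<open>\<open>f_coercive\<close> with \<open>W = 0\<close>. For
  \<open>\<bar>t\<bar> > \<delta> / 2\<close> the square is at most a multiple of the power
  \<open>p\<close>; this gap between the orders 2 and \<open>p\<close> keeps nonzero critical points
  away from 0.\<close>

lemma f_coercive_0:
  obtains C where "C > 0" "\<And>t. f t * t \<le> (1 - m) * t\<^sup>2 + C * \<bar>t\<bar> powr p"
proof -
  obtain C where C: "C \<ge> 0" "\<And>t. \<bar>f t\<bar> \<le> C * \<bar>t\<bar> + 1 * \<bar>t\<bar> powr (p - 1)" using growth[of 1] by auto
  define D where "D = max M (2 * C)"
  have D0: "D \<ge> 0" using C by (simp add: D_def le_max_iff_disj)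
  define C' where "C' = D * (2 / \<delta>) powr (p - 2) + 1"
  have "C' > 0" using D0 by (simp add: C'_def add_nonneg_pos)
  moreover have "f t * t \<le> (1 - m) * t\<^sup>2 + C' * \<bar>t\<bar> powr p" for t
  proof -
    have "f t * t \<le> (1 - m) * t\<^sup>2 + D * (if \<bar>t\<bar> > \<delta> / 2 then t\<^sup>2 else 0) + \<bar>t\<bar> powr p"
      using f_coercive[of C 1 D t 0] C by (simp add: D_def)
    moreover have "(if \<bar>t\<bar> > \<delta> / 2 then t\<^sup>2 else 0) \<le> (2 / \<delta>) powr (p - 2) * \<bar>t\<bar> powr p"
    proof (cases "\<bar>t\<bar> > \<delta> / 2")
      case True
      have "1 \<le> (2 / \<delta> * \<bar>t\<bar>) powr (p - 2)" using True \<delta> p by (intro ge_one_powr_ge_zero) (auto simp: field_simps)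
      also have "(2 / \<delta> * \<bar>t\<bar>) powr (p - 2) = (2 / \<delta>) powr (p - 2) * \<bar>t\<bar> powr (p - 2)"
        by (intro powr_mult)
      finally have "t\<^sup>2 * 1 \<le> t\<^sup>2 * ((2 / \<delta>) powr (p - 2) * \<bar>t\<bar> powr (p - 2))"
        by (intro mult_left_mono) auto
      also have "t\<^sup>2 * ((2 / \<delta>) powr (p - 2) * \<bar>t\<bar> powr (p - 2)) = (2 / \<delta>) powr (p - 2) * (\<bar>t\<bar> powr (p - 2) * \<bar>t\<bar> powr 2)"
      proof -
        have "\<bar>t\<bar> powr 2 = t\<^sup>2" using True \<delta> by (simp add: powr_numeral)
        then show ?thesis by (simp add: mult_ac)
      qed
      also have "\<bar>t\<bar> powr (p - 2) * \<bar>t\<bar> powr 2 = \<bar>t\<bar> powr p" by (subst powr_add[symmetric]) simp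
      finally show ?thesis using True by simp
    qed simp
    then have "D * (if \<bar>t\<bar> > \<delta> / 2 then t\<^sup>2 else 0) \<le> D * ((2 / \<delta>) powr (p - 2) * \<bar>t\<bar> powr p)"
      using D0 by (rule mult_left_mono)
    ultimately show ?thesis unfolding C'_def distrib_right by simp
  qed
  ultimately show thesis using that by blast
qed

section \<open>Integrals with critical growth\<close>

lemma rep_powr:
  fixes z :: "'n H1"
  shows "integrable lborel (\<lambda>x. \<bar>rep_H1 z x\<bar> powr p)" "(\<integral>x. \<bar>rep_H1 z x\<bar> powr p \<partial>lborel) \<le> S * norm z powr p"
proof -
  have *: "integrable lborel (\<lambda>x. \<bar>rep_H1 z x\<bar> powr p) \<and> (\<integral>x. \<bar>rep_H1 z x\<bar> powr p \<partial>lborel) \<le> S * norm z powr p"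
  proof (cases "z = 0")
    case True
    have "AE x in lborel. \<bar>rep_H1 z x\<bar> powr p = 0" using rep_zero True by auto
    then have "integrable lborel (\<lambda>x. \<bar>rep_H1 z x\<bar> powr p)" "(\<integral>x. \<bar>rep_H1 z x\<bar> powr p \<partial>lborel) = 0"
      by (auto intro!: integral_eq_zero_AE integrable_cong_AE_imp[OF integrable_zero])
    then show ?thesis using True by simp
  next
    case False
    define y where "y = (1 / norm z) *\<^sub>R z"
    have y: "norm y \<le> 1" using False by (simp add: y_def)
    have iy: "integrable lborel (\<lambda>x. \<bar>rep_H1 y x\<bar> powr p)"
      by (intro integrableI_bounded) (use order_le_less_trans[OF Sobolev[OF y] ennreal_less_top] in auto)
    have "ennreal (\<integral>x. \<bar>rep_H1 y x\<bar> powr p \<partial>lborel) \<le> ennreal S"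
      using Sobolev[OF y] nn_integral_eq_integral[OF iy] by simp
    then have le: "(\<integral>x. \<bar>rep_H1 y x\<bar> powr p \<partial>lborel) \<le> S" using S by (subst (asm) ennreal_le_iff) auto
    have "AE x in lborel. rep_H1 (norm z *\<^sub>R y) x = norm z * rep_H1 y x" by (rule rep_scaleR)
    then have ae: "AE x in lborel. norm z powr p * \<bar>rep_H1 y x\<bar> powr p = \<bar>rep_H1 z x\<bar> powr p"
      using False by (auto simp: y_def abs_mult powr_mult)
    have "integrable lborel (\<lambda>x. \<bar>rep_H1 z x\<bar> powr p)"
      by (rule integrable_cong_AE_imp[OF _ _ ae]) (use iy in auto)
    moreover have "(\<integral>x. norm z powr p * \<bar>rep_H1 y x\<bar> powr p \<partial>lborel) = (\<integral>x. \<bar>rep_H1 z x\<bar> powr p \<partial>lborel)"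
      by (rule integral_cong_AE[OF _ _ ae]) auto
    ultimately show ?thesis using mult_left_mono[OF le, of "norm z powr p"] by (simp add: mult.commute)
  qed
  then show "integrable lborel (\<lambda>x. \<bar>rep_H1 z x\<bar> powr p)" "(\<integral>x. \<bar>rep_H1 z x\<bar> powr p \<partial>lborel) \<le> S * norm z powr p"
    by auto
qed

lemma rep_powr_bounded:
  fixes z :: "'n H1"
  assumes "norm z \<le> B"
  shows "(\<integral>x. \<bar>rep_H1 z x\<bar> powr p \<partial>lborel) \<le> S * B powr p"
  using assms S p by (intro order_trans[OF rep_powr(2)] mult_left_mono powr_mono2) auto

lemma integrable_add_powr:
  fixes a b :: "real^'n \<Rightarrow> real"
  assumes [measurable]: "a \<in> borel_measurable borel" "b \<in> borel_measurable borel"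
    and a: "integrable lborel (\<lambda>x. \<bar>a x\<bar> powr p)" and b: "integrable lborel (\<lambda>x. \<bar>b x\<bar> powr p)"
  shows "integrable lborel (\<lambda>x. (\<bar>a x\<bar> + \<bar>b x\<bar>) powr p)"
    and "(\<integral>x. (\<bar>a x\<bar> + \<bar>b x\<bar>) powr p \<partial>lborel)
      \<le> 2 powr p * ((\<integral>x. \<bar>a x\<bar> powr p \<partial>lborel) + (\<integral>x. \<bar>b x\<bar> powr p \<partial>lborel))"
proof -
  have i: "integrable lborel (\<lambda>x. 2 powr p * (\<bar>a x\<bar> powr p + \<bar>b x\<bar> powr p))" using a b by simp
  have le: "(\<bar>a x\<bar> + \<bar>b x\<bar>) powr p \<le> 2 powr p * (\<bar>a x\<bar> powr p + \<bar>b x\<bar> powr p)" for x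
    using p by (intro powr_add_le) auto
  show 1: "integrable lborel (\<lambda>x. (\<bar>a x\<bar> + \<bar>b x\<bar>) powr p)"
    by (rule Bochner_Integration.integrable_bound[OF i]) (use le in \<open>auto intro!: AE_I2\<close>)
  have "(\<integral>x. (\<bar>a x\<bar> + \<bar>b x\<bar>) powr p \<partial>lborel) \<le> (\<integral>x. 2 powr p * (\<bar>a x\<bar> powr p + \<bar>b x\<bar> powr p) \<partial>lborel)"
    by (rule integral_mono[OF 1 i le])
  then show "(\<integral>x. (\<bar>a x\<bar> + \<bar>b x\<bar>) powr p \<partial>lborel)
      \<le> 2 powr p * ((\<integral>x. \<bar>a x\<bar> powr p \<partial>lborel) + (\<integral>x. \<bar>b x\<bar> powr p \<partial>lborel))"
    using a b by simp
qed

lemma integrable_dominated_pairing: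
  fixes a b d \<psi> :: "real^'n \<Rightarrow> real"
  assumes L: "L2 a" "L2 b" "L2 \<psi>"
    and pa: "integrable lborel (\<lambda>x. \<bar>a x\<bar> powr p)" and pb: "integrable lborel (\<lambda>x. \<bar>b x\<bar> powr p)"
    and p\<psi>: "integrable lborel (\<lambda>x. \<bar>\<psi> x\<bar> powr p)"
    and d [measurable]: "d \<in> borel_measurable borel" and C: "C \<ge> 0" and \<eta>: "\<eta> \<ge> 0"
    and dle: "\<And>x. \<bar>d x\<bar> \<le> C * (\<bar>a x\<bar> + \<bar>b x\<bar>) + \<eta> * (\<bar>a x\<bar> + \<bar>b x\<bar>) powr (p - 1)"
  shows "integrable lborel (\<lambda>x. d x * \<psi> x)"
proof (rule Bochner_Integration.integrable_bound)
  note [measurable] = L[THEN L2_measurable]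
  have iab: "integrable lborel (\<lambda>x. (\<bar>a x\<bar> + \<bar>b x\<bar>) powr p)" by (rule integrable_add_powr) (use pa pb in auto)
  have "integrable lborel (\<lambda>x. (\<bar>\<bar>a x\<bar> + \<bar>b x\<bar>\<bar> + \<bar>\<psi> x\<bar>) powr p)"
    by (rule integrable_add_powr) (use iab p\<psi> in auto)
  then show "integrable lborel (\<lambda>x. C * (\<bar>a x\<bar> * \<bar>\<psi> x\<bar> + \<bar>b x\<bar> * \<bar>\<psi> x\<bar>) + \<eta> * (\<bar>a x\<bar> + \<bar>b x\<bar> + \<bar>\<psi> x\<bar>) powr p)"
    using L2_mult[OF L2_abs[OF L(1)] L2_abs[OF L(3)]] L2_mult[OF L2_abs[OF L(2)] L2_abs[OF L(3)]] by simp
  have "\<bar>d x * \<psi> x\<bar> \<le> C * (\<bar>a x\<bar> * \<bar>\<psi> x\<bar> + \<bar>b x\<bar> * \<bar>\<psi> x\<bar>) + \<eta> * (\<bar>a x\<bar> + \<bar>b x\<bar> + \<bar>\<psi> x\<bar>) powr p" for x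
  proof -
    have "\<bar>d x * \<psi> x\<bar> \<le> (C * (\<bar>a x\<bar> + \<bar>b x\<bar>) + \<eta> * (\<bar>a x\<bar> + \<bar>b x\<bar>) powr (p - 1)) * \<bar>\<psi> x\<bar>"
      unfolding abs_mult by (intro mult_right_mono dle) auto
    also have "\<dots> = C * (\<bar>a x\<bar> * \<bar>\<psi> x\<bar> + \<bar>b x\<bar> * \<bar>\<psi> x\<bar>) + \<eta> * ((\<bar>a x\<bar> + \<bar>b x\<bar>) powr (p - 1) * \<bar>\<psi> x\<bar>)"
      by (simp add: algebra_simps)
    also have "\<dots> \<le> C * (\<bar>a x\<bar> * \<bar>\<psi> x\<bar> + \<bar>b x\<bar> * \<bar>\<psi> x\<bar>) + \<eta> * (\<bar>a x\<bar> + \<bar>b x\<bar> + \<bar>\<psi> x\<bar>) powr p"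
      using p \<eta> by (intro add_left_mono mult_left_mono powr_mult_le) auto
    finally show ?thesis .
  qed
  then show "AE x in lborel. norm (d x * \<psi> x) \<le> norm (C * (\<bar>a x\<bar> * \<bar>\<psi> x\<bar> + \<bar>b x\<bar> * \<bar>\<psi> x\<bar>) + \<eta> * (\<bar>a x\<bar> + \<bar>b x\<bar> + \<bar>\<psi> x\<bar>) powr p)"
    unfolding real_norm_def by (intro AE_I2 order_trans[OF _ abs_ge_self])
qed (use L[THEN L2_measurable] in measurable)

text \<open>The critical growth costs no compactness here: up to the terms \<open>C * \<bar>b n\<bar>\<close> and \<open>\<eta> * (\<bar>a\<bar> + \<bar>b n\<bar>) powr (p - 1)\<close>,
  which are small after integration against \<open>\<psi> n\<close>, the function \<open>d n\<close> is dominated by \<open>C * \<bar>a\<bar>\<close>.\<close>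

lemma dominated_pairing_null:
  fixes a :: "real^'n \<Rightarrow> real" and b d \<psi> :: "nat \<Rightarrow> real^'n \<Rightarrow> real"
  assumes L: "L2 a" "\<And>n. L2 (b n)" "\<And>n. L2 (\<psi> n)"
    and pa: "integrable lborel (\<lambda>x. \<bar>a x\<bar> powr p)" and pb: "\<And>n. integrable lborel (\<lambda>x. \<bar>b n x\<bar> powr p)"
    and p\<psi>: "\<And>n. integrable lborel (\<lambda>x. \<bar>\<psi> n x\<bar> powr p)"
    and B: "\<And>n. (\<integral>x. \<bar>b n x\<bar> powr p \<partial>lborel) \<le> B" "\<And>n. (\<integral>x. \<bar>\<psi> n x\<bar> powr p \<partial>lborel) \<le> B"
      "\<And>n. (\<integral>x. (\<psi> n x)\<^sup>2 \<partial>lborel) \<le> B"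
    and d [measurable]: "\<And>n. d n \<in> borel_measurable borel"
    and dle: "\<And>\<eta>. \<eta> > 0 \<Longrightarrow> \<exists>C\<ge>0. \<forall>n x. \<bar>d n x\<bar> \<le> C * (\<bar>a x\<bar> + \<bar>b n x\<bar>) + \<eta> * (\<bar>a x\<bar> + \<bar>b n x\<bar>) powr (p - 1)"
    and dlim: "AE x in lborel. (\<lambda>n. d n x) \<longlonglongrightarrow> 0"
    and cross: "(\<lambda>n. \<integral>x. \<bar>b n x\<bar> * \<bar>\<psi> n x\<bar> \<partial>lborel) \<longlonglongrightarrow> 0"
  shows "(\<lambda>n. \<integral>x. \<bar>d n x\<bar> * \<bar>\<psi> n x\<bar> \<partial>lborel) \<longlonglongrightarrow> 0"
  unfolding LIMSEQ_iff
proof (intro allI impI)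
  fix e :: real assume e: "e > 0"
  note [measurable] = L[THEN L2_measurable]
  define A where "A = (\<integral>x. \<bar>a x\<bar> powr p \<partial>lborel)"
  have A: "A \<ge> 0" by (simp add: A_def)
  have B0: "B \<ge> 0" using B(3)[of 0] by (rule order_trans[rotated]) simp
  \<comment> \<open>Bounds the integral of \<open>(\<bar>a x\<bar> + \<bar>b n x\<bar> +
    \<bar>\<psi> n x\<bar>) powr p\<close> for all \<open>n\<close>; each of the two additions costs
    a factor \<open>2 powr p\<close>.\<close>
  define Q where "Q = 2 powr p * (2 powr p * (A + B) + B)"
  have Q: "Q \<ge> 0" using A B0 by (simp add: Q_def)
  define \<eta> where "\<eta> = e / (4 * (Q + 1))"
  have \<eta>: "\<eta> > 0" using e Q by (simp add: \<eta>_def)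
  have \<eta>Q: "\<eta> * Q \<le> e / 4" using e Q by (simp add: \<eta>_def field_simps)
  obtain C where C: "C \<ge> 0" and dC: "\<And>n x. \<bar>d n x\<bar> \<le> C * (\<bar>a x\<bar> + \<bar>b n x\<bar>) + \<eta> * (\<bar>a x\<bar> + \<bar>b n x\<bar>) powr (p - 1)"
    using dle[OF \<eta>] by blast
  \<comment> \<open>The part of \<open>d n\<close> not paid for by \<open>b n\<close> and
    \<open>\<eta>\<close>. It is dominated by \<open>C * \<bar>a x\<bar>\<close> with
    \<open>a\<close> fixed and tends to 0 a.e., hence also in L2.\<close>
  define E where "E n x = max 0 (\<bar>d n x\<bar> - C * \<bar>b n x\<bar> - \<eta> * (\<bar>a x\<bar> + \<bar>b n x\<bar>) powr (p - 1))" for n x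
  have [measurable]: "E n \<in> borel_measurable borel" for n unfolding E_def[abs_def] by measurable
  have E0: "0 \<le> E n x" "E n x \<le> C * \<bar>a x\<bar>" "E n x \<le> \<bar>d n x\<bar>" for n x
  proof -
    show "0 \<le> E n x" by (simp add: E_def)
    show "E n x \<le> C * \<bar>a x\<bar>" using dC[of n x] C by (simp add: E_def distrib_left)
    have "0 \<le> C * \<bar>b n x\<bar> + \<eta> * (\<bar>a x\<bar> + \<bar>b n x\<bar>) powr (p - 1)" using C \<eta> by simp
    then show "E n x \<le> \<bar>d n x\<bar>" unfolding E_def by linarith
  qed
  have Esq: "(E n x)\<^sup>2 \<le> C\<^sup>2 * (a x)\<^sup>2" for n x
    using power_mono[OF E0(2) E0(1), of n x 2] by (simp add: power_mult_distrib)
  have aC: "integrable lborel (\<lambda>x. C\<^sup>2 * (a x)\<^sup>2)" using L2_square_integrable[OF L(1)] by simp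
  have EL: "L2 (E n)" for n
    unfolding L2_def
  proof
    show "integrable lborel (\<lambda>x. (norm (E n x))\<^sup>2)"
      by (rule Bochner_Integration.integrable_bound[OF aC]) (simp_all add: Esq)
  qed simp
  have "(\<lambda>n. \<integral>x. (E n x)\<^sup>2 \<partial>lborel) \<longlonglongrightarrow> (\<integral>x. 0 \<partial>(lborel :: (real^'n) measure))"
  proof (rule integral_dominated_convergence[OF _ _ aC])
    show "AE x in lborel. (\<lambda>n. (E n x)\<^sup>2) \<longlonglongrightarrow> 0"
      using dlim
    proof (rule AE_mp, intro AE_I2 impI)
      fix x assume "(\<lambda>n. d n x) \<longlonglongrightarrow> 0"
      then have "(\<lambda>n. E n x) \<longlonglongrightarrow> 0"
        by (rule Lim_null_comparison[OF _ tendsto_rabs_zero, rotated]) (simp add: E0)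
      then show "(\<lambda>n. (E n x)\<^sup>2) \<longlonglongrightarrow> 0" by (simp add: tendsto_null_power)
    qed
  qed (simp_all add: Esq)
  then have E2: "(\<lambda>n. \<integral>x. (E n x)\<^sup>2 \<partial>lborel) \<longlonglongrightarrow> 0" by simp
  \<comment> \<open>Young parameter for pairing \<open>E n\<close> with \<open>\<psi> n\<close>: the
    squared L2 norm of \<open>\<psi> n\<close> is only bounded by \<open>B\<close>, that of
    \<open>E n\<close> tends to 0.\<close>
  define t where "t = 4 * (B + 1) / e"
  have t: "t > 0" using e B0 by (simp add: t_def)
  have tB: "B / t < e / 4" using e B0 by (simp add: t_def field_simps)
  have ev1: "\<forall>\<^sub>F n in sequentially. (\<integral>x. (E n x)\<^sup>2 \<partial>lborel) < e / (4 * t)"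
    using e t by (intro order_tendstoD(2)[OF E2]) simp
  have ev2: "\<forall>\<^sub>F n in sequentially. (\<integral>x. \<bar>b n x\<bar> * \<bar>\<psi> n x\<bar> \<partial>lborel) < e / (4 * (C + 1))"
    using e C by (intro order_tendstoD(2)[OF cross]) simp
  have "\<forall>\<^sub>F n in sequentially. (\<integral>x. \<bar>d n x\<bar> * \<bar>\<psi> n x\<bar> \<partial>lborel) < e"
    using ev1 ev2
  proof eventually_elim
    case (elim n)
    let ?P = "\<lambda>x. (\<bar>\<bar>a x\<bar> + \<bar>b n x\<bar>\<bar> + \<bar>\<psi> n x\<bar>) powr p"
    have iab: "integrable lborel (\<lambda>x. \<bar>\<bar>a x\<bar> + \<bar>b n x\<bar>\<bar> powr p)"
      using integrable_add_powr(1)[OF _ _ pa pb, of n] by simp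
    have iP: "integrable lborel ?P" by (rule integrable_add_powr) (use iab p\<psi> in auto)
    have P: "(\<integral>x. ?P x \<partial>lborel) \<le> Q"
    proof -
      have "(\<integral>x. ?P x \<partial>lborel) \<le> 2 powr p * ((\<integral>x. \<bar>\<bar>a x\<bar> + \<bar>b n x\<bar>\<bar> powr p \<partial>lborel) + (\<integral>x. \<bar>\<psi> n x\<bar> powr p \<partial>lborel))"
        by (rule integrable_add_powr) (use iab p\<psi> in auto)
      also have "(\<integral>x. \<bar>\<bar>a x\<bar> + \<bar>b n x\<bar>\<bar> powr p \<partial>lborel) \<le> 2 powr p * (A + (\<integral>x. \<bar>b n x\<bar> powr p \<partial>lborel))"
        using integrable_add_powr(2)[OF _ _ pa pb, of n] by (simp add: A_def)
      also have "\<dots> \<le> 2 powr p * (A + B)" using B(1)[of n] by simp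
      finally have "(\<integral>x. ?P x \<partial>lborel) \<le> 2 powr p * (2 powr p * (A + B) + (\<integral>x. \<bar>\<psi> n x\<bar> powr p \<partial>lborel))" by simp
      also have "\<dots> \<le> Q" unfolding Q_def by (intro mult_left_mono add_left_mono B) simp
      finally show ?thesis .
    qed
    have i1: "integrable lborel (\<lambda>x. E n x * \<bar>\<psi> n x\<bar>)" by (intro L2_mult EL L2_abs L)
    have i2: "integrable lborel (\<lambda>x. \<bar>b n x\<bar> * \<bar>\<psi> n x\<bar>)" by (intro L2_mult L2_abs L)
    have "(\<integral>x. \<bar>d n x\<bar> * \<bar>\<psi> n x\<bar> \<partial>lborel) \<le> (\<integral>x. E n x * \<bar>\<psi> n x\<bar> + C * (\<bar>b n x\<bar> * \<bar>\<psi> n x\<bar>) + \<eta> * ?P x \<partial>lborel)"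
    proof (rule integral_mono)
      show "integrable lborel (\<lambda>x. \<bar>d n x\<bar> * \<bar>\<psi> n x\<bar>)"
        using integrable_dominated_pairing[OF L(1) L(2) L(3) pa pb p\<psi> d C less_imp_le[OF \<eta>] dC, of n]
        by (simp add: integrable_abs flip: abs_mult)
      show "integrable lborel (\<lambda>x. E n x * \<bar>\<psi> n x\<bar> + C * (\<bar>b n x\<bar> * \<bar>\<psi> n x\<bar>) + \<eta> * ?P x)"
        using i1 i2 iP by simp
      fix x
      have "\<bar>d n x\<bar> \<le> E n x + C * \<bar>b n x\<bar> + \<eta> * (\<bar>a x\<bar> + \<bar>b n x\<bar>) powr (p - 1)"
        unfolding E_def by linarith
      then have "\<bar>d n x\<bar> * \<bar>\<psi> n x\<bar> \<le> (E n x + C * \<bar>b n x\<bar> + \<eta> * (\<bar>a x\<bar> + \<bar>b n x\<bar>) powr (p - 1)) * \<bar>\<psi> n x\<bar>"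
        by (rule mult_right_mono) simp
      also have "\<dots> = E n x * \<bar>\<psi> n x\<bar> + C * (\<bar>b n x\<bar> * \<bar>\<psi> n x\<bar>) + \<eta> * ((\<bar>a x\<bar> + \<bar>b n x\<bar>) powr (p - 1) * \<bar>\<psi> n x\<bar>)"
        by (simp add: algebra_simps)
      also have "\<dots> \<le> E n x * \<bar>\<psi> n x\<bar> + C * (\<bar>b n x\<bar> * \<bar>\<psi> n x\<bar>) + \<eta> * ?P x"
        using p \<eta> powr_mult_le[of "\<bar>a x\<bar> + \<bar>b n x\<bar>" "\<bar>\<psi> n x\<bar>" p] by (intro add_left_mono mult_left_mono) auto
      finally show "\<bar>d n x\<bar> * \<bar>\<psi> n x\<bar> \<le> E n x * \<bar>\<psi> n x\<bar> + C * (\<bar>b n x\<bar> * \<bar>\<psi> n x\<bar>) + \<eta> * ?P x" .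
    qed
    also have "\<dots> = (\<integral>x. E n x * \<bar>\<psi> n x\<bar> \<partial>lborel) + C * (\<integral>x. \<bar>b n x\<bar> * \<bar>\<psi> n x\<bar> \<partial>lborel) + \<eta> * (\<integral>x. ?P x \<partial>lborel)"
      using i1 i2 iP by simp
    also have "\<dots> < (e / 4 + e / 4) + e / 4 + e / 4"
    proof (intro add_less_le_mono)
      have "(\<integral>x. E n x * \<bar>\<psi> n x\<bar> \<partial>lborel) \<le> t * (\<integral>x. (E n x)\<^sup>2 \<partial>lborel) + (\<integral>x. (\<psi> n x)\<^sup>2 \<partial>lborel) / t"
        using L2_young[OF EL L(3) t, of n n] E0(1) by simp
      also have "\<dots> \<le> t * (e / (4 * t)) + B / t"
        using elim B(3)[of n] t by (intro add_mono mult_left_mono divide_right_mono) auto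
      also have "\<dots> < e / 4 + e / 4"
      proof -
        have "t * (e / (4 * t)) = e / 4" using t by simp
        then show ?thesis using tB by linarith
      qed
      finally show "(\<integral>x. E n x * \<bar>\<psi> n x\<bar> \<partial>lborel) < e / 4 + e / 4" .
      have "C * (\<integral>x. \<bar>b n x\<bar> * \<bar>\<psi> n x\<bar> \<partial>lborel) \<le> C * (e / (4 * (C + 1)))"
        using elim C by (intro mult_left_mono) auto
      also have "\<dots> \<le> e / 4" using C e by (simp add: field_simps)
      finally show "C * (\<integral>x. \<bar>b n x\<bar> * \<bar>\<psi> n x\<bar> \<partial>lborel) \<le> e / 4" .
      have "\<eta> * (\<integral>x. ?P x \<partial>lborel) \<le> \<eta> * Q" using P \<eta> by (intro mult_left_mono) auto
      then show "\<eta> * (\<integral>x. ?P x \<partial>lborel) \<le> e / 4" using \<eta>Q by linarith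
    qed
    finally show ?case by simp
  qed
  then show "\<exists>no. \<forall>n\<ge>no. norm ((\<integral>x. \<bar>d n x\<bar> * \<bar>\<psi> n x\<bar> \<partial>lborel) - 0) < e"
    by (simp add: eventually_sequentially abs_of_nonneg)
qed

end

text \<open>\<open>C\<close> may depend on \<open>\<eta>\<close>, while \<open>K\<close> and
  \<open>Y\<close> may not; in this form the small coefficient of the critical power is
  exploited.\<close>

lemma null_by_small_multiples:
  fixes X Y :: "nat \<Rightarrow> real"
  assumes "K \<ge> 0" and Y: "Y \<longlonglongrightarrow> 0"
    and le: "\<And>\<eta>. \<eta> > 0 \<Longrightarrow> \<exists>C. \<forall>n. \<bar>X n\<bar> \<le> C * Y n + \<eta> * K"
  shows "X \<longlonglongrightarrow> 0"
  unfolding LIMSEQ_iff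
proof (intro allI impI)
  fix e :: real assume e: "e > 0"
  define \<eta> where "\<eta> = e / (2 * (K + 1))"
  have "\<eta> > 0" using e assms(1) by (simp add: \<eta>_def)
  then obtain C where C: "\<And>n. \<bar>X n\<bar> \<le> C * Y n + \<eta> * K" using le by blast
  have \<eta>K: "\<eta> * K \<le> e / 2" using e assms(1) by (simp add: \<eta>_def field_simps)
  have "\<forall>\<^sub>F n in sequentially. C * Y n < e / 2"
    using e by (intro order_tendstoD(2)[OF tendsto_mult_right_zero[OF Y]]) simp
  then have "\<forall>\<^sub>F n in sequentially. \<bar>X n\<bar> < e"
  proof eventually_elim
    case (elim n)
    then show ?case using C[of n] \<eta>K by linarith
  qed
  then show "\<exists>no. \<forall>n\<ge>no. norm (X n - 0) < e" by (simp add: eventually_sequentially)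
qed

lemma bounded_Palais_Smale_subseq:
  assumes "bounded_Palais_Smale J \<beta> u" and r: "strict_mono r"
  shows "bounded_Palais_Smale J \<beta> (\<lambda>n. u (r n))"
  using assms(1) LIMSEQ_subseq_LIMSEQ[OF _ r] bounded_subset[of "range u" "range (\<lambda>n. u (r n))"]
  unfolding bounded_Palais_Smale_def comp_def by blast

context critical_problem
begin

section \<open>The functional, its derivative and weak limits\<close>

definition J :: "'n H1 \<Rightarrow> real" where
  "J u = (norm u)\<^sup>2 / 2 - (\<integral>x. F (rep_H1 u x) \<partial>lborel)"

definition dJ :: "'n H1 \<Rightarrow> 'n H1 \<Rightarrow> real" where
  "dJ u h = u \<bullet> h - (\<integral>x. f (rep_H1 u x) * rep_H1 h x \<partial>lborel)"

lemma integrable_F_rep: "integrable lborel (\<lambda>x. F (rep_H1 (z :: 'n H1) x))"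
proof -
  obtain C where C: "C \<ge> 0" "\<And>t. \<bar>f t\<bar> \<le> C * \<bar>t\<bar> + 1 * \<bar>t\<bar> powr (p - 1)" using growth[of 1] by auto
  show ?thesis
  proof (rule Bochner_Integration.integrable_bound)
    show "integrable lborel (\<lambda>x. C * (rep_H1 z x)\<^sup>2 + 1 * \<bar>rep_H1 z x\<bar> powr p)"
      using L2_square_integrable[OF L2_rep, of z] rep_powr(1)[of z] by simp
    show "AE x in lborel. norm (F (rep_H1 z x)) \<le> norm (C * (rep_H1 z x)\<^sup>2 + 1 * \<bar>rep_H1 z x\<bar> powr p)"
      unfolding real_norm_def using F_growth[OF C(2) C(1)] by (intro AE_I2 order_trans[OF _ abs_ge_self]) auto
  qed simp
qed

lemma integrable_f_rep: "integrable lborel (\<lambda>x. f (rep_H1 u x) * rep_H1 (h :: 'n H1) x)"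
proof -
  obtain C where C: "C \<ge> 0" "\<And>t. \<bar>f t\<bar> \<le> C * \<bar>t\<bar> + 1 * \<bar>t\<bar> powr (p - 1)" using growth[of 1] by auto
  show ?thesis
    by (rule integrable_dominated_pairing[OF L2_rep L2_zero L2_rep rep_powr(1) _ rep_powr(1) _ C(1), of _ 1])
      (use C p in auto)
qed

lemma bounded_linear_f_pairing: "bounded_linear (\<lambda>h :: 'n H1. \<integral>x. f (rep_H1 u x) * rep_H1 h x \<partial>lborel)"
proof -
  let ?L = "\<lambda>h :: 'n H1. \<integral>x. f (rep_H1 u x) * rep_H1 h x \<partial>lborel"
  have add: "?L (h + k) = ?L h + ?L k" for h k
  proof -
    have "?L (h + k) = (\<integral>x. f (rep_H1 u x) * rep_H1 h x + f (rep_H1 u x) * rep_H1 k x \<partial>lborel)"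
      using rep_plus[of h k] by (intro integral_cong_AE) (auto simp: distrib_left)
    then show ?thesis using integrable_f_rep by simp
  qed
  have scale: "?L (c *\<^sub>R h) = c * ?L h" for c h
  proof -
    have "?L (c *\<^sub>R h) = (\<integral>x. c * (f (rep_H1 u x) * rep_H1 h x) \<partial>lborel)"
      using rep_scaleR[of c h] by (intro integral_cong_AE) auto
    then show ?thesis by simp
  qed
  obtain C where C: "C \<ge> 0" "\<And>t. \<bar>f t\<bar> \<le> C * \<bar>t\<bar> + 1 * \<bar>t\<bar> powr (p - 1)" using growth[of 1] by auto
  \<comment> \<open>A bound on the unit ball only: \<open>powr_mult_le\<close> mixes
    \<open>u\<close> and \<open>h\<close> in one power, so the linear dependence on
    \<open>norm h\<close> is recovered by scaling at the end.\<close>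
  define K where "K = C * ((norm u)\<^sup>2 + 1) + 2 powr p * (S * norm u powr p + S)"
  have K: "\<bar>?L h\<bar> \<le> K" if "norm h \<le> 1" for h
  proof -
    let ?u = "rep_H1 u" and ?h = "rep_H1 h"
    have i: "integrable lborel (\<lambda>x. (\<bar>?u x\<bar> + \<bar>?h x\<bar>) powr p)"
      "(\<integral>x. (\<bar>?u x\<bar> + \<bar>?h x\<bar>) powr p \<partial>lborel) \<le> 2 powr p * ((\<integral>x. \<bar>?u x\<bar> powr p \<partial>lborel) + (\<integral>x. \<bar>?h x\<bar> powr p \<partial>lborel))"
      by (intro integrable_add_powr rep_powr(1) measurable_rep)+
    have i2: "integrable lborel (\<lambda>x. (?u x)\<^sup>2)" "integrable lborel (\<lambda>x. (?h x)\<^sup>2)"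
      by (intro L2_square_integrable L2_rep)+
    have "\<bar>?L h\<bar> \<le> (\<integral>x. \<bar>f (?u x) * ?h x\<bar> \<partial>lborel)" by (rule integral_abs_bound)
    also have "\<dots> \<le> (\<integral>x. C * ((?u x)\<^sup>2 + (?h x)\<^sup>2) + (\<bar>?u x\<bar> + \<bar>?h x\<bar>) powr p \<partial>lborel)"
    proof (rule integral_mono)
      show "integrable lborel (\<lambda>x. \<bar>f (?u x) * ?h x\<bar>)" by (intro integrable_abs integrable_f_rep)
      show "integrable lborel (\<lambda>x. C * ((?u x)\<^sup>2 + (?h x)\<^sup>2) + (\<bar>?u x\<bar> + \<bar>?h x\<bar>) powr p)" using i i2 by simp
      fix x
      have "\<bar>f (?u x) * ?h x\<bar> \<le> (C * \<bar>?u x\<bar> + 1 * \<bar>?u x\<bar> powr (p - 1)) * \<bar>?h x\<bar>"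
        unfolding abs_mult by (intro mult_right_mono C) auto
      also have "\<dots> = C * \<bar>?u x * ?h x\<bar> + \<bar>?u x\<bar> powr (p - 1) * \<bar>?h x\<bar>"
        by (simp add: abs_mult algebra_simps)
      also have "\<dots> \<le> C * ((?u x)\<^sup>2 + (?h x)\<^sup>2) + (\<bar>?u x\<bar> + \<bar>?h x\<bar>) powr p"
        using C p by (intro add_mono mult_left_mono powr_mult_le abs_mult_le_squares) auto
      finally show "\<bar>f (?u x) * ?h x\<bar> \<le> C * ((?u x)\<^sup>2 + (?h x)\<^sup>2) + (\<bar>?u x\<bar> + \<bar>?h x\<bar>) powr p" .
    qed
    also have "\<dots> = C * ((\<integral>x. (?u x)\<^sup>2 \<partial>lborel) + (\<integral>x. (?h x)\<^sup>2 \<partial>lborel)) + (\<integral>x. (\<bar>?u x\<bar> + \<bar>?h x\<bar>) powr p \<partial>lborel)"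
      using i i2 by simp
    also have "\<dots> \<le> K"
      unfolding K_def
    proof (intro add_mono mult_left_mono order_trans[OF i(2)])
      show "(\<integral>x. (?h x)\<^sup>2 \<partial>lborel) \<le> 1"
        using that by (intro order_trans[OF integral_rep_squared_le]) (simp add: abs_square_le_1)
      show "(\<integral>x. \<bar>?h x\<bar> powr p \<partial>lborel) \<le> S" using rep_powr_bounded[OF that] by simp
    qed (use C integral_rep_squared_le rep_powr(2) in auto)
    finally show ?thesis .
  qed
  show ?thesis
  proof (rule bounded_linear_intro[of _ K])
    show "norm (?L h) \<le> norm h * K" for h
    proof (cases "h = 0")
      case True
      then show ?thesis using scale[of 0 h] by simp
    next
      case False
      have "\<bar>?L ((1 / norm h) *\<^sub>R h)\<bar> \<le> K" using False by (intro K) simp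
      then have "\<bar>?L h\<bar> / norm h \<le> K" unfolding scale by (simp add: abs_mult)
      then show ?thesis using False by (simp add: pos_divide_le_eq mult.commute)
    qed
  qed (use add scale in auto)
qed

lemma bounded_linear_dJ: "bounded_linear (dJ u)"
  unfolding dJ_def[abs_def]
  by (intro bounded_linear_sub bounded_linear_inner_right bounded_linear_f_pairing)

lemma strong_null_imp_weak_null:
  fixes x :: "nat \<Rightarrow> 'n H1"
  assumes "x \<longlonglongrightarrow> 0" shows "weakly_converges_to x 0"
  unfolding weakly_converges_to_def using assms bounded_linear.tendsto by blast

text \<open>Checked along sequences, where a subsequence of the increments converges a.e. The
  nonlinear remainder is \<open>norm h\<close> times the pairing of the error \<open>d\<close> of
  the difference quotient with the normalised increment \<open>y\<close>, and
  \<open>dominated_pairing_null\<close> applies to that pairing.\<close>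

lemma J_has_derivative: "(J has_derivative dJ u) (at u)"
  unfolding has_derivative_at
proof (intro conjI bounded_linear_dJ)
  define R where "R h = (\<integral>x. F (rep_H1 (u + h) x) \<partial>lborel) - (\<integral>x. F (rep_H1 u x) \<partial>lborel)
    - (\<integral>x. f (rep_H1 u x) * rep_H1 h x \<partial>lborel)" for h
  have JR: "J (u + h) - J u - dJ u h = (norm h)\<^sup>2 / 2 - R h" for h
  proof -
    have "(norm (u + h))\<^sup>2 = (norm u)\<^sup>2 + 2 * (u \<bullet> h) + (norm h)\<^sup>2"
      unfolding power2_norm_eq_inner by (simp add: inner_add_left inner_add_right inner_commute)
    then show ?thesis unfolding J_def dJ_def R_def by linarith
  qed
  show "((\<lambda>h. norm (J (u + h) - J u - dJ u h) / norm h) \<longlongrightarrow> 0) (at 0)"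
    unfolding tendsto_at_iff_sequentially
  proof (intro allI impI LIMSEQ_if_subseq_subseq)
    fix X :: "nat \<Rightarrow> 'n H1" and r :: "nat \<Rightarrow> nat"
    assume X: "\<forall>i. X i \<in> UNIV - {0}" "X \<longlonglongrightarrow> 0" and r: "strict_mono r"
    define h where "h n = X (r n)" for n
    have h0: "h n \<noteq> 0" for n using X(1) by (auto simp: h_def)
    have hlim: "h \<longlonglongrightarrow> 0" using LIMSEQ_subseq_LIMSEQ[OF X(2) r] by (simp add: h_def[abs_def] comp_def)
    obtain B where B: "\<And>n. norm (h n) \<le> B"
      using convergent_imp_bounded[OF hlim] by (auto simp: bounded_iff)
    obtain s where s: "strict_mono s" and ae: "AE x in lborel. (\<lambda>n. rep_H1 (h (s n)) x) \<longlonglongrightarrow> 0"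
      using AE_null_subseq[of "\<lambda>n. rep_H1 (h n)"] L2_rep
        weak_null_imp_pairing_null[OF strong_null_imp_weak_null[OF hlim] B] by blast
    define y where "y n = (1 / norm (h (s n))) *\<^sub>R h (s n)" for n
    have y: "norm (y n) \<le> 1" for n using h0 by (simp add: y_def)
    define a where "a = rep_H1 u"
    define b where "b n = rep_H1 (h (s n))" for n
    \<comment> \<open>The case distinction matters: division by zero would leave the value
      \<open>- f (a x)\<close>.\<close>
    define d where "d n x = (if b n x = 0 then 0 else (F (a x + b n x) - F (a x)) / b n x - f (a x))" for n x
    have [measurable]: "a \<in> borel_measurable borel" "b n \<in> borel_measurable borel" for n
      by (simp_all add: a_def b_def)
    have dm [measurable]: "d n \<in> borel_measurable borel" for n unfolding d_def[abs_def] by measurable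
    have dle: "\<exists>C\<ge>0. \<forall>n x. \<bar>d n x\<bar> \<le> C * (\<bar>a x\<bar> + \<bar>b n x\<bar>) + \<eta> * (\<bar>a x\<bar> + \<bar>b n x\<bar>) powr (p - 1)" if "\<eta> > 0" for \<eta>
    proof -
      obtain C where C: "C \<ge> 0"
        "\<And>r s t. \<bar>s\<bar> \<le> r \<Longrightarrow> \<bar>t\<bar> \<le> r \<Longrightarrow> \<bar>f s\<bar> + \<bar>f t\<bar> \<le> C * r + \<eta> * r powr (p - 1)"
        using growth_two[OF \<open>\<eta> > 0\<close>] by blast
      have "\<bar>d n x\<bar> \<le> C * (\<bar>a x\<bar> + \<bar>b n x\<bar>) + \<eta> * (\<bar>a x\<bar> + \<bar>b n x\<bar>) powr (p - 1)" for n x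
      proof (cases "b n x = 0")
        case False
        obtain t where t: "\<bar>t\<bar> \<le> \<bar>a x\<bar> + \<bar>b n x\<bar>" "F (a x + b n x) - F (a x) = b n x * f t" by (rule F_increment)
        have "\<bar>d n x\<bar> \<le> \<bar>f t\<bar> + \<bar>f (a x)\<bar>" using False t(2) by (simp add: d_def)
        then show ?thesis using C(2)[OF t(1), of "a x"] by simp
      qed (use C that in \<open>simp add: d_def\<close>)
      then show ?thesis using C(1) by blast
    qed
    have dlim: "AE x in lborel. (\<lambda>n. d n x) \<longlonglongrightarrow> 0"
      using ae
    proof (rule AE_mp, intro AE_I2 impI)
      fix x assume l: "(\<lambda>n. rep_H1 (h (s n)) x) \<longlonglongrightarrow> 0"
      let ?q = "\<lambda>t. if t = 0 then 0 else (F (a x + t) - F (a x)) / t - f (a x)"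
      have "((\<lambda>t. (F (a x + t) - F (a x)) / t - f (a x)) \<longlongrightarrow> f (a x) - f (a x)) (at 0)"
        using DERIV_F[of "a x"] unfolding DERIV_def by (intro tendsto_intros)
      then have "((\<lambda>t. (F (a x + t) - F (a x)) / t - f (a x)) \<longlongrightarrow> 0) (at 0)" by simp
      then have "(?q \<longlongrightarrow> 0) (at 0)"
        by (rule Lim_transform_eventually) (auto simp: eventually_at_filter)
      then have "isCont ?q 0" by (simp add: isCont_def)
      from isCont_tendsto_compose[OF this l] show "(\<lambda>n. d n x) \<longlonglongrightarrow> 0"
        unfolding d_def b_def by simp
    qed
    have b_y: "AE x in lborel. b n x = norm (h (s n)) * rep_H1 (y n) x" for n
    proof -
      have "norm (h (s n)) *\<^sub>R y n = h (s n)" using h0 by (simp add: y_def)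
      then show ?thesis using rep_scaleR[of "norm (h (s n))" "y n"] by (simp add: b_def)
    qed
    \<comment> \<open>\<open>b n\<close> is \<open>norm (h (s n))\<close> times the normalised
      increment, whose L2 norm is at most 1.\<close>
    have cross: "(\<lambda>n. \<integral>x. \<bar>b n x\<bar> * \<bar>rep_H1 (y n) x\<bar> \<partial>lborel) \<longlonglongrightarrow> 0"
    proof (rule Lim_null_comparison[OF always_eventually])
      show "(\<lambda>n. norm (h (s n))) \<longlonglongrightarrow> 0"
        using LIMSEQ_subseq_LIMSEQ[OF tendsto_norm_zero[OF hlim] s] by (simp add: comp_def)
      show "\<forall>n. norm (\<integral>x. \<bar>b n x\<bar> * \<bar>rep_H1 (y n) x\<bar> \<partial>lborel) \<le> norm (h (s n))"
      proof
        fix n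
        have "(\<integral>x. \<bar>b n x\<bar> * \<bar>rep_H1 (y n) x\<bar> \<partial>lborel) = (\<integral>x. norm (h (s n)) * (rep_H1 (y n) x)\<^sup>2 \<partial>lborel)"
          using b_y[of n] by (intro integral_cong_AE) (auto simp: abs_mult power2_eq_square abs_mult_self_eq mult.assoc)
        also have "\<dots> \<le> norm (h (s n)) * 1"
          using y[of n] order_trans[OF integral_rep_squared_le[of "y n"]]
          by (subst integral_mult_right_zero, intro mult_left_mono) (auto simp: abs_square_le_1)
        finally show "norm (\<integral>x. \<bar>b n x\<bar> * \<bar>rep_H1 (y n) x\<bar> \<partial>lborel) \<le> norm (h (s n))" by simp
      qed
    qed
    define K where "K = S * max B 1 powr p + 1"
    have null: "(\<lambda>n. \<integral>x. \<bar>d n x\<bar> * \<bar>rep_H1 (y n) x\<bar> \<partial>lborel) \<longlonglongrightarrow> 0"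
    proof (rule dominated_pairing_null[where a = a and b = b and B = K, OF _ _ _ _ _ _ _ _ _ dm dle dlim cross])
      have SK: "S * max B 1 powr p \<le> K" by (simp add: K_def)
      show "(\<integral>x. \<bar>b n x\<bar> powr p \<partial>lborel) \<le> K" for n
        unfolding b_def using B[of "s n"] by (intro order_trans[OF rep_powr_bounded SK]) simp
      show "(\<integral>x. \<bar>rep_H1 (y n) x\<bar> powr p \<partial>lborel) \<le> K" for n
        using y[of n] by (intro order_trans[OF rep_powr_bounded SK]) simp
      show "(\<integral>x. (rep_H1 (y n) x)\<^sup>2 \<partial>lborel) \<le> K" for n
      proof -
        have "(\<integral>x. (rep_H1 (y n) x)\<^sup>2 \<partial>lborel) \<le> 1"
          using y[of n] by (intro order_trans[OF integral_rep_squared_le]) (simp add: abs_square_le_1)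
        then show ?thesis using S by (simp add: K_def add_increasing)
      qed
    qed (simp_all add: a_def b_def L2_rep rep_powr(1))
    have Rle: "\<bar>R (h (s n))\<bar> \<le> norm (h (s n)) * (\<integral>x. \<bar>d n x\<bar> * \<bar>rep_H1 (y n) x\<bar> \<partial>lborel)" for n
    proof -
      have "R (h (s n)) = (\<integral>x. F (rep_H1 (u + h (s n)) x) - F (a x) - f (a x) * b n x \<partial>lborel)"
        unfolding R_def a_def b_def using integrable_F_rep integrable_f_rep by simp
      also have "\<dots> = (\<integral>x. norm (h (s n)) * (d n x * rep_H1 (y n) x) \<partial>lborel)"
      proof (rule integral_cong_AE)
        show "AE x in lborel. F (rep_H1 (u + h (s n)) x) - F (a x) - f (a x) * b n x = norm (h (s n)) * (d n x * rep_H1 (y n) x)"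
          using rep_plus[of u "h (s n)"] b_y[of n]
        proof eventually_elim
          case (elim x)
          have "F (a x + b n x) - F (a x) - f (a x) * b n x = d n x * b n x"
            by (simp add: d_def field_simps)
          then show ?case using elim by (simp add: a_def b_def mult_ac)
        qed
      qed simp_all
      finally have "R (h (s n)) = norm (h (s n)) * (\<integral>x. d n x * rep_H1 (y n) x \<partial>lborel)" by simp
      then show ?thesis
        using integral_abs_bound[of lborel "\<lambda>x. d n x * rep_H1 (y n) x"] by (simp add: abs_mult mult_left_mono)
    qed
    have "(\<lambda>n. norm (J (u + h (s n)) - J u - dJ u (h (s n))) / norm (h (s n))) \<longlonglongrightarrow> 0"
    proof (rule Lim_null_comparison[OF always_eventually])
      have hs: "(\<lambda>n. norm (h (s n))) \<longlonglongrightarrow> 0"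
        using LIMSEQ_subseq_LIMSEQ[OF tendsto_norm_zero[OF hlim] s] by (simp add: comp_def)
      show "(\<lambda>n. norm (h (s n)) / 2 + (\<integral>x. \<bar>d n x\<bar> * \<bar>rep_H1 (y n) x\<bar> \<partial>lborel)) \<longlonglongrightarrow> 0"
        using tendsto_add[OF tendsto_divide_zero[OF hs, of 2] null] by simp
      show "\<forall>n. norm (norm (J (u + h (s n)) - J u - dJ u (h (s n))) / norm (h (s n)))
          \<le> norm (h (s n)) / 2 + (\<integral>x. \<bar>d n x\<bar> * \<bar>rep_H1 (y n) x\<bar> \<partial>lborel)"
      proof
        fix n
        have hp: "norm (h (s n)) > 0" using h0 by simp
        have "\<bar>J (u + h (s n)) - J u - dJ u (h (s n))\<bar> \<le> (norm (h (s n)))\<^sup>2 / 2 + \<bar>R (h (s n))\<bar>"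
          unfolding JR using abs_triangle_ineq4[of "(norm (h (s n)))\<^sup>2 / 2" "R (h (s n))"] by simp
        also have "\<dots> \<le> (norm (h (s n)) / 2 + (\<integral>x. \<bar>d n x\<bar> * \<bar>rep_H1 (y n) x\<bar> \<partial>lborel)) * norm (h (s n))"
          using Rle[of n] by (simp add: distrib_left power2_eq_square mult.commute)
        finally show "norm (norm (J (u + h (s n)) - J u - dJ u (h (s n))) / norm (h (s n)))
            \<le> norm (h (s n)) / 2 + (\<integral>x. \<bar>d n x\<bar> * \<bar>rep_H1 (y n) x\<bar> \<partial>lborel)"
          using hp by (simp add: pos_divide_le_eq)
      qed
    qed
    then show "\<exists>s. strict_mono s \<and> (\<lambda>n. ((\<lambda>h. norm (J (u + h) - J u - dJ u h) / norm h) \<circ> X) (r (s n))) \<longlonglongrightarrow> 0"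
      using s by (auto simp: h_def comp_def)
  qed
qed

text \<open>The inner product passes to the weak limit directly. For the nonlinear term
  \<open>dominated_pairing_null\<close> is used with the constant sequence \<open>h\<close>, whose
  cross term vanishes by weak convergence. A subsequence is enough, as \<open>dJ (x n) h\<close>
  converges to 0 along the whole sequence.\<close>

lemma dJ_weak_limit:
  fixes x :: "nat \<Rightarrow> 'n H1"
  assumes x: "weakly_converges_to x w" and bdd: "bounded (range x)" and lim: "(\<lambda>n. dJ (x n) h) \<longlonglongrightarrow> 0"
  shows "dJ w h = 0"
proof -
  define v where "v n = x n - w" for n
  have v: "weakly_converges_to v 0"
    using weakly_converges_to_diff[OF x weakly_converges_to_const[of w]] by (simp add: v_def[abs_def])
  have "bounded (range v)"
    using bounded_minus_comp[OF bdd, of "\<lambda>_. w"] by (simp add: v_def[abs_def] image_def)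
  then obtain B where B: "\<And>n. norm (v n) \<le> B" by (auto simp: bounded_iff)
  note pn = weak_null_imp_pairing_null[OF v B]
  obtain s where s: "strict_mono s" and ae: "AE t in lborel. (\<lambda>n. rep_H1 (v (s n)) t) \<longlonglongrightarrow> 0"
    using AE_null_subseq[of "\<lambda>n. rep_H1 (v n)"] L2_rep pn by blast
  define a where "a = rep_H1 w"
  define b where "b n = rep_H1 (v (s n))" for n
  define d where "d n t = f (a t + b n t) - f (a t)" for n t
  have [measurable]: "a \<in> borel_measurable borel" "b n \<in> borel_measurable borel" for n
    by (simp_all add: a_def b_def)
  have dm [measurable]: "d n \<in> borel_measurable borel" for n unfolding d_def[abs_def] by measurable
  have dle: "\<exists>C\<ge>0. \<forall>n t. \<bar>d n t\<bar> \<le> C * (\<bar>a t\<bar> + \<bar>b n t\<bar>) + \<eta> * (\<bar>a t\<bar> + \<bar>b n t\<bar>) powr (p - 1)" if "\<eta> > 0" for \<eta>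
  proof -
    obtain C where C: "C \<ge> 0"
      "\<And>r s t. \<bar>s\<bar> \<le> r \<Longrightarrow> \<bar>t\<bar> \<le> r \<Longrightarrow> \<bar>f s\<bar> + \<bar>f t\<bar> \<le> C * r + \<eta> * r powr (p - 1)"
      using growth_two[OF \<open>\<eta> > 0\<close>] by blast
    have "\<bar>d n t\<bar> \<le> C * (\<bar>a t\<bar> + \<bar>b n t\<bar>) + \<eta> * (\<bar>a t\<bar> + \<bar>b n t\<bar>) powr (p - 1)" for n t
      using abs_triangle_ineq4[of "f (a t + b n t)" "f (a t)"] C(2)[OF abs_triangle_ineq[of "a t" "b n t"], of "a t"]
      by (simp add: d_def)
    then show ?thesis using C(1) by blast
  qed
  have dlim: "AE t in lborel. (\<lambda>n. d n t) \<longlonglongrightarrow> 0"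
    using ae
  proof (rule AE_mp, intro AE_I2 impI)
    fix t assume "(\<lambda>n. rep_H1 (v (s n)) t) \<longlonglongrightarrow> 0"
    then have "(\<lambda>n. a t + b n t) \<longlonglongrightarrow> a t" unfolding b_def using tendsto_add[OF tendsto_const] by fastforce
    from isCont_tendsto_compose[OF isCont_f this] show "(\<lambda>n. d n t) \<longlonglongrightarrow> 0"
      unfolding d_def using LIM_zero by blast
  qed
  have cross: "(\<lambda>n. \<integral>t. \<bar>b n t\<bar> * \<bar>rep_H1 h t\<bar> \<partial>lborel) \<longlonglongrightarrow> 0"
    using LIMSEQ_subseq_LIMSEQ[OF pn[OF L2_rep] s] by (simp add: b_def comp_def)
  define K where "K = S * max B (norm h) powr p + (norm h)\<^sup>2"
  have null: "(\<lambda>n. \<integral>t. \<bar>d n t\<bar> * \<bar>rep_H1 h t\<bar> \<partial>lborel) \<longlonglongrightarrow> 0"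
  proof (rule dominated_pairing_null[where a = a and b = b and B = K and \<psi> = "\<lambda>_. rep_H1 h", OF _ _ _ _ _ _ _ _ _ dm dle dlim cross])
    have SK: "S * max B (norm h) powr p \<le> K" by (simp add: K_def)
    show "(\<integral>t. \<bar>b n t\<bar> powr p \<partial>lborel) \<le> K" for n
      unfolding b_def using B[of "s n"] by (intro order_trans[OF rep_powr_bounded SK]) simp
    show "(\<integral>t. \<bar>rep_H1 h t\<bar> powr p \<partial>lborel) \<le> K"
      by (intro order_trans[OF rep_powr_bounded SK]) simp
    show "(\<integral>t. (rep_H1 h t)\<^sup>2 \<partial>lborel) \<le> K"
      using S by (intro order_trans[OF integral_rep_squared_le]) (simp add: K_def)
  qed (simp_all add: a_def b_def L2_rep rep_powr(1))
  have eq: "dJ (x (s n)) h = x (s n) \<bullet> h - (\<integral>t. f (a t) * rep_H1 h t \<partial>lborel) - (\<integral>t. d n t * rep_H1 h t \<partial>lborel)" for n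
  proof -
    have "(\<integral>t. d n t * rep_H1 h t \<partial>lborel) = (\<integral>t. f (rep_H1 (x (s n)) t) * rep_H1 h t - f (a t) * rep_H1 h t \<partial>lborel)"
    proof (rule integral_cong_AE)
      show "AE t in lborel. d n t * rep_H1 h t = f (rep_H1 (x (s n)) t) * rep_H1 h t - f (a t) * rep_H1 h t"
        using rep_diff[of "x (s n)" w] by eventually_elim (simp add: d_def a_def b_def v_def left_diff_distrib)
    qed simp_all
    then show ?thesis unfolding dJ_def a_def using integrable_f_rep by simp
  qed
  have "(\<lambda>n. \<integral>t. d n t * rep_H1 h t \<partial>lborel) \<longlonglongrightarrow> 0"
    by (rule Lim_null_comparison[OF always_eventually null])
      (use integral_abs_bound[of lborel "\<lambda>t. d _ t * rep_H1 h t"] in \<open>simp add: abs_mult\<close>)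
  moreover have "(\<lambda>n. x (s n) \<bullet> h) \<longlonglongrightarrow> w \<bullet> h"
    using weakly_converges_to_subseq[OF x s] by (simp add: weakly_converges_to_iff_inner[OF complete_H1])
  ultimately have "(\<lambda>n. dJ (x (s n)) h) \<longlonglongrightarrow> w \<bullet> h - (\<integral>t. f (a t) * rep_H1 h t \<partial>lborel) - 0"
    unfolding eq by (intro tendsto_diff tendsto_const)
  moreover have "(\<lambda>n. dJ (x (s n)) h) \<longlonglongrightarrow> 0" using LIMSEQ_subseq_LIMSEQ[OF lim s] by (simp add: comp_def)
  ultimately show ?thesis using LIMSEQ_unique by (fastforce simp: dJ_def a_def)
qed

text \<open>The norms split by expanding the square. For \<open>J\<close>,
  \<open>F_splitting\<close> leaves the pairing of \<open>x n - w\<close> with the fixed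
  \<open>w\<close>, which tends to 0, and \<open>\<eta>\<close> times a bounded integral of
  powers.\<close>

lemma weak_limit_splitting:
  fixes x :: "nat \<Rightarrow> 'n H1"
  assumes x: "weakly_converges_to x w" and bdd: "bounded (range x)"
  shows "(\<lambda>n. (norm (x n))\<^sup>2 - (norm (x n - w))\<^sup>2) \<longlonglongrightarrow> (norm w)\<^sup>2"
    and "(\<lambda>n. J (x n) - J (x n - w)) \<longlonglongrightarrow> J w"
proof -
  have "(\<lambda>n. x n \<bullet> w) \<longlonglongrightarrow> w \<bullet> w"
    using x unfolding weakly_converges_to_iff_inner[OF complete_H1] by blast
  then have "(\<lambda>n. 2 * (x n \<bullet> w) - (norm w)\<^sup>2) \<longlonglongrightarrow> 2 * (w \<bullet> w) - (norm w)\<^sup>2"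
    by (intro tendsto_diff tendsto_mult tendsto_const)
  moreover have "2 * (x n \<bullet> w) - (norm w)\<^sup>2 = (norm (x n))\<^sup>2 - (norm (x n - w))\<^sup>2" for n
    unfolding norm_diff_squared by simp
  moreover have "2 * (w \<bullet> w) - (norm w)\<^sup>2 = (norm w)\<^sup>2" by (simp add: power2_norm_eq_inner)
  ultimately show sq: "(\<lambda>n. (norm (x n))\<^sup>2 - (norm (x n - w))\<^sup>2) \<longlonglongrightarrow> (norm w)\<^sup>2" by simp
  define v where "v n = x n - w" for n
  have v: "weakly_converges_to v 0"
    using weakly_converges_to_diff[OF x weakly_converges_to_const[of w]] by (simp add: v_def[abs_def])
  have "bounded (range v)"
    using bounded_minus_comp[OF bdd, of "\<lambda>_. w"] by (simp add: v_def[abs_def] image_def)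
  then obtain B where B: "\<And>n. norm (v n) \<le> B" by (auto simp: bounded_iff)
  let ?D = "\<lambda>n. (\<integral>t. F (rep_H1 (x n) t) \<partial>lborel) - (\<integral>t. F (rep_H1 (v n) t) \<partial>lborel) - (\<integral>t. F (rep_H1 w t) \<partial>lborel)"
  have "?D \<longlonglongrightarrow> 0"
  proof (rule null_by_small_multiples)
    show "(\<lambda>n. \<integral>t. \<bar>rep_H1 (v n) t\<bar> * \<bar>rep_H1 w t\<bar> \<partial>lborel) \<longlonglongrightarrow> 0"
      by (rule weak_null_imp_pairing_null[OF v B L2_rep])
    define K where "K = 2 * (2 powr p * (S * B powr p + S * norm w powr p))"
    show "0 \<le> K" using S by (simp add: K_def)
    fix \<eta> :: real assume \<eta>: "\<eta> > 0"
    then obtain C where C: "C \<ge> 0" "\<And>t. \<bar>f t\<bar> \<le> C * \<bar>t\<bar> + \<eta> * \<bar>t\<bar> powr (p - 1)" using growth by blast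
    have "\<bar>?D n\<bar> \<le> 3 * C * (\<integral>t. \<bar>rep_H1 (v n) t\<bar> * \<bar>rep_H1 w t\<bar> \<partial>lborel) + \<eta> * K" for n
    proof -
      let ?v = "rep_H1 (v n)" and ?w = "rep_H1 w"
      have iP: "integrable lborel (\<lambda>t. (\<bar>?v t\<bar> + \<bar>?w t\<bar>) powr p)"
        and P: "(\<integral>t. (\<bar>?v t\<bar> + \<bar>?w t\<bar>) powr p \<partial>lborel) \<le> 2 powr p * ((\<integral>t. \<bar>?v t\<bar> powr p \<partial>lborel) + (\<integral>t. \<bar>?w t\<bar> powr p \<partial>lborel))"
        by (intro integrable_add_powr rep_powr(1) measurable_rep)+
      have ic: "integrable lborel (\<lambda>t. \<bar>?v t\<bar> * \<bar>?w t\<bar>)" by (intro L2_mult L2_abs L2_rep)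
      have "?D n = (\<integral>t. F (rep_H1 (x n) t) - F (?v t) - F (?w t) \<partial>lborel)"
        using integrable_F_rep by simp
      then have "\<bar>?D n\<bar> \<le> (\<integral>t. \<bar>F (rep_H1 (x n) t) - F (?v t) - F (?w t)\<bar> \<partial>lborel)" by simp
      also have "\<dots> \<le> (\<integral>t. 3 * C * (\<bar>?v t\<bar> * \<bar>?w t\<bar>) + 2 * \<eta> * (\<bar>?v t\<bar> + \<bar>?w t\<bar>) powr p \<partial>lborel)"
      proof (rule integral_mono_AE)
        show "integrable lborel (\<lambda>t. \<bar>F (rep_H1 (x n) t) - F (?v t) - F (?w t)\<bar>)" using integrable_F_rep by simp
        show "integrable lborel (\<lambda>t. 3 * C * (\<bar>?v t\<bar> * \<bar>?w t\<bar>) + 2 * \<eta> * (\<bar>?v t\<bar> + \<bar>?w t\<bar>) powr p)" using ic iP by simp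
        show "AE t in lborel. \<bar>F (rep_H1 (x n) t) - F (?v t) - F (?w t)\<bar> \<le> 3 * C * (\<bar>?v t\<bar> * \<bar>?w t\<bar>) + 2 * \<eta> * (\<bar>?v t\<bar> + \<bar>?w t\<bar>) powr p"
          using rep_diff[of "x n" w]
        proof eventually_elim
          case (elim t)
          then have "rep_H1 (x n) t = ?v t + ?w t" by (simp add: v_def)
          then show ?case using F_splitting[OF C(2) C(1) \<eta>] by simp
        qed
      qed
      also have "\<dots> = 3 * C * (\<integral>t. \<bar>?v t\<bar> * \<bar>?w t\<bar> \<partial>lborel) + 2 * \<eta> * (\<integral>t. (\<bar>?v t\<bar> + \<bar>?w t\<bar>) powr p \<partial>lborel)"
        using ic iP by simp
      also have "\<dots> \<le> 3 * C * (\<integral>t. \<bar>?v t\<bar> * \<bar>?w t\<bar> \<partial>lborel) + 2 * \<eta> * (2 powr p * (S * B powr p + S * norm w powr p))"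
        using \<eta> by (intro add_left_mono mult_left_mono order_trans[OF P] add_mono rep_powr_bounded B rep_powr(2)) auto
      finally show ?thesis by (simp add: K_def mult_ac)
    qed
    then show "\<exists>C. \<forall>n. \<bar>?D n\<bar> \<le> C * (\<integral>t. \<bar>rep_H1 (v n) t\<bar> * \<bar>rep_H1 w t\<bar> \<partial>lborel) + \<eta> * K" by blast
  qed
  from tendsto_diff[OF tendsto_divide[OF sq tendsto_const[of 2]] this]
  have "(\<lambda>n. ((norm (x n))\<^sup>2 - (norm (x n - w))\<^sup>2) / 2 - ?D n - (\<integral>t. F (rep_H1 w t) \<partial>lborel)) \<longlonglongrightarrow> (norm w)\<^sup>2 / 2 - (\<integral>t. F (rep_H1 w t) \<partial>lborel)"
    by (intro tendsto_diff tendsto_const) simp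
  then show "(\<lambda>n. J (x n) - J (x n - w)) \<longlonglongrightarrow> J w"
    unfolding J_def v_def by (simp add: diff_divide_distrib algebra_simps)
qed

text \<open>Solving the expression \<open>dJ (v n + W n) (v n)\<close> for
  \<open>(norm (v n))\<^sup>2\<close> and inserting \<open>f_coercive\<close> produces
  \<open>(1 - m) * (norm (v n))\<^sup>2\<close> on the right. It is absorbed on the left, which
  leaves the factor \<open>m\<close>; all other terms tend to 0 or carry
  \<open>\<eta>\<close>.\<close>

lemma vanishing_remainder_null:
  fixes v W :: "nat \<Rightarrow> 'n H1"
  assumes bv: "bounded (range v)" and bW: "bounded (range W)"
    and super: "(\<lambda>n. \<integral>t. (if \<bar>rep_H1 (v n) t\<bar> > \<delta> / 2 then (rep_H1 (v n) t)\<^sup>2 else 0) \<partial>lborel) \<longlonglongrightarrow> 0"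
    and cross: "(\<lambda>n. \<integral>t. \<bar>rep_H1 (v n) t\<bar> * \<bar>rep_H1 (W n) t\<bar> \<partial>lborel) \<longlonglongrightarrow> 0"
    and orth: "(\<lambda>n. W n \<bullet> v n) \<longlonglongrightarrow> 0" and PS: "(\<lambda>n. dJ (v n + W n) (v n)) \<longlonglongrightarrow> 0"
  shows "(\<lambda>n. norm (v n)) \<longlonglongrightarrow> 0"
proof -
  obtain B where B: "\<And>n. norm (v n) \<le> B" using bv by (auto simp: bounded_iff)
  obtain B' where B': "\<And>n. norm (W n) \<le> B'" using bW by (auto simp: bounded_iff)
  let ?X = "\<lambda>n. \<integral>t. (if \<bar>rep_H1 (v n) t\<bar> > \<delta> / 2 then (rep_H1 (v n) t)\<^sup>2 else 0) \<partial>lborel"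
  let ?Y = "\<lambda>n. \<integral>t. \<bar>rep_H1 (v n) t\<bar> * \<bar>rep_H1 (W n) t\<bar> \<partial>lborel"
  have "(\<lambda>n. m * (norm (v n))\<^sup>2) \<longlonglongrightarrow> 0"
  proof (rule null_by_small_multiples)
    show "(\<lambda>n. \<bar>dJ (v n + W n) (v n)\<bar> + \<bar>W n \<bullet> v n\<bar> + ?X n + ?Y n) \<longlonglongrightarrow> 0"
      using tendsto_add[OF tendsto_add[OF tendsto_add[OF tendsto_rabs[OF PS] tendsto_rabs[OF orth]] super] cross] by simp
    define K where "K = 2 powr p * (S * B powr p + S * B' powr p)"
    show "0 \<le> K" using S by (simp add: K_def)
    fix \<eta> :: real assume \<eta>: "\<eta> > 0"
    then obtain C where C: "C \<ge> 0" "\<And>t. \<bar>f t\<bar> \<le> C * \<bar>t\<bar> + \<eta> * \<bar>t\<bar> powr (p - 1)" using growth by blast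
    \<comment> \<open>Besides the two bounds that \<open>f_coercive\<close> asks for,
      \<open>D \<ge> 1\<close> makes \<open>D\<close> a common factor of all four null
      terms.\<close>
    define D where "D = max 1 (max M (2 * C))"
    have D: "D \<ge> M" "D \<ge> 2 * C" "D \<ge> 1" by (auto simp: D_def)
    have "\<bar>m * (norm (v n))\<^sup>2\<bar> \<le> D * (\<bar>dJ (v n + W n) (v n)\<bar> + \<bar>W n \<bullet> v n\<bar> + ?X n + ?Y n) + \<eta> * K" for n
    proof -
      let ?v = "rep_H1 (v n)" and ?W = "rep_H1 (W n)"
      have iP: "integrable lborel (\<lambda>t. (\<bar>?v t\<bar> + \<bar>?W t\<bar>) powr p)"
        and P: "(\<integral>t. (\<bar>?v t\<bar> + \<bar>?W t\<bar>) powr p \<partial>lborel) \<le> 2 powr p * ((\<integral>t. \<bar>?v t\<bar> powr p \<partial>lborel) + (\<integral>t. \<bar>?W t\<bar> powr p \<partial>lborel))"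
        by (intro integrable_add_powr rep_powr(1) measurable_rep)+
      have ic: "integrable lborel (\<lambda>t. \<bar>?v t\<bar> * \<bar>?W t\<bar>)" by (intro L2_mult L2_abs L2_rep)
      have i2: "integrable lborel (\<lambda>t. (?v t)\<^sup>2)" by (rule L2_square_integrable[OF L2_rep])
      have iX: "integrable lborel (\<lambda>t. if \<bar>?v t\<bar> > \<delta> / 2 then (?v t)\<^sup>2 else 0)"
        by (rule Bochner_Integration.integrable_bound[OF i2]) auto
      have "(\<integral>t. f (rep_H1 (v n + W n) t) * ?v t \<partial>lborel)
          \<le> (\<integral>t. (1 - m) * (?v t)\<^sup>2 + D * (if \<bar>?v t\<bar> > \<delta> / 2 then (?v t)\<^sup>2 else 0)
            + D * (\<bar>?v t\<bar> * \<bar>?W t\<bar>) + \<eta> * (\<bar>?v t\<bar> + \<bar>?W t\<bar>) powr p \<partial>lborel)"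
      proof (rule integral_mono_AE[OF integrable_f_rep])
        show "integrable lborel (\<lambda>t. (1 - m) * (?v t)\<^sup>2 + D * (if \<bar>?v t\<bar> > \<delta> / 2 then (?v t)\<^sup>2 else 0)
            + D * (\<bar>?v t\<bar> * \<bar>?W t\<bar>) + \<eta> * (\<bar>?v t\<bar> + \<bar>?W t\<bar>) powr p)"
          by (intro Bochner_Integration.integrable_add integrable_mult_right i2 iX ic iP)
        show "AE t in lborel. f (rep_H1 (v n + W n) t) * ?v t \<le> (1 - m) * (?v t)\<^sup>2
            + D * (if \<bar>?v t\<bar> > \<delta> / 2 then (?v t)\<^sup>2 else 0) + D * (\<bar>?v t\<bar> * \<bar>?W t\<bar>) + \<eta> * (\<bar>?v t\<bar> + \<bar>?W t\<bar>) powr p"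
          using rep_plus[of "v n" "W n"]
          by eventually_elim (use f_coercive[OF C(2) C(1) \<eta> D(1,2)] in simp)
      qed
      also have "\<dots> = (1 - m) * (\<integral>t. (?v t)\<^sup>2 \<partial>lborel) + D * ?X n + D * ?Y n + \<eta> * (\<integral>t. (\<bar>?v t\<bar> + \<bar>?W t\<bar>) powr p \<partial>lborel)"
        using i2 iX ic iP by simp
      also have "\<dots> \<le> (1 - m) * (norm (v n))\<^sup>2 + D * ?X n + D * ?Y n + \<eta> * K"
        unfolding K_def using \<eta> m
        by (intro add_mono mult_left_mono integral_rep_squared_le order_trans[OF P] rep_powr_bounded B B' order_trans[OF zero_le_one D(3)]) auto
      finally have 1: "(\<integral>t. f (rep_H1 (v n + W n) t) * ?v t \<partial>lborel) \<le> (1 - m) * (norm (v n))\<^sup>2 + D * ?X n + D * ?Y n + \<eta> * K" .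
      have "(norm (v n))\<^sup>2 = dJ (v n + W n) (v n) - W n \<bullet> v n + (\<integral>t. f (rep_H1 (v n + W n) t) * ?v t \<partial>lborel)"
        by (simp add: dJ_def inner_add_left power2_norm_eq_inner)
      then have "m * (norm (v n))\<^sup>2 \<le> \<bar>dJ (v n + W n) (v n)\<bar> + \<bar>W n \<bullet> v n\<bar> + D * ?X n + D * ?Y n + \<eta> * K"
        using 1 unfolding left_diff_distrib by linarith
      also have "\<dots> \<le> D * \<bar>dJ (v n + W n) (v n)\<bar> + D * \<bar>W n \<bullet> v n\<bar> + D * ?X n + D * ?Y n + \<eta> * K"
        using mult_right_mono[OF D(3), of "\<bar>dJ (v n + W n) (v n)\<bar>"] mult_right_mono[OF D(3), of "\<bar>W n \<bullet> v n\<bar>"] by simp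
      finally show ?thesis using m by (simp add: distrib_left)
    qed
    then show "\<exists>C. \<forall>n. \<bar>m * (norm (v n))\<^sup>2\<bar> \<le> C * (\<bar>dJ (v n + W n) (v n)\<bar> + \<bar>W n \<bullet> v n\<bar> + ?X n + ?Y n) + \<eta> * K" by blast
  qed
  from tendsto_divide_zero[OF this, of m] have "(\<lambda>n. (norm (v n))\<^sup>2) \<longlonglongrightarrow> 0" using m by simp
  from tendsto_real_sqrt[OF this] show ?thesis by simp
qed

text \<open>Testing the derivative at \<open>w\<close> with \<open>w\<close> itself bounds
  \<open>m * (norm w)\<^sup>2\<close> by a multiple of \<open>norm w powr p\<close>, and
  \<open>p > 2\<close>.\<close>

lemma critical_point_norm_ge:
  obtains c where "c > 0" "\<And>w :: 'n H1. dJ w w = 0 \<Longrightarrow> w \<noteq> 0 \<Longrightarrow> c \<le> norm w"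
proof -
  obtain C where C: "C > 0" "\<And>t. f t * t \<le> (1 - m) * t\<^sup>2 + C * \<bar>t\<bar> powr p"
    using f_coercive_0 by blast
  \<comment> \<open>The solution of \<open>C * S * c powr (p - 2) = m\<close>.\<close>
  define c where "c = (m / (C * S)) powr (1 / (p - 2))"
  have cp: "c > 0" using m C S by (simp add: c_def)
  moreover have "c \<le> norm w" if w: "dJ w w = 0" "w \<noteq> 0" for w :: "'n H1"
  proof -
    let ?w = "rep_H1 w"
    have i2: "integrable lborel (\<lambda>t. (?w t)\<^sup>2)" by (rule L2_square_integrable[OF L2_rep])
    have "(norm w)\<^sup>2 = (\<integral>t. f (?w t) * ?w t \<partial>lborel)" using w(1) by (simp add: dJ_def power2_norm_eq_inner)
    also have "\<dots> \<le> (\<integral>t. (1 - m) * (?w t)\<^sup>2 + C * \<bar>?w t\<bar> powr p \<partial>lborel)"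
      using i2 rep_powr(1)[of w] by (intro integral_mono integrable_f_rep C) simp
    also have "\<dots> = (1 - m) * (\<integral>t. (?w t)\<^sup>2 \<partial>lborel) + C * (\<integral>t. \<bar>?w t\<bar> powr p \<partial>lborel)"
      using i2 rep_powr(1)[of w] by simp
    also have "\<dots> \<le> (1 - m) * (norm w)\<^sup>2 + C * (S * norm w powr p)"
      using m C by (intro add_mono mult_left_mono integral_rep_squared_le rep_powr(2)) auto
    finally have 1: "m * (norm w)\<^sup>2 \<le> C * S * norm w powr p" by (simp add: algebra_simps)
    have "norm w powr p = norm w powr (p - 2) * norm w powr 2" by (subst powr_add[symmetric]) simp
    then have "norm w powr p = norm w powr (p - 2) * (norm w)\<^sup>2" using w(2) by (simp add: powr_numeral)
    then have "m * (norm w)\<^sup>2 \<le> C * S * norm w powr (p - 2) * (norm w)\<^sup>2" using 1 by (simp add: mult.assoc)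
    then have "m \<le> C * S * norm w powr (p - 2)" using w(2) by (simp add: mult_le_cancel_right)
    then have "m / (C * S) \<le> norm w powr (p - 2)" using C S by (simp add: pos_divide_le_eq mult.commute)
    then have "c \<le> (norm w powr (p - 2)) powr (1 / (p - 2))"
      unfolding c_def using m C S p by (intro powr_mono2) auto
    also have "\<dots> = norm w" using p w(2) by (simp add: powr_powr)
    finally show ?thesis .
  qed
  ultimately show thesis using that by blast
qed

lemma J_translate: "J (translate y u) = J u"
proof -
  have "(\<integral>x. F (rep_H1 (translate y u) x) \<partial>lborel) = (\<integral>x. F (rep_H1 u (x + y)) \<partial>lborel)"
    using rep_translate[of y u] by (intro integral_cong_AE) auto
  also have "\<dots> = (\<integral>x. F (rep_H1 u x) \<partial>lborel)" by (rule lborel_integral_translate) simp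
  finally show ?thesis by (simp add: J_def norm_translate)
qed

lemma dJ_translate: "dJ (translate y u) h = dJ u (translate (- y) h)"
proof -
  have "(\<integral>x. f (rep_H1 u x) * rep_H1 (translate (- y) h) x \<partial>lborel) = (\<integral>x. f (rep_H1 u x) * rep_H1 h (x + - y) \<partial>lborel)"
    using rep_translate[of "- y" h] by (intro integral_cong_AE) auto
  also have "\<dots> = (\<integral>x. f (rep_H1 u (x + y)) * rep_H1 h x \<partial>lborel)"
    using lborel_integral_translate[of "\<lambda>x. f (rep_H1 u x) * rep_H1 h (x + - y)" y] by simp
  also have "\<dots> = (\<integral>x. f (rep_H1 (translate y u) x) * rep_H1 h x \<partial>lborel)"
    using rep_translate[of y u] by (intro integral_cong_AE) auto
  finally show ?thesis by (simp add: dJ_def inner_translate_left)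
qed

lemma J_0: "J 0 = 0"
proof -
  have "(\<integral>x. F (rep_H1 (0 :: 'n H1) x) \<partial>lborel) = 0"
    using rep_zero by (intro integral_eq_zero_AE) (auto simp: F_0)
  then show ?thesis by (simp add: J_def)
qed

lemma J_tendsto_0:
  fixes v :: "nat \<Rightarrow> 'n H1"
  assumes "(\<lambda>n. norm (v n)) \<longlonglongrightarrow> 0" shows "(\<lambda>n. J (v n)) \<longlonglongrightarrow> 0"
proof -
  have "isCont J 0" using has_derivative_continuous[OF J_has_derivative] by simp
  moreover have "v \<longlonglongrightarrow> 0" using assms by (simp add: tendsto_norm_zero_iff)
  ultimately show ?thesis using isCont_tendsto_compose J_0 by fastforce
qed

lemma bounded_Palais_Smale_dJ:
  fixes u h :: "nat \<Rightarrow> 'n H1"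
  assumes PS: "bounded_Palais_Smale J \<beta> u" and h: "bounded (range h)"
  shows "(\<lambda>n. dJ (u n) (h n)) \<longlonglongrightarrow> 0"
proof -
  obtain B where B: "\<And>n. norm (h n) \<le> B" using h by (auto simp: bounded_iff)
  have fd: "frechet_derivative J (at (u n)) = dJ (u n)" for n
    using frechet_derivative_at[OF J_has_derivative] by simp
  have on: "(\<lambda>n. onorm (dJ (u n)) * B) \<longlonglongrightarrow> 0"
    using PS tendsto_mult_left_zero unfolding bounded_Palais_Smale_def fd by blast
  show ?thesis
  proof (rule Lim_null_comparison[OF always_eventually on], intro allI)
    fix n
    have "norm (dJ (u n) (h n)) \<le> onorm (dJ (u n)) * norm (h n)" by (rule onorm[OF bounded_linear_dJ])
    also have "\<dots> \<le> onorm (dJ (u n)) * B" by (intro mult_left_mono B onorm_pos_le bounded_linear_dJ)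
    finally show "norm (dJ (u n) (h n)) \<le> onorm (dJ (u n)) * B" .
  qed
qed

end

section \<open>Profile decompositions\<close>

lemma rep_sum: "AE x in lborel. rep_H1 (\<Sum>i\<in>I. u i) x = (\<Sum>i\<in>I. rep_H1 (u i) x)"
proof (induction I rule: infinite_finite_induct)
  case (insert i I)
  show ?case
    using insert.IH rep_plus[of "u i" "\<Sum>i\<in>I. u i"]
    by eventually_elim (simp add: insert.hyps)
qed (use rep_zero in auto)

lemma not_filterlim_at_top_subseq:
  fixes X :: "nat \<Rightarrow> real"
  assumes "\<not> filterlim X at_top sequentially"
  shows "\<exists>t S. strict_mono (t :: nat \<Rightarrow> nat) \<and> (\<forall>n. X (t n) \<le> S)"
proof -
  obtain S where "\<exists>\<^sub>F n in sequentially. X n \<le> S"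
    using assms unfolding filterlim_at_top_dense by (auto simp: not_eventually not_less)
  then have "infinite {n. X n \<le> S}"
    by (simp add: frequently_cofinite cofinite_eq_sequentially[symmetric])
  then obtain t :: "nat \<Rightarrow> nat" where "strict_mono t" "\<And>n. t n \<in> {n. X n \<le> S}"
    using infinite_enumerate by blast
  then show ?thesis by auto
qed

context critical_problem
begin

text \<open>Since \<open>translate y\<close> maps a function \<open>v\<close> to
  \<open>v (x + y)\<close>, a profile seen in the frame of \<open>y k n\<close> is put back in place
  by \<open>translate (- y k n)\<close>.\<close>

definition remainder ::
    "(nat \<Rightarrow> 'n H1) \<Rightarrow> nat \<Rightarrow> (nat \<Rightarrow> nat) \<Rightarrow> (nat \<Rightarrow> nat \<Rightarrow> real^'n) \<Rightarrow> (nat \<Rightarrow> 'n H1) \<Rightarrow> nat \<Rightarrow> 'n H1" where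
  "remainder u l r y w n = u (r n) - (\<Sum>k=1..l. translate (- y k n) (w k))"

text \<open>The last three conjuncts are the invariants of the induction: the remainder is weakly
  null in the frame of every profile, and squared norm and energy split. Nontriviality starts at
  index 2, because the profile at the prescribed centre 0 may vanish.\<close>

definition profiles ::
    "(nat \<Rightarrow> 'n H1) \<Rightarrow> nat \<Rightarrow> (nat \<Rightarrow> nat) \<Rightarrow> (nat \<Rightarrow> nat \<Rightarrow> real^'n) \<Rightarrow> (nat \<Rightarrow> 'n H1) \<Rightarrow> bool" where
  "profiles u l r y w \<longleftrightarrow> l \<ge> 1 \<and> strict_mono r \<and> (\<forall>n. y 1 n = 0) \<and>
    (\<forall>i j. 1 \<le> i \<and> i < j \<and> j \<le> l \<longrightarrow> filterlim (\<lambda>n. norm (y i n - y j n)) at_top sequentially) \<and>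
    (\<forall>k\<in>{1..l}. weakly_converges_to (\<lambda>n. translate (y k n) (u (r n))) (w k)) \<and>
    (\<forall>k\<in>{2..l}. w k \<noteq> 0) \<and>
    (\<forall>k\<in>{1..l}. weakly_converges_to (\<lambda>n. translate (y k n) (remainder u l r y w n)) 0) \<and>
    (\<lambda>n. (norm (u (r n)))\<^sup>2 - (norm (remainder u l r y w n))\<^sup>2) \<longlonglongrightarrow> (\<Sum>k=1..l. (norm (w k))\<^sup>2) \<and>
    (\<lambda>n. J (u (r n)) - J (remainder u l r y w n)) \<longlonglongrightarrow> (\<Sum>k=1..l. J (w k))"

lemma bounded_remainder:
  assumes "bounded (range u)"
  shows "bounded (range (remainder u l r y w))"
proof -
  obtain B where B: "\<And>n. norm (u n) \<le> B" using assms by (auto simp: bounded_iff)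
  have "norm (remainder u l r y w n) \<le> B + (\<Sum>k=1..l. norm (w k))" for n
  proof -
    have "norm (remainder u l r y w n) \<le> norm (u (r n)) + norm (\<Sum>k=1..l. translate (- y k n) (w k))"
      unfolding remainder_def by (rule norm_triangle_ineq4)
    also have "\<dots> \<le> B + (\<Sum>k=1..l. norm (translate (- y k n) (w k)))"
      by (intro add_mono B norm_sum)
    finally show ?thesis by (simp add: norm_translate)
  qed
  then show ?thesis by (auto simp: bounded_iff)
qed

text \<open>By translation invariance, the derivative at the translate is the derivative at
  \<open>u (r n)\<close> tested with a translate of \<open>h\<close>, whose norm is that of
  \<open>h\<close>.\<close>

lemma Palais_Smale_profile_critical:
  assumes PS: "bounded_Palais_Smale J \<beta> u" and r: "strict_mono r"
    and w: "weakly_converges_to (\<lambda>n. translate (y n) (u (r n))) w"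
  shows "dJ w h = 0"
proof (rule dJ_weak_limit[OF w])
  have PS': "bounded_Palais_Smale J \<beta> (\<lambda>n. u (r n))"
    by (rule bounded_Palais_Smale_subseq[OF PS r])
  moreover have "bounded (range (\<lambda>n. translate (- y n) h))" by (auto simp: bounded_iff norm_translate)
  ultimately show "(\<lambda>n. dJ (translate (y n) (u (r n))) h) \<longlonglongrightarrow> 0"
    unfolding dJ_translate by (rule bounded_Palais_Smale_dJ)
  have "bounded (range (\<lambda>n. u (r n)))" using PS' by (simp add: bounded_Palais_Smale_def)
  then show "bounded (range (\<lambda>n. translate (y n) (u (r n))))" by (rule bounded_range_translate)
qed

lemma profiles_1:
  assumes "bounded (range u)"
  obtains r w where "profiles u 1 r (\<lambda>_ _. 0) w"
proof -
  obtain r w where r: "strict_mono r" and w: "weakly_converges_to (\<lambda>n. u (r n)) w"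
    using bounded_has_weakly_convergent_subseq[OF complete_H1 assms] by blast
  have rem: "remainder u 1 r (\<lambda>_ _. 0) (\<lambda>_. w) n = u (r n) - w" for n
    by (simp add: remainder_def translate_0)
  have bdd: "bounded (range (\<lambda>n. u (r n)))" using assms by (rule bounded_subset) auto
  have "weakly_converges_to (\<lambda>n. u (r n) - w) 0"
    using weakly_converges_to_diff[OF w weakly_converges_to_const[of w]] by simp
  then have "profiles u 1 r (\<lambda>_ _. 0) (\<lambda>_. w)"
    unfolding profiles_def rem using r w weak_limit_splitting[OF w bdd] by (auto simp: translate_0)
  then show thesis by (rule that)
qed

text \<open>A nonzero weak limit of translated remainders is a new profile. If its centres stayed
  within bounded distance of old ones along a subsequence, the remainder would be weakly null there
  too. So they separate, and old and new profiles do not meet in the weak limits.\<close>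

lemma profiles_Suc:
  assumes bdd: "bounded (range u)" and P: "profiles u l r y w"
    and s: "strict_mono s" and z: "weakly_converges_to (\<lambda>n. translate (z n) (remainder u l r y w (s n))) v" and "v \<noteq> 0"
  shows "profiles u (Suc l) (r \<circ> s) (\<lambda>k n. if k = Suc l then z n else y k (s n)) (w(Suc l := v))"
proof -
  let ?y = "\<lambda>k n. if k = Suc l then z n else y k (s n)" and ?w = "w(Suc l := v)"
  let ?R = "remainder u l r y w" and ?R' = "remainder u (Suc l) (r \<circ> s) ?y ?w"
  have l: "l \<ge> 1" and r: "strict_mono r" and y1: "\<And>n. y 1 n = 0"
    and div: "\<And>i j. 1 \<le> i \<Longrightarrow> i < j \<Longrightarrow> j \<le> l \<Longrightarrow> filterlim (\<lambda>n. norm (y i n - y j n)) at_top sequentially"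
    and wk: "\<And>k. k \<in> {1..l} \<Longrightarrow> weakly_converges_to (\<lambda>n. translate (y k n) (u (r n))) (w k)"
    and w0: "\<And>k. k \<in> {2..l} \<Longrightarrow> w k \<noteq> 0"
    and Rk: "\<And>k. k \<in> {1..l} \<Longrightarrow> weakly_converges_to (\<lambda>n. translate (y k n) (?R n)) 0"
    and nrm: "(\<lambda>n. (norm (u (r n)))\<^sup>2 - (norm (?R n))\<^sup>2) \<longlonglongrightarrow> (\<Sum>k=1..l. (norm (w k))\<^sup>2)"
    and Jl: "(\<lambda>n. J (u (r n)) - J (?R n)) \<longlonglongrightarrow> (\<Sum>k=1..l. J (w k))"
    using P unfolding profiles_def by blast+
  have bR: "bounded (range ?R)" by (rule bounded_remainder[OF bdd])
  have bRs: "bounded (range (\<lambda>n. translate (z n) (?R (s n))))"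
    by (rule bounded_range_translate[OF bounded_subset[OF bR]]) auto
  have R': "?R' n = ?R (s n) - translate (- z n) v" for n
  proof -
    have "(\<Sum>k=1..l. translate (- ?y k n) (?w k)) = (\<Sum>k=1..l. translate (- y k (s n)) (w k))"
      by (intro sum.cong) auto
    then show ?thesis by (simp add: remainder_def sum.cl_ivl_Suc)
  qed
  have zR': "translate (z n) (?R' n) = translate (z n) (?R (s n)) - v" for n
    by (simp add: R' translate_diff translate_translate translate_0)
  have zy: "filterlim (\<lambda>n. norm (y k (s n) - z n)) at_top sequentially" if k: "k \<in> {1..l}" for k
  proof (rule ccontr)
    assume nf: "\<not> ?thesis"
    obtain t :: "nat \<Rightarrow> nat" and S where t: "strict_mono t" and S: "\<forall>n. norm (y k (s (t n)) - z (t n)) \<le> S"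
      using not_filterlim_at_top_subseq[OF nf] by blast
    have st: "strict_mono (\<lambda>n. s (t n))" using strict_mono_o[OF s t] by (simp add: comp_def)
    have "weakly_converges_to (\<lambda>n. translate (z (t n) - y k (s (t n))) (translate (y k (s (t n))) (?R (s (t n))))) 0"
    proof (rule weak_null_translate_bounded)
      show "weakly_converges_to (\<lambda>n. translate (y k (s (t n))) (?R (s (t n)))) 0"
        by (rule weakly_converges_to_subseq[OF Rk[OF k] st])
      show "bounded (range (\<lambda>n. translate (y k (s (t n))) (?R (s (t n)))))"
        by (rule bounded_range_translate[OF bounded_subset[OF bR]]) auto
      show "norm (z (t n) - y k (s (t n))) \<le> S" for n using S by (simp add: norm_minus_commute)
    qed
    then have "weakly_converges_to (\<lambda>n. translate (z (t n)) (?R (s (t n)))) 0"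
      by (simp add: translate_translate)
    then have "v = 0" using weak_limit_unique weakly_converges_to_subseq[OF z t] by blast
    then show False using \<open>v \<noteq> 0\<close> by simp
  qed
  have zy': "filterlim (\<lambda>n. norm (z n - y k (s n))) at_top sequentially" if "k \<in> {1..l}" for k
    using zy[OF that] by (simp add: norm_minus_commute)
  \<comment> \<open>In the frame of \<open>z n\<close> the old profiles move off to infinity, so
    \<open>u\<close> and the remainder have the same weak limit.\<close>
  have uz: "weakly_converges_to (\<lambda>n. translate (z n) (u (r (s n)))) v"
  proof -
    have "weakly_converges_to (\<lambda>n. translate (z n) (?R (s n)) + (\<Sum>k=1..l. translate (z n - y k (s n)) (w k))) (v + (\<Sum>k=1..l. 0))"
      by (intro weakly_converges_to_add weakly_converges_to_sum z weak_null_translate_at_infinity zy')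
    moreover have "translate (z n) (?R (s n)) + (\<Sum>k=1..l. translate (z n - y k (s n)) (w k)) = translate (z n) (u (r (s n)))" for n
      by (simp add: remainder_def translate_diff translate_sum translate_translate)
    ultimately show ?thesis by simp
  qed
  have Rk': "weakly_converges_to (\<lambda>n. translate (?y k n) (?R' n)) 0" if "k \<in> {1..Suc l}" for k
  proof (cases "k = Suc l")
    case True
    show ?thesis
      using weakly_converges_to_diff[OF z weakly_converges_to_const[of v]] by (simp add: True zR')
  next
    case False
    then have k: "k \<in> {1..l}" using that by auto
    have "weakly_converges_to (\<lambda>n. translate (y k (s n)) (?R (s n)) - translate (y k (s n) - z n) v) (0 - 0)"
      by (intro weakly_converges_to_diff weakly_converges_to_subseq[OF Rk[OF k] s] weak_null_translate_at_infinity zy k)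
    then show ?thesis using False by (simp add: R' translate_diff translate_translate)
  qed
  \<comment> \<open>The splitting is applied in the frame of the new profile; \<open>norm\<close>
    and \<open>J\<close> are invariant under the translation.\<close>
  note split = weak_limit_splitting[OF z bRs, folded zR']
  have nrm': "(\<lambda>n. (norm (u (r (s n))))\<^sup>2 - (norm (?R' n))\<^sup>2) \<longlonglongrightarrow> (\<Sum>k=1..l. (norm (w k))\<^sup>2) + (norm v)\<^sup>2"
    using tendsto_add[OF LIMSEQ_subseq_LIMSEQ[OF nrm s] split(1)] by (simp add: comp_def norm_translate)
  have J': "(\<lambda>n. J (u (r (s n))) - J (?R' n)) \<longlonglongrightarrow> (\<Sum>k=1..l. J (w k)) + J v"
    using tendsto_add[OF LIMSEQ_subseq_LIMSEQ[OF Jl s] split(2)] by (simp add: comp_def J_translate)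
  have sums: "(\<Sum>k=1..Suc l. (norm (?w k))\<^sup>2) = (\<Sum>k=1..l. (norm (w k))\<^sup>2) + (norm v)\<^sup>2"
    "(\<Sum>k=1..Suc l. J (?w k)) = (\<Sum>k=1..l. J (w k)) + J v"
    by (simp_all add: sum.cl_ivl_Suc)
  show ?thesis
    unfolding profiles_def
  proof (intro conjI allI impI ballI)
    show "strict_mono (r \<circ> s)" by (rule strict_mono_o[OF r s])
    show "?y 1 n = 0" for n using l y1 by simp
    show "filterlim (\<lambda>n. norm (?y i n - ?y j n)) at_top sequentially" if ij: "1 \<le> i \<and> i < j \<and> j \<le> Suc l" for i j
    proof (cases "j = Suc l")
      case True
      then show ?thesis using zy[of i] ij by simp
    next
      case False
      then have "filterlim (\<lambda>n. norm (y i (s n) - y j (s n))) at_top sequentially"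
        using filterlim_compose[OF div[of i j] filterlim_subseq[OF s]] ij by simp
      then show ?thesis using False ij by simp
    qed
    show "weakly_converges_to (\<lambda>n. translate (?y k n) (u ((r \<circ> s) n))) (?w k)" if "k \<in> {1..Suc l}" for k
      using uz weakly_converges_to_subseq[OF wk s, of k] that by (cases "k = Suc l") auto
    show "?w k \<noteq> 0" if "k \<in> {2..Suc l}" for k
      using w0[of k] \<open>v \<noteq> 0\<close> that by (cases "k = Suc l") auto
    show "weakly_converges_to (\<lambda>n. translate (?y k n) (?R' n)) 0" if "k \<in> {1..Suc l}" for k
      by (rule Rk'[OF that])
    show "(\<lambda>n. (norm (u ((r \<circ> s) n)))\<^sup>2 - (norm (?R' n))\<^sup>2) \<longlonglongrightarrow> (\<Sum>k=1..Suc l. (norm (?w k))\<^sup>2)"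
      unfolding sums comp_def using nrm' by (simp add: comp_def)
    show "(\<lambda>n. J (u ((r \<circ> s) n)) - J (?R' n)) \<longlonglongrightarrow> (\<Sum>k=1..Suc l. J (?w k))"
      unfolding sums comp_def using J' by (simp add: comp_def)
  qed simp
qed

text \<open>The squared norms of the profiles sum to at most \<open>B\<^sup>2\<close>, and all norms
  but the first are at least \<open>c\<close>, so
  \<open>real (l - 1) * c\<^sup>2 \<le> B\<^sup>2\<close>.\<close>

lemma profiles_bounded:
  assumes PS: "bounded_Palais_Smale J \<beta> u"
  obtains L where "\<And>l r y w. profiles u l r y w \<Longrightarrow> l \<le> L"
proof -
  obtain B where B: "\<And>n. norm (u n) \<le> B"
    using PS unfolding bounded_Palais_Smale_def by (auto simp: bounded_iff)
  obtain c where c: "c > 0" "\<And>w :: 'n H1. dJ w w = 0 \<Longrightarrow> w \<noteq> 0 \<Longrightarrow> c \<le> norm w"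
    by (rule critical_point_norm_ge) blast
  obtain L :: nat where L: "B\<^sup>2 / c\<^sup>2 + 1 < real L" using reals_Archimedean2 by blast
  have "l \<le> L" if P: "profiles u l r y w" for l r y w
  proof -
    have r: "strict_mono r" and wk: "\<And>k. k \<in> {1..l} \<Longrightarrow> weakly_converges_to (\<lambda>n. translate (y k n) (u (r n))) (w k)"
      and w0: "\<And>k. k \<in> {2..l} \<Longrightarrow> w k \<noteq> 0"
      and nrm: "(\<lambda>n. (norm (u (r n)))\<^sup>2 - (norm (remainder u l r y w n))\<^sup>2) \<longlonglongrightarrow> (\<Sum>k=1..l. (norm (w k))\<^sup>2)"
      using P unfolding profiles_def by blast+
    have "(\<Sum>k=1..l. (norm (w k))\<^sup>2) \<le> B\<^sup>2"
    proof (rule LIMSEQ_le_const2[OF nrm], intro exI[of _ 0] allI impI)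
      fix n
      have "(norm (u (r n)))\<^sup>2 \<le> B\<^sup>2" using B by (intro power_mono) auto
      then show "(norm (u (r n)))\<^sup>2 - (norm (remainder u l r y w n))\<^sup>2 \<le> B\<^sup>2"
        using zero_le_power2[of "norm (remainder u l r y w n)"] by linarith
    qed
    moreover have "(\<Sum>k\<in>{2..l}. c\<^sup>2) \<le> (\<Sum>k=1..l. (norm (w k))\<^sup>2)"
    proof -
      have "c\<^sup>2 \<le> (norm (w k))\<^sup>2" if k: "k \<in> {2..l}" for k
      proof (rule power_mono)
        have "dJ (w k) (w k) = 0" using k by (intro Palais_Smale_profile_critical[OF PS r wk]) auto
        then show "c \<le> norm (w k)" using c(2) w0[OF k] by blast
      qed (use c in simp)
      then have "(\<Sum>k\<in>{2..l}. c\<^sup>2) \<le> (\<Sum>k\<in>{2..l}. (norm (w k))\<^sup>2)" by (rule sum_mono)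
      also have "\<dots> \<le> (\<Sum>k=1..l. (norm (w k))\<^sup>2)" by (rule sum_mono2) auto
      finally show ?thesis .
    qed
    ultimately have "real (l - 1) * c\<^sup>2 \<le> B\<^sup>2" by simp
    then have "real (l - 1) \<le> B\<^sup>2 / c\<^sup>2" using c(1) by (simp add: pos_le_divide_eq)
    then have "real (l - 1) + 1 < real L" using L by linarith
    then show ?thesis by linarith
  qed
  then show thesis using that by blast
qed

lemma maximal_profiles_remainder_null:
  assumes PS: "bounded_Palais_Smale J \<beta> u" and P: "profiles u l r y w"
    and max: "\<And>r y w. \<not> profiles u (Suc l) r y w"
  shows "(\<lambda>n. norm (remainder u l r y w n)) \<longlonglongrightarrow> 0"
proof -
  let ?R = "remainder u l r y w" and ?W = "\<lambda>n. \<Sum>k=1..l. translate (- y k n) (w k)"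
  have bdd: "bounded (range u)" using PS by (simp add: bounded_Palais_Smale_def)
  have r: "strict_mono r" and Rk: "\<And>k. k \<in> {1..l} \<Longrightarrow> weakly_converges_to (\<lambda>n. translate (y k n) (?R n)) 0"
    using P unfolding profiles_def by blast+
  have bR: "bounded (range ?R)" by (rule bounded_remainder[OF bdd])
  then obtain B where B: "\<And>n. norm (?R n) \<le> B" by (auto simp: bounded_iff)
  have RW: "?R n + ?W n = u (r n)" for n by (simp add: remainder_def)
  show ?thesis
  proof (rule vanishing_remainder_null[OF bR])
    have "norm (?W n) \<le> (\<Sum>k=1..l. norm (w k))" for n
      using norm_sum[of "\<lambda>k. translate (- y k n) (w k)" "{1..l}"] by (simp add: norm_translate)
    then show "bounded (range ?W)" by (auto simp: bounded_iff)
    show "(\<lambda>n. \<integral>t. (if \<bar>rep_H1 (?R n) t\<bar> > \<delta> / 2 then (rep_H1 (?R n) t)\<^sup>2 else 0) \<partial>lborel) \<longlonglongrightarrow> 0"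
    proof (rule vanishing_superlevel[OF bR])
      fix s z v assume "strict_mono s" "weakly_converges_to (\<lambda>n. translate (z n) (?R (s n))) v"
      \<comment> \<open>Maximality: a nonzero limit would extend the family.\<close>
      then show "v = 0" using profiles_Suc[OF bdd P] max by blast
    qed (use \<delta> in simp)
    show "(\<lambda>n. ?W n \<bullet> ?R n) \<longlonglongrightarrow> 0"
    proof -
      have "?W n \<bullet> ?R n = (\<Sum>k=1..l. translate (y k n) (?R n) \<bullet> w k)" for n
        unfolding inner_sum_left by (intro sum.cong refl) (metis inner_commute inner_translate_left)
      moreover have "(\<lambda>n. \<Sum>k=1..l. translate (y k n) (?R n) \<bullet> w k) \<longlonglongrightarrow> (\<Sum>k=1..l. 0 \<bullet> w k)"
        using Rk unfolding weakly_converges_to_iff_inner[OF complete_H1] by (intro tendsto_sum) blast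
      ultimately show ?thesis by simp
    qed
    show "(\<lambda>n. dJ (?R n + ?W n) (?R n)) \<longlonglongrightarrow> 0"
      unfolding RW by (rule bounded_Palais_Smale_dJ[OF bounded_Palais_Smale_subseq[OF PS r] bR])
    \<comment> \<open>The triangle inequality gives a sum over the profiles; each summand is shifted
      into the frame of its own profile, where the remainder is weakly null and the other factor is
      fixed.\<close>
    show "(\<lambda>n. \<integral>t. \<bar>rep_H1 (?R n) t\<bar> * \<bar>rep_H1 (?W n) t\<bar> \<partial>lborel) \<longlonglongrightarrow> 0"
    proof (rule Lim_null_comparison[OF always_eventually], intro allI)
      have "(\<lambda>n. \<Sum>k=1..l. \<integral>t. \<bar>rep_H1 (translate (y k n) (?R n)) t\<bar> * \<bar>rep_H1 (w k) t\<bar> \<partial>lborel) \<longlonglongrightarrow> (\<Sum>k=1..l. 0)"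
      proof (intro tendsto_sum weak_null_imp_pairing_null[OF Rk] L2_rep)
        show "norm (translate (y k n) (?R n)) \<le> B" for k n using B by (simp add: norm_translate)
      qed
      then show "(\<lambda>n. \<Sum>k=1..l. \<integral>t. \<bar>rep_H1 (translate (y k n) (?R n)) t\<bar> * \<bar>rep_H1 (w k) t\<bar> \<partial>lborel) \<longlonglongrightarrow> 0" by simp
      fix n
      have i: "integrable lborel (\<lambda>t. \<bar>rep_H1 v t\<bar> * \<bar>rep_H1 v' t\<bar>)" for v v' :: "'n H1"
        by (intro L2_mult L2_abs L2_rep)
      have "(\<integral>t. \<bar>rep_H1 (?R n) t\<bar> * \<bar>rep_H1 (?W n) t\<bar> \<partial>lborel)
          \<le> (\<integral>t. (\<Sum>k=1..l. \<bar>rep_H1 (?R n) t\<bar> * \<bar>rep_H1 (translate (- y k n) (w k)) t\<bar>) \<partial>lborel)"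
      proof (rule integral_mono_AE[OF i])
        show "integrable lborel (\<lambda>t. \<Sum>k=1..l. \<bar>rep_H1 (?R n) t\<bar> * \<bar>rep_H1 (translate (- y k n) (w k)) t\<bar>)"
          by (intro Bochner_Integration.integrable_sum i)
        show "AE t in lborel. \<bar>rep_H1 (?R n) t\<bar> * \<bar>rep_H1 (?W n) t\<bar>
            \<le> (\<Sum>k=1..l. \<bar>rep_H1 (?R n) t\<bar> * \<bar>rep_H1 (translate (- y k n) (w k)) t\<bar>)"
          using rep_sum[of "\<lambda>k. translate (- y k n) (w k)" "{1..l}"]
          by eventually_elim (simp add: sum_distrib_left[symmetric] mult_left_mono sum_abs)
      qed
      also have "\<dots> = (\<Sum>k=1..l. \<integral>t. \<bar>rep_H1 (?R n) t\<bar> * \<bar>rep_H1 (translate (- y k n) (w k)) t\<bar> \<partial>lborel)"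
        by (intro Bochner_Integration.integral_sum i)
      also have "\<dots> = (\<Sum>k=1..l. \<integral>t. \<bar>rep_H1 (translate (y k n) (?R n)) t\<bar> * \<bar>rep_H1 (w k) t\<bar> \<partial>lborel)"
      proof (rule sum.cong[OF refl])
        fix k
        let ?G = "\<lambda>t. \<bar>rep_H1 (?R n) t\<bar> * \<bar>rep_H1 (w k) (t + - y k n)\<bar>"
        have "(\<integral>t. \<bar>rep_H1 (?R n) t\<bar> * \<bar>rep_H1 (translate (- y k n) (w k)) t\<bar> \<partial>lborel) = (\<integral>t. ?G t \<partial>lborel)"
          using rep_translate[of "- y k n" "w k"] by (intro integral_cong_AE) auto
        also have "\<dots> = (\<integral>t. ?G (t + y k n) \<partial>lborel)"
          by (rule lborel_integral_translate[symmetric]) simp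
        also have "\<dots> = (\<integral>t. \<bar>rep_H1 (translate (y k n) (?R n)) t\<bar> * \<bar>rep_H1 (w k) t\<bar> \<partial>lborel)"
          using rep_translate[of "y k n" "?R n"] by (intro integral_cong_AE) auto
        finally show "(\<integral>t. \<bar>rep_H1 (?R n) t\<bar> * \<bar>rep_H1 (translate (- y k n) (w k)) t\<bar> \<partial>lborel)
            = (\<integral>t. \<bar>rep_H1 (translate (y k n) (?R n)) t\<bar> * \<bar>rep_H1 (w k) t\<bar> \<partial>lborel)" .
      qed
      finally show "norm (\<integral>t. \<bar>rep_H1 (?R n) t\<bar> * \<bar>rep_H1 (?W n) t\<bar> \<partial>lborel)
          \<le> (\<Sum>k=1..l. \<integral>t. \<bar>rep_H1 (translate (y k n) (?R n)) t\<bar> * \<bar>rep_H1 (w k) t\<bar> \<partial>lborel)" by simp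
    qed
  qed
qed

theorem Palais_Smale_decomposition:
  assumes PS: "bounded_Palais_Smale J \<beta> u"
  obtains l r y w where "profiles u l r y w" "(\<lambda>n. norm (remainder u l r y w n)) \<longlonglongrightarrow> 0"
proof -
  have bdd: "bounded (range u)" using PS by (simp add: bounded_Palais_Smale_def)
  obtain L where L: "\<And>l r y w. profiles u l r y w \<Longrightarrow> l \<le> L" by (rule profiles_bounded[OF PS]) blast
  let ?Q = "\<lambda>l. \<exists>r y w. profiles u l r y w"
  have "?Q 1" using profiles_1[OF bdd] by metis
  define l where "l = Greatest ?Q"
  have "?Q l" unfolding l_def by (rule GreatestI_nat[of ?Q 1 L]) (use \<open>?Q 1\<close> L in blast)+
  then obtain r y w where P: "profiles u l r y w" by blast
  have "\<not> ?Q (Suc l)"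
  proof
    assume "?Q (Suc l)"
    then have "Suc l \<le> l" unfolding l_def by (rule Greatest_le_nat[of ?Q _ L]) (use L in blast)
    then show False by simp
  qed
  then show thesis using that[OF P maximal_profiles_remainder_null[OF PS P]] by blast
qed

end

section \<open>The nonlinearity of the theorem\<close>

lemma primitive_has_derivative:
  assumes "continuous_on UNIV g"
  shows "(primitive g has_real_derivative g t) (at t)"
proof -
  \<comment> \<open>An interval with 0 and \<open>t\<close> in its interior, so that the derivative
    within it is the full derivative at \<open>t\<close>.\<close>
  let ?a = "- \<bar>t\<bar> - 1" and ?b = "\<bar>t\<bar> + 1"
  have "((\<lambda>u. LBINT y=ereal 0..ereal u. g y) has_vector_derivative g t) (at t within {?a..?b})"
    by (rule interval_integral_FTC2) (auto intro: continuous_on_subset[OF assms])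
  then have "(primitive g has_vector_derivative g t) (at t within {?a..?b})"
    by (simp add: primitive_def[abs_def] zero_ereal_def)
  moreover have "at t within {?a..?b} = at t" by (rule at_within_interior) (auto simp: interior_atLeastAtMost_real)
  ultimately show ?thesis by (simp add: has_real_derivative_iff_has_vector_derivative)
qed

lemma primitive_0: "primitive g 0 = 0"
  by (simp add: primitive_def flip: zero_ereal_def)

text \<open>Linear near 0, and at most \<open>\<eta>\<close> times the power far out. In between
  \<open>g\<close> is bounded by compactness, and there a constant is at most a multiple of
  \<open>\<bar>t\<bar>\<close> because \<open>\<bar>t\<bar> > \<delta>\<close>.\<close>

lemma subcritical_growth:
  fixes g :: "real \<Rightarrow> real" and q :: real
  assumes g: "continuous_on UNIV g" and \<delta>: "\<delta> > 0"
    and near: "\<And>t. \<bar>t\<bar> \<le> \<delta> \<Longrightarrow> \<bar>g t\<bar> \<le> K * \<bar>t\<bar>"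
    and inf: "((\<lambda>t. g t / \<bar>t\<bar> powr q) \<longlongrightarrow> 0) at_infinity" and \<eta>: "\<eta> > 0"
  shows "\<exists>C\<ge>0. \<forall>t. \<bar>g t\<bar> \<le> C * \<bar>t\<bar> + \<eta> * \<bar>t\<bar> powr q"
proof -
  have "\<forall>\<^sub>F t in at_infinity. \<bar>g t / \<bar>t\<bar> powr q\<bar> < \<eta>"
    using order_tendstoD(2)[OF tendsto_rabs_zero[OF inf] \<eta>] .
  then obtain b where b: "\<And>t. b \<le> \<bar>t\<bar> \<Longrightarrow> \<bar>g t / \<bar>t\<bar> powr q\<bar> < \<eta>"
    unfolding eventually_at_infinity real_norm_def by blast
  define R where "R = max b 1"
  have far: "\<bar>g t\<bar> \<le> \<eta> * \<bar>t\<bar> powr q" if "\<bar>t\<bar> \<ge> R" for t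
  proof -
    have "\<bar>t\<bar> powr q > 0" using that by (auto simp: R_def)
    then show ?thesis using b[of t] that by (simp add: R_def abs_divide pos_divide_less_eq less_imp_le)
  qed
  have "compact (g ` {-R..R})"
    by (intro compact_continuous_image continuous_on_subset[OF g]) auto
  then have "bounded (g ` {-R..R})" by (rule compact_imp_bounded)
  then obtain A where "\<forall>x\<in>g ` {-R..R}. norm x \<le> A" unfolding bounded_iff by blast
  then have A: "\<And>t. t \<in> {-R..R} \<Longrightarrow> \<bar>g t\<bar> \<le> A" by simp
  define C where "C = max 0 K + \<bar>A\<bar> / \<delta>"
  have C: "C \<ge> 0" using \<delta> by (simp add: C_def)
  have "\<bar>g t\<bar> \<le> C * \<bar>t\<bar> + \<eta> * \<bar>t\<bar> powr q" for t
  proof -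
    have p0: "0 \<le> \<eta> * \<bar>t\<bar> powr q" "0 \<le> C * \<bar>t\<bar>" using \<eta> C by simp_all
    consider "\<bar>t\<bar> \<le> \<delta>" | "\<bar>t\<bar> \<ge> R" | "\<bar>t\<bar> > \<delta>" "\<bar>t\<bar> < R" by linarith
    then show ?thesis
    proof cases
      case 1
      have "K * \<bar>t\<bar> \<le> C * \<bar>t\<bar>" using \<delta> by (intro mult_right_mono) (auto simp: C_def add_increasing2)
      then show ?thesis using near[OF 1] p0 by linarith
    next
      case 2
      then show ?thesis using far[OF 2] p0 by linarith
    next
      case 3
      have "\<bar>g t\<bar> \<le> \<bar>A\<bar>" using A[of t] 3 by (auto simp: abs_less_iff)
      also have "\<bar>A\<bar> = \<bar>A\<bar> / \<delta> * \<delta>" using \<delta> by simp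
      also have "\<dots> \<le> C * \<bar>t\<bar>" using 3 \<delta> by (intro mult_mono) (auto simp: C_def)
      finally show ?thesis using p0 by linarith
    qed
  qed
  then show ?thesis using C by blast
qed

text \<open>The two limits confine the slope \<open>g t / t\<close> near 0 to an interval with
  negative upper end. The slope is stated as a factor \<open>c\<close> so that \<open>t = 0\<close>
  is covered.\<close>

lemma mass_near_0:
  fixes g :: "real \<Rightarrow> real"
  assumes g: "continuous_on UNIV g"
    and lo: "- \<infinity> < Liminf (at 0) (\<lambda>t. ereal (g t / t))"
    and hi: "Limsup (at 0) (\<lambda>t. ereal (g t / t)) < 0"
  obtains m \<delta> K where "0 < m" "m \<le> 1" "\<delta> > 0" "K \<ge> 0"
    "\<And>t. \<bar>t\<bar> \<le> \<delta> \<Longrightarrow> \<exists>c. g t = c * t \<and> \<bar>c\<bar> \<le> K \<and> c \<le> - m"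
proof -
  obtain a where a: "ereal a < Liminf (at 0) (\<lambda>t. ereal (g t / t))"
    using ereal_dense2[OF lo] by blast
  obtain b where b: "Limsup (at 0) (\<lambda>t. ereal (g t / t)) < ereal b" "ereal b < 0"
    using ereal_dense2[OF hi] by blast
  have "\<forall>\<^sub>F t in at 0. a < g t / t \<and> g t / t < b"
    using less_LiminfD[OF a] Limsup_lessD[OF b(1)] by eventually_elim simp
  then obtain d where d: "d > 0" "\<And>t. t \<noteq> 0 \<Longrightarrow> \<bar>t\<bar> < d \<Longrightarrow> a < g t / t \<and> g t / t < b"
    unfolding eventually_at by (auto simp: dist_real_def)
  \<comment> \<open>Capped at 1 because the coercivity estimates use \<open>1 - m \<ge> 0\<close>.
    The 1 inside \<open>K\<close> makes \<open>c = - m\<close> admissible at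
    \<open>t = 0\<close>.\<close>
  define m where "m = min (- b) 1"
  define K where "K = max \<bar>a\<bar> (max \<bar>b\<bar> 1)"
  have m: "0 < m" "m \<le> 1" using b(2) by (auto simp: m_def)
  have ne: "\<exists>c. g t = c * t \<and> \<bar>c\<bar> \<le> K \<and> c \<le> - m" if "t \<noteq> 0" "\<bar>t\<bar> < d" for t
    using d(2)[OF that] that(1) by (intro exI[of _ "g t / t"]) (auto simp: K_def m_def)
  \<comment> \<open>The limits at 0 do not involve the value there; it follows from the linear bound
    by continuity.\<close>
  have "g 0 = 0"
  proof -
    have "(g \<longlongrightarrow> 0) (at 0)"
    proof (rule Lim_null_comparison)
      show "((\<lambda>t. K * \<bar>t\<bar>) \<longlongrightarrow> 0) (at 0)" by (intro tendsto_mult_right_zero tendsto_rabs_zero tendsto_ident_at)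
      have "norm (g t) \<le> K * \<bar>t\<bar>" if t: "t \<noteq> 0" "\<bar>t\<bar> < d" for t
      proof -
        obtain c where "g t = c * t" "\<bar>c\<bar> \<le> K" using ne[OF t] by blast
        then show ?thesis by (simp add: abs_mult mult_right_mono)
      qed
      then show "\<forall>\<^sub>F t in at 0. norm (g t) \<le> K * \<bar>t\<bar>"
        unfolding eventually_at using d(1) by (auto simp: dist_real_def)
    qed
    moreover have "(g \<longlongrightarrow> g 0) (at 0)"
      using g by (simp add: continuous_on_eq_continuous_at isCont_def)
    ultimately show ?thesis using LIM_unique by blast
  qed
  then have z: "\<exists>c. g 0 = c * 0 \<and> \<bar>c\<bar> \<le> K \<and> c \<le> - m"
    using m by (intro exI[of _ "- m"]) (auto simp: K_def m_def)
  show thesis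
  proof (rule that[OF m, of "d / 2" K])
    show "\<exists>c. g t = c * t \<and> \<bar>c\<bar> \<le> K \<and> c \<le> - m" if "\<bar>t\<bar> \<le> d / 2" for t
      using ne[of t] z that d(1) by (cases "t = 0") auto
  qed (use d in \<open>auto simp: K_def\<close>)
qed

theorem theorem3p1:
  fixes g :: "real \<Rightarrow> real"
    and u :: "nat \<Rightarrow> 'n::finite H1"
    and \<beta> :: real
  assumes "CARD('n) \<ge> 3"
    and "continuous_on UNIV g"
    and "- \<infinity> < Liminf (at 0) (\<lambda>t. ereal (g t / t))"
    and "Limsup (at 0) (\<lambda>t. ereal (g t / t)) < 0"
    and "((\<lambda>t. g t / \<bar>t\<bar> powr ((real CARD('n) + 2) / (real CARD('n) - 2))) \<longlongrightarrow> 0) at_infinity"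
    and "bounded_Palais_Smale (energy g) \<beta> u"
  shows "\<exists>(r :: nat \<Rightarrow> nat) (l :: nat) (y :: nat \<Rightarrow> nat \<Rightarrow> real^'n) (w :: nat \<Rightarrow> 'n H1).
    strict_mono r \<and> l \<ge> 1 \<and>
    (\<forall>n. y 1 n = 0) \<and>
    (\<forall>i j. 1 \<le> i \<and> i < j \<and> j \<le> l \<longrightarrow> filterlim (\<lambda>n. norm (y i n - y j n)) at_top sequentially) \<and>
    (\<forall>k\<in>{1..l}. weakly_converges_to (\<lambda>n. translate (y k n) (u (r n))) (w k) \<and>
       (energy g has_derivative (\<lambda>_. 0)) (at (w k))) \<and>
    (\<forall>k\<in>{2..l}. w k \<noteq> 0) \<and>
    (\<lambda>n. energy g (u (r n))) \<longlonglongrightarrow> \<beta> \<and> \<beta> = (\<Sum>k=1..l. energy g (w k)) \<and>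
    (\<lambda>n. norm (u (r n) - (\<Sum>k=1..l. translate (- y k n) (w k)))) \<longlonglongrightarrow> 0"
proof -
  define p where "p = crit_exp TYPE('n)"
  have N: "real CARD('n) \<ge> 3" using assms(1) by simp
  have p: "p > 2" "p - 1 = (real CARD('n) + 2) / (real CARD('n) - 2)"
    using N by (auto simp: p_def crit_exp_def field_simps)
  obtain m \<delta> K where m: "0 < m" "m \<le> 1" and \<delta>: "\<delta> > 0" and K: "K \<ge> 0"
    and near: "\<And>t. \<bar>t\<bar> \<le> \<delta> \<Longrightarrow> \<exists>c. g t = c * t \<and> \<bar>c\<bar> \<le> K \<and> c \<le> - m"
    using mass_near_0[OF assms(2-4)] by metis
  obtain S where S: "S > 0"
    "\<And>z::'n H1. norm z \<le> 1 \<Longrightarrow> (\<integral>\<^sup>+x. ennreal (\<bar>rep_H1 z x\<bar> powr p) \<partial>lborel) \<le> ennreal S"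
    using Sobolev_unit_ball[OF assms(1)] unfolding p_def by metis
  define f where "f t = t + g t" for t
  define F where "F t = t\<^sup>2 / 2 + primitive g t" for t
  \<comment> \<open>Where \<open>g\<close> has slope \<open>c\<close>, \<open>f\<close> has slope
    \<open>1 + c\<close>, hence the bound \<open>1 + K\<close>.\<close>
  interpret critical_problem f F p m "1 + K" \<delta> S "TYPE('n)"
  proof
    show "continuous_on UNIV f" unfolding f_def by (intro continuous_intros assms(2))
    show "(F has_real_derivative f t) (at t)" for t
      unfolding F_def f_def by (auto intro!: derivative_eq_intros primitive_has_derivative assms(2))
    show "F 0 = 0" by (simp add: F_def primitive_0)
    show "\<exists>C\<ge>0. \<forall>t. \<bar>f t\<bar> \<le> C * \<bar>t\<bar> + \<eta> * \<bar>t\<bar> powr (p - 1)" if "\<eta> > 0" for \<eta>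
    proof -
      have "\<bar>g t\<bar> \<le> K * \<bar>t\<bar>" if t: "\<bar>t\<bar> \<le> \<delta>" for t
      proof -
        obtain c where "g t = c * t" "\<bar>c\<bar> \<le> K" using near[OF t] by blast
        then show ?thesis by (simp add: abs_mult mult_right_mono)
      qed
      from subcritical_growth[OF assms(2) \<delta> this assms(5) \<open>\<eta> > 0\<close>]
      obtain C where C: "C \<ge> 0" "\<And>t. \<bar>g t\<bar> \<le> C * \<bar>t\<bar> + \<eta> * \<bar>t\<bar> powr (p - 1)" unfolding p(2) by blast
      have "\<bar>f t\<bar> \<le> (1 + C) * \<bar>t\<bar> + \<eta> * \<bar>t\<bar> powr (p - 1)" for t
        using abs_triangle_ineq[of t "g t"] C(2)[of t] unfolding f_def distrib_right by linarith
      then show ?thesis using C(1) by (intro exI[of _ "1 + C"]) auto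
    qed
    show "\<exists>c. f t = c * t \<and> \<bar>c\<bar> \<le> 1 + K \<and> c \<le> 1 - m" if t: "\<bar>t\<bar> \<le> \<delta>" for t
    proof -
      obtain c where "g t = c * t" "\<bar>c\<bar> \<le> K" "c \<le> - m" using near[OF t] by blast
      then show ?thesis by (intro exI[of _ "1 + c"]) (auto simp: f_def distrib_right)
    qed
  qed (use p m \<delta> S in auto)
  \<comment> \<open>The summand \<open>t\<^sup>2 / 2\<close> of \<open>F\<close> cancels the L2 part
    of the squared norm.\<close>
  have energy: "energy g = J"
  proof
    fix z :: "'n H1"
    have i: "integrable lborel (\<lambda>x. (rep_H1 z x)\<^sup>2 / 2)"
      using L2_square_integrable[OF L2_rep, of z] by simp
    have "(\<integral>x. primitive g (rep_H1 z x) \<partial>lborel) = (\<integral>x. F (rep_H1 z x) - (rep_H1 z x)\<^sup>2 / 2 \<partial>lborel)"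
      by (simp add: F_def)
    also have "\<dots> = (\<integral>x. F (rep_H1 z x) \<partial>lborel) - (\<integral>x. (rep_H1 z x)\<^sup>2 \<partial>lborel) / 2"
      using i integrable_F_rep[of z] by simp
    finally show "energy g z = J z" unfolding energy_def J_def norm_H1_squared by (simp add: add_divide_distrib)
  qed
  have PS: "bounded_Palais_Smale J \<beta> u" using assms(6) by (simp add: energy)
  obtain l r y w where P: "profiles u l r y w" and null: "(\<lambda>n. norm (remainder u l r y w n)) \<longlonglongrightarrow> 0"
    by (rule Palais_Smale_decomposition[OF PS])
  have l: "l \<ge> 1" and r: "strict_mono r" and y1: "\<forall>n. y 1 n = 0"
    and div: "\<forall>i j. 1 \<le> i \<and> i < j \<and> j \<le> l \<longrightarrow> filterlim (\<lambda>n. norm (y i n - y j n)) at_top sequentially"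
    and wk: "\<forall>k\<in>{1..l}. weakly_converges_to (\<lambda>n. translate (y k n) (u (r n))) (w k)"
    and w0: "\<forall>k\<in>{2..l}. w k \<noteq> 0"
    and Jl: "(\<lambda>n. J (u (r n)) - J (remainder u l r y w n)) \<longlonglongrightarrow> (\<Sum>k=1..l. J (w k))"
    using P unfolding profiles_def by blast+
  have crit: "(J has_derivative (\<lambda>_. 0)) (at (w k))" if "k \<in> {1..l}" for k
  proof -
    have "dJ (w k) = (\<lambda>_. 0)" using Palais_Smale_profile_critical[OF PS r] wk that by blast
    then show ?thesis using J_has_derivative[of "w k"] by simp
  qed
  have \<beta>: "(\<lambda>n. J (u (r n))) \<longlonglongrightarrow> \<beta>"
    using bounded_Palais_Smale_subseq[OF PS r] by (simp add: bounded_Palais_Smale_def)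
  have "(\<lambda>n. J (u (r n))) \<longlonglongrightarrow> (\<Sum>k=1..l. J (w k))"
    using tendsto_add[OF Jl J_tendsto_0[OF null]] by simp
  then have "\<beta> = (\<Sum>k=1..l. J (w k))" using \<beta> LIMSEQ_unique by blast
  then show ?thesis
    unfolding energy
    using r l y1 div wk w0 crit \<beta> null[unfolded remainder_def]
    by (intro exI[of _ r] exI[of _ l] exI[of _ y] exI[of _ w]) blast
qed

end
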